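(* For $s\ge0$ and $n\ge1$ let $Y(s,n)=\sum_{1\le i,j\le n}a(i,j;n,s)\,e(i,j;n)$ be a random matrix such that $$\{\mathrm{Re}\, a(i,j;n,s):1\le i,j\le n,\ s\in\mathbb N\}\cup\{\mathrm{Im}\, a(i,j;n,s):1\le i,j\le n,\ s\in\mathbb N\}$$ are independent centered Gaussian random variables with variance $(2n)^{-1}$. Let $(B(j,n))_{j\in\mathbb N}$ be a family of elements of $\mathfrak M_n$, stable under multiplication and adjunction, which contains $p_1(n),\dots,p_d(n)$, such that for every $j$ the sequence $(\|E(B(j,n))\|)_n$ is bounded, and which converges in $\mathcal D$-distribution as $n\to\infty$. Then the family $(\{B(j,n):j\in\mathbb N\},(\{Y(s,n)\})_s)$ is asymptotically free with amalgamation over $\mathcal D$ as $n\to\infty$, and the limit $\mathcal D$-distribution of each $Y(s,n)$ is the $\mathcal D$-circular distribution with covariance $\varphi$.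
   Context: $(\mathcal A,\varphi)$ is a tracial $*$-noncommutative probability space with self-adjoint nonzero pairwise orthogonal projections $p_1,\dots,p_d$ with sum $1$; $\rho_i=\varphi(p_i)\ne0$; $\mathcal D=\mathrm{Span}\{p_1,\dots,p_d\}$; $E(x)=\sum_i\rho_i^{-1}\varphi(p_ixp_i)p_i$ is the conditional expectation $\mathcal A\to\mathcal D$. For $n\ge1$, $q_1(n),\dots,q_d(n)$ are positive integers with sum $n$ and $q_i(n)/n\to\rho_i$. $\mathfrak M_n$ is the algebra of (constant) complex $n\times n$ matrices, $e(i,j;n)$ its matrix units, $\mathrm{tr}$ the normalized trace. $\mathcal D$ is identified with a $*$-subalgebra of $\mathfrak M_n$ by $\sum\lambda_ip_i\mapsto\mathrm{diag}(\lambda_1I_{q_1(n)},\dots,\lambda_dI_{q_d(n)})$; $p_k(n)$ is the image of $p_k$. Random $n\times n$ matrices (with entries having all moments) form an algebra $M_n$ with state $\mathbb E\,\mathrm{tr}$, and $E:M_n\to\mathcal D$ is $E(X)=\sum_k\frac{\mathbb E\,\mathrm{Tr}(p_k(n)Xp_k(n))}{q_k(n)}p_k$. $\|\cdot\|$ on $\mathcal D$ is the operator norm. The $\mathcal D$-distribution of a family $(a_i)$ is the map sending each word $X_{i_0}^{\epsilon_0}d_0\cdots X_{i_m}^{\epsilon_m}d_m$ ($d_j\in\mathcal D$, $\epsilon_j\in\{1,*\}$) to $E(a_{i_0}^{\epsilon_0}d_0\cdots a_{i_m}^{\epsilon_m}d_m)$; convergence in $\mathcal D$-distribution is pointwise convergence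 of $\mathcal D$-distributions to that of a family in $\mathcal A$ (possibly after enlarging $(\mathcal A,\varphi)$). $*$-subalgebras $(\mathcal A_i)_{i\in I}$ containing $\mathcal D$ are free with amalgamation over $\mathcal D$ if $E(x(1)\cdots x(m))=0$ whenever $i_1\neq\cdots\neq i_m$ (consecutive indices distinct) and $x(j)\in\mathcal A_{i_j}\cap\ker E$; subsets are free with amalgamation over $\mathcal D$ if they are contained in such $*$-subalgebras. A family of sets of matrices is asymptotically free with amalgamation over $\mathcal D$ if the whole collection of matrices converges jointly in $\mathcal D$-distribution and the corresponding sets of limit elements are free with amalgamation over $\mathcal D$. $\mathcal D$-valued cumulants $c_m:\mathcal A^{\otimes_{\mathcal D}m}\to\mathcal D$ are the $\mathcal D$-bimodule maps determined by $E(a_1\cdots a_m)=\sum_{\sigma\in NC(m)}c_\sigma(a_1\otimes\cdots\otimes a_m)$ (sum over noncrossing partitions, $c_\sigma$ the usual nested product of the $c_k$ over blocks). The $\mathcal D$-circular distribution with covariance $\varphi$ is the $\mathcal D$-distribution of an element $c$ with: $c_1(c)=c_1(c^* )=0$; for all $d\in\mathcal D$, $c_2(cd\otimes c)=c_2(c^*d\otimes c^* )=0$ and $c_2(cd\otimes c^* )=c_2(c^*d\otimes c)=\varphi(d)1$; and $c_k(c^{\varepsilon_1}d_1\otimes\cdots\otimes c^{\varepsilon_k}d_k)=0$ for all $k\ge3$, $\varepsilon_i\in\{1,*\}$, $d_i\in\mathcal D$. *)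

theory Defs
  imports
    "HOL-Probability.Probability"
    "HOL-Algebra.Ring"
    "HOL-Library.Disjoint_Sets"
    "Jordan_Normal_Form.Schur_Decomposition"
begin

section \<open>Tracial noncommutative probability spaces\<close>

record 'a ncps = "'a ring" +
  scal :: "complex \<Rightarrow> 'a \<Rightarrow> 'a"
  adj :: "'a \<Rightarrow> 'a"
  state :: "'a \<Rightarrow> complex"

locale star_algebra = ring A for A :: "'a ncps" (structure) +
  assumes scal_closed: "x \<in> carrier A \<Longrightarrow> scal A c x \<in> carrier A"
    and scal_add_left: "x \<in> carrier A \<Longrightarrow> scal A (c + c') x = scal A c x \<oplus> scal A c' x"
    and scal_add_right:
      "x \<in> carrier A \<Longrightarrow> y \<in> carrier A \<Longrightarrow> scal A c (x \<oplus> y) = scal A c x \<oplus> scal A c y"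
    and scal_scal: "x \<in> carrier A \<Longrightarrow> scal A c (scal A c' x) = scal A (c * c') x"
    and scal_one: "x \<in> carrier A \<Longrightarrow> scal A 1 x = x"
    and scal_mult_left:
      "x \<in> carrier A \<Longrightarrow> y \<in> carrier A \<Longrightarrow> scal A c x \<otimes> y = scal A c (x \<otimes> y)"
    and scal_mult_right:
      "x \<in> carrier A \<Longrightarrow> y \<in> carrier A \<Longrightarrow> x \<otimes> scal A c y = scal A c (x \<otimes> y)"
    and adj_closed: "x \<in> carrier A \<Longrightarrow> adj A x \<in> carrier A"
    and adj_adj: "x \<in> carrier A \<Longrightarrow> adj A (adj A x) = x"
    and adj_add:
      "x \<in> carrier A \<Longrightarrow> y \<in> carrier A \<Longrightarrow> adj A (x \<oplus> y) = adj A x \<oplus> adj A y"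
    and adj_scal: "x \<in> carrier A \<Longrightarrow> adj A (scal A c x) = scal A (cnj c) (adj A x)"
    and adj_mult:
      "x \<in> carrier A \<Longrightarrow> y \<in> carrier A \<Longrightarrow> adj A (x \<otimes> y) = adj A y \<otimes> adj A x"

locale tracial_ncps = star_algebra +
  assumes state_add:
      "x \<in> carrier A \<Longrightarrow> y \<in> carrier A \<Longrightarrow> state A (x \<oplus> y) = state A x + state A y"
    and state_scal: "x \<in> carrier A \<Longrightarrow> state A (scal A c x) = c * state A x"
    and state_one: "state A \<one> = 1"
    and state_pos:
      "x \<in> carrier A \<Longrightarrow> Im (state A (adj A x \<otimes> x)) = 0 \<and> 0 \<le> Re (state A (adj A x \<otimes> x))"
    and state_trace:
      "x \<in> carrier A \<Longrightarrow> y \<in> carrier A \<Longrightarrow> state A (x \<otimes> y) = state A (y \<otimes> x)"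

text \<open>
  The projections are \<open>p 0, \<dots>, p (d - 1)\<close>, and \<open>\<rho>\<^sub>i\<close> is \<open>state A (p i)\<close>.
\<close>

locale projection_ncps = tracial_ncps +
  fixes d :: nat and p :: "nat \<Rightarrow> 'a"
  assumes proj_closed: "i < d \<Longrightarrow> p i \<in> carrier A"
    and proj_adj: "i < d \<Longrightarrow> adj A (p i) = p i"
    and proj_idem: "i < d \<Longrightarrow> p i \<otimes> p i = p i"
    and proj_orth: "i < d \<Longrightarrow> j < d \<Longrightarrow> i \<noteq> j \<Longrightarrow> p i \<otimes> p j = \<zero>"
    and proj_sum: "(\<Oplus>i\<in>{..<d}. p i) = \<one>"
    and proj_nonzero: "i < d \<Longrightarrow> p i \<noteq> \<zero>"
    and proj_state: "i < d \<Longrightarrow> state A (p i) \<noteq> 0"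

definition enlargement :: "'a ncps \<Rightarrow> 'b ncps \<Rightarrow> ('a \<Rightarrow> 'b) \<Rightarrow> bool" where
  "enlargement A B \<iota> \<longleftrightarrow>
     tracial_ncps B \<and> \<iota> \<in> Ring.ring_hom A B \<and> inj_on \<iota> (carrier A) \<and>
     (\<forall>x\<in>carrier A. (\<forall>c. \<iota> (scal A c x) = scal B c (\<iota> x)) \<and>
        \<iota> (adj A x) = adj B (\<iota> x) \<and> state B (\<iota> x) = state A x)"

text \<open>
  HOL cannot quantify existentially over types, so an enlargement whose existence is claimed has to
  live on a named type.  Elements of the type below can be cosets in the free algebra
  (finitely supported functions on words) generated by \<open>'b\<close> and letters
  \<open>(s, False)\<close>, \<open>(s, True)\<close> standing for \<open>y\<^sub>s\<close> and \<open>y\<^sub>s\<^sup>*\<close>; it is therefore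
  large enough for every algebra generated by an algebra on \<open>'b\<close> and a sequence \<open>y\<^sub>s\<close>.
\<close>

type_synonym 'b adjoined = "(('b + nat \<times> bool) list \<Rightarrow> complex) set"


section \<open>The subalgebra \<open>\<D>\<close> and freeness with amalgamation\<close>

text \<open>
  Since the \<open>p k\<close> are linearly independent, an element \<open>\<Sum>\<^sub>k l\<^sub>k p\<^sub>k\<close> of \<open>\<D>\<close> is the
  same thing as its coordinate vector \<open>l\<close>, of which only the entries with index below \<open>d\<close> matter.
  These coordinates express the identification of \<open>\<D>\<close> with diagonal matrices below.
\<close>

definition D_elem :: "'a ncps \<Rightarrow> nat \<Rightarrow> (nat \<Rightarrow> 'a) \<Rightarrow> (nat \<Rightarrow> complex) \<Rightarrow> 'a" where
  "D_elem A d p l = (\<Oplus>\<^bsub>A\<^esub>k\<in>{..<d}. scal A (l k) (p k))"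

definition D_span :: "'a ncps \<Rightarrow> nat \<Rightarrow> (nat \<Rightarrow> 'a) \<Rightarrow> 'a set" where
  "D_span A d p = range (D_elem A d p)"

definition cond_coord :: "'a ncps \<Rightarrow> (nat \<Rightarrow> 'a) \<Rightarrow> 'a \<Rightarrow> nat \<Rightarrow> complex" where
  "cond_coord A p x k = inverse (state A (p k)) * state A (p k \<otimes>\<^bsub>A\<^esub> x \<otimes>\<^bsub>A\<^esub> p k)"

definition cond_exp :: "'a ncps \<Rightarrow> nat \<Rightarrow> (nat \<Rightarrow> 'a) \<Rightarrow> 'a \<Rightarrow> 'a" where
  "cond_exp A d p x = D_elem A d p (cond_coord A p x)"

definition list_mult :: "'a ncps \<Rightarrow> 'a list \<Rightarrow> 'a" where
  "list_mult A xs = foldr (\<otimes>\<^bsub>A\<^esub>) xs \<one>\<^bsub>A\<^esub>"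

definition star_subalgebra :: "'a ncps \<Rightarrow> 'a set \<Rightarrow> bool" where
  "star_subalgebra A S \<longleftrightarrow>
     S \<subseteq> carrier A \<and> \<one>\<^bsub>A\<^esub> \<in> S \<and>
     (\<forall>x\<in>S. \<forall>y\<in>S. x \<oplus>\<^bsub>A\<^esub> y \<in> S \<and> x \<otimes>\<^bsub>A\<^esub> y \<in> S) \<and>
     (\<forall>x\<in>S. adj A x \<in> S \<and> (\<forall>c. scal A c x \<in> S))"

definition D_free_algebras :: "'a ncps \<Rightarrow> nat \<Rightarrow> (nat \<Rightarrow> 'a) \<Rightarrow> ('g \<Rightarrow> 'a set) \<Rightarrow> bool" where
  "D_free_algebras A d p S \<longleftrightarrow>
     (\<forall>g. star_subalgebra A (S g) \<and> D_span A d p \<subseteq> S g) \<and>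
     (\<forall>gs xs. gs \<noteq> [] \<and> length xs = length gs \<and>
        (\<forall>j. Suc j < length gs \<longrightarrow> gs ! j \<noteq> gs ! Suc j) \<and>
        (\<forall>j<length gs. xs ! j \<in> S (gs ! j) \<and> cond_exp A d p (xs ! j) = \<zero>\<^bsub>A\<^esub>) \<longrightarrow>
        cond_exp A d p (list_mult A xs) = \<zero>\<^bsub>A\<^esub>)"

definition D_free :: "'a ncps \<Rightarrow> nat \<Rightarrow> (nat \<Rightarrow> 'a) \<Rightarrow> ('g \<Rightarrow> 'a set) \<Rightarrow> bool" where
  "D_free A d p T \<longleftrightarrow> (\<exists>S. D_free_algebras A d p S \<and> (\<forall>g. T g \<subseteq> S g))"


section \<open>\<open>\<D>\<close>-valued cumulants and \<open>\<D>\<close>-circular elements\<close>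

definition noncrossing_partitions :: "nat \<Rightarrow> nat set set set" where
  "noncrossing_partitions m =
     {\<sigma>. partition_on {..<m} \<sigma> \<and>
         \<not> (\<exists>V\<in>\<sigma>. \<exists>W\<in>\<sigma>. V \<noteq> W \<and>
              (\<exists>i\<in>V. \<exists>j\<in>W. \<exists>k\<in>V. \<exists>l\<in>W. i < j \<and> j < k \<and> k < l))}"

definition last_block :: "nat set set \<Rightarrow> nat set" where
  "last_block \<sigma> = (ARG_MAX Min V. V \<in> \<sigma>)"

text \<open>
  In a noncrossing partition the block with the largest minimum is an interval among the remaining
  indices.  The value of the cumulant on this block, an element of \<open>\<D>\<close>, is multiplied to the
  argument immediately to its left, and the block is removed.  (If the block has no left neighbour, it
  is the only block.)  The numerical
  argument counts the blocks still to be removed until one is left.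
\<close>

primrec nested_cumulant_aux ::
  "'a ncps \<Rightarrow> ('a list \<Rightarrow> 'a) \<Rightarrow> nat \<Rightarrow> nat set set \<Rightarrow> (nat \<Rightarrow> 'a) \<Rightarrow> 'a" where
  "nested_cumulant_aux A \<kappa> 0 \<sigma> a = \<kappa> (map a (sorted_list_of_set (\<Union>\<sigma>)))"
| "nested_cumulant_aux A \<kappa> (Suc r) \<sigma> a =
     (let V = last_block \<sigma>;
          u = Max {i \<in> \<Union>\<sigma>. i < Min V}
      in nested_cumulant_aux A \<kappa> r (\<sigma> - {V})
           (a(u := a u \<otimes>\<^bsub>A\<^esub> \<kappa> (map a (sorted_list_of_set V)))))"

definition nested_cumulant ::
  "'a ncps \<Rightarrow> ('a list \<Rightarrow> 'a) \<Rightarrow> nat set set \<Rightarrow> (nat \<Rightarrow> 'a) \<Rightarrow> 'a" where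
  "nested_cumulant A \<kappa> \<sigma> a = nested_cumulant_aux A \<kappa> (card \<sigma> - 1) \<sigma> a"

text \<open>
  \<open>\<kappa> [a\<^sub>1, \<dots>, a\<^sub>m]\<close> stands for \<open>c\<^sub>m(a\<^sub>1 \<otimes> \<cdots> \<otimes> a\<^sub>m)\<close>.  The first five conditions say
  that \<open>\<kappa>\<close> induces \<open>\<D>\<close>-bimodule maps from the tensor powers over \<open>\<D>\<close> to \<open>\<D>\<close>
  (complex homogeneity follows, scalars being in \<open>\<D>\<close>).  The last one is the moment-cumulant
  formula; its term for the one-block partition is \<open>c\<^sub>m\<close>, so \<open>\<kappa>\<close> is unique on nonempty lists
  over the carrier.
\<close>

definition D_cumulants :: "'a ncps \<Rightarrow> nat \<Rightarrow> (nat \<Rightarrow> 'a) \<Rightarrow> ('a list \<Rightarrow> 'a) \<Rightarrow> bool" where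
  "D_cumulants A d p \<kappa> \<longleftrightarrow>
     (\<forall>as. as \<noteq> [] \<and> set as \<subseteq> carrier A \<longrightarrow> \<kappa> as \<in> D_span A d p) \<and>
     (\<forall>as\<in>lists (carrier A). \<forall>bs\<in>lists (carrier A). \<forall>x\<in>carrier A. \<forall>y\<in>carrier A.
        \<kappa> (as @ [x \<oplus>\<^bsub>A\<^esub> y] @ bs) = \<kappa> (as @ [x] @ bs) \<oplus>\<^bsub>A\<^esub> \<kappa> (as @ [y] @ bs)) \<and>
     (\<forall>as\<in>lists (carrier A). \<forall>bs\<in>lists (carrier A). \<forall>x\<in>carrier A. \<forall>y\<in>carrier A.
      \<forall>e\<in>D_span A d p.
        \<kappa> (as @ [x \<otimes>\<^bsub>A\<^esub> e, y] @ bs) = \<kappa> (as @ [x, e \<otimes>\<^bsub>A\<^esub> y] @ bs)) \<and>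
     (\<forall>as\<in>lists (carrier A). \<forall>x\<in>carrier A. \<forall>e\<in>D_span A d p.
        \<kappa> ([e \<otimes>\<^bsub>A\<^esub> x] @ as) = e \<otimes>\<^bsub>A\<^esub> \<kappa> ([x] @ as)) \<and>
     (\<forall>as\<in>lists (carrier A). \<forall>x\<in>carrier A. \<forall>e\<in>D_span A d p.
        \<kappa> (as @ [x \<otimes>\<^bsub>A\<^esub> e]) = \<kappa> (as @ [x]) \<otimes>\<^bsub>A\<^esub> e) \<and>
     (\<forall>as. as \<noteq> [] \<and> set as \<subseteq> carrier A \<longrightarrow>
        cond_exp A d p (list_mult A as) =
          (\<Oplus>\<^bsub>A\<^esub>\<sigma>\<in>noncrossing_partitions (length as). nested_cumulant A \<kappa> \<sigma> (\<lambda>i. as ! i)))"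

definition eps :: "'a ncps \<Rightarrow> bool \<Rightarrow> 'a \<Rightarrow> 'a" where
  "eps A \<epsilon> x = (if \<epsilon> then adj A x else x)"

definition D_circular :: "'a ncps \<Rightarrow> nat \<Rightarrow> (nat \<Rightarrow> 'a) \<Rightarrow> 'a \<Rightarrow> bool" where
  "D_circular A d p c \<longleftrightarrow>
     c \<in> carrier A \<and>
     (\<exists>\<kappa>. D_cumulants A d p \<kappa> \<and>
        \<kappa> [c] = \<zero>\<^bsub>A\<^esub> \<and> \<kappa> [adj A c] = \<zero>\<^bsub>A\<^esub> \<and>
        (\<forall>e\<in>D_span A d p.
           \<kappa> [c \<otimes>\<^bsub>A\<^esub> e, c] = \<zero>\<^bsub>A\<^esub> \<and>
           \<kappa> [adj A c \<otimes>\<^bsub>A\<^esub> e, adj A c] = \<zero>\<^bsub>A\<^esub> \<and>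
           \<kappa> [c \<otimes>\<^bsub>A\<^esub> e, adj A c] = scal A (state A e) \<one>\<^bsub>A\<^esub> \<and>
           \<kappa> [adj A c \<otimes>\<^bsub>A\<^esub> e, c] = scal A (state A e) \<one>\<^bsub>A\<^esub>) \<and>
        (\<forall>w. 3 \<le> length w \<and> (\<forall>(\<epsilon>, e)\<in>set w. e \<in> D_span A d p) \<longrightarrow>
           \<kappa> (map (\<lambda>(\<epsilon>, e). eps A \<epsilon> c \<otimes>\<^bsub>A\<^esub> e) w) = \<zero>\<^bsub>A\<^esub>))"


section \<open>Random matrices\<close>

text \<open>
  Matrix indices start at 0; the \<open>k\<close>-th block consists of the \<open>q k\<close> indices following the
  first \<open>q 0 + \<cdots> + q (k - 1)\<close>.
\<close>

definition block_index :: "(nat \<Rightarrow> nat) \<Rightarrow> nat \<Rightarrow> nat" where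
  "block_index q i = (LEAST k. i < (\<Sum>l\<le>k. q l))"

definition D_mat :: "(nat \<Rightarrow> nat) \<Rightarrow> nat \<Rightarrow> (nat \<Rightarrow> complex) \<Rightarrow> complex mat" where
  "D_mat q n l = mat_diag n (\<lambda>i. l (block_index q i))"

definition p_mat :: "(nat \<Rightarrow> nat) \<Rightarrow> nat \<Rightarrow> nat \<Rightarrow> complex mat" where
  "p_mat q n k = D_mat q n (\<lambda>l. if l = k then 1 else 0)"

definition Tr :: "complex mat \<Rightarrow> complex" where
  "Tr X = (\<Sum>i<dim_row X. X $$ (i, i))"

definition E_mat ::
  "'w measure \<Rightarrow> (nat \<Rightarrow> nat) \<Rightarrow> nat \<Rightarrow> ('w \<Rightarrow> complex mat) \<Rightarrow> nat \<Rightarrow> complex" where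
  "E_mat M q n X k = (\<integral>\<omega>. Tr (p_mat q n k * X \<omega> * p_mat q n k) \<partial>M) / of_nat (q k)"

definition euclid_norm :: "complex vec \<Rightarrow> real" where
  "euclid_norm v = L2_set (\<lambda>i. cmod (vec_index v i)) {..<dim_vec v}"

definition op_norm :: "complex mat \<Rightarrow> real" where
  "op_norm X =
     (SUP v\<in>{v \<in> carrier_vec (dim_col X). euclid_norm v \<le> 1}. euclid_norm (X *\<^sub>v v))"


section \<open>Convergence in \<open>\<D>\<close>-distribution\<close>

text \<open>
  The letter \<open>(i, \<epsilon>, l)\<close> of a word stands for \<open>X\<^sub>i\<^sup>\<epsilon> d\<close>, where \<open>d\<close> has coordinates
  \<open>l\<close> and \<open>\<epsilon> = True\<close> means that the adjoint is taken.
\<close>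

type_synonym 'i D_word = "('i \<times> bool \<times> (nat \<Rightarrow> complex)) list"

definition word_elem ::
  "'a ncps \<Rightarrow> nat \<Rightarrow> (nat \<Rightarrow> 'a) \<Rightarrow> ('i \<Rightarrow> 'a) \<Rightarrow> 'i D_word \<Rightarrow> 'a" where
  "word_elem A d p x w = list_mult A (map (\<lambda>(i, \<epsilon>, l). eps A \<epsilon> (x i) \<otimes>\<^bsub>A\<^esub> D_elem A d p l) w)"

definition word_mat ::
  "(nat \<Rightarrow> nat) \<Rightarrow> nat \<Rightarrow> ('i \<Rightarrow> complex mat) \<Rightarrow> 'i D_word \<Rightarrow> complex mat" where
  "word_mat q n X w =
     foldr (*) (map (\<lambda>(i, \<epsilon>, l). (if \<epsilon> then mat_adjoint (X i) else X i) * D_mat q n l) w) (1\<^sub>m n)"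

text \<open>
  \<open>X i n\<close> is the \<open>n\<close>-th random matrix with index \<open>i\<close>, defined on the probability space \<open>M n\<close>.
  Convergence in the finite-dimensional space \<open>\<D>\<close> is convergence of the coordinates.
\<close>

definition converges_in_D_distribution ::
  "(nat \<Rightarrow> 'w measure) \<Rightarrow> (nat \<Rightarrow> nat \<Rightarrow> nat) \<Rightarrow> ('i \<Rightarrow> nat \<Rightarrow> 'w \<Rightarrow> complex mat) \<Rightarrow>
   'a ncps \<Rightarrow> nat \<Rightarrow> (nat \<Rightarrow> 'a) \<Rightarrow> ('i \<Rightarrow> 'a) \<Rightarrow> bool" where
  "converges_in_D_distribution M q X A d p x \<longleftrightarrow>
     (\<forall>i. x i \<in> carrier A) \<and>
     (\<forall>w. w \<noteq> [] \<longrightarrow>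
        (\<forall>k<d. (\<lambda>n. E_mat (M n) (q n) n (\<lambda>\<omega>. word_mat (q n) n (\<lambda>i. X i n \<omega>) w) k)
                 \<longlonglongrightarrow> cond_coord A p (word_elem A d p x w) k))"

definition asymptotically_D_free ::
  "(nat \<Rightarrow> 'w measure) \<Rightarrow> (nat \<Rightarrow> nat \<Rightarrow> nat) \<Rightarrow> ('i \<Rightarrow> nat \<Rightarrow> 'w \<Rightarrow> complex mat) \<Rightarrow>
   ('g \<Rightarrow> 'i set) \<Rightarrow> 'a ncps \<Rightarrow> nat \<Rightarrow> (nat \<Rightarrow> 'a) \<Rightarrow> ('i \<Rightarrow> 'a) \<Rightarrow> bool" where
  "asymptotically_D_free M q X G A d p x \<longleftrightarrow>
     converges_in_D_distribution M q X A d p x \<and> D_free A d p (\<lambda>g. x ` G g)"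

end

(*
  On the free algebra generated by the limit algebra A1 and letters y_s, y_s^* let om be the functional
  that extends the state of A1 and satisfies the Schwinger-Dyson recursion
    om (y_s w) = sum over all w = u y_s^* v of om (u) om (v),    and likewise with y_s and y_s^* exchanged.
  It is tracial.  It is positive because om (w^* z) decomposes according to the pairs joining w^* to z,
  which exhibits it as a sum of products of positive kernels, as on a full Fock space.  Modulo its null
  ideal the free algebra is the limit space A2.  Freeness over D follows by applying the recursion to an
  alternating product of centered elements, and the D-moments of y_s satisfy the recursion obtained from
  the moment-cumulant formula when only the second cumulants survive.

  On the matrix side, Gaussian integration by parts gives the same recursion, up to O(1/n^2), for
  expectations of products of normalized traces.  Induction on the number of Gaussian letters shows that
  such expectations converge to the corresponding products of values of om.  Treating products of traces
  from the start makes a separate concentration argument unnecessary.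
*)

theory Submission
  imports Defs "HOL-Library.Poly_Mapping"
begin

section \<open>Splitting words at a letter\<close>

text \<open>The recursion for \<open>om\<close> is not taken as its definition. The function
  \<open>e\<close> deletes noncrossing pairs but keeps the constant letters, so it is the
  conditional expectation onto the algebra of constants, and \<open>om\<close> is the state composed
  with it. Positivity needs this extra information, because what lies between joining pairs
  contributes a Gram kernel of values of \<open>e\<close>; freeness needs it, because
  \<open>e\<close> maps the algebra of one \<open>y_s\<close> and the projections into D. The state
  of \<open>A1\<close> may fail to be faithful, and then the quotient by the null ideal of
  \<open>om\<close> does not contain \<open>A1\<close>; the limit space is therefore
  \<open>A1\<close> times this quotient, coded as sets so as to live on the prescribed type.
  Circularity speaks of a cumulant family on the whole limit algebra, not only on words in one
  element. Hence D-valued cumulants are constructed on an arbitrary space with projections, arity by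
  arity, and their values at \<open>y_s\<close> are obtained by matching the sum over noncrossing
  partitions with the recursion, position by position.\<close>

primrec ssum :: "'l \<Rightarrow> ('l list \<Rightarrow> 'l list \<Rightarrow> 'v::comm_monoid_add) \<Rightarrow> 'l list \<Rightarrow> 'v" where
  "ssum t F [] = 0"
| "ssum t F (x # w) = (if x = t then F [] w else 0) + ssum t (\<lambda>u v. F (x # u) v) w"

text \<open>Registered as a congruence rule for recursive definitions: \<open>e\<close> and
  \<open>K\<close> call themselves on the pieces inside the summand, and the context
  \<open>w' = u @ t' # v\<close> supplied here is what makes these pieces provably shorter.\<close>

lemma ssum_cong [fundef_cong]:
  assumes "w = w'" "t = t'" "\<And>u v. w' = u @ t' # v \<Longrightarrow> F u v = G u v"
  shows "ssum t F w = ssum t' G w'"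
  using assms(3) unfolding assms(1,2)
proof (induction w' arbitrary: F G)
  case (Cons x w)
  have "ssum t' (\<lambda>u v. F (x # u) v) w = ssum t' (\<lambda>u v. G (x # u) v) w"
    by (rule Cons.IH) (simp add: Cons.prems)
  moreover have "x = t' \<Longrightarrow> F [] w = G [] w" using Cons.prems[of "[]" w] by simp
  ultimately show ?case by simp
qed simp

lemma ssum_zero: "ssum t (\<lambda>u v. 0) w = 0"
  by (induction w) auto

lemma ssum_eq_0I: "(\<And>u v. w = u @ t # v \<Longrightarrow> F u v = 0) \<Longrightarrow> ssum t F w = 0"
  by (subst ssum_cong[where G = "\<lambda>_ _. 0"]) (auto simp: ssum_zero)

lemma ssum_add: "ssum t (\<lambda>u v. F u v + G u v) w = ssum t F w + ssum t G w"
  by (induction w arbitrary: F G) (auto simp: algebra_simps)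

lemma ssum_additive:
  assumes "\<And>x y. h (x + y) = h x + h y" "h 0 = 0"
  shows "ssum t (\<lambda>u v. h (F u v)) w = h (ssum t F w)"
  by (induction w arbitrary: F) (auto simp: assms)

lemma ssum_distrib_left: "ssum t (\<lambda>u v. c * F u v) w = (c :: 'v::semiring_0) * ssum t F w"
  by (rule ssum_additive) (auto simp: algebra_simps)

lemma ssum_distrib_right: "ssum t (\<lambda>u v. F u v * c) w = ssum t F w * (c :: 'v::semiring_0)"
  by (rule ssum_additive) (auto simp: algebra_simps)

lemma ssum_append:
  "ssum t F (w @ z) = ssum t (\<lambda>u v. F u (v @ z)) w + ssum t (\<lambda>u v. F (w @ u) v) z"
  by (induction w arbitrary: F) (auto simp: algebra_simps)

text \<open>Coassociativity of splitting: both sides run over the factorizations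
  \<open>w = x @ t' # y @ t # z\<close>. It allows two pairs to be removed in either order.\<close>

lemma ssum_assoc:
  "ssum t (\<lambda>u v. ssum t' (\<lambda>u' v'. G u' v' v) u) w = ssum t' (\<lambda>u' v'. ssum t (\<lambda>u v. G u' u v) v') w"
  by (induction w arbitrary: G) (auto simp: ssum_add ssum_zero algebra_simps)

lemma ssum_sum: "ssum t (\<lambda>u v. \<Sum>i\<in>I. F i u v) w = (\<Sum>i\<in>I. ssum t (F i) w)"
  by (induction w arbitrary: F) (auto simp: sum.distrib)

lemma ssum_swap:
  "ssum t (\<lambda>u v. ssum t' (\<lambda>u' v'. G u v u' v') w') w = ssum t' (\<lambda>u' v'. ssum t (\<lambda>u v. G u v u' v') w) w'"
  by (induction w arbitrary: G) (auto simp: ssum_add ssum_zero)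

text \<open>Injectivity is demanded at the split letter only: the map used later may send different
  constant letters to the same element of the algebra, while it fixes the Gaussian letters.\<close>

lemma ssum_map:
  assumes "\<And>x. x \<in> set w \<Longrightarrow> f x = f t \<longleftrightarrow> x = t"
  shows "ssum (f t) F (map f w) = ssum t (\<lambda>u v. F (map f u) (map f v)) w"
  using assms by (induction w arbitrary: F) auto

section \<open>The free algebra\<close>

text \<open>With concatenation as the noncommutative addition of exponents, the convolution product
  on finitely supported functions on words is the product of the free algebra.\<close>

instantiation list :: (type) monoid_add
begin
definition zero_list :: "'a list" where "zero_list = []"
definition plus_list :: "'a list \<Rightarrow> 'a list \<Rightarrow> 'a list" where "plus_list = (@)"
instance by standard (auto simp: zero_list_def plus_list_def)
end

abbreviation mon :: "'l list \<Rightarrow> 'l list \<Rightarrow>\<^sub>0 complex" where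
  "mon w \<equiv> Poly_Mapping.single w 1"

abbreviation const :: "complex \<Rightarrow> 'l list \<Rightarrow>\<^sub>0 complex" where
  "const c \<equiv> Poly_Mapping.single [] c"

lemma one_eq_mon: "1 = mon []"
  by (simp add: zero_list_def[symmetric])

lemma mon_mult: "mon u * mon v = mon (u @ v)"
  by (simp add: mult_single plus_list_def)

lemma const_one: "const 1 = 1" by (simp add: one_eq_mon)

lemma const_mult: "const (c * c') = const c * const c'"
  by (simp add: mult_single plus_list_def)

lemma const_add: "const (c + c') = const c + const c'"
  by (simp add: single_add)

lemma single_eq_const_mon: "Poly_Mapping.single w c = const c * mon w"
  by (simp add: mult_single plus_list_def)

lemma FA_induct [case_names mon add scale]:
  assumes "\<And>w. P (mon w)" "\<And>f g. P f \<Longrightarrow> P g \<Longrightarrow> P (f + g)" "\<And>c f. P f \<Longrightarrow> P (const c * f)"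
  shows "P (f :: 'l list \<Rightarrow>\<^sub>0 complex)"
proof (induction f rule: update_induct)
  case const
  have "P (const 0 * mon [])" by (intro assms)
  then show ?case by simp
next
  case (update f a b)
  have "Poly_Mapping.update a b f = Poly_Mapping.single a b + f"
    using update(1) by (intro poly_mapping_eqI)
      (auto simp: lookup_update lookup_add lookup_single in_keys_iff when_def)
  then show ?case using update assms by (auto simp: single_eq_const_mon[of a b])
qed

lemma const_comm: "const c * f = f * const c"
proof (induction f rule: FA_induct)
  case (mon w)
  show ?case by (simp add: mult_single plus_list_def)
next
  case (add f g)
  then show ?case by (simp add: algebra_simps)
next
  case (scale c' f)
  have "const c * (const c' * f) = const (c * c') * f"
    by (simp only: const_mult mult.assoc)
  also have "\<dots> = const c' * (const c * f)"
    by (simp only: const_mult mult.assoc mult.commute[of c])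
  also have "\<dots> = const c' * f * const c"
    by (simp only: scale mult.assoc)
  finally show ?case .
qed

lemma const_left_comm: "f * (const c * g) = const c * (f * g)"
  by (metis const_comm mult.assoc)

definition lin :: "('l list \<Rightarrow> complex) \<Rightarrow> ('l list \<Rightarrow>\<^sub>0 complex) \<Rightarrow> complex" where
  "lin g f = (\<Sum>w\<in>Poly_Mapping.keys f. Poly_Mapping.lookup f w * g w)"

lemma lin_superset:
  assumes "finite S" "Poly_Mapping.keys f \<subseteq> S"
  shows "lin g f = (\<Sum>w\<in>S. Poly_Mapping.lookup f w * g w)"
  unfolding lin_def by (rule sum.mono_neutral_left) (use assms in \<open>auto simp: in_keys_iff\<close>)

lemma lin_add [simp]: "lin g (f + f') = lin g f + lin g f'"
proof -
  let ?S = "Poly_Mapping.keys f \<union> Poly_Mapping.keys f'"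
  have "Poly_Mapping.keys (f + f') \<subseteq> ?S" by (rule keys_add)
  then show ?thesis
    by (subst (1 2 3) lin_superset[of ?S]) (auto simp: lookup_add algebra_simps sum.distrib)
qed

lemma lin_single [simp]: "lin g (Poly_Mapping.single w c) = c * g w"
  by (auto simp: lin_def)

lemma lin_zero [simp]: "lin g 0 = 0"
  by (auto simp: lin_def)

lemma lookup_const_mult: "Poly_Mapping.lookup (const c * f) w = c * Poly_Mapping.lookup f w"
  using mult_map_scale_conv_mult[of c f, symmetric]
  by (auto simp: zero_list_def Poly_Mapping.map.rep_eq when_def)

lemma lin_const_mult [simp]: "lin g (const c * f) = c * lin g f"
proof -
  have "Poly_Mapping.keys (const c * f) \<subseteq> Poly_Mapping.keys f"
    by (auto simp: in_keys_iff lookup_const_mult)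
  then show ?thesis
    by (subst (1 2) lin_superset[of "Poly_Mapping.keys f"])
      (auto simp: lookup_const_mult sum_distrib_left mult.assoc intro!: sum.cong)
qed

lemma lin_mult_const [simp]: "lin g (f * const c) = c * lin g f"
  by (simp add: const_comm[symmetric])

lemma lin_uminus [simp]: "lin g (- f) = - lin g f"
  using lin_add[of g f "- f"] by (simp add: eq_neg_iff_add_eq_0 add.commute)

lemma lin_diff [simp]: "lin g (f - f') = lin g f - lin g f'"
  using lin_add[of g f "- f'"] by simp

lemma lin_sum [simp]: "lin g (\<Sum>i\<in>I. f i) = (\<Sum>i\<in>I. lin g (f i))"
  by (induction I rule: infinite_finite_induct) auto

definition linear_fa :: "(('l list \<Rightarrow>\<^sub>0 complex) \<Rightarrow> complex) \<Rightarrow> bool" where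
  "linear_fa h \<longleftrightarrow> (\<forall>f g. h (f + g) = h f + h g) \<and> (\<forall>c f. h (const c * f) = c * h f)"

lemma linear_fa_lin: "linear_fa h \<Longrightarrow> h f = lin (\<lambda>w. h (mon w)) f"
  by (induction f rule: FA_induct) (auto simp: linear_fa_def)

lemma ssum_rev_map:
  assumes "\<And>x. f (f x) = x"
  shows "ssum (f t) F (rev (map f w)) = ssum t (\<lambda>u v. F (rev (map f v)) (rev (map f u))) w"
proof -
  have inj: "f x = f y \<longleftrightarrow> x = y" for x y using assms by metis
  show ?thesis
    by (induction w arbitrary: F) (auto simp: ssum_append ssum_zero inj add.commute)
qed

text \<open>The algebra of constants enters only through a tracial positive functional on words over
  an alphabet with involution \<open>st\<close>. Its multiplication is not part of the data;
  relations of the algebra reappear as combinations of words that the functional cannot see.\<close>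

locale free_circular =
  fixes \<tau> :: "'c list \<Rightarrow> complex" and st :: "'c \<Rightarrow> 'c"
  assumes tau_Nil: "\<tau> [] = 1"
    and tau_trace: "\<tau> (u @ v) = \<tau> (v @ u)"
    and tau_star: "\<tau> (rev (map st w)) = cnj (\<tau> w)"
    and st_st: "st (st a) = a"
    and tau_pos: "finite S \<Longrightarrow>
      (\<Sum>u\<in>S. \<Sum>v\<in>S. cnj (c u) * c v * \<tau> (rev (map st u) @ v)) \<in> \<real>\<^sub>\<ge>\<^sub>0"
begin

definition bar :: "nat \<times> bool \<Rightarrow> nat \<times> bool" where
  "bar t = (fst t, \<not> snd t)"

lemma bar_bar [simp]: "bar (bar t) = t"
  by (simp add: bar_def)

lemma bar_eq_iff [simp]: "bar t = bar t' \<longleftrightarrow> t = t'" "bar t = t' \<longleftrightarrow> t = bar t'"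
  by (metis bar_bar)+

primrec la :: "'c + nat \<times> bool \<Rightarrow> 'c + nat \<times> bool" where
  "la (Inl a) = Inl (st a)"
| "la (Inr t) = Inr (bar t)"

lemma la_la [simp]: "la (la x) = x"
  by (cases x) (auto simp: st_st)

definition wadj :: "('c + nat \<times> bool) list \<Rightarrow> ('c + nat \<times> bool) list" where
  "wadj w = rev (map la w)"

lemma wadj_simps [simp]:
  "wadj [] = []" "wadj (x # w) = wadj w @ [la x]" "wadj (u @ v) = wadj v @ wadj u" "wadj (wadj w) = w"
  by (auto simp: wadj_def rev_map[symmetric] o_def)

lemma wadj_eq_iff: "wadj u = wadj v \<longleftrightarrow> u = v"
  by (metis wadj_simps(4))

definition star :: "(('c + nat \<times> bool) list \<Rightarrow>\<^sub>0 complex) \<Rightarrow> (('c + nat \<times> bool) list \<Rightarrow>\<^sub>0 complex)" where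
  "star f = Poly_Mapping.map cnj (Poly_Mapping.map_key wadj f)"

lemma lookup_star: "Poly_Mapping.lookup (star f) w = cnj (Poly_Mapping.lookup f (wadj w))"
proof -
  have "inj wadj" by (auto simp: inj_def wadj_eq_iff)
  then show ?thesis
    by (auto simp: star_def Poly_Mapping.map.rep_eq map_key.rep_eq when_def)
qed

lemma star_add [simp]: "star (f + g) = star f + star g"
  by (rule poly_mapping_eqI) (auto simp: lookup_star lookup_add)

lemma star_zero [simp]: "star 0 = 0"
  by (rule poly_mapping_eqI) (auto simp: lookup_star)

lemma star_single [simp]: "star (Poly_Mapping.single w c) = Poly_Mapping.single (wadj w) (cnj c)"
  by (rule poly_mapping_eqI) (auto simp: lookup_star lookup_single when_def)

lemma star_star [simp]: "star (star f) = f"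
  by (rule poly_mapping_eqI) (auto simp: lookup_star)

lemma star_scale [simp]: "star (const c * f) = const (cnj c) * star f"
  by (rule poly_mapping_eqI) (auto simp: lookup_star lookup_const_mult)

lemma star_mult_mon: "star (mon u * g) = star g * star (mon u)"
proof (induction g rule: FA_induct)
  case (scale c f)
  then show ?case by (simp add: const_left_comm mult.assoc)
qed (auto simp: algebra_simps mult_single plus_list_def)

lemma star_mult [simp]: "star (f * g) = star g * star f"
proof (induction f rule: FA_induct)
  case (mon w) show ?case by (rule star_mult_mon)
next
  case (add f f') then show ?case by (simp add: algebra_simps)
next
  case (scale c f)
  then show ?case by (simp add: const_left_comm mult.assoc)
qed

lemma star_one [simp]: "star 1 = 1"
  by (simp add: one_eq_mon)

section \<open>The functional \<open>om\<close>: recursion, trace property and adjoint\<close>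

definition tau0 :: "('c + nat \<times> bool) list \<Rightarrow> complex" where
  "tau0 w = (if set w \<subseteq> range Inl then \<tau> (map projl w) else 0)"

lemma tau0_trace: "tau0 (u @ v) = tau0 (v @ u)"
  by (auto simp: tau0_def tau_trace)

lemma tau0_wadj: "tau0 (wadj w) = cnj (tau0 w)"
proof (cases "set w \<subseteq> range Inl")
  case True
  then have "map projl (map la w) = map st (map projl w)"
    by (induction w) auto
  then have "map projl (wadj w) = rev (map st (map projl w))"
    by (simp add: wadj_def rev_map[symmetric])
  moreover have "set (wadj w) \<subseteq> range Inl"
    using True by (auto simp: wadj_def)
  ultimately show ?thesis using True by (simp only: tau0_def tau_star if_True)
next
  case False
  then obtain t where "Inr t \<in> set w"
    by (metis obj_sumE rangeI subsetI)
  then have "Inr (bar t) \<in> set (wadj w)"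
    by (force simp: wadj_def)
  then have "\<not> set (wadj w) \<subseteq> range Inl" by auto
  then show ?thesis using False by (simp add: tau0_def)
qed

text \<open>Since \<open>tau0\<close> gives words with a Gaussian letter the value 0, trace property
  and hermitian symmetry hold on the whole free algebra without side conditions.\<close>

definition phi0 where "phi0 = lin tau0"

lemma phi0_mult_comm: "phi0 (f * g) = phi0 (g * f)"
proof (induction f rule: FA_induct)
  case (mon w)
  show ?case
  proof (induction g rule: FA_induct)
    case (mon v) show ?case by (simp add: phi0_def mon_mult tau0_trace)
  next
    case (scale c f) then show ?case by (simp add: phi0_def const_left_comm mult.assoc)
  qed (simp add: phi0_def algebra_simps)
next
  case (scale c f) then show ?case by (simp add: phi0_def const_left_comm mult.assoc)
qed (simp add: phi0_def algebra_simps)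

lemma phi0_star: "phi0 (star f) = cnj (phi0 f)"
  by (induction f rule: FA_induct) (auto simp: phi0_def tau0_wadj)

lemma phi0_simps [simp]:
  "phi0 (f + g) = phi0 f + phi0 g" "phi0 (const c * f) = c * phi0 f"
  "phi0 0 = 0" "phi0 1 = 1" "phi0 (const c) = c"
  "phi0 (f * (const c * g)) = c * phi0 (f * g)"
  "phi0 (const c * f * g) = c * phi0 (f * g)"
  by (auto simp: phi0_def one_eq_mon tau0_def tau_Nil const_left_comm mult.assoc)

text \<open>The conditional expectation onto the algebra of constant letters. A leading Gaussian
  letter is paired with each matching letter in turn; the enclosed word \<open>u\<close> contributes
  the scalar \<open>phi0 (e u)\<close>, while the constants of the outer word \<open>v\<close> are
  kept.\<close>

function e :: "('c + nat \<times> bool) list \<Rightarrow> (('c + nat \<times> bool) list \<Rightarrow>\<^sub>0 complex)" where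
  "e [] = 1"
| "e (Inl a # w) = mon [Inl a] * e w"
| "e (Inr t # w) = ssum (Inr (bar t)) (\<lambda>u v. const (phi0 (e u)) * e v) w"
  by pat_completeness auto
termination
  by (relation "Wellfounded.measure length") auto

definition om0 where "om0 w = phi0 (e w)"
definition om where "om = lin om0"

lemma om_mon [simp]: "om (mon w) = om0 w"
  by (simp add: om_def)

lemma om_simps [simp]:
  "om (f + g) = om f + om g" "om (f - g) = om f - om g" "om (- f) = - om f" "om (const c * f) = c * om f"
  "om (f * const c) = c * om f"
  "om 0 = 0" "om 1 = 1" "om (\<Sum>i\<in>I. F i) = (\<Sum>i\<in>I. om (F i))" "om (const c) = c"
  by (auto simp: om_def om0_def one_eq_mon)

lemma om_const_mult [simp]: "om (f * (const c * g)) = c * om (f * g)"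
  "om (const c * f * g) = c * om (f * g)"
  by (simp_all add: const_left_comm mult.assoc)

lemma om0_Nil [simp]: "om0 [] = 1" by (simp add: om0_def)

lemma e_snoc_Inl: "e (w @ [Inl a]) = e w * mon [Inl a]"
proof (induction w rule: e.induct)
  case 1 then show ?case by simp
next
  case (2 a w) then show ?case by (simp add: mult.assoc)
next
  case (3 t w)
  have "e (Inr t # w @ [Inl a]) =
      ssum (Inr (bar t)) (\<lambda>u v. const (phi0 (e u)) * e (v @ [Inl a])) w"
    by (simp add: ssum_append)
  also have "\<dots> = ssum (Inr (bar t)) (\<lambda>u v. const (phi0 (e u)) * e v * mon [Inl a]) w"
    by (rule ssum_cong) (auto simp: 3 mult.assoc)
  finally show ?case by (simp add: ssum_distrib_right)
qed

lemma phi0_ssum: "phi0 (ssum t F w) = ssum t (\<lambda>u v. phi0 (F u v)) w"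
  by (rule ssum_additive[symmetric]) auto

text \<open>The definition peels letters from the left; this is the mirror recursion from the right,
  needed for trace and adjoint. A leading Gaussian letter and the appended one are paired with each
  other or have separate partners, and in the latter case \<open>ssum_assoc\<close> exchanges the
  order of the two removals.\<close>

lemma e_snoc_Inr: "e (w @ [Inr t]) = ssum (Inr (bar t)) (\<lambda>u v. const (om0 v) * e u) w"
proof (induction w rule: length_induct)
  case (1 w)
  show ?case
  proof (cases w)
    case Nil then show ?thesis by simp
  next
    case (Cons x w')
    show ?thesis
    proof (cases x)
      case (Inl a)
      then show ?thesis using 1 Cons
        by (simp add: ssum_distrib_left[symmetric] const_left_comm)
    next
      case (Inr t')
      have "e (w @ [Inr t]) = ssum (Inr (bar t')) (\<lambda>u v. const (phi0 (e u)) * e (v @ [Inr t])) w'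
          + (if t = bar t' then const (phi0 (e w')) else 0)"
        by (simp add: Cons Inr ssum_append)
      also have "ssum (Inr (bar t')) (\<lambda>u v. const (phi0 (e u)) * e (v @ [Inr t])) w' =
          ssum (Inr (bar t')) (\<lambda>u v. ssum (Inr (bar t)) (\<lambda>u' v'. const (om0 v') * (const (phi0 (e u)) * e u')) v) w'"
      proof (rule ssum_cong[OF refl refl])
        fix u v assume "w' = u @ Inr (bar t') # v"
        then have "e (v @ [Inr t]) = ssum (Inr (bar t)) (\<lambda>u v. const (om0 v) * e u) v"
          using 1 Cons by simp
        then show "const (phi0 (e u)) * e (v @ [Inr t]) =
            ssum (Inr (bar t)) (\<lambda>u' v'. const (om0 v') * (const (phi0 (e u)) * e u')) v"
          by (simp only: ssum_distrib_left[symmetric]) (intro ssum_cong refl const_left_comm)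
      qed
      also have "\<dots> = ssum (Inr (bar t)) (\<lambda>u v. const (om0 v) * e (Inr t' # u)) w'"
        by (subst ssum_assoc[symmetric]) (simp add: ssum_distrib_left)
      also have "\<dots> + (if t = bar t' then const (phi0 (e w')) else 0) =
          ssum (Inr (bar t)) (\<lambda>u v. const (om0 v) * e u) w"
        by (auto simp: Cons Inr om0_def add.commute)
      finally show ?thesis .
    qed
  qed
qed

lemma om0_Inr: "om0 (Inr t # w) = ssum (Inr (bar t)) (\<lambda>u v. om0 u * om0 v) w"
  by (simp add: om0_def phi0_ssum)

lemma om0_snoc_Inr: "om0 (w @ [Inr t]) = ssum (Inr (bar t)) (\<lambda>u v. om0 u * om0 v) w"
  by (simp add: om0_def e_snoc_Inr phi0_ssum) (simp add: om0_def mult.commute)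

text \<open>A constant letter is moved by the trace property of \<open>phi0\<close>. For a Gaussian
  letter the left and the right recursion give the same sum, because the values inside and outside
  the pair are scalars.\<close>

lemma om0_rotate1: "om0 (x # w) = om0 (w @ [x])"
proof (cases x)
  case (Inl a)
  then show ?thesis by (simp add: om0_def e_snoc_Inl phi0_mult_comm)
qed (simp add: om0_snoc_Inr om0_Inr)

lemma om0_trace: "om0 (u @ v) = om0 (v @ u)"
proof (induction u arbitrary: v)
  case (Cons x u)
  have "om0 ((x # u) @ v) = om0 (u @ (v @ [x]))" using om0_rotate1[of x "u @ v"] by simp
  also have "\<dots> = om0 (v @ [x] @ u)" using Cons[of "v @ [x]"] by simp
  finally show ?case by simp
qed simp

lemma om_comm: "om (f * g) = om (g * f)"
proof (induction f rule: FA_induct)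
  case (mon w)
  show ?case
  proof (induction g rule: FA_induct)
    case (mon v) show ?case by (simp add: mon_mult om0_trace)
  qed (simp_all add: algebra_simps del: mult.assoc)
qed (simp_all add: algebra_simps del: mult.assoc)

lemma e_wadj: "e (wadj w) = star (e w)"
proof (induction w rule: e.induct)
  case (2 a w)
  then show ?case by (simp add: e_snoc_Inl)
next
  case (3 t w)
  have "e (wadj (Inr t # w)) = ssum (la (Inr (bar t))) (\<lambda>u v. const (om0 v) * e u) (wadj w)"
    by (simp add: e_snoc_Inr)
  also have "\<dots> = ssum (Inr (bar t)) (\<lambda>u v. const (om0 (wadj u)) * e (wadj v)) w"
    unfolding wadj_def by (rule ssum_rev_map) simp
  also have "\<dots> = ssum (Inr (bar t)) (\<lambda>u v. star (const (phi0 (e u)) * e v)) w"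
    by (rule ssum_cong) (auto simp: 3 om0_def phi0_star simp del: star_mult)
  also have "\<dots> = star (e (Inr t # w))"
    by (simp only: e.simps, rule ssum_additive) auto
  finally show ?case .
qed simp

lemma om0_wadj: "om0 (wadj w) = cnj (om0 w)"
  by (simp add: om0_def e_wadj phi0_star)

lemma om_star: "om (star f) = cnj (om f)"
  by (induction f rule: FA_induct) (auto simp: om0_wadj)

section \<open>Positivity\<close>

text \<open>The contribution to \<open>om0 (wadj w @ z)\<close> of the pairings in which no pair
  joins the two halves.\<close>

definition K0 where "K0 w z = phi0 (star (e w) * e z)"

function K where
  "K \<Lambda> w z = K0 w z + (\<Sum>t\<in>\<Lambda>. ssum (Inr t) (\<lambda>u w'. ssum (Inr t) (\<lambda>u' z'. K0 u u' * K \<Lambda> w' z') z) w)"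
  by pat_completeness auto
termination
  by (relation "Wellfounded.measure (\<lambda>(_, w, _). length w)") auto

declare K.simps [simp del]

lemma K_Nil: "K \<Lambda> [] z = om0 z"
  by (subst K.simps) (simp add: K0_def om0_def)

lemma K_Inl: "K \<Lambda> (Inl a # w) z = K \<Lambda> w (Inl (st a) # z)"
  by (subst (1 2) K.simps) (simp add: K0_def mult.assoc)

text \<open>The word \<open>wadj w @ z\<close> stays the same and only the cut between its halves
  moves across one letter. That letter either has its partner in \<open>w\<close>, with weight
  \<open>cnj (om0 u)\<close>, or in \<open>z\<close>, with weight \<open>om0 u\<close>; both sides
  reduce to the sum of these two contributions, one of which is a joining pair before the move and
  the other after it.\<close>

lemma K_Inr:
  assumes "finite \<Lambda>" "t \<in> \<Lambda>" "bar t \<in> \<Lambda>"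
  shows "K \<Lambda> (Inr t # w) z = K \<Lambda> w (Inr (bar t) # z)"
proof -
  have star_e: "star (e (Inr t # w)) = ssum (Inr (bar t)) (\<lambda>u v. const (cnj (om0 u)) * star (e v)) w" for t w
    unfolding e.simps
    by (subst ssum_additive[where h = star, symmetric]) (auto simp: om0_def simp del: star_mult)
  have K0_1: "K0 (Inr t # w) z = ssum (Inr (bar t)) (\<lambda>u v. cnj (om0 u) * K0 v z) w" for w z
    unfolding K0_def star_e by (simp add: ssum_distrib_right[symmetric] phi0_ssum)
  have K0_2: "K0 w (Inr (bar t) # z) = ssum (Inr t) (\<lambda>u v. om0 u * K0 w v) z" for w z
    by (simp add: K0_def ssum_distrib_left[symmetric] phi0_ssum om0_def)
  have K0_Nil1: "K0 [] z = om0 z" and K0_Nil2: "K0 z [] = cnj (om0 z)" for z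
    by (auto simp: K0_def om0_def phi0_star)
  have "K \<Lambda> (Inr t # w) z = ssum (Inr (bar t)) (\<lambda>u v. cnj (om0 u) * K0 v z) w +
      ssum (Inr t) (\<lambda>u' z'. om0 u' * K \<Lambda> w z') z +
      (\<Sum>s\<in>\<Lambda>. ssum (Inr s) (\<lambda>u w'. ssum (Inr s) (\<lambda>u' z'. K0 (Inr t # u) u' * K \<Lambda> w' z') z) w)"
  proof -
    have "(\<Sum>s\<in>\<Lambda>. if t = s then ssum (Inr s) (\<lambda>u' z'. om0 u' * K \<Lambda> w z') z else 0) =
      ssum (Inr t) (\<lambda>u' z'. om0 u' * K \<Lambda> w z') z"
      using assms by (simp add: sum.delta)
    then show ?thesis
      by (subst K.simps) (simp add: K0_1[of w] sum.distrib K0_Nil1 cong: if_cong)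
  qed
  also have "(\<Sum>s\<in>\<Lambda>. ssum (Inr s) (\<lambda>u w'. ssum (Inr s) (\<lambda>u' z'. K0 (Inr t # u) u' * K \<Lambda> w' z') z) w) =
     (\<Sum>s\<in>\<Lambda>. ssum (Inr (bar t)) (\<lambda>u1 v1. ssum (Inr s) (\<lambda>u w'. ssum (Inr s) (\<lambda>u' z'. cnj (om0 u1) * K0 u u' * K \<Lambda> w' z') z) v1) w)"
    by (subst ssum_assoc[symmetric], subst (2) ssum_swap) (simp add: K0_1 ssum_distrib_right)
  also have "\<dots> = ssum (Inr (bar t)) (\<lambda>u1 v1. cnj (om0 u1) *
      (\<Sum>s\<in>\<Lambda>. ssum (Inr s) (\<lambda>u w'. ssum (Inr s) (\<lambda>u' z'. K0 u u' * K \<Lambda> w' z') z) v1)) w"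
    by (simp add: ssum_sum[symmetric] ssum_distrib_left[symmetric] sum_distrib_left mult.assoc)
  finally have L: "K \<Lambda> (Inr t # w) z = ssum (Inr (bar t)) (\<lambda>u v. cnj (om0 u) * K \<Lambda> v z) w +
      ssum (Inr t) (\<lambda>u' z'. om0 u' * K \<Lambda> w z') z"
    by (subst (2) K.simps) (simp add: algebra_simps ssum_add)
  have "K \<Lambda> w (Inr (bar t) # z) = ssum (Inr t) (\<lambda>u v. om0 u * K0 w v) z +
      ssum (Inr (bar t)) (\<lambda>u w'. cnj (om0 u) * K \<Lambda> w' z) w +
      (\<Sum>s\<in>\<Lambda>. ssum (Inr s) (\<lambda>u w'. ssum (Inr s) (\<lambda>u' z'. K0 u (Inr (bar t) # u') * K \<Lambda> w' z') z) w)"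
  proof -
    have 1: "ssum (Inr s) (\<lambda>u w'. if bar t = s then K0 u [] * K \<Lambda> w' z else 0) w =
       (if bar t = s then ssum (Inr (bar t)) (\<lambda>u w'. cnj (om0 u) * K \<Lambda> w' z) w else 0)" for s
      by (auto simp: ssum_zero K0_Nil2)
    have "(\<Sum>s\<in>\<Lambda>. ssum (Inr s) (\<lambda>u w'. if bar t = s then K0 u [] * K \<Lambda> w' z else 0) w) =
      ssum (Inr (bar t)) (\<lambda>u w'. cnj (om0 u) * K \<Lambda> w' z) w"
      unfolding 1 using assms by (simp add: sum.delta del: bar_eq_iff)
    then show ?thesis
      by (subst K.simps) (simp add: K0_2[of w] ssum_add sum.distrib del: bar_eq_iff cong: if_cong)
  qed
  also have "(\<Sum>s\<in>\<Lambda>. ssum (Inr s) (\<lambda>u w'. ssum (Inr s) (\<lambda>u' z'. K0 u (Inr (bar t) # u') * K \<Lambda> w' z') z) w) =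
     (\<Sum>s\<in>\<Lambda>. ssum (Inr t) (\<lambda>u1 v1. ssum (Inr s) (\<lambda>u w'. ssum (Inr s) (\<lambda>u' z'. om0 u1 * K0 u u' * K \<Lambda> w' z') v1) w) z)"
    by (subst ssum_swap, subst ssum_assoc[symmetric]) (simp add: K0_2 ssum_distrib_right)
  also have "\<dots> = ssum (Inr t) (\<lambda>u1 v1. om0 u1 *
      (\<Sum>s\<in>\<Lambda>. ssum (Inr s) (\<lambda>u w'. ssum (Inr s) (\<lambda>u' z'. K0 u u' * K \<Lambda> w' z') v1) w)) z"
    by (simp add: ssum_sum[symmetric] ssum_distrib_left[symmetric] sum_distrib_left mult.assoc)
  finally have R: "K \<Lambda> w (Inr (bar t) # z) = ssum (Inr t) (\<lambda>u v. om0 u * K \<Lambda> w v) z +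
      ssum (Inr (bar t)) (\<lambda>u w'. cnj (om0 u) * K \<Lambda> w' z) w"
    by (subst (2) K.simps) (simp add: algebra_simps ssum_add)
  show ?thesis unfolding L R by (simp add: add.commute)
qed

text \<open>The letters of \<open>w\<close> are moved across the cut one by one, until the left half
  is empty and \<open>K_Nil\<close> applies.\<close>

lemma om0_eq_K:
  assumes "finite \<Lambda>" "\<And>t. t \<in> \<Lambda> \<Longrightarrow> bar t \<in> \<Lambda>" "\<And>t. Inr t \<in> set w \<Longrightarrow> t \<in> \<Lambda>"
  shows "om0 (wadj w @ z) = K \<Lambda> w z"
  using assms(3)
proof (induction w arbitrary: z)
  case Nil
  then show ?case by (simp add: K_Nil)
next
  case (Cons x w)
  then have "om0 (wadj (x # w) @ z) = K \<Lambda> w (la x # z)" by simp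
  also have "\<dots> = K \<Lambda> (x # w) z"
    using Cons.prems assms(1,2) by (cases x) (auto simp: K_Inl K_Inr)
  finally show ?case .
qed

end

section \<open>Positive kernels as finite sums of rank-one kernels\<close>

lemma nonneg_Reals_iff: "(z :: complex) \<in> \<real>\<^sub>\<ge>\<^sub>0 \<longleftrightarrow> Im z = 0 \<and> 0 \<le> Re z"
proof
  assume "Im z = 0 \<and> 0 \<le> Re z"
  then have "z = of_real (Re z)" "Re z \<ge> 0" by (auto simp: complex_eq_iff)
  then show "z \<in> \<real>\<^sub>\<ge>\<^sub>0" by (metis nonneg_Reals_of_real_iff)
qed (auto elim!: nonneg_Reals_cases)

text \<open>In this form positivity visibly passes to products of kernels and to sums over
  splittings, the two operations from which \<open>K\<close> is built.\<close>

definition gram :: "('a \<Rightarrow> 'a \<Rightarrow> complex) \<Rightarrow> 'a set \<Rightarrow> bool" where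
  "gram k S \<longleftrightarrow> (\<exists>fs. \<forall>u\<in>S. \<forall>v\<in>S. k u v = (\<Sum>f\<leftarrow>fs. cnj (f u) * f v))"

lemma sesqui_insert:
  fixes k :: "'a \<Rightarrow> 'a \<Rightarrow> complex"
  assumes "finite S" "x \<notin> S"
  shows "(\<Sum>u\<in>insert x S. \<Sum>v\<in>insert x S. cnj (c u) * c v * k u v) =
    cnj (c x) * c x * k x x + cnj (c x) * (\<Sum>v\<in>S. c v * k x v) +
    c x * (\<Sum>u\<in>S. cnj (c u) * k u x) + (\<Sum>u\<in>S. \<Sum>v\<in>S. cnj (c u) * c v * k u v)"
  using assms by (simp add: sum.distrib sum_distrib_left algebra_simps)

text \<open>Cholesky elimination of one point. If \<open>k x x = 0\<close>, positivity forces the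
  row of \<open>x\<close> to vanish; otherwise the Schur complement of \<open>x\<close> is again
  positive, and the rank-one kernel split off is added to its decomposition.\<close>

lemma psd_gram:
  assumes "finite S"
    and "\<And>u v. u \<in> S \<Longrightarrow> v \<in> S \<Longrightarrow> k v u = cnj (k u v)"
    and "\<And>c. (\<Sum>u\<in>S. \<Sum>v\<in>S. cnj (c u) * c v * k u v) \<in> \<real>\<^sub>\<ge>\<^sub>0"
  shows "gram k S"
  using assms
proof (induction S arbitrary: k rule: finite_induct)
  case empty
  show ?case by (auto simp: gram_def)
next
  case (insert x S)
  note herm = insert.prems(1) and psd = insert.prems(2)
  have psd_S: "(\<Sum>u\<in>S. \<Sum>v\<in>S. cnj (c u) * c v * k u v) \<in> \<real>\<^sub>\<ge>\<^sub>0" for c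
  proof -
    have "(\<Sum>u\<in>S. f u * (if u = x then 0 else g u)) = (\<Sum>u\<in>S. f u * g u)" for f g :: "'a \<Rightarrow> complex"
      using insert.hyps by (intro sum.cong) auto
    moreover have "(\<Sum>u\<in>S. \<Sum>v\<in>S. cnj (if u = x then 0 else c u) * (if v = x then 0 else c v) * k u v) =
      (\<Sum>u\<in>S. \<Sum>v\<in>S. cnj (c u) * c v * k u v)"
      using insert.hyps by (intro sum.cong) auto
    ultimately show ?thesis
      using psd[of "\<lambda>u. if u = x then 0 else c u"] insert.hyps
      by (simp only: sesqui_insert[OF insert.hyps]) simp
  qed
  have "k x x \<in> \<real>\<^sub>\<ge>\<^sub>0"
  proof -
    have "(\<Sum>u\<in>S. g u * (if u = x then 1 else 0)) = 0"
      "(\<Sum>u\<in>S. (if u = x then 1 else 0) * g u) = 0" for g :: "'a \<Rightarrow> complex"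
      using insert.hyps by (auto intro!: sum.neutral)
    moreover have "(\<Sum>u\<in>S. \<Sum>v\<in>S. cnj (if u = x then 1 else 0) * (if v = x then 1 else 0) * k u v) = 0"
      using insert.hyps by (auto intro!: sum.neutral)
    moreover have "(\<Sum>u\<in>S. cnj (if u = x then 1 else 0) * k u x) = 0"
      using insert.hyps by (auto intro!: sum.neutral)
    ultimately show ?thesis
      using psd[of "\<lambda>u. if u = x then 1 else 0"] insert.hyps
      by (simp only: sesqui_insert[OF insert.hyps]) simp
  qed
  then obtain a where a: "k x x = complex_of_real a" "a \<ge> 0"
    by (elim nonneg_Reals_cases)
  show ?case
  proof (cases "a = 0")
    case True
    have zero: "k x v = 0" if v: "v \<in> S" for v
    proof (rule ccontr)
      assume nz: "k x v \<noteq> 0"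
      have vx: "v \<noteq> x" using v insert.hyps by auto
      \<comment> \<open>With \<open>c x = - r * k x v\<close> and \<open>c v = 1\<close> the form
        has real part \<open>Re (k v v) - 2 * r * (cmod (k x v))\<^sup>2\<close>, which this
        \<open>r\<close> makes negative.\<close>
      define r where "r = (\<bar>Re (k v v)\<bar> + 1) / (cmod (k x v))\<^sup>2"
      define c where "c u = (if u = x then - complex_of_real r * k x v else if u = v then 1 else 0)" for u
      have 1: "(\<Sum>w\<in>S. c w * g w) = g v" for g
      proof -
        have "(\<Sum>w\<in>S. c w * g w) = (\<Sum>w\<in>S. if w = v then g w else 0)"
          using insert.hyps by (intro sum.cong) (auto simp: c_def)
        then show ?thesis using v insert.hyps by simp
      qed
      have 2: "(\<Sum>w\<in>S. cnj (c w) * g w) = g v" for g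
      proof -
        have "(\<Sum>w\<in>S. cnj (c w) * g w) = (\<Sum>w\<in>S. if w = v then g w else 0)"
          using insert.hyps by (intro sum.cong) (auto simp: c_def)
        then show ?thesis using v insert.hyps by simp
      qed
      have 3: "(\<Sum>u\<in>S. \<Sum>w\<in>S. cnj (c u) * c w * k u w) = k v v"
        by (simp add: mult.assoc sum_distrib_left[symmetric] 1 2)
      have "(\<Sum>u\<in>insert x S. \<Sum>v\<in>insert x S. cnj (c u) * c v * k u v) =
          cnj (c x) * k x v + c x * k v x + k v v"
        unfolding sesqui_insert[OF insert.hyps] 1 2 3 using a True by simp
      also have "k v x = cnj (k x v)" by (rule herm) (use v in auto)
      finally have "Re (cnj (c x) * k x v + c x * cnj (k x v) + k v v) \<ge> 0"
        using psd[of c] by (simp add: nonneg_Reals_iff)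
      moreover have "Re (cnj (c x) * k x v + c x * cnj (k x v)) = - 2 * r * (cmod (k x v))\<^sup>2"
        unfolding cmod_power2 by (simp add: c_def algebra_simps power2_eq_square)
      moreover have "r * (cmod (k x v))\<^sup>2 = \<bar>Re (k v v)\<bar> + 1"
        using nz by (simp add: r_def)
      ultimately show False by (simp add: abs_if split: if_splits)
    qed
    obtain fs where fs: "\<forall>u\<in>S. \<forall>v\<in>S. k u v = (\<Sum>f\<leftarrow>fs. cnj (f u) * f v)"
      using insert.IH[of k, OF insert.prems(1)[OF insertI2 insertI2] psd_S] unfolding gram_def by blast
    have zero': "k v x = 0" if "v \<in> S" for v using zero[OF that] herm[of x v] that by auto
    have "\<forall>u\<in>insert x S. \<forall>v\<in>insert x S. k u v =
        (\<Sum>f\<leftarrow>map (\<lambda>f u. if u = x then 0 else f u) fs. cnj (f u) * f v)"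
    proof (intro ballI)
      fix u v assume uv: "u \<in> insert x S" "v \<in> insert x S"
      show "k u v = (\<Sum>f\<leftarrow>map (\<lambda>f u. if u = x then 0 else f u) fs. cnj (f u) * f v)"
      proof (cases "u = x \<or> v = x")
        case True
        then have "k u v = 0" using zero zero' a \<open>a = 0\<close> uv by auto
        then show ?thesis using True by (auto simp: o_def)
      next
        case False
        then have "k u v = (\<Sum>f\<leftarrow>fs. cnj (f u) * f v)" using fs uv by auto
        then show ?thesis using False by (simp add: o_def)
      qed
    qed
    then show ?thesis unfolding gram_def by blast
  next
    case False
    define k' where "k' u v = k u v - k u x * k x v / k x x" for u v
    have a0: "a > 0" using a False by simp
    have "gram k' S"
    proof (rule insert.IH)
      fix u v assume "u \<in> S" "v \<in> S"
      then have "k v u = cnj (k u v)" "k v x = cnj (k x v)" "k x u = cnj (k u x)"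
        by (intro herm; simp)+
      then show "k' v u = cnj (k' u v)" by (simp add: k'_def a)
    next
      fix c
      define s where "s = (\<Sum>v\<in>S. c v * k x v)"
      \<comment> \<open>Completing the square: \<open>- s / a\<close> minimizes the form in the
        coordinate of \<open>x\<close>, and the minimum is the form of the Schur complement at
        \<open>c\<close>.\<close>
      define c' where "c' u = (if u = x then - s / a else c u)" for u
      have eq: "(\<Sum>v\<in>S. c' v * g v) = (\<Sum>v\<in>S. c v * g v)"
        "(\<Sum>v\<in>S. cnj (c' v) * g v) = (\<Sum>v\<in>S. cnj (c v) * g v)" for g
        using insert.hyps by (auto simp: c'_def intro!: sum.cong)
      have s': "(\<Sum>u\<in>S. cnj (c u) * k u x) = cnj s"
        unfolding s_def cnj_sum complex_cnj_mult by (intro sum.cong arg_cong2[where f = "(*)"] refl herm) auto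
      have "(\<Sum>u\<in>insert x S. \<Sum>v\<in>insert x S. cnj (c' u) * c' v * k u v) =
         - s * cnj s / a + (\<Sum>u\<in>S. \<Sum>v\<in>S. cnj (c u) * c v * k u v)"
        unfolding sesqui_insert[OF insert.hyps] eq s' s_def[symmetric]
        by (simp add: mult.assoc sum_distrib_left[symmetric] eq)
          (use a0 in \<open>simp add: c'_def a field_simps\<close>)
      also have "\<dots> = (\<Sum>u\<in>S. \<Sum>v\<in>S. cnj (c u) * c v * k' u v)"
      proof -
        have "(\<Sum>u\<in>S. \<Sum>v\<in>S. cnj (c u) * c v * (k u x * k x v / k x x)) = (\<Sum>u\<in>S. cnj (c u) * k u x) * s / a"
          by (simp add: s_def a sum_product sum_divide_distrib) (simp add: ac_simps)
        then show ?thesis unfolding s'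
          by (simp add: k'_def right_diff_distrib sum_subtractf algebra_simps)
      qed
      finally show "(\<Sum>u\<in>S. \<Sum>v\<in>S. cnj (c u) * c v * k' u v) \<in> \<real>\<^sub>\<ge>\<^sub>0"
        using psd[of c'] by simp
    qed
    then obtain fs where fs: "\<forall>u\<in>S. \<forall>v\<in>S. k' u v = (\<Sum>f\<leftarrow>fs. cnj (f u) * f v)"
      unfolding gram_def by auto
    have sq: "complex_of_real (sqrt a) * complex_of_real (sqrt a) = a"
      using a0 by (simp flip: of_real_mult)
    \<comment> \<open>The rank-one kernel removed in \<open>k'\<close> comes back with
      \<open>sqrt a\<close> distributed over its two factors; the other functions are extended by 0
      at \<open>x\<close>.\<close>
    have "\<forall>u\<in>insert x S. \<forall>v\<in>insert x S. k u v =
        (\<Sum>f\<leftarrow>(\<lambda>u. k x u / sqrt a) # map (\<lambda>f u. if u = x then 0 else f u) fs. cnj (f u) * f v)"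
    proof (intro ballI)
      fix u v assume uv: "u \<in> insert x S" "v \<in> insert x S"
      have "cnj (k x u) = k u x" by (rule herm[symmetric]) (use uv in auto)
      then have 1: "cnj (k x u / sqrt a) * (k x v / sqrt a) = k u x * k x v / a"
        using sq by simp
      show "k u v = (\<Sum>f\<leftarrow>(\<lambda>u. k x u / sqrt a) # map (\<lambda>f u. if u = x then 0 else f u) fs. cnj (f u) * f v)"
      proof (cases "u = x \<or> v = x")
        case True
        then have "k u x * k x v / a = k u v" using a a0 by auto
        then show ?thesis using True 1 by (auto simp: o_def)
      next
        case False
        then have "k' u v = (\<Sum>f\<leftarrow>fs. cnj (f u) * f v)" using fs uv by auto
        then show ?thesis using False 1 by (auto simp: o_def k'_def a algebra_simps)
      qed
    qed
    then show ?thesis unfolding gram_def by blast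
  qed
qed

lemma sum_list_mult_sum_list:
  "sum_list (map f xs) * sum_list (map g ys) = (\<Sum>(x, y)\<leftarrow>List.product xs ys. f x * (g y :: 'b::semiring_0))"
  by (induction xs) (simp_all add: distrib_right sum_list_const_mult o_def)

lemma sum_list_map_concat: "sum_list (map g (concat xss)) = (\<Sum>xs\<leftarrow>xss. sum_list (map g xs))"
  by (induction xss) auto

lemma sum_list_product:
  "(\<Sum>(x, y)\<leftarrow>List.product xs ys. h x y) = (\<Sum>x\<leftarrow>xs. \<Sum>y\<leftarrow>ys. (h x y :: 'b::comm_monoid_add))"
  by (induction xs) (auto simp: o_def)

lemma ssum_sum_list: "ssum t (\<lambda>u v. \<Sum>i\<leftarrow>xs. F i u v) w = (\<Sum>i\<leftarrow>xs. ssum t (F i) w)"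
  by (induction xs) (auto simp: ssum_zero ssum_add)

context free_circular
begin

lemma K0_herm: "K0 z w = cnj (K0 w z)"
  by (simp add: K0_def phi0_star[symmetric])

lemma keys_e: "Poly_Mapping.keys (e w) \<subseteq> {v. set v \<subseteq> range Inl}"
proof (induction w rule: e.induct)
  case (2 a w)
  show ?case
  proof
    fix v assume "v \<in> Poly_Mapping.keys (e (Inl a # w))"
    then obtain x y where "v = x @ y" "x \<in> Poly_Mapping.keys (mon [Inl a])" "y \<in> Poly_Mapping.keys (e w)"
      using keys_mult[of "mon [Inl a]" "e w"] unfolding e.simps plus_list_def by blast
    then show "v \<in> {v. set v \<subseteq> range Inl}" using 2 by (force split: if_splits)
  qed
next
  case (3 t w)
  have keys_add_subset: "Poly_Mapping.keys (f + g) \<subseteq> A" if "Poly_Mapping.keys f \<subseteq> A" "Poly_Mapping.keys g \<subseteq> A"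
    for f g :: "('c + nat \<times> bool) list \<Rightarrow>\<^sub>0 complex" and A
    using keys_add[of f g] that by auto
  have *: "Poly_Mapping.keys (ssum s F w) \<subseteq> A"
    if "\<And>u v. w = u @ s # v \<Longrightarrow> Poly_Mapping.keys (F u v) \<subseteq> A" for A s and F :: "_ \<Rightarrow> _ \<Rightarrow> (('c + nat \<times> bool) list \<Rightarrow>\<^sub>0 complex)" and w
    using that
  proof (induction w arbitrary: F)
    case (Cons x w)
    have "Poly_Mapping.keys (ssum s (\<lambda>u v. F (x # u) v) w) \<subseteq> A"
      by (rule Cons.IH) (use Cons.prems in auto)
    moreover have "x = s \<Longrightarrow> Poly_Mapping.keys (F [] w) \<subseteq> A" using Cons.prems by auto
    ultimately show ?case by (cases "x = s") (simp_all add: keys_add_subset)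
  qed simp
  show ?case unfolding e.simps
  proof (rule *)
    fix u v assume "w = u @ Inr (bar t) # v"
    then have "Poly_Mapping.keys (e v) \<subseteq> {v. set v \<subseteq> range Inl}" using 3 by blast
    then show "Poly_Mapping.keys (const (phi0 (e u)) * e v) \<subseteq> {v. set v \<subseteq> range Inl}"
      by (auto simp: in_keys_iff lookup_const_mult)
  qed
qed (auto simp: one_eq_mon)

lemma phi0_pos:
  assumes "Poly_Mapping.keys f \<subseteq> {v. set v \<subseteq> range Inl}"
  shows "phi0 (star f * f) \<in> \<real>\<^sub>\<ge>\<^sub>0"
proof -
  let ?S = "Poly_Mapping.keys f" and ?c = "Poly_Mapping.lookup f"
  have f: "f = (\<Sum>w\<in>?S. Poly_Mapping.single w (?c w))"
    by (rule poly_mapping_eqI) (auto simp: lookup_sum lookup_single when_def in_keys_iff)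
  have star_sum: "star (\<Sum>i\<in>I. g i) = (\<Sum>i\<in>I. star (g i))" for I :: "'x set" and g
    by (induction I rule: infinite_finite_induct) auto
  have phi0_sum: "phi0 (\<Sum>i\<in>I. g i) = (\<Sum>i\<in>I. phi0 (g i))" for I :: "'x set" and g
    by (induction I rule: infinite_finite_induct) auto
  have Inl_projl: "map Inl (map projl u) = u" if "u \<in> ?S" for u
  proof -
    have "set u \<subseteq> range Inl" using assms that by auto
    then show ?thesis by (induction u) auto
  qed
  then have inj: "inj_on (map projl) ?S"
    by (rule inj_on_inverseI)
  have "phi0 (star f * f) = (\<Sum>u\<in>?S. \<Sum>v\<in>?S. cnj (?c u) * ?c v * tau0 (wadj u @ v))"
    by (subst (1 2) f) (simp add: star_sum sum_product phi0_sum mult_single plus_list_def, simp add: phi0_def)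
  also have "\<dots> = (\<Sum>u\<in>?S. \<Sum>v\<in>?S. cnj (?c u) * ?c v * \<tau> (rev (map st (map projl u)) @ map projl v))"
  proof (intro sum.cong refl)
    fix u v assume "u \<in> ?S" "v \<in> ?S"
    then have uv: "set u \<subseteq> range Inl" "set v \<subseteq> range Inl" using assms by auto
    from uv(1) have "map projl (map la u) = map st (map projl u)"
      by (induction u) auto
    then have "map projl (wadj u) = rev (map st (map projl u))"
      by (simp add: wadj_def rev_map[symmetric])
    moreover have "set (wadj u) \<subseteq> range Inl"
      using uv(1) by (auto simp: wadj_def)
    ultimately show "cnj (?c u) * ?c v * tau0 (wadj u @ v) =
        cnj (?c u) * ?c v * \<tau> (rev (map st (map projl u)) @ map projl v)"
      using uv by (simp add: tau0_def)
  qed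
  also have "\<dots> = (\<Sum>u\<in>map projl ` ?S. \<Sum>v\<in>map projl ` ?S.
      cnj (?c (map Inl u)) * ?c (map Inl v) * \<tau> (rev (map st u) @ v))"
  proof -
    show ?thesis using inj Inl_projl by (simp add: sum.reindex o_def)
  qed
  also have "\<dots> \<in> \<real>\<^sub>\<ge>\<^sub>0" by (rule tau_pos) simp
  finally show ?thesis .
qed

lemma K0_gram: "finite S \<Longrightarrow> gram K0 S"
proof (rule psd_gram)
  fix c :: "('c + nat \<times> bool) list \<Rightarrow> complex"
  assume fin: "finite S"
  define f where "f = (\<Sum>u\<in>S. const (c u) * e u)"
  have star_sum: "star (\<Sum>i\<in>I. g i) = (\<Sum>i\<in>I. star (g i))" for I :: "'x set" and g
    by (induction I rule: infinite_finite_induct) auto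
  have phi0_sum: "phi0 (\<Sum>i\<in>I. g i) = (\<Sum>i\<in>I. phi0 (g i))" for I :: "'x set" and g
    by (induction I rule: infinite_finite_induct) auto
  have "(\<Sum>u\<in>S. \<Sum>v\<in>S. cnj (c u) * c v * K0 u v) = phi0 (star f * f)"
    by (simp add: f_def star_sum sum_product phi0_sum K0_def mult.assoc del: star_mult)
  moreover have "Poly_Mapping.keys f \<subseteq> {v. set v \<subseteq> range Inl}"
  proof
    fix v assume v: "v \<in> Poly_Mapping.keys f"
    then obtain u where "u \<in> S" "Poly_Mapping.lookup (const (c u) * e u) v \<noteq> 0"
      unfolding f_def in_keys_iff lookup_sum by (metis (no_types, lifting) sum.not_neutral_contains_not_neutral)
    then show "v \<in> {v. set v \<subseteq> range Inl}" using keys_e[of u] by (auto simp: lookup_const_mult in_keys_iff)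
  qed
  ultimately show "(\<Sum>u\<in>S. \<Sum>v\<in>S. cnj (c u) * c v * K0 u v) \<in> \<real>\<^sub>\<ge>\<^sub>0"
    using phi0_pos by simp
qed (auto intro: K0_herm)

text \<open>A rank-one summand \<open>f\<close> of \<open>K0\<close> and a rank-one summand
  \<open>g\<close> of \<open>K\<close> on shorter words combine, through the splitting at
  \<open>t\<close>, to the rank-one kernel of \<open>h t f g\<close>. So the recursion for
  \<open>K\<close> turns decompositions into a decomposition, one length at a time.\<close>

lemma K_gram:
  assumes "finite \<Lambda>" "finite L"
  shows "gram (K \<Lambda>) {w. set w \<subseteq> L \<and> length w \<le> n}"
proof (induction n)
  case 0
  have eq: "{w. set w \<subseteq> L \<and> length w \<le> 0} = {[]}" by auto
  show ?case unfolding eq gram_def by (rule exI[of _ "[\<lambda>_. 1]"]) (simp add: K_Nil)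
next
  case (Suc n)
  let ?S = "\<lambda>n. {w. set w \<subseteq> L \<and> length w \<le> n}"
  obtain ls where ls: "set ls = \<Lambda>" "distinct ls" using assms finite_distinct_list by metis
  have "finite (?S (Suc n))" using finite_lists_length_le[OF assms(2)] by simp
  from K0_gram[OF this] obtain fs where fs: "\<forall>u\<in>?S (Suc n). \<forall>v\<in>?S (Suc n). K0 u v = (\<Sum>f\<leftarrow>fs. cnj (f u) * f v)"
    unfolding gram_def by blast
  from Suc obtain gs where gs: "\<forall>u\<in>?S n. \<forall>v\<in>?S n. K \<Lambda> u v = (\<Sum>f\<leftarrow>gs. cnj (f u) * f v)"
    unfolding gram_def by blast
  define h where "h t f g = ssum (Inr t) (\<lambda>u v. f u * g v)"
    for t :: "nat \<times> bool" and f g :: "('c + nat \<times> bool) list \<Rightarrow> complex"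
  define hs where "hs = fs @ concat (map (\<lambda>t. map (\<lambda>(f, g). h t f g) (List.product fs gs)) ls)"
  have "\<forall>w\<in>?S (Suc n). \<forall>z\<in>?S (Suc n). K \<Lambda> w z = (\<Sum>f\<leftarrow>hs. cnj (f w) * f z)"
  proof (intro ballI)
    fix w z assume w: "w \<in> ?S (Suc n)" and z: "z \<in> ?S (Suc n)"
    have "ssum (Inr t) (\<lambda>u w'. ssum (Inr t) (\<lambda>u' z'. K0 u u' * K \<Lambda> w' z') z) w =
       (\<Sum>(f, g)\<leftarrow>List.product fs gs. cnj (h t f g w) * h t f g z)" for t
    proof -
      have "ssum (Inr t) (\<lambda>u w'. ssum (Inr t) (\<lambda>u' z'. K0 u u' * K \<Lambda> w' z') z) w =
         ssum (Inr t) (\<lambda>u w'. ssum (Inr t) (\<lambda>u' z'.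
           (\<Sum>f\<leftarrow>fs. \<Sum>g\<leftarrow>gs. cnj (f u * g w') * (f u' * g z'))) z) w"
      proof (intro ssum_cong refl)
        fix u w' u' z' assume "w = u @ Inr t # w'" "z = u' @ Inr t # z'"
        then have *: "u \<in> ?S (Suc n)" "u' \<in> ?S (Suc n)" "w' \<in> ?S n" "z' \<in> ?S n"
          using w z by auto
        have "K0 u u' * K \<Lambda> w' z' = (\<Sum>f\<leftarrow>fs. cnj (f u) * f u') * (\<Sum>g\<leftarrow>gs. cnj (g w') * g z')"
          using fs gs * by simp
        then show "K0 u u' * K \<Lambda> w' z' = (\<Sum>f\<leftarrow>fs. \<Sum>g\<leftarrow>gs. cnj (f u * g w') * (f u' * g z'))"
          by (simp add: sum_list_mult_sum_list sum_list_product ac_simps)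
      qed
      also have "\<dots> = (\<Sum>f\<leftarrow>fs. \<Sum>g\<leftarrow>gs. ssum (Inr t) (\<lambda>u w'. cnj (f u * g w')) w * h t f g z)"
        by (simp only: ssum_sum_list ssum_distrib_left ssum_distrib_right h_def)
      also have "\<dots> = (\<Sum>f\<leftarrow>fs. \<Sum>g\<leftarrow>gs. cnj (h t f g w) * h t f g z)"
        by (subst ssum_additive[where h = cnj]) (simp_all add: h_def)
      finally show ?thesis by (simp add: sum_list_product)
    qed
    then have "K \<Lambda> w z = (\<Sum>f\<leftarrow>fs. cnj (f w) * f z) +
        (\<Sum>t\<leftarrow>ls. \<Sum>(f, g)\<leftarrow>List.product fs gs. cnj (h t f g w) * h t f g z)"
      using fs w z ls by (subst K.simps) (auto simp: sum_list_distinct_conv_sum_set)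
    also have "\<dots> = (\<Sum>f\<leftarrow>hs. cnj (f w) * f z)"
      by (simp add: hs_def sum_list_map_concat o_def case_prod_unfold)
    finally show "K \<Lambda> w z = (\<Sum>f\<leftarrow>hs. cnj (f w) * f z)" .
  qed
  then show ?case unfolding gram_def by blast
qed

lemma gram_psd:
  assumes "gram k S"
  shows "(\<Sum>u\<in>S. \<Sum>v\<in>S. cnj (c u) * c v * k u v) \<in> \<real>\<^sub>\<ge>\<^sub>0"
proof -
  obtain fs where fs: "\<forall>u\<in>S. \<forall>v\<in>S. k u v = (\<Sum>f\<leftarrow>fs. cnj (f u) * f v)"
    using assms unfolding gram_def by blast
  have "(\<Sum>u\<in>S. \<Sum>v\<in>S. cnj (c u) * c v * (\<Sum>f\<leftarrow>fs. cnj (f u) * f v)) =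
     (\<Sum>f\<leftarrow>fs. cnj (\<Sum>u\<in>S. c u * f u) * (\<Sum>u\<in>S. c u * f u))"
  proof (induction fs)
    case (Cons f fs)
    have "(\<Sum>u\<in>S. \<Sum>v\<in>S. cnj (c u) * c v * (cnj (f u) * f v)) = cnj (\<Sum>u\<in>S. c u * f u) * (\<Sum>u\<in>S. c u * f u)"
      unfolding cnj_sum sum_product by (intro sum.cong refl) (simp add: ac_simps)
    then show ?case using Cons by (simp add: algebra_simps sum.distrib)
  qed simp
  also have "\<dots> \<in> \<real>\<^sub>\<ge>\<^sub>0"
  proof (induction fs)
    case (Cons f fs)
    have "cnj z * z \<in> \<real>\<^sub>\<ge>\<^sub>0" for z
      by (simp add: nonneg_Reals_iff)
    from this[of "\<Sum>u\<in>S. c u * f u"] show ?case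
      using Cons by (simp only: list.map sum_list.Cons nonneg_Reals_add_I)
  qed simp
  finally show ?thesis using fs by simp
qed

lemma om_pos: "om (star f * f) \<in> \<real>\<^sub>\<ge>\<^sub>0"
proof -
  let ?S = "Poly_Mapping.keys f" and ?c = "Poly_Mapping.lookup f"
  define L where "L = \<Union> (set ` ?S)"
  \<comment> \<open>Moving the cut requires a finite set of letters that contains all Gaussian
    letters of the support and is closed under \<open>bar\<close>.\<close>
  define \<Lambda> where "\<Lambda> = {t. Inr t \<in> L} \<union> bar ` {t. Inr t \<in> L}"
  define n where "n = Max (insert 0 (length ` ?S))"
  have finL: "finite L" by (auto simp: L_def)
  have "finite {t. Inr t \<in> L}"
    using finite_vimageI[OF finL, of Inr] by (simp add: vimage_def)
  then have fin: "finite \<Lambda>" by (auto simp: \<Lambda>_def)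
  have f: "f = (\<Sum>w\<in>?S. Poly_Mapping.single w (?c w))"
    by (rule poly_mapping_eqI) (auto simp: lookup_sum lookup_single when_def in_keys_iff)
  have star_sum: "star (\<Sum>i\<in>I. g i) = (\<Sum>i\<in>I. star (g i))" for I :: "'x set" and g
    by (induction I rule: infinite_finite_induct) auto
  have "om (star f * f) = (\<Sum>u\<in>?S. \<Sum>v\<in>?S. cnj (?c u) * ?c v * om0 (wadj u @ v))"
    by (subst (1 2) f) (simp add: star_sum sum_product mult_single plus_list_def, simp add: om_def)
  also have "\<dots> = (\<Sum>u\<in>?S. \<Sum>v\<in>?S. cnj (?c u) * ?c v * K \<Lambda> u v)"
    by (intro sum.cong refl arg_cong2[where f = "(*)"] om0_eq_K fin) (auto simp: \<Lambda>_def L_def)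
  also have "\<dots> \<in> \<real>\<^sub>\<ge>\<^sub>0"
  proof (rule gram_psd)
    have "?S \<subseteq> {w. set w \<subseteq> L \<and> length w \<le> n}"
      by (auto simp: L_def n_def)
    then show "gram (K \<Lambda>) ?S"
      using K_gram[OF fin finL, of n] unfolding gram_def by blast
  qed
  finally show ?thesis .
qed

end

section \<open>Free difference quotients and the Schwinger-Dyson equation\<close>

definition bilinear_fa :: "(('l list \<Rightarrow>\<^sub>0 complex) \<Rightarrow> ('l list \<Rightarrow>\<^sub>0 complex) \<Rightarrow> complex) \<Rightarrow> bool" where
  "bilinear_fa F \<longleftrightarrow> (\<forall>a. linear_fa (F a)) \<and> (\<forall>b. linear_fa (\<lambda>a. F a b))"

lemma bilinear_faD:
  assumes "bilinear_fa F"
  shows "F (a + a') b = F a b + F a' b" "F (const c * a) b = c * F a b"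
    "F a (b + b') = F a b + F a b'" "F a (const c * b) = c * F a b"
  using assms by (auto simp: bilinear_fa_def linear_fa_def)

lemma bilinear_fa_shift:
  assumes "bilinear_fa F"
  shows "bilinear_fa (\<lambda>a b. F a (b * Z))" "bilinear_fa (\<lambda>a b. F (Z * a) b)"
  using bilinear_faD[OF assms]
  by (auto simp: bilinear_fa_def linear_fa_def algebra_simps const_left_comm)

text \<open>The free difference quotient at the letter \<open>t\<close>, which sends a word to the
  sum of the tensors of \<open>u\<close> and \<open>v\<close> over \<open>w = u @ t # v\<close>,
  followed by the bilinear functional \<open>F\<close>. Tensor products need not be formed in this
  way.\<close>

definition dd where
  "dd t F Z = lin (\<lambda>w. ssum t (\<lambda>u v. F (mon u) (mon v)) w) Z"

lemma dd_simps [simp]: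
  "dd t F (Z + Z') = dd t F Z + dd t F Z'" "dd t F (const c * Z) = c * dd t F Z"
  "dd t F (mon w) = ssum t (\<lambda>u v. F (mon u) (mon v)) w" "dd t F 0 = 0"
  by (auto simp: dd_def)

lemma dd_add: "dd t (\<lambda>a b. F a b + G a b) Z = dd t F Z + dd t G Z"
  by (induction Z rule: FA_induct) (auto simp: ssum_add algebra_simps)

lemma dd_scale: "dd t (\<lambda>a b. c * F a b) Z = c * dd t F Z"
  by (induction Z rule: FA_induct) (auto simp: ssum_distrib_left algebra_simps)

text \<open>The Leibniz rule: the letter that is split off lies in the left or in the right
  factor.\<close>

lemma dd_mult:
  assumes "bilinear_fa F"
  shows "dd t F (Z * Z') = dd t (\<lambda>a b. F a (b * Z')) Z + dd t (\<lambda>a b. F (Z * a) b) Z'"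
proof (induction Z rule: FA_induct)
  case (mon w)
  show ?case
  proof (induction Z' rule: FA_induct)
    case (mon v)
    show ?case by (simp add: mon_mult ssum_append)
  next
    case (add f g)
    then show ?case by (simp add: distrib_left bilinear_faD[OF assms] dd_add)
  next
    case (scale c f)
    then show ?case
      by (simp add: const_left_comm[of "mon w"] bilinear_faD[OF assms] dd_scale const_left_comm distrib_left)
  qed
next
  case (add f g)
  then show ?case by (simp add: distrib_right bilinear_faD[OF assms] dd_add)
next
  case (scale c f)
  then show ?case by (simp add: mult.assoc bilinear_faD[OF assms] dd_scale distrib_left)
qed

lemma dd_eq_0I:
  assumes "\<And>w u v. w \<in> Poly_Mapping.keys Z \<Longrightarrow> w = u @ t # v \<Longrightarrow> F (mon u) (mon v) = 0"
  shows "dd t F Z = 0"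
  unfolding dd_def lin_def
  by (intro sum.neutral ballI mult_eq_0_iff[THEN iffD2] disjI2 ssum_eq_0I assms)

lemma dd_prod_list_eq_0I:
  assumes "bilinear_fa F"
    and "\<And>As x Bs. Xs = As @ x # Bs \<Longrightarrow>
      dd t (\<lambda>a b. F (prod_list As * a) (b * prod_list Bs)) x = 0"
  shows "dd t F (prod_list Xs) = 0"
  using assms
proof (induction Xs arbitrary: F)
  case Nil
  show ?case by (simp add: one_eq_mon)
next
  case (Cons y Xs)
  have "dd t (\<lambda>a b. F (y * a) b) (prod_list Xs) = 0"
  proof (rule Cons.IH)
    show "bilinear_fa (\<lambda>a b. F (y * a) b)" by (rule bilinear_fa_shift) fact
    fix As x Bs assume "Xs = As @ x # Bs"
    then show "dd t (\<lambda>a b. F (y * (prod_list As * a)) (b * prod_list Bs)) x = 0"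
      using Cons.prems(2)[of "y # As" x Bs] by (simp add: mult.assoc)
  qed
  moreover have "dd t (\<lambda>a b. F a (b * prod_list Xs)) y = 0"
    using Cons.prems(2)[of "[]" y Xs] by simp
  ultimately show ?case by (simp add: dd_mult[OF Cons.prems(1)])
qed

context free_circular
begin

lemma e_Inl_append: "set w \<subseteq> range Inl \<Longrightarrow> e (w @ v) = mon w * e v"
proof (induction w)
  case (Cons x w)
  then obtain a where "x = Inl a" by auto
  then show ?case using Cons by (simp add: mult.assoc[symmetric] mon_mult)
qed (simp add: one_eq_mon[symmetric])

lemma e_Inl: "set w \<subseteq> range Inl \<Longrightarrow> e w = mon w"
  using e_Inl_append[of w "[]"] by simp

lemma phi0_mon [simp]: "phi0 (mon w) = tau0 w"
  by (simp add: phi0_def)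

lemma om_Inl: "Poly_Mapping.keys f \<subseteq> {w. set w \<subseteq> range Inl} \<Longrightarrow> om f = phi0 f"
  unfolding om_def phi0_def lin_def
  by (intro sum.cong) (auto simp: om0_def e_Inl)

text \<open>Constant letters at the front pass through \<open>e\<close> unchanged, so a combination
  of constant words that is invisible to \<tau> against every continuation is invisible to
  \<open>om\<close> against every element of the free algebra. All relations of the algebra of
  constants are transferred by this lemma.\<close>

lemma null_letters:
  assumes "\<And>v. (\<Sum>i\<in>I. c i * \<tau> (\<alpha> i @ v)) = 0"
  shows "om ((\<Sum>i\<in>I. const (c i) * mon (map Inl (\<alpha> i))) * h) = 0"
proof -
  have phi0_sum: "phi0 (\<Sum>i\<in>I. g i) = (\<Sum>i\<in>I. phi0 (g i))" for g
    by (induction I rule: infinite_finite_induct) auto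
  have 1: "phi0 ((\<Sum>i\<in>I. const (c i) * mon (map Inl (\<alpha> i))) * g) = 0" for g
  proof (induction g rule: FA_induct)
    case (mon v)
    have "phi0 ((\<Sum>i\<in>I. const (c i) * mon (map Inl (\<alpha> i))) * mon v) =
        (\<Sum>i\<in>I. c i * tau0 (map Inl (\<alpha> i) @ v))"
      by (simp add: sum_distrib_right phi0_sum mult.assoc mon_mult)
    also have "\<dots> = (if set v \<subseteq> range Inl then (\<Sum>i\<in>I. c i * \<tau> (\<alpha> i @ map projl v)) else 0)"
      by (auto simp: tau0_def o_def intro!: sum.cong)
    finally show ?case by (simp add: assms)
  qed (simp_all add: algebra_simps const_left_comm)
  show ?thesis
  proof (induction h rule: FA_induct)
    case (mon w)
    have "om ((\<Sum>i\<in>I. const (c i) * mon (map Inl (\<alpha> i))) * mon w) =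
       (\<Sum>i\<in>I. c i * phi0 (mon (map Inl (\<alpha> i)) * e w))"
      by (simp add: sum_distrib_right mult.assoc mon_mult om0_def)
        (intro sum.cong refl, subst e_Inl_append, auto)
    also have "\<dots> = phi0 ((\<Sum>i\<in>I. const (c i) * mon (map Inl (\<alpha> i))) * e w)"
      by (simp add: sum_distrib_right mult.assoc phi0_sum)
    finally show ?case by (simp add: 1)
  qed (simp_all add: algebra_simps const_left_comm)
qed

lemma om_SD:
  assumes "set \<alpha> \<subseteq> range Inl"
  shows "om (mon \<alpha> * (mon [Inr t] * Z)) = dd (Inr (bar t)) (\<lambda>a b. om a * om (mon \<alpha> * b)) Z"
proof (induction Z rule: FA_induct)
  case (mon w)
  have "om0 (\<alpha> @ Inr t # w) = ssum (Inr (bar t)) (\<lambda>u v. om0 u * om0 (\<alpha> @ v)) w"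
    using assms
    by (simp add: om0_def e_Inl_append ssum_distrib_left[symmetric] const_left_comm phi0_ssum)
  then show ?case by (simp add: mon_mult)
qed (simp_all add: algebra_simps const_left_comm)

lemma om_rotate: "om (a * (b * c)) = om (b * (c * a))"
  using om_comm[of a "b * c"] by (simp add: mult.assoc)

lemma bilinear_om: "bilinear_fa (\<lambda>a b. om (f * a) * om (g * b))" "bilinear_fa (\<lambda>a b. om a * om (g * b))"
  by (auto simp: bilinear_fa_def linear_fa_def algebra_simps)

end

section \<open>Freeness over the span of the projections\<close>

locale free_circular_proj = free_circular \<tau> st
  for \<tau> :: "'c list \<Rightarrow> complex" and st +
  fixes d :: nat and P :: "nat \<Rightarrow> 'c"
  assumes P_mult: "k < d \<Longrightarrow> l < d \<Longrightarrow> \<tau> (P k # P l # v) = (if k = l then \<tau> (P k # v) else 0)"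
    and P_sum: "(\<Sum>k<d. \<tau> (P k # v)) = \<tau> v"
    and P_star: "k < d \<Longrightarrow> st (P k) = P k"
    and P_nonzero: "k < d \<Longrightarrow> \<tau> [P k] \<noteq> 0"
begin

definition pm where "pm k = mon [Inl (P k) :: 'c + nat \<times> bool]"

lemma om_pm_pm: "k < d \<Longrightarrow> l < d \<Longrightarrow> om (pm k * (pm l * h)) = (if k = l then om (pm k * h) else 0)"
  using null_letters[where I = "{0::nat, 1}" and c = "\<lambda>i. if i = 0 then 1 else if k = l then -1 else 0"
      and \<alpha> = "\<lambda>i. if i = 0 then [P k, P l] else [P k]" and h = h]
  by (auto simp: P_mult pm_def algebra_simps mon_mult one_eq_mon[symmetric] single_uminus)
     (simp_all add: mult.assoc[symmetric] mon_mult)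

lemma om_pm_sum: "(\<Sum>k<d. om (pm k * h)) = om h"
  using null_letters[where I = "insert d {..<d}" and c = "\<lambda>i. if i = d then -1 else 1"
      and \<alpha> = "\<lambda>i. if i = d then [] else [P i]" and h = h] P_sum
  by (auto simp: pm_def algebra_simps one_eq_mon[symmetric] single_uminus sum_distrib_left sum_distrib_right)

definition Pword where "Pword w \<longleftrightarrow> set w \<subseteq> Inl ` P ` {..<d}"

text \<open>Modulo the null ideal, the words in the projections span \<open>\<D>\<close>.\<close>

lemma om_Pword:
  assumes "Pword w"
  shows "om (mon w * h) = (\<Sum>k<d. om (pm k * mon w) / \<tau> [P k] * om (pm k * h))"
  using assms
proof (induction w arbitrary: h)
  case Nil
  have "om (pm k) = \<tau> [P k]" for k
    by (simp add: pm_def om0_def tau0_def mon_mult one_eq_mon)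
  then show ?case using P_nonzero by (simp add: one_eq_mon[symmetric] om_pm_sum)
next
  case (Cons x w)
  then obtain l where l: "l < d" "x = Inl (P l)" and w: "Pword w" by (auto simp: Pword_def)
  have xw: "mon (x # w) = pm l * mon w" by (simp add: pm_def l mon_mult)
  have "om (mon (x # w) * h) = om (mon w * (h * pm l))"
    by (simp only: xw mult.assoc om_rotate[of "pm l"])
  also have "\<dots> = (\<Sum>k<d. om (pm k * mon w) / \<tau> [P k] * om (pm k * (h * pm l)))"
    by (rule Cons.IH[OF w])
  also have "\<dots> = (\<Sum>k<d. if k = l then om (pm l * mon w) / \<tau> [P l] * om (pm l * h) else 0)"
  proof (rule sum.cong[OF refl])
    fix k assume k: "k \<in> {..<d}"
    have "om (pm k * (h * pm l)) = om (pm l * (pm k * h))" by (rule om_rotate[symmetric])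
    then show "om (pm k * mon w) / \<tau> [P k] * om (pm k * (h * pm l)) =
        (if k = l then om (pm l * mon w) / \<tau> [P l] * om (pm l * h) else 0)"
      using k l by (simp add: om_pm_pm)
  qed
  also have "\<dots> = (\<Sum>k<d. om (pm k * mon (x # w)) / \<tau> [P k] * om (pm k * h))"
    unfolding xw using l by (intro sum.cong[OF refl]) (auto simp: om_pm_pm)
  finally show ?case .
qed

text \<open>\<open>None\<close> stands for the constants and \<open>Some s\<close> for
  \<open>y_s\<close> with its adjoint. The projections belong to every group, so that the
  polynomials over each group contain D.\<close>

definition letters :: "nat option \<Rightarrow> ('c + nat \<times> bool) set" where
  "letters g = (case g of None \<Rightarrow> range Inl | Some s \<Rightarrow> Inl ` P ` {..<d} \<union> {Inr (s, False), Inr (s, True)})"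

definition over :: "nat option \<Rightarrow> (('c + nat \<times> bool) list \<Rightarrow>\<^sub>0 complex) \<Rightarrow> bool" where
  "over g f \<longleftrightarrow> Poly_Mapping.keys f \<subseteq> {w. set w \<subseteq> letters g}"

text \<open>Up to the nonzero factor \<open>\<tau> [P k]\<close> the number
  \<open>om (pm k * f)\<close> is the coordinate of index \<open>k\<close> of the conditional
  expectation of \<open>f\<close> onto D.\<close>

definition centered :: "(('c + nat \<times> bool) list \<Rightarrow>\<^sub>0 complex) \<Rightarrow> bool" where
  "centered f \<longleftrightarrow> (\<forall>k<d. om (pm k * f) = 0)"

definition calt where
  "calt X \<longleftrightarrow> distinct_adj (map fst X) \<and> (\<forall>(g, f)\<in>set X. over g f \<and> centered f)"

lemma keys_mult_subset:
  fixes f g :: "'l list \<Rightarrow>\<^sub>0 complex"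
  assumes "Poly_Mapping.keys f \<subseteq> {w. set w \<subseteq> A}" "Poly_Mapping.keys g \<subseteq> {w. set w \<subseteq> A}"
  shows "Poly_Mapping.keys (f * g) \<subseteq> {w. set w \<subseteq> A}"
  using keys_mult[of f g] assms by (fastforce simp: plus_list_def)

lemma keys_ssum_subset:
  fixes F :: "'l list \<Rightarrow> 'l list \<Rightarrow> ('l list \<Rightarrow>\<^sub>0 complex)"
  assumes "\<And>u v. w = u @ s # v \<Longrightarrow> Poly_Mapping.keys (F u v) \<subseteq> A"
  shows "Poly_Mapping.keys (ssum s F w) \<subseteq> A"
  using assms
proof (induction w arbitrary: F)
  case (Cons x w)
  have "Poly_Mapping.keys (ssum s (\<lambda>u v. F (x # u) v) w) \<subseteq> A"
    by (rule Cons.IH) (use Cons.prems in auto)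
  moreover have "x = s \<Longrightarrow> Poly_Mapping.keys (F [] w) \<subseteq> A" using Cons.prems by auto
  ultimately show ?case
    using keys_add[of "F [] w" "ssum s (\<lambda>u v. F (x # u) v) w"] by auto
qed simp

lemma keys_const_mult: "Poly_Mapping.keys (const c * f) \<subseteq> Poly_Mapping.keys f"
  by (auto simp: in_keys_iff lookup_const_mult)

text \<open>Pairs are replaced by scalars and the projections are the only constants in such a word:
  \<open>e\<close> maps the algebra of one \<open>y_s\<close> and the projections into D.\<close>

lemma keys_e_Pword:
  "set w \<subseteq> letters (Some s) \<Longrightarrow> Poly_Mapping.keys (e w) \<subseteq> {w. set w \<subseteq> Inl ` P ` {..<d}}"
proof (induction w rule: e.induct)
  case (2 a w)
  then show ?case
    by (simp only: e.simps, intro keys_mult_subset) (auto simp: letters_def)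
next
  case (3 t w)
  show ?case unfolding e.simps
  proof (rule keys_ssum_subset)
    fix u v assume w: "w = u @ Inr (bar t) # v"
    then have "Poly_Mapping.keys (e v) \<subseteq> {w. set w \<subseteq> Inl ` P ` {..<d}}"
      using 3 by (metis (no_types, lifting) Un_subset_iff insert_subset list.simps(15) set_append)
    then show "Poly_Mapping.keys (const (phi0 (e u)) * e v) \<subseteq> {w. set w \<subseteq> Inl ` P ` {..<d}}"
      using keys_const_mult by blast
  qed
qed (auto simp: one_eq_mon)

lemma om_keys_expand: "om (f * h) = (\<Sum>w\<in>Poly_Mapping.keys f. Poly_Mapping.lookup f w * om (mon w * h))"
proof -
  have "om (f * h) = lin (\<lambda>w. om (mon w * h)) f"
    by (rule linear_fa_lin) (auto simp: linear_fa_def algebra_simps)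
  then show ?thesis by (simp add: lin_def)
qed

lemma om_Dpoly:
  assumes "Poly_Mapping.keys f \<subseteq> {w. set w \<subseteq> Inl ` P ` {..<d}}"
  shows "om (f * h) = (\<Sum>k<d. om (pm k * f) / \<tau> [P k] * om (pm k * h))"
proof -
  have "om (pm k * f) = (\<Sum>w\<in>Poly_Mapping.keys f. Poly_Mapping.lookup f w * om (pm k * mon w))" for k
    using om_keys_expand[of f "pm k"] by (simp add: om_comm)
  then have "(\<Sum>k<d. om (pm k * f) / \<tau> [P k] * om (pm k * h)) =
    (\<Sum>w\<in>Poly_Mapping.keys f. Poly_Mapping.lookup f w * (\<Sum>k<d. om (pm k * mon w) / \<tau> [P k] * om (pm k * h)))"
    by (simp add: sum_distrib_left sum_distrib_right sum_divide_distrib mult.assoc) (rule sum.swap)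
  also have "\<dots> = om (f * h)"
    unfolding om_keys_expand[of f h]
    by (intro sum.cong refl arg_cong2[where f = "(*)"] om_Pword[symmetric])
      (use assms in \<open>auto simp: Pword_def\<close>)
  finally show ?thesis by simp
qed

text \<open>Modulo the null ideal \<open>f\<close> is an element of D and only rescales the
  coordinates of the conditional expectation of \<open>g\<close>. This is what allows a coefficient
  from D to be absorbed into a neighbouring centered factor.\<close>

lemma centered_Dpoly_mult:
  assumes "Poly_Mapping.keys f \<subseteq> {w. set w \<subseteq> Inl ` P ` {..<d}}" "centered g"
  shows "centered (f * g)"
  unfolding centered_def
proof (intro allI impI)
  fix k assume k: "k < d"
  have "om (pm k * (f * g)) = om (f * (g * pm k))" by (rule om_rotate)
  also have "\<dots> = (\<Sum>l<d. om (pm l * f) / \<tau> [P l] * om (pm l * (g * pm k)))"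
    by (rule om_Dpoly) fact
  also have "\<dots> = 0"
  proof (rule sum.neutral, intro ballI)
    fix l assume l: "l \<in> {..<d}"
    have "om (pm l * (g * pm k)) = om (pm k * (pm l * g))" by (rule om_rotate[symmetric])
    then show "om (pm l * f) / \<tau> [P l] * om (pm l * (g * pm k)) = 0"
      using k l assms(2) by (simp add: om_pm_pm centered_def)
  qed
  finally show "om (pm k * (f * g)) = 0" .
qed

text \<open>No letter of \<open>w\<close> ends up paired with a letter of the centered factors
  behind it, so the pairs inside \<open>w\<close> can be removed by \<open>e\<close>. The constant
  prefix \<alpha> is carried along for a leading factor of constants and for the constants that are
  split off from \<open>w\<close> during the induction.\<close>

definition claimA where
  "claimA X \<longleftrightarrow> (\<forall>(\<alpha> :: ('c + nat \<times> bool) list) s w. set \<alpha> \<subseteq> range Inl \<and> set w \<subseteq> letters (Some s) \<and> calt X \<and>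
     (X = [] \<or> fst (hd X) \<noteq> Some s) \<longrightarrow>
     om (mon \<alpha> * (mon w * prod_list (map snd X))) = om (mon \<alpha> * (e w * prod_list (map snd X))))"

definition claimC where
  "claimC X \<longleftrightarrow> (calt X \<and> X \<noteq> [] \<longrightarrow> om (prod_list (map snd X)) = 0)"

lemma claimAD:
  assumes "claimA X" "set \<alpha> \<subseteq> range Inl" "set w \<subseteq> letters (Some s)" "calt X"
    "X = [] \<or> fst (hd X) \<noteq> Some s"
  shows "om (mon \<alpha> * (mon w * prod_list (map snd X))) = om (mon \<alpha> * (e w * prod_list (map snd X)))"
  using assms unfolding claimA_def by blast

text \<open>The Schwinger-Dyson equation at the first Gaussian letter of \<open>w\<close> has two
  kinds of terms. A partner inside \<open>w\<close> leaves a shorter word for the inner induction. A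
  partner in a later factor \<open>f\<close> encloses \<open>w'\<close>, some centered factors and
  the initial part \<open>u\<close> of a word of \<open>f\<close>; by the trace \<open>u\<close> and
  \<open>w'\<close> meet, \<open>e (u @ w')\<close> lies in D and is absorbed into the first
  enclosed factor, and the shorter alternating product vanishes by \<open>claimC\<close>.\<close>

lemma claimA_step:
  assumes A: "\<And>Y. length Y < length X \<Longrightarrow> claimA Y" and C: "\<And>Y. length Y < length X \<Longrightarrow> claimC Y"
  shows "claimA X"
  unfolding claimA_def
proof (intro allI impI, elim conjE)
  fix \<alpha> :: "('c + nat \<times> bool) list" and s w
  assume "set \<alpha> \<subseteq> range Inl" "set w \<subseteq> letters (Some s)" and X: "calt X" "X = [] \<or> fst (hd X) \<noteq> Some s"
  then show "om (mon \<alpha> * (mon w * prod_list (map snd X))) = om (mon \<alpha> * (e w * prod_list (map snd X)))"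
  proof (induction "length w" arbitrary: w \<alpha> rule: less_induct)
    case less
    let ?PX = "prod_list (map snd X)"
    show ?case
    proof (cases "set w \<subseteq> range Inl")
      case True
      then show ?thesis by (simp add: e_Inl)
    next
      case False
      then have "\<exists>x\<in>set w. x \<notin> range Inl" by blast
      from split_list_first_prop[OF this] obtain \<delta> x w'
        where w: "w = \<delta> @ x # w'" "x \<notin> range Inl" "\<forall>y\<in>set \<delta>. y \<in> range Inl"
        by (elim exE conjE) (rule that, assumption+, simp)
      then obtain t where x: "x = Inr t" by (cases x) auto
      have t: "fst t = s" using less.prems(2) w x by (auto simp: letters_def)
      have \<delta>: "set \<delta> \<subseteq> range Inl" using w by auto
      have \<alpha>\<delta>: "set (\<alpha> @ \<delta>) \<subseteq> range Inl" using \<delta> less.prems by auto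
      let ?F = "\<lambda>a b. om a * om (mon (\<alpha> @ \<delta>) * b)"
      have "om (mon \<alpha> * (mon w * ?PX)) = om (mon (\<alpha> @ \<delta>) * (mon [Inr t] * (mon w' * ?PX)))"
        by (simp add: w x mon_mult mult.assoc[symmetric])
      also have "\<dots> = dd (Inr (bar t)) ?F (mon w' * ?PX)"
        by (rule om_SD) fact
      also have "\<dots> = ssum (Inr (bar t)) (\<lambda>u v. om0 u * om (mon (\<alpha> @ \<delta>) * (mon v * ?PX))) w' +
          dd (Inr (bar t)) (\<lambda>a b. ?F (mon w' * a) b) ?PX"
        by (subst dd_mult[OF bilinear_om(2)]) simp
      also have "dd (Inr (bar t)) (\<lambda>a b. ?F (mon w' * a) b) ?PX = 0"
      proof (rule dd_prod_list_eq_0I)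
        show "bilinear_fa (\<lambda>a b. ?F (mon w' * a) b)" by (rule bilinear_om)
        fix As' f Bs' assume "map snd X = As' @ f # Bs'"
        then obtain As g Bs where AB: "X = As @ (g, f) # Bs" "As' = map snd As"
          by (auto simp: map_eq_append_conv)
        show "dd (Inr (bar t)) (\<lambda>a b. ?F (mon w' * (prod_list As' * a)) (b * prod_list Bs')) f = 0"
        proof (rule dd_eq_0I)
          fix z u v assume z: "z \<in> Poly_Mapping.keys f" "z = u @ Inr (bar t) # v"
          have og: "over g f" using X AB by (auto simp: calt_def)
          then have zl: "set z \<subseteq> letters g" using z(1) unfolding over_def by blast
          then have g: "g = Some s" using z t by (auto simp: letters_def bar_def split: option.splits)
          \<comment> \<open>The factor \<open>f\<close> belongs to the algebra of \<open>s\<close>,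
            whereas the list of factors does not begin in that algebra; so at least one centered
            factor is enclosed.\<close>
          have "As \<noteq> []" using X AB g by auto
          then obtain g1 f1 As1 where As: "As = (g1, f1) # As1" by (cases As) auto
          have cAs: "calt As" using X AB by (auto simp: calt_def distinct_adj_append_iff)
          have uw: "set (u @ w') \<subseteq> letters (Some s)"
            using zl z g less.prems(2) w by auto
          let ?q = "e (u @ w')"
          have q: "Poly_Mapping.keys ?q \<subseteq> {w. set w \<subseteq> Inl ` P ` {..<d}}"
            by (rule keys_e_Pword[OF uw])
          have "om (mon w' * (prod_list As' * mon u)) = om (mon [] * (mon (u @ w') * prod_list As'))"
            unfolding om_rotate[of "mon u", symmetric]
            by (simp add: one_eq_mon[symmetric] mon_mult[symmetric] mult.assoc)
          also have "\<dots> = om (mon [] * (?q * prod_list As'))"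
          proof -
            have "fst (hd As) \<noteq> Some s" using X AB As by auto
            moreover have "claimA As" by (rule A) (simp add: AB)
            ultimately show ?thesis
              unfolding AB(2) by (intro claimAD[OF _ _ uw cAs]) auto
          qed
          also have "\<dots> = om (prod_list (map snd ((g1, ?q * f1) # As1)))"
            by (simp add: AB As one_eq_mon[symmetric] mult.assoc)
          also have "\<dots> = 0"
          proof -
            have "over g1 (?q * f1)"
              unfolding over_def
            proof (rule keys_mult_subset)
              show "Poly_Mapping.keys ?q \<subseteq> {w. set w \<subseteq> letters g1}"
                using q by (auto simp: letters_def split: option.splits) blast+
              show "Poly_Mapping.keys f1 \<subseteq> {w. set w \<subseteq> letters g1}"
                using cAs As by (auto simp: calt_def over_def)
            qed
            moreover have "centered (?q * f1)"
              using cAs As by (intro centered_Dpoly_mult q) (auto simp: calt_def)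
            ultimately have "calt ((g1, ?q * f1) # As1)"
              using cAs As by (auto simp: calt_def)
            then show ?thesis using C[of "(g1, ?q * f1) # As1"] AB As by (simp add: claimC_def)
          qed
          finally show "?F (mon w' * (prod_list As' * mon u)) (mon v * prod_list Bs') = 0"
            by simp
        qed
      qed
      also have "ssum (Inr (bar t)) (\<lambda>u v. om0 u * om (mon (\<alpha> @ \<delta>) * (mon v * ?PX))) w' =
          ssum (Inr (bar t)) (\<lambda>u v. om0 u * om (mon (\<alpha> @ \<delta>) * (e v * ?PX))) w'"
      proof (rule ssum_cong[OF refl refl])
        fix u v assume w': "w' = u @ Inr (bar t) # v"
        have "om (mon (\<alpha> @ \<delta>) * (mon v * ?PX)) = om (mon (\<alpha> @ \<delta>) * (e v * ?PX))"
          by (rule less.hyps) (use w w' \<alpha>\<delta> less.prems X in auto)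
        then show "om0 u * om (mon (\<alpha> @ \<delta>) * (mon v * ?PX)) = om0 u * om (mon (\<alpha> @ \<delta>) * (e v * ?PX))"
          by simp
      qed
      also have "\<dots> = om (mon (\<alpha> @ \<delta>) * (ssum (Inr (bar t)) (\<lambda>u v. const (om0 u) * e v) w' * ?PX))"
        by (subst ssum_additive[where h = "\<lambda>x. om (mon (\<alpha> @ \<delta>) * (x * ?PX))", symmetric])
          (auto simp: algebra_simps)
      also have "\<dots> = om (mon \<alpha> * (e w * ?PX))"
        by (simp add: w x e_Inl_append \<delta> mon_mult[symmetric] om0_def mult.assoc)
      finally show ?thesis by simp
    qed
  qed
qed

text \<open>If the first factor belongs to some \<open>y_s\<close>, \<open>claimA\<close> replaces
  it by its image under \<open>e\<close>, which lies in D and has the coordinates of the centered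
  factor, hence is null. If the first factor consists of constants, its words become the prefix
  \<alpha> and the same argument is applied to the second factor, which then belongs to some
  \<open>y_s\<close>.\<close>

lemma claimC_step:
  assumes A: "\<And>Y. length Y < length X \<Longrightarrow> claimA Y"
  shows "claimC X"
  unfolding claimC_def
proof (intro impI, elim conjE)
  assume X: "calt X" "X \<noteq> []"
  have key: "(\<Sum>w\<in>Poly_Mapping.keys f. Poly_Mapping.lookup f w * om (e w * Q)) = 0"
    if "over (Some s) f" "centered f" for f s Q
  proof -
    have kw: "set w \<subseteq> letters (Some s)" if "w \<in> Poly_Mapping.keys f" for w
      using that \<open>over (Some s) f\<close> by (auto simp: over_def)
    have "(\<Sum>w\<in>Poly_Mapping.keys f. Poly_Mapping.lookup f w * om (e w * Q)) =
      (\<Sum>w\<in>Poly_Mapping.keys f. Poly_Mapping.lookup f w *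
         (\<Sum>k<d. om (pm k * mon w) / \<tau> [P k] * om (pm k * Q)))"
    proof (intro sum.cong refl)
      fix w assume w: "w \<in> Poly_Mapping.keys f"
      \<comment> \<open>\<open>claimA\<close> without any further factor and with the projection as
        prefix: \<open>e\<close> preserves coordinates in D.\<close>
      have "om (pm k * e w) = om (pm k * mon w)" for k
      proof -
        have "claimA []" using A X by auto
        moreover have "calt []" by (simp add: calt_def)
        moreover have "set [Inl (P k)] \<subseteq> range (Inl :: 'c \<Rightarrow> 'c + nat \<times> bool)" by auto
        ultimately show ?thesis
          using claimAD[of "[]" "[Inl (P k)]" w s] kw[OF w] by (simp add: pm_def)
      qed
      then show "Poly_Mapping.lookup f w * om (e w * Q) = Poly_Mapping.lookup f w *
         (\<Sum>k<d. om (pm k * mon w) / \<tau> [P k] * om (pm k * Q))"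
        by (subst om_Dpoly[OF keys_e_Pword[OF kw[OF w]]]) simp
    qed
    also have "\<dots> = (\<Sum>k<d. (\<Sum>w\<in>Poly_Mapping.keys f. Poly_Mapping.lookup f w * om (mon w * pm k)) / \<tau> [P k] * om (pm k * Q))"
      by (simp add: sum_distrib_left sum_distrib_right sum_divide_distrib mult.assoc om_comm[of _ "pm _"])
        (rule sum.swap)
    also have "\<dots> = 0"
      using \<open>centered f\<close> unfolding om_keys_expand[symmetric] by (simp add: centered_def om_comm[of f])
    finally show ?thesis .
  qed
  obtain g1 f1 X1 where X1: "X = (g1, f1) # X1" using X by (cases X) auto
  show "om (prod_list (map snd X)) = 0"
  proof (cases g1)
    case (Some s)
    have "om (prod_list (map snd X)) =
       (\<Sum>w\<in>Poly_Mapping.keys f1. Poly_Mapping.lookup f1 w * om (mon [] * (mon w * prod_list (map snd X1))))"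
      by (simp add: X1 om_keys_expand[of f1] one_eq_mon[symmetric])
    also have "\<dots> = (\<Sum>w\<in>Poly_Mapping.keys f1. Poly_Mapping.lookup f1 w * om (mon [] * (e w * prod_list (map snd X1))))"
    proof (intro sum.cong refl)
      fix w assume w: "w \<in> Poly_Mapping.keys f1"
      have "set w \<subseteq> letters (Some s)" using w X X1 Some by (auto simp: calt_def over_def)
      moreover have "calt X1" "X1 = [] \<or> fst (hd X1) \<noteq> Some s"
        using X X1 Some by (auto simp: calt_def distinct_adj_Cons hd_map)
      ultimately have "om (mon [] * (mon w * prod_list (map snd X1))) = om (mon [] * (e w * prod_list (map snd X1)))"
        using X1 by (intro claimAD A) auto
      then show "Poly_Mapping.lookup f1 w * om (mon [] * (mon w * prod_list (map snd X1))) =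
        Poly_Mapping.lookup f1 w * om (mon [] * (e w * prod_list (map snd X1)))" by simp
    qed
    also have "\<dots> = 0"
      using key[of s f1 "prod_list (map snd X1)"] X X1 Some
      by (auto simp: calt_def one_eq_mon[symmetric])
    finally show ?thesis .
  next
    case None
    show ?thesis
    proof (cases X1)
      case Nil
      \<comment> \<open>A single factor of constants: the projections sum to 1, so all coordinates
        being zero forces the value itself to be zero.\<close>
      have "(\<Sum>k<d. om (pm k * f1)) = 0"
        using X X1 by (intro sum.neutral) (auto simp: calt_def centered_def)
      then show ?thesis using om_pm_sum[of f1] by (simp add: X1 Nil)
    next
      case (Cons y X2)
      obtain g2 f2 where y: "y = (g2, f2)" by force
      obtain s where s: "g2 = Some s"
        using X X1 None Cons y by (cases g2) (auto simp: calt_def)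
      have cX2: "calt X2" "X2 = [] \<or> fst (hd X2) \<noteq> Some s"
        using X X1 Cons y s by (auto simp: calt_def distinct_adj_Cons hd_map)
      have "om (mon \<alpha> * (f2 * prod_list (map snd X2))) = 0" if \<alpha>: "\<alpha> \<in> Poly_Mapping.keys f1" for \<alpha>
      proof -
        let ?Q = "prod_list (map snd X2)"
        have \<alpha>': "set \<alpha> \<subseteq> range Inl" using \<alpha> X X1 None by (auto simp: calt_def over_def letters_def)
        have "om (mon \<alpha> * (f2 * ?Q)) = om (f2 * (?Q * mon \<alpha>))" by (rule om_rotate)
        also have "\<dots> = (\<Sum>w\<in>Poly_Mapping.keys f2. Poly_Mapping.lookup f2 w * om (mon \<alpha> * (mon w * ?Q)))"
          unfolding om_keys_expand[of f2]
          by (intro sum.cong refl arg_cong2[where f = "(*)"] om_rotate[symmetric])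
        also have "\<dots> = (\<Sum>w\<in>Poly_Mapping.keys f2. Poly_Mapping.lookup f2 w * om (mon \<alpha> * (e w * ?Q)))"
        proof (intro sum.cong refl arg_cong2[where f = "(*)"])
          fix w assume w: "w \<in> Poly_Mapping.keys f2"
          have "set w \<subseteq> letters (Some s)" using w X X1 Cons y s by (auto simp: calt_def over_def)
          then show "om (mon \<alpha> * (mon w * ?Q)) = om (mon \<alpha> * (e w * ?Q))"
            using X1 Cons cX2 \<alpha>' by (intro claimAD A) auto
        qed
        also have "\<dots> = (\<Sum>w\<in>Poly_Mapping.keys f2. Poly_Mapping.lookup f2 w * om (e w * (?Q * mon \<alpha>)))"
          by (intro sum.cong refl arg_cong2[where f = "(*)"] om_rotate)
        also have "\<dots> = 0"
          by (rule key[of s]) (use X X1 Cons y s in \<open>auto simp: calt_def\<close>)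
        finally show ?thesis .
      qed
      then show ?thesis
        by (simp add: X1 Cons y om_keys_expand[of f1])
    qed
  qed
qed

lemma claims: "claimA X \<and> claimC X"
proof (induction X rule: length_induct)
  case (1 X)
  then have IH: "claimA Y" "claimC Y" if "length Y < length X" for Y
    using that by auto
  show ?case by (rule conjI[OF claimA_step[OF IH] claimC_step[OF IH(1)]])
qed

theorem om_alternating: "calt X \<Longrightarrow> X \<noteq> [] \<Longrightarrow> om (prod_list (map snd X)) = 0"
  using claims[of X] by (simp add: claimC_def)

end

section \<open>Noncrossing partitions by removal of the last block\<close>

text \<open>One removal step of \<open>nested_cumulant_aux\<close> on lists: the
  \<open>i + 1\<close> entries behind position \<open>p\<close> form the block, its value is
  multiplied to entry \<open>p\<close>, and the list resumes at
  \<open>p + 1 + (i + 1)\<close>.\<close>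

definition contract :: "'a ncps \<Rightarrow> ('a list \<Rightarrow> 'a) \<Rightarrow> nat \<Rightarrow> nat \<Rightarrow> 'a list \<Rightarrow> 'a list" where
  "contract A \<kappa> p i L = take p L @ [L ! p \<otimes>\<^bsub>A\<^esub> \<kappa> (take (Suc i) (drop (Suc p) L))] @ drop (p + i + 2) L"

text \<open>Sum over the noncrossing partitions all of whose block minima are among the positions \<open>0, \<dots>, p\<close>.\<close>

primrec nc_sum :: "'a ncps \<Rightarrow> ('a list \<Rightarrow> 'a) \<Rightarrow> nat \<Rightarrow> 'a list \<Rightarrow> 'a" where
  "nc_sum A \<kappa> 0 L = \<kappa> L"
| "nc_sum A \<kappa> (Suc p) L = nc_sum A \<kappa> p L \<oplus>\<^bsub>A\<^esub> (\<Oplus>\<^bsub>A\<^esub>i\<in>{..<length L - Suc p}. nc_sum A \<kappa> p (contract A \<kappa> p i L))"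

definition noncrossing :: "nat set set \<Rightarrow> bool" where
  "noncrossing \<sigma> \<longleftrightarrow> (\<forall>V\<in>\<sigma>. \<forall>W\<in>\<sigma>. V \<noteq> W \<longrightarrow>
     (\<forall>i\<in>V. \<forall>j\<in>W. \<forall>k\<in>V. \<forall>l\<in>W. \<not> (i < j \<and> j < k \<and> k < l)))"

lemma noncrossingD:
  assumes "noncrossing \<sigma>" "V \<in> \<sigma>" "W \<in> \<sigma>" "V \<noteq> W"
    and "i \<in> V" "j \<in> W" "k \<in> V" "l \<in> W" "i < j" "j < k" "k < l"
  shows False
  using assms(1)[unfolded noncrossing_def, rule_format, OF assms(2-8)] assms(9-11) by simp

lemma noncrossing_subset:
  assumes "noncrossing \<sigma>" "\<sigma>' \<subseteq> \<sigma>"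
  shows "noncrossing \<sigma>'"
  unfolding noncrossing_def
proof (intro ballI impI notI, elim conjE)
  fix V W i j k l
  assume "V \<in> \<sigma>'" "W \<in> \<sigma>'" "V \<noteq> W" "i \<in> V" "j \<in> W" "k \<in> V" "l \<in> W" "i < j" "j < k" "k < l"
  with assms(2) show False using noncrossingD[OF assms(1), of V W i j k l] by auto
qed

lemma noncrossing_iff:
  "noncrossing \<sigma> \<longleftrightarrow> \<not> (\<exists>V\<in>\<sigma>. \<exists>W\<in>\<sigma>. V \<noteq> W \<and>
     (\<exists>i\<in>V. \<exists>j\<in>W. \<exists>k\<in>V. \<exists>l\<in>W. i < j \<and> j < k \<and> k < l))" (is "_ \<longleftrightarrow> \<not> ?C")
proof
  assume nc: "noncrossing \<sigma>"
  show "\<not> ?C"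
  proof
    assume ?C
    then obtain V W i j k l where "V \<in> \<sigma>" "W \<in> \<sigma>" "V \<noteq> W" "i \<in> V" "j \<in> W" "k \<in> V" "l \<in> W"
      "i < j" "j < k" "k < l"
      by (elim bexE conjE) (rule that; assumption)
    then show False by (rule noncrossingD[OF nc])
  qed
next
  assume n: "\<not> ?C"
  show "noncrossing \<sigma>"
    unfolding noncrossing_def
  proof (intro ballI impI notI)
    fix V W i j k l
    assume a: "V \<in> \<sigma>" "W \<in> \<sigma>" "V \<noteq> W" "i \<in> V" "j \<in> W" "k \<in> V" "l \<in> W" "i < j \<and> j < k \<and> k < l"
    have "\<exists>i\<in>V. \<exists>j\<in>W. \<exists>k\<in>V. \<exists>l\<in>W. i < j \<and> j < k \<and> k < l"
      using a(4-8) by (intro bexI[of _ i] bexI[of _ j] bexI[of _ k] bexI[of _ l])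
    then have ?C using a(1-3) by (intro bexI[of _ V] bexI[of _ W] conjI)
    then show False using n by contradiction
  qed
qed

text \<open>Minima are bounded by their position in \<open>S\<close> rather than by value, because
  \<open>S\<close> acquires gaps when blocks are removed; the positions up to \<open>p\<close> may
  start a block.\<close>

definition NCm :: "nat set \<Rightarrow> nat \<Rightarrow> nat set set set" where
  "NCm S p = {\<sigma>. partition_on S \<sigma> \<and> noncrossing \<sigma> \<and>
     (\<forall>V\<in>\<sigma>. Min V \<in> set (take (Suc p) (sorted_list_of_set S)))}"

lemma initial_segment:
  assumes "sorted_wrt (<) (ys :: nat list)" "V \<subseteq> set ys"
    and "\<And>y z. y \<in> set ys \<Longrightarrow> z \<in> V \<Longrightarrow> y < z \<Longrightarrow> y \<in> V"
  shows "V = set (take (card V) ys)"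
  using assms
proof (induction ys arbitrary: V)
  case (Cons y ys)
  show ?case
  proof (cases "V = {}")
    case False
    then obtain z where z: "z \<in> V" by auto
    then have yV: "y \<in> V" using Cons.prems(1,2) Cons.prems(3)[of y z] by auto
    have fin: "finite V" using Cons.prems(2) finite_subset by auto
    have ynot: "y \<notin> set ys" using Cons.prems(1) by auto
    have "V - {y} = set (take (card (V - {y})) ys)"
    proof (rule Cons.IH)
      show "sorted_wrt (<) ys" using Cons.prems(1) by simp
      show "V - {y} \<subseteq> set ys" using Cons.prems(2) by auto
      show "y' \<in> V - {y}" if "y' \<in> set ys" "z \<in> V - {y}" "y' < z" for y' z
        using that Cons.prems(3)[of y' z] ynot by auto
    qed
    moreover have "card V = Suc (card (V - {y}))"
      using card_Suc_Diff1[OF fin yV] by simp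
    ultimately show ?thesis using yV by (metis insert_Diff list.simps(15) take_Suc_Cons)
  qed auto
qed auto

lemma finite_NCm: "finite S \<Longrightarrow> finite (NCm S p)"
  by (rule finite_subset[of _ "Pow (Pow S)"]) (auto simp: NCm_def partition_on_def)

locale sorted_split =
  fixes S :: "nat set" and p :: nat and xs and x :: nat
  defines "xs \<equiv> sorted_list_of_set S"
  assumes fin: "finite S" and len: "Suc p < card S"
  defines "x \<equiv> xs ! Suc p"
begin

lemma xs: "sorted_wrt (<) xs" "set xs = S" "length xs = card S" "distinct xs"
  using fin by (auto simp: xs_def)

lemma split_xs: "xs = take (Suc p) xs @ x # drop (Suc (Suc p)) xs"
  using id_take_nth_drop[of "Suc p" xs] len xs by (simp add: x_def)

lemma drop_xs: "drop (Suc p) xs = x # drop (Suc (Suc p)) xs"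
  using len xs by (metis Cons_nth_drop_Suc x_def)

lemma below: "y \<in> set (take (Suc p) xs) \<longleftrightarrow> y \<in> S \<and> y < x"
proof -
  have "sorted_wrt (<) (take (Suc p) xs @ x # drop (Suc (Suc p)) xs)"
    using xs split_xs by simp
  then have 1: "\<forall>y\<in>set (take (Suc p) xs). y < x" "\<forall>y\<in>set (drop (Suc (Suc p)) xs). x < y"
    by (auto simp: sorted_wrt_append)
  have "S = set (take (Suc p) xs) \<union> {x} \<union> set (drop (Suc (Suc p)) xs)"
    using split_xs xs(2) by (metis Un_insert_right list.simps(15) set_append sup_bot_right insert_is_Un Un_assoc)
  then show ?thesis using 1 by auto
qed

lemma above: "y \<in> set (drop (Suc p) xs) \<longleftrightarrow> y \<in> S \<and> x \<le> y"
proof -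
  have "sorted_wrt (<) (take (Suc p) xs @ x # drop (Suc (Suc p)) xs)"
    using xs split_xs by simp
  then have 1: "\<forall>y\<in>set (take (Suc p) xs). y < x" "\<forall>y\<in>set (drop (Suc (Suc p)) xs). x < y"
    by (auto simp: sorted_wrt_append)
  have "S = set (take (Suc p) xs) \<union> {x} \<union> set (drop (Suc (Suc p)) xs)"
    using split_xs xs(2) by (metis Un_insert_right list.simps(15) set_append sup_bot_right insert_is_Un Un_assoc)
  then show ?thesis using 1 unfolding drop_xs by auto
qed

lemma take2: "y \<in> set (take (Suc (Suc p)) xs) \<longleftrightarrow> y = x \<or> (y \<in> S \<and> y < x)"
proof -
  have "take (Suc (Suc p)) xs = take (Suc p) xs @ [x]"
    using len xs by (simp add: take_Suc_conv_app_nth[of "Suc p"] x_def)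
  then show ?thesis using below[of y] by auto
qed

definition V where "V i = set (take (Suc i) (drop (Suc p) xs))"

lemma V_props:
  assumes "i < card S - Suc p"
  shows "V i \<subseteq> S" "x \<in> V i" "Min (V i) = x" "finite (V i)" "sorted_list_of_set (V i) = take (Suc i) (drop (Suc p) xs)"
    "card (V i) = Suc i" "\<And>y. y \<in> V i \<Longrightarrow> x \<le> y"
    "\<And>y z. y \<in> S \<Longrightarrow> x \<le> y \<Longrightarrow> z \<in> V i \<Longrightarrow> y < z \<Longrightarrow> y \<in> V i"
proof -
  show sub: "V i \<subseteq> S" unfolding V_def using xs(2) by (meson order_trans set_drop_subset set_take_subset)
  show xV: "x \<in> V i" by (simp add: V_def drop_xs)
  show ge: "\<And>y. y \<in> V i \<Longrightarrow> x \<le> y" unfolding V_def using above by (meson in_set_takeD)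
  show fV: "finite (V i)" by (simp add: V_def)
  show "Min (V i) = x" using xV ge fV by (simp add: Min_eqI)
  have st: "sorted_wrt (<) (take (Suc i) (drop (Suc p) xs))"
    using xs(1) by (simp add: sorted_wrt_take sorted_wrt_drop)
  then show "sorted_list_of_set (V i) = take (Suc i) (drop (Suc p) xs)"
    unfolding V_def by (simp add: strict_sorted_iff sorted_list_of_set.idem_if_sorted_distinct)
  show "card (V i) = Suc i"
    unfolding V_def using st assms xs by (simp add: distinct_card strict_sorted_iff)
  show "y \<in> V i" if y: "y \<in> S" "x \<le> y" and z: "z \<in> V i" "y < z" for y z
  proof -
    have "y \<in> set (drop (Suc p) xs)" using y above by auto
    then have "y \<in> set (take (Suc i) (drop (Suc p) xs)) \<or> y \<in> set (drop (Suc i) (drop (Suc p) xs))"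
      by (metis Un_iff append_take_drop_id set_append)
    moreover have "\<not> y \<in> set (drop (Suc i) (drop (Suc p) xs))"
    proof
      assume "y \<in> set (drop (Suc i) (drop (Suc p) xs))"
      moreover have "sorted_wrt (<) (take (Suc i) (drop (Suc p) xs) @ drop (Suc i) (drop (Suc p) xs))"
        using xs(1) by (simp only: append_take_drop_id sorted_wrt_drop)
      ultimately have "z < y" using z(1) unfolding V_def sorted_wrt_append by blast
      then show False using z by simp
    qed
    ultimately show ?thesis by (simp add: V_def)
  qed
qed

lemma sorted_diff:
  assumes "i < card S - Suc p"
  shows "sorted_list_of_set (S - V i) = take (Suc p) xs @ drop (p + i + 2) xs"
proof -
  have eq: "xs = take (Suc p) xs @ (take (Suc i) (drop (Suc p) xs) @ drop (p + i + 2) xs)"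
    by (metis (no_types, lifting) add.commute add_2_eq_Suc' add_Suc_shift append_take_drop_id drop_drop plus_nat.simps(2))
  have d: "distinct (take (Suc p) xs @ (take (Suc i) (drop (Suc p) xs) @ drop (p + i + 2) xs))"
    using xs(4) eq by simp
  have s: "sorted_wrt (<) (take (Suc p) xs @ (take (Suc i) (drop (Suc p) xs) @ drop (p + i + 2) xs))"
    using xs(1) eq by simp
  have "S = set (take (Suc p) xs) \<union> (V i \<union> set (drop (p + i + 2) xs))"
    unfolding V_def using xs(2) eq by (metis set_append)
  then have "S - V i = set (take (Suc p) xs @ drop (p + i + 2) xs)"
    using d unfolding V_def by auto
  moreover have "sorted_wrt (<) (take (Suc p) xs @ drop (p + i + 2) xs)"
    using s by (auto simp: sorted_wrt_append)
  ultimately show ?thesis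
    by (metis sorted_list_of_set.idem_if_sorted_distinct strict_sorted_iff)
qed

lemma take_sorted_diff:
  "i < card S - Suc p \<Longrightarrow> take (Suc p) (sorted_list_of_set (S - V i)) = take (Suc p) xs"
  using sorted_diff[of i] len xs(3) by simp

text \<open>Let a block have minimum \<open>x\<close>, the last point allowed to start a block. A
  point of \<open>S\<close> between \<open>x\<close> and another point of the block lies in the same
  block: otherwise its own block has a minimum below \<open>x\<close> and the two blocks cross. So
  the block is an interval \<open>V i\<close>, and removing it leaves a partition whose minima are
  bounded by \<open>p\<close>.\<close>

lemma NCm_Suc:
  "NCm S (Suc p) = NCm S p \<union> (\<Union>i\<in>{..<card S - Suc p}. insert (V i) ` NCm (S - V i) p)"
proof (intro equalityI subsetI)
  fix \<sigma> assume \<sigma>: "\<sigma> \<in> NCm S (Suc p)"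
  then have part: "partition_on S \<sigma>" and nc: "noncrossing \<sigma>"
    and mins: "\<And>W. W \<in> \<sigma> \<Longrightarrow> Min W = x \<or> (Min W \<in> S \<and> Min W < x)"
    using take2 by (auto simp: NCm_def xs_def)
  have finW: "finite W" "W \<noteq> {}" "W \<subseteq> S" if "W \<in> \<sigma>" for W
    using part that fin by (auto simp: partition_on_def intro: finite_subset)
  show "\<sigma> \<in> NCm S p \<union> (\<Union>i\<in>{..<card S - Suc p}. insert (V i) ` NCm (S - V i) p)"
  proof (cases "\<exists>W\<in>\<sigma>. Min W = x")
    case False
    then have "\<sigma> \<in> NCm S p" using part nc mins below by (auto simp: NCm_def xs_def)
    then show ?thesis by simp
  next
    case True
    then obtain W where W: "W \<in> \<sigma>" "Min W = x" by auto
    have xW: "x \<in> W" using finW[OF W(1)] W(2) Min_in by blast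
    have disj: "W' = W" if "W' \<in> \<sigma>" "y \<in> W'" "y \<in> W" for W' y
      using part that W(1) by (auto simp: partition_on_def disjoint_def)
    have seg: "W = set (take (card W) (drop (Suc p) xs))"
    proof (rule initial_segment)
      show "sorted_wrt (<) (drop (Suc p) xs)" using xs(1) by (simp add: sorted_wrt_drop)
      show "W \<subseteq> set (drop (Suc p) xs)" using finW[OF W(1)] W(2) above by auto
      fix y z assume y: "y \<in> set (drop (Suc p) xs)" and z: "z \<in> W" "y < z"
      show "y \<in> W"
      proof (rule ccontr)
        assume nW: "y \<notin> W"
        have yS: "y \<in> S" "x \<le> y" using y above by auto
        then obtain W' where W': "W' \<in> \<sigma>" "y \<in> W'" using part by (auto simp: partition_on_def)
        have ne: "W' \<noteq> W" using nW W' by auto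
        have mW': "Min W' \<in> W'" using finW[OF W'(1)] Min_in by blast
        then have "Min W' \<noteq> x" using disj[OF W'(1)] xW ne by auto
        then have "Min W' < x" using mins[OF W'(1)] by auto
        moreover have "x < y" using yS nW xW by (metis le_neq_implies_less)
        ultimately show False
          using noncrossingD[OF nc W'(1) W(1) ne mW' xW W'(2) z(1)] z(2) by blast
      qed
    qed
    define i where "i = card W - 1"
    have cW: "card W = Suc i" using finW[OF W(1)] by (simp add: i_def card_gt_0_iff)
    have WV: "W = V i" using seg cW by (simp add: V_def)
    have "card W \<le> length (drop (Suc p) xs)"
      by (metis card_length seg length_take min.cobounded2 order_trans min.bounded_iff)
    then have i: "i < card S - Suc p" using cW xs by simp
    have "\<sigma> - {W} \<in> NCm (S - V i) p"
    proof -
      have "partition_on (S - W) (\<sigma> - {W})"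
        using part W(1) unfolding partition_on_def disjoint_def by auto
      moreover have "noncrossing (\<sigma> - {W})" by (rule noncrossing_subset[OF nc]) auto
      moreover have "Min U \<in> set (take (Suc p) (sorted_list_of_set (S - V i)))" if "U \<in> \<sigma> - {W}" for U
      proof -
        have "Min U \<in> U" using finW[of U] that Min_in by blast
        then have "Min U \<noteq> x" using disj[of U x] xW that by auto
        then have "Min U \<in> S \<and> Min U < x" using mins[of U] that by auto
        then show ?thesis using below take_sorted_diff[OF i] by simp
      qed
      ultimately show ?thesis by (simp add: NCm_def WV)
    qed
    then show ?thesis using W(1) WV i by (auto intro!: bexI[of _ i] image_eqI[of _ _ "\<sigma> - {W}"])
  qed
next
  fix \<sigma> assume "\<sigma> \<in> NCm S p \<union> (\<Union>i\<in>{..<card S - Suc p}. insert (V i) ` NCm (S - V i) p)"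
  then show "\<sigma> \<in> NCm S (Suc p)"
  proof
    assume "\<sigma> \<in> NCm S p"
    then show ?thesis using below take2 by (auto simp: NCm_def xs_def)
  next
    assume "\<sigma> \<in> (\<Union>i\<in>{..<card S - Suc p}. insert (V i) ` NCm (S - V i) p)"
    then obtain i \<sigma>' where i: "i < card S - Suc p" and \<sigma>': "\<sigma>' \<in> NCm (S - V i) p" and \<sigma>: "\<sigma> = insert (V i) \<sigma>'"
      by auto
    note Vp = V_props[OF i]
    have part: "partition_on (S - V i) \<sigma>'" and nc: "noncrossing \<sigma>'"
      using \<sigma>' by (auto simp: NCm_def)
    have mins: "Min W \<in> S \<and> Min W < x" if "W \<in> \<sigma>'" for W
      using \<sigma>' that below by (auto simp: NCm_def take_sorted_diff[OF i])
    have WS: "W \<subseteq> S - V i" if "W \<in> \<sigma>'" for W using part that by (auto simp: partition_on_def)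
    have "partition_on S \<sigma>"
      using part Vp(1,2) unfolding \<sigma> partition_on_def disjoint_def by auto
    moreover have "noncrossing \<sigma>"
      unfolding noncrossing_def
    proof (intro ballI impI notI, elim conjE)
      fix X Y a b c e assume XY: "X \<in> \<sigma>" "Y \<in> \<sigma>" "X \<noteq> Y" and abc: "a \<in> X" "b \<in> Y" "c \<in> X" "e \<in> Y" "a < b" "b < c" "c < e"
      consider "X \<in> \<sigma>'" "Y \<in> \<sigma>'" | "X = V i" "Y \<in> \<sigma>'" | "X \<in> \<sigma>'" "Y = V i"
        using XY \<sigma> by auto
      then show False
      proof cases
        case 1 then show ?thesis using noncrossingD[OF nc 1 XY(3) abc] by blast
      next
        case 2
        then have "b \<in> S" "b \<notin> V i" using abc WS by auto
        moreover have "x \<le> b" using Vp(7)[of a] abc 2 by auto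
        ultimately show ?thesis using Vp(8)[of b c] abc 2 by auto
      next
        case 3
        then have "c \<in> S" "c \<notin> V i" using abc WS by auto
        moreover have "x \<le> c" using Vp(7)[of b] abc 3 by auto
        ultimately show ?thesis using Vp(8)[of c e] abc 3 by auto
      qed
    qed
    moreover have "Min W \<in> set (take (Suc (Suc p)) xs)" if "W \<in> \<sigma>" for W
      using that \<sigma> mins Vp(3) take2 by auto
    ultimately show ?thesis by (simp add: NCm_def xs_def)
  qed
qed

text \<open>\<open>V i\<close> has the strictly largest minimum, hence is the block chosen by
  \<open>last_block\<close>, and the largest point of \<open>S\<close> below it sits at position
  \<open>p\<close>, where its value is multiplied on.\<close>

lemma nested_insert:
  assumes i: "i < card S - Suc p" and \<sigma>': "\<sigma>' \<in> NCm (S - V i) p"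
  shows "nested_cumulant_aux A \<kappa> (card (insert (V i) \<sigma>') - 1) (insert (V i) \<sigma>') a =
    nested_cumulant_aux A \<kappa> (card \<sigma>' - 1) \<sigma>'
      (a(xs ! p := a (xs ! p) \<otimes>\<^bsub>A\<^esub> \<kappa> (map a (take (Suc i) (drop (Suc p) xs)))))"
    and "V i \<notin> \<sigma>'"
proof -
  note Vp = V_props[OF i]
  have part: "partition_on (S - V i) \<sigma>'" using \<sigma>' by (auto simp: NCm_def)
  have mins: "Min W < x" if "W \<in> \<sigma>'" for W
    using \<sigma>' that below by (auto simp: NCm_def take_sorted_diff[OF i])
  show notin: "V i \<notin> \<sigma>'" using mins Vp(3) by blast
  have fin': "finite \<sigma>'" using part fin by (metis finite_Diff finite_elements)
  have xp: "xs ! p \<in> set (take (Suc p) xs)"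
    using len xs by (simp add: take_Suc_conv_app_nth)
  have "xs ! p \<in> S - V i"
    using xp below Vp(7) by force
  then have "\<sigma>' \<noteq> {}" using part by (auto simp: partition_on_def)
  then obtain r where r: "card \<sigma>' = Suc r" using fin' by (metis card_eq_0_iff not0_implies_Suc)
  have lb: "last_block (insert (V i) \<sigma>') = V i"
  proof -
    let ?Q = "\<lambda>W. W \<in> insert (V i) \<sigma>'"
    have "?Q (last_block (insert (V i) \<sigma>')) \<and> (\<forall>y. ?Q y \<longrightarrow> \<not> Min (last_block (insert (V i) \<sigma>')) < Min y)"
      unfolding last_block_def
      by (rule arg_maxI[of ?Q "V i"]) (use mins Vp(3) in \<open>auto simp: less_imp_le not_less\<close>)
    then show ?thesis using mins Vp(3) by auto
  qed
  have un: "\<Union> (insert (V i) \<sigma>') = S" using part Vp(1) by (auto simp: partition_on_def)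
  have mx: "Max {j \<in> S. j < x} = xs ! p"
  proof (rule Max_eqI)
    show "finite {j \<in> S. j < x}" using fin by simp
    show "xs ! p \<in> {j \<in> S. j < x}" using xp below by auto
    fix y assume "y \<in> {j \<in> S. j < x}"
    then have "y \<in> set (take (Suc p) xs)" using below by auto
    then obtain j where j: "j < Suc p" "y = xs ! j" by (auto simp: in_set_conv_nth)
    have "j = p \<or> xs ! j < xs ! p" using xs(1) j(1) len xs(3) by (auto simp: sorted_wrt_iff_nth_less less_Suc_eq)
    then show "y \<le> xs ! p" using j by auto
  qed
  have rm: "insert (V i) \<sigma>' - {V i} = \<sigma>'" using notin by auto
  show "nested_cumulant_aux A \<kappa> (card (insert (V i) \<sigma>') - 1) (insert (V i) \<sigma>') a =
    nested_cumulant_aux A \<kappa> (card \<sigma>' - 1) \<sigma>'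
      (a(xs ! p := a (xs ! p) \<otimes>\<^bsub>A\<^esub> \<kappa> (map a (take (Suc i) (drop (Suc p) xs)))))"
  proof -
    have "card (insert (V i) \<sigma>') - 1 = Suc r" "card \<sigma>' - 1 = r"
      using fin' notin r by auto
    then show ?thesis
      by (simp only: rm nested_cumulant_aux.simps Let_def lb un Vp(3,5) mx)
  qed
qed

end

text \<open>The partitions are sorted by whether position \<open>p + 1\<close> starts a block and by
  the length of that block. Its removal leaves the positions up to \<open>p\<close> in place, so the
  induction is on \<open>p\<close> with \<open>S\<close> and \<open>a\<close> arbitrary. Membership
  in the carrier is proved at the same time, since finite sums in the ring are rearranged only for
  carrier-valued families.\<close>

lemma sum_nested_eq_nc_sum:
  assumes "abelian_monoid A" and mclosed: "\<And>x y. x \<in> carrier A \<Longrightarrow> y \<in> carrier A \<Longrightarrow> x \<otimes>\<^bsub>A\<^esub> y \<in> carrier A"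
    and \<kappa>: "\<And>L. L \<noteq> [] \<Longrightarrow> set L \<subseteq> carrier A \<Longrightarrow> \<kappa> L \<in> carrier A"
    and "finite S" "p < card S" "a ` S \<subseteq> carrier A"
  shows "(\<Oplus>\<^bsub>A\<^esub>\<sigma>\<in>NCm S p. nested_cumulant A \<kappa> \<sigma> a) = nc_sum A \<kappa> p (map a (sorted_list_of_set S)) \<and>
    (\<forall>\<sigma>\<in>NCm S p. nested_cumulant A \<kappa> \<sigma> a \<in> carrier A)"
  using assms(4-6)
proof (induction p arbitrary: S a)
  interpret abelian_monoid A by fact
  case 0
  have S: "S \<noteq> {}" "finite S" using 0 by auto
  have hd: "set (take (Suc 0) (sorted_list_of_set S)) = {Min S}"
    using S by (simp add: sorted_list_of_set_nonempty)
  have "NCm S 0 = {{S}}"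
  proof (intro equalityI subsetI)
    fix \<sigma> assume \<sigma>: "\<sigma> \<in> NCm S 0"
    then have part: "partition_on S \<sigma>" and m: "\<And>W. W \<in> \<sigma> \<Longrightarrow> Min W = Min S"
      unfolding NCm_def hd by auto
    have "Min S \<in> W" if "W \<in> \<sigma>" for W
    proof -
      have "finite W" "W \<noteq> {}" using part that S by (auto simp: partition_on_def intro: finite_subset)
      then show ?thesis using m[OF that] Min_in by metis
    qed
    then have "W \<inter> W' \<noteq> {}" if "W \<in> \<sigma>" "W' \<in> \<sigma>" for W W'
      using that by blast
    then have "W = W'" if "W \<in> \<sigma>" "W' \<in> \<sigma>" for W W'
      using disjointD[OF partition_onD2[OF part] that] that by blast
    moreover obtain W where W: "W \<in> \<sigma>" using partition_onD1[OF part] S by auto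
    ultimately have "\<sigma> = {W}" by blast
    then have "\<sigma> = {S}" using partition_onD1[OF part] by simp
    then show "\<sigma> \<in> {{S}}" by simp
  next
    fix \<sigma> assume "\<sigma> \<in> {{S}}"
    then show "\<sigma> \<in> NCm S 0"
      using S by (auto simp: NCm_def hd partition_on_def noncrossing_def disjoint_def)
  qed
  moreover have "nested_cumulant A \<kappa> {S} a = \<kappa> (map a (sorted_list_of_set S))"
    by (simp add: nested_cumulant_def)
  moreover have "\<kappa> (map a (sorted_list_of_set S)) \<in> carrier A"
    using 0 S by (intro \<kappa>) auto
  ultimately show ?case by simp
next
  interpret abelian_monoid A by fact
  case (Suc p)
  interpret sorted_split S p "sorted_list_of_set S" "sorted_list_of_set S ! Suc p"
    by (simp_all add: sorted_split_def Suc.prems)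
  let ?xs = "sorted_list_of_set S"
  let ?I = "{..<card S - Suc p}"
  define a' where "a' i = a(?xs ! p := a (?xs ! p) \<otimes>\<^bsub>A\<^esub> \<kappa> (map a (take (Suc i) (drop (Suc p) ?xs))))" for i
  have IH0: "(\<Oplus>\<^bsub>A\<^esub>\<sigma>\<in>NCm S p. nested_cumulant A \<kappa> \<sigma> a) = nc_sum A \<kappa> p (map a ?xs)"
    "\<And>\<sigma>. \<sigma> \<in> NCm S p \<Longrightarrow> nested_cumulant A \<kappa> \<sigma> a \<in> carrier A"
    using Suc.IH[of S a] Suc.prems by auto
  have ac: "a ` set L \<subseteq> carrier A" if "set L \<subseteq> S" for L using Suc.prems(3) that by auto
  have xp: "?xs ! p \<in> S" using Suc.prems xs by (metis Suc_lessD nth_mem)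
  have a'c: "a' i ` S \<subseteq> carrier A" if "i \<in> ?I" for i
  proof -
    have "\<kappa> (map a (take (Suc i) (drop (Suc p) ?xs))) \<in> carrier A"
      using V_props(1)[of i] that ac[of "take (Suc i) (drop (Suc p) ?xs)"] drop_xs
      by (intro \<kappa>) (auto simp: V_def)
    then show ?thesis using Suc.prems(3) xp by (auto simp: a'_def intro!: mclosed)
  qed
  have map_a': "map (a' i) (sorted_list_of_set (S - V i)) = contract A \<kappa> p i (map a ?xs)" if i: "i \<in> ?I" for i
  proof -
    have len: "p < length ?xs" using Suc.prems xs by simp
    have "distinct (take p ?xs @ ?xs ! p # drop (Suc p) ?xs)"
      using xs(4) id_take_nth_drop[OF len] by simp
    then have 1: "?xs ! p \<notin> set (take p ?xs)" "?xs ! p \<notin> set (drop (Suc p) ?xs)" by auto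
    have "drop (p + i + 2) ?xs = drop (Suc i) (drop (Suc p) ?xs)"
      by (simp add: add.commute)
    then have 2: "?xs ! p \<notin> set (drop (p + i + 2) ?xs)" using 1(2) by (metis in_set_dropD)
    have "sorted_list_of_set (S - V i) = take p ?xs @ [?xs ! p] @ drop (p + i + 2) ?xs"
      using sorted_diff[of i] i len by (simp add: take_Suc_conv_app_nth)
    then show ?thesis using 1 2 len
      by (simp add: contract_def a'_def take_map drop_map)
  qed
  have cardV: "card (S - V i) = card S - Suc i" if "i \<in> ?I" for i
    using V_props[of i] that by (simp add: card_Diff_subset)
  have IH: "(\<Oplus>\<^bsub>A\<^esub>\<sigma>\<in>NCm (S - V i) p. nested_cumulant A \<kappa> \<sigma> (a' i)) = nc_sum A \<kappa> p (contract A \<kappa> p i (map a ?xs))"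
    "\<And>\<sigma>. \<sigma> \<in> NCm (S - V i) p \<Longrightarrow> nested_cumulant A \<kappa> \<sigma> (a' i) \<in> carrier A" if i: "i \<in> ?I" for i
  proof -
    have "p < card (S - V i)" "a' i ` (S - V i) \<subseteq> carrier A"
      using cardV[OF i] i Suc.prems a'c[OF i] by auto
    then show "(\<Oplus>\<^bsub>A\<^esub>\<sigma>\<in>NCm (S - V i) p. nested_cumulant A \<kappa> \<sigma> (a' i)) = nc_sum A \<kappa> p (contract A \<kappa> p i (map a ?xs))"
      "\<And>\<sigma>. \<sigma> \<in> NCm (S - V i) p \<Longrightarrow> nested_cumulant A \<kappa> \<sigma> (a' i) \<in> carrier A"
      using Suc.IH[of "S - V i" "a' i"] fin map_a'[OF i] by auto
  qed
  have ins: "nested_cumulant A \<kappa> (insert (V i) \<sigma>') a = nested_cumulant A \<kappa> \<sigma>' (a' i)" "V i \<notin> \<sigma>'"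
    if "i \<in> ?I" "\<sigma>' \<in> NCm (S - V i) p" for i \<sigma>'
    using nested_insert(1)[of i \<sigma>' A \<kappa> a] nested_insert(2)[of i \<sigma>'] that by (auto simp: nested_cumulant_def a'_def)
  let ?F = "\<lambda>i. insert (V i) ` NCm (S - V i) p"
  have closed: "nested_cumulant A \<kappa> \<sigma> a \<in> carrier A" if "i \<in> ?I" "\<sigma> \<in> ?F i" for i \<sigma>
    using that ins IH by auto
  have minF: "\<exists>W\<in>\<sigma>. Min W = ?xs ! Suc p" if "i \<in> ?I" "\<sigma> \<in> ?F i" for i \<sigma>
    using that V_props(3)[of i] by auto
  have minS: "\<not> (\<exists>W\<in>\<sigma>. Min W = ?xs ! Suc p)" if "\<sigma> \<in> NCm S p" for \<sigma>
    using that below by (auto simp: NCm_def)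
  have disjF: "?F i \<inter> ?F j = {}" if ij: "i \<in> ?I" "j \<in> ?I" "i \<noteq> j" for i j
  proof (rule ccontr)
    assume "?F i \<inter> ?F j \<noteq> {}"
    then obtain \<sigma> where "\<sigma> \<in> ?F i" "\<sigma> \<in> ?F j" by blast
    then have "V i \<in> \<sigma>" "V j \<in> \<sigma>" "\<sigma> \<in> NCm S (Suc p)" using NCm_Suc ij by auto
    moreover have "?xs ! Suc p \<in> V i" "?xs ! Suc p \<in> V j" using V_props(2) ij by auto
    ultimately have "V i = V j" by (auto simp: NCm_def partition_on_def disjoint_def)
    then have "card (V i) = card (V j)" by simp
    then show False using V_props(6) ij by auto
  qed
  have "(\<Oplus>\<^bsub>A\<^esub>\<sigma>\<in>NCm S (Suc p). nested_cumulant A \<kappa> \<sigma> a) =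
      (\<Oplus>\<^bsub>A\<^esub>\<sigma>\<in>NCm S p. nested_cumulant A \<kappa> \<sigma> a) \<oplus>\<^bsub>A\<^esub>
      (\<Oplus>\<^bsub>A\<^esub>\<sigma>\<in>(\<Union>i\<in>?I. ?F i). nested_cumulant A \<kappa> \<sigma> a)"
    unfolding NCm_Suc
  proof (rule add.finprod_Un_disjoint)
    show "NCm S p \<inter> (\<Union>i\<in>?I. ?F i) = {}"
      using minF minS by blast
    show "(\<lambda>\<sigma>. nested_cumulant A \<kappa> \<sigma> a) \<in> (\<Union>i\<in>?I. ?F i) \<rightarrow> carrier A"
      using closed by blast
  qed (use fin finite_NCm IH0(2) in auto)
  also have "(\<Oplus>\<^bsub>A\<^esub>\<sigma>\<in>(\<Union>i\<in>?I. ?F i). nested_cumulant A \<kappa> \<sigma> a) =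
      (\<Oplus>\<^bsub>A\<^esub>i\<in>?I. \<Oplus>\<^bsub>A\<^esub>\<sigma>\<in>?F i. nested_cumulant A \<kappa> \<sigma> a)"
    by (rule add.finprod_UN_disjoint)
      (use fin finite_NCm closed disjF in \<open>auto simp: pairwise_def disjnt_def\<close>)
  also have "\<dots> = (\<Oplus>\<^bsub>A\<^esub>i\<in>?I. nc_sum A \<kappa> p (contract A \<kappa> p i (map a ?xs)))"
  proof (rule add.finprod_cong')
    show "(\<lambda>i. nc_sum A \<kappa> p (contract A \<kappa> p i (map a ?xs))) \<in> ?I \<rightarrow> carrier A"
    proof
      fix i assume i: "i \<in> ?I"
      show "nc_sum A \<kappa> p (contract A \<kappa> p i (map a ?xs)) \<in> carrier A"
        unfolding IH(1)[OF i, symmetric] by (rule finsum_closed) (use IH(2)[OF i] in auto)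
    qed
    fix i assume i: "i \<in> ?I"
    have inj: "inj_on (insert (V i)) (NCm (S - V i) p)"
    proof (rule inj_onI)
      fix \<sigma>1 \<sigma>2 assume "\<sigma>1 \<in> NCm (S - V i) p" "\<sigma>2 \<in> NCm (S - V i) p" "insert (V i) \<sigma>1 = insert (V i) \<sigma>2"
      then show "\<sigma>1 = \<sigma>2" using ins(2)[OF i] insert_ident by metis
    qed
    have "(\<Oplus>\<^bsub>A\<^esub>\<sigma>\<in>?F i. nested_cumulant A \<kappa> \<sigma> a) =
      (\<Oplus>\<^bsub>A\<^esub>\<sigma>\<in>NCm (S - V i) p. nested_cumulant A \<kappa> (insert (V i) \<sigma>) a)"
      by (rule add.finprod_reindex) (use closed[OF i] inj in auto)
    also have "\<dots> = (\<Oplus>\<^bsub>A\<^esub>\<sigma>\<in>NCm (S - V i) p. nested_cumulant A \<kappa> \<sigma> (a' i))"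
      by (rule add.finprod_cong') (use ins[OF i] IH(2)[OF i] in auto)
    finally show "(\<Oplus>\<^bsub>A\<^esub>\<sigma>\<in>?F i. nested_cumulant A \<kappa> \<sigma> a) = nc_sum A \<kappa> p (contract A \<kappa> p i (map a ?xs))"
      using IH(1)[OF i] by simp
  qed auto
  finally have "(\<Oplus>\<^bsub>A\<^esub>\<sigma>\<in>NCm S (Suc p). nested_cumulant A \<kappa> \<sigma> a) = nc_sum A \<kappa> (Suc p) (map a ?xs)"
    using IH0(1) xs by simp
  moreover have "\<forall>\<sigma>\<in>NCm S (Suc p). nested_cumulant A \<kappa> \<sigma> a \<in> carrier A"
    unfolding NCm_Suc using IH0(2) closed by auto
  ultimately show ?case by blast
qed

lemma sum_noncrossing_eq_nc_sum:
  assumes "abelian_monoid A" and "\<And>x y. x \<in> carrier A \<Longrightarrow> y \<in> carrier A \<Longrightarrow> x \<otimes>\<^bsub>A\<^esub> y \<in> carrier A"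
    and "\<And>L. L \<noteq> [] \<Longrightarrow> set L \<subseteq> carrier A \<Longrightarrow> \<kappa> L \<in> carrier A"
    and "as \<noteq> []" "set as \<subseteq> carrier A"
  shows "(\<Oplus>\<^bsub>A\<^esub>\<sigma>\<in>noncrossing_partitions (length as). nested_cumulant A \<kappa> \<sigma> (\<lambda>i. as ! i)) =
    nc_sum A \<kappa> (length as - 1) as"
proof -
  have "Min W \<in> {..<length as}" if "partition_on {..<length as} \<sigma>" "W \<in> \<sigma>" for \<sigma> W
  proof -
    have "finite W" "W \<noteq> {}" "W \<subseteq> {..<length as}"
      using that by (auto simp: partition_on_def intro: finite_subset)
    then show ?thesis using Min_in by blast
  qed
  \<comment> \<open>The bound \<open>length as - 1\<close> admits every position, so the condition
    on the minima is void.\<close>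
  then have "noncrossing_partitions (length as) = NCm {..<length as} (length as - 1)"
    using assms(4)
    unfolding noncrossing_partitions_def NCm_def noncrossing_iff[symmetric]
    by (auto simp: lessThan_atLeast0)
  moreover have "(\<lambda>i. as ! i) ` {..<length as} \<subseteq> carrier A"
    using assms(5) nth_mem by blast
  ultimately show ?thesis
    using sum_nested_eq_nc_sum[of A \<kappa> "{..<length as}" "length as - 1" "\<lambda>i. as ! i"] assms
    by (auto simp: lessThan_atLeast0 map_nth)
qed

section \<open>Moment-cumulant sums in coordinates\<close>

definition circular_cumulant :: "((nat \<Rightarrow> complex) \<Rightarrow> complex) \<Rightarrow> (bool \<times> (nat \<Rightarrow> complex)) list \<Rightarrow> nat \<Rightarrow> complex" where
  "circular_cumulant \<phi> w k = (if length w = 2 \<and> fst (w ! 0) \<noteq> fst (w ! 1) then \<phi> (snd (w ! 0)) * snd (w ! 1) k else 0)"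

text \<open>The inner coefficient enters the covariance, the outer one factors out by the bimodule
  property: for different exponents the second cumulant with coefficients \<open>l\<close> and
  \<open>m\<close> is the scalar \<open>\<phi> l\<close> times \<open>m\<close>.\<close>

lemma circular_cumulant_pair: "circular_cumulant \<phi> [(b, l), (b', m)] = (if b \<noteq> b' then (\<lambda>k. \<phi> l * m k) else (\<lambda>_. 0))"
  by (auto simp: circular_cumulant_def fun_eq_iff)

lemma circular_cumulant_zero: "length w \<noteq> 2 \<Longrightarrow> circular_cumulant \<phi> w = (\<lambda>_. 0)"
  by (auto simp: circular_cumulant_def fun_eq_iff)

text \<open>On words whose letters are one element or its adjoint followed by a coefficient from D,
  contracting a block changes only the coefficient of the letter to its left; so the recursion of
  \<open>nc_sum\<close> can be run on coordinate vectors.\<close>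

definition coord_contract :: "((bool \<times> (nat \<Rightarrow> complex)) list \<Rightarrow> nat \<Rightarrow> complex) \<Rightarrow> nat \<Rightarrow> nat \<Rightarrow>
    (bool \<times> (nat \<Rightarrow> complex)) list \<Rightarrow> (bool \<times> (nat \<Rightarrow> complex)) list" where
  "coord_contract f r i w = take r w @ [(fst (w ! r), \<lambda>k. snd (w ! r) k * f (take (Suc i) (drop (Suc r) w)) k)] @ drop (r + i + 2) w"

primrec coord_nc_sum :: "((bool \<times> (nat \<Rightarrow> complex)) list \<Rightarrow> nat \<Rightarrow> complex) \<Rightarrow> nat \<Rightarrow>
    (bool \<times> (nat \<Rightarrow> complex)) list \<Rightarrow> nat \<Rightarrow> complex" where
  "coord_nc_sum f 0 w k = f w k"
| "coord_nc_sum f (Suc r) w k = coord_nc_sum f r w k + (\<Sum>i<length w - Suc r. coord_nc_sum f r (coord_contract f r i w) k)"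

section \<open>\<open>\<D>\<close>-valued cumulants exist\<close>

context projection_ncps
begin

abbreviation De where "De \<equiv> D_elem A d p"
abbreviation DD where "DD \<equiv> D_span A d p"
abbreviation E where "E \<equiv> cond_exp A d p"

lemma De_closed [simp]: "De l \<in> carrier A"
  unfolding D_elem_def by (intro finsum_closed) (auto intro!: scal_closed proj_closed)

lemma DD_closed: "e \<in> DD \<Longrightarrow> e \<in> carrier A"
  by (auto simp: D_span_def)

lemma De_cong: "(\<And>k. k < d \<Longrightarrow> l k = m k) \<Longrightarrow> De l = De m"
  unfolding D_elem_def by (rule finsum_cong') (auto intro!: scal_closed proj_closed)

lemma De_add: "De (\<lambda>k. l k + m k) = De l \<oplus> De m"
  unfolding D_elem_def
  by (subst finsum_addf[symmetric]) (auto intro!: scal_closed proj_closed finsum_cong' simp: scal_add_left proj_closed)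

lemma scal_zero_left: "x \<in> carrier A \<Longrightarrow> scal A 0 x = \<zero>"
  using scal_add_left[of x 0 0] scal_closed[of x 0]
  by (metis add.inv_closed add.r_cancel_one' add_0)

lemma De_zero: "De (\<lambda>_. 0) = \<zero>"
  unfolding D_elem_def
  by (subst finsum_cong'[where g = "\<lambda>_. \<zero>" and B = "{..<d}"]) (auto simp: scal_zero_left proj_closed)

lemma De_sum: "finite I \<Longrightarrow> De (\<lambda>k. \<Sum>i\<in>I. l i k) = (\<Oplus>i\<in>I. De (l i))"
  by (induction I rule: finite_induct) (auto simp: De_zero De_add)

lemma scal_zero_right: "scal A c \<zero> = \<zero>"
  using scal_add_right[of \<zero> \<zero> c] scal_closed[of \<zero> c]
  by (metis add.r_cancel_one' l_zero zero_closed)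

lemma De_proj: "k < d \<Longrightarrow> De l \<otimes> p k = scal A (l k) (p k)"
proof -
  assume k: "k < d"
  have "De l \<otimes> p k = (\<Oplus>j\<in>{..<d}. scal A (l j) (p j) \<otimes> p k)"
    unfolding D_elem_def by (rule finsum_ldistr) (auto intro!: scal_closed proj_closed simp: k)
  also have "\<dots> = (\<Oplus>j\<in>{..<d}. if k = j then scal A (l j) (p j) else \<zero>)"
    by (rule finsum_cong')
      (use k in \<open>auto intro!: scal_closed proj_closed simp: scal_mult_left proj_closed proj_idem proj_orth scal_zero_right\<close>)
  also have "\<dots> = scal A (l k) (p k)"
    by (rule add.finprod_singleton) (use k in \<open>auto intro!: scal_closed proj_closed\<close>)
  finally show ?thesis .
qed

lemma De_mult: "De l \<otimes> De m = De (\<lambda>k. l k * m k)"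
proof -
  have "De l \<otimes> De m = (\<Oplus>j\<in>{..<d}. De l \<otimes> scal A (m j) (p j))"
    unfolding D_elem_def[of _ _ _ m] by (rule finsum_rdistr) (auto intro!: scal_closed proj_closed)
  also have "\<dots> = De (\<lambda>k. l k * m k)"
    unfolding D_elem_def[of _ _ _ "\<lambda>k. l k * m k"]
    by (rule finsum_cong')
      (auto intro!: scal_closed proj_closed simp: scal_mult_right proj_closed De_proj scal_scal mult.commute)
  finally show ?thesis .
qed

lemma De_comm: "De l \<otimes> De m = De m \<otimes> De l"
  by (simp add: De_mult mult.commute)

lemma De_unit:
  assumes "k < d"
  shows "De (\<lambda>j. if j = k then 1 else 0) = p k"
proof -
  have "De (\<lambda>j. if j = k then 1 else 0) = (\<Oplus>j\<in>{..<d}. if k = j then p j else \<zero>)"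
    unfolding D_elem_def by (rule finsum_cong')
      (auto intro!: scal_closed proj_closed simp: scal_zero_left scal_one proj_closed)
  also have "\<dots> = p k"
    by (rule add.finprod_singleton) (use assms in \<open>auto intro!: proj_closed\<close>)
  finally show ?thesis .
qed

lemma proj_De: "k < d \<Longrightarrow> p k \<otimes> De l = scal A (l k) (p k)"
  using De_comm[of l] De_proj[of k l] De_unit[of k] by metis

lemma De_one: "De (\<lambda>_. 1) = \<one>"
  unfolding proj_sum[symmetric] D_elem_def
  by (rule finsum_cong') (auto simp: scal_one proj_closed)

lemma De_scal: "De (\<lambda>k. c * l k) = scal A c (De l)"
proof -
  have "De (\<lambda>_. c) = (\<Oplus>j\<in>{..<d}. scal A c \<one> \<otimes> p j)"
    unfolding D_elem_def
    by (rule finsum_cong') (auto intro!: scal_closed proj_closed m_closed simp: scal_mult_left proj_closed)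
  also have "\<dots> = scal A c \<one> \<otimes> \<one>"
    unfolding proj_sum[symmetric]
    by (rule finsum_rdistr[symmetric]) (auto intro!: scal_closed proj_closed finsum_closed)
  finally have "De (\<lambda>_. c) = scal A c \<one>"
    using scal_closed[of \<one> c] by simp
  then show ?thesis
    using De_mult[of "\<lambda>_. c" l] scal_mult_left[of \<one> "De l" c] by simp
qed

lemma De_const: "De (\<lambda>_. c) = scal A c \<one>"
  using De_scal[of c "\<lambda>_. 1"] by (simp add: De_one)

lemma state_zero: "state A \<zero> = 0"
  using state_add[of \<zero> \<zero>] by simp

lemma state_finsum: "finite I \<Longrightarrow> (\<And>i. i \<in> I \<Longrightarrow> f i \<in> carrier A) \<Longrightarrow> state A (\<Oplus>i\<in>I. f i) = (\<Sum>i\<in>I. state A (f i))"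
  by (induction I rule: finite_induct) (auto simp: state_zero state_add finsum_closed Pi_def)

lemma state_De: "state A (De l) = (\<Sum>k<d. l k * state A (p k))"
  unfolding D_elem_def
  by (subst state_finsum) (auto simp: scal_closed proj_closed state_scal)

lemma cond_coord_eq:
  assumes "k < d" "x \<in> carrier A"
  shows "cond_coord A p x k = inverse (state A (p k)) * state A (p k \<otimes> x)"
proof -
  have "state A (p k \<otimes> x \<otimes> p k) = state A (p k \<otimes> (p k \<otimes> x))"
    using assms by (intro state_trace) (auto simp: proj_closed)
  then show ?thesis
    using assms by (simp add: cond_coord_def m_assoc[symmetric] proj_closed proj_idem)
qed

lemma cond_coord_De: "k < d \<Longrightarrow> cond_coord A p (De l) k = l k"
  by (simp add: cond_coord_eq proj_De state_scal proj_closed proj_state)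

lemma De_inj: "De l = De m \<Longrightarrow> k < d \<Longrightarrow> l k = m k"
  by (metis cond_coord_De)

lemma E_closed [simp]: "E x \<in> carrier A"
  by (simp add: cond_exp_def)

lemma E_in_DD: "E x \<in> DD"
  by (simp add: cond_exp_def D_span_def)

lemma E_add: "x \<in> carrier A \<Longrightarrow> y \<in> carrier A \<Longrightarrow> E (x \<oplus> y) = E x \<oplus> E y"
  unfolding cond_exp_def De_add[symmetric]
  by (rule De_cong) (simp add: cond_coord_eq r_distr proj_closed state_add algebra_simps)

lemma E_left: "x \<in> carrier A \<Longrightarrow> E (De l \<otimes> x) = De l \<otimes> E x"
  unfolding cond_exp_def De_mult
  by (rule De_cong)
    (simp add: cond_coord_eq m_assoc[symmetric] proj_closed proj_De scal_mult_left state_scal)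

lemma E_right: "x \<in> carrier A \<Longrightarrow> E (x \<otimes> De l) = E x \<otimes> De l"
proof -
  assume x: "x \<in> carrier A"
  have "state A (p k \<otimes> (x \<otimes> De l)) = l k * state A (p k \<otimes> x)" if k: "k < d" for k
  proof -
    have "state A (p k \<otimes> (x \<otimes> De l)) = state A ((p k \<otimes> x) \<otimes> De l)"
      using x k by (simp add: m_assoc proj_closed)
    also have "\<dots> = state A (De l \<otimes> (p k \<otimes> x))"
      using x k by (intro state_trace) (auto simp: proj_closed)
    also have "De l \<otimes> (p k \<otimes> x) = scal A (l k) (p k \<otimes> x)"
      using x k by (simp add: m_assoc[symmetric] proj_closed De_proj scal_mult_left)
    finally show ?thesis using x k by (simp add: state_scal proj_closed)
  qed
  then show ?thesis using x
    unfolding cond_exp_def De_mult by (intro De_cong) (simp add: cond_coord_eq)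
qed

lemma list_mult_closed [simp]: "set L \<subseteq> carrier A \<Longrightarrow> list_mult A L \<in> carrier A"
  by (induction L) (auto simp: list_mult_def)

lemma list_mult_Nil [simp]: "list_mult A [] = \<one>"
  by (simp add: list_mult_def)

lemma list_mult_Cons [simp]: "list_mult A (x # L) = x \<otimes> list_mult A L"
  by (simp add: list_mult_def)

lemma list_mult_append:
  "set L \<subseteq> carrier A \<Longrightarrow> set M \<subseteq> carrier A \<Longrightarrow> list_mult A (L @ M) = list_mult A L \<otimes> list_mult A M"
  by (induction L) (auto simp: m_assoc)

text \<open>The bimodule conditions at a fixed arity, phrased with list updates so that a position
  can be followed through \<open>contract\<close>. Fixing the arity permits the cumulants to be
  built one arity at a time.\<close>

definition bimod :: "nat \<Rightarrow> ('a list \<Rightarrow> 'a) \<Rightarrow> bool" where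
  "bimod m T \<longleftrightarrow>
     (\<forall>L. length L = m \<and> set L \<subseteq> carrier A \<longrightarrow> T L \<in> DD) \<and>
     (\<forall>L k x y. length L = m \<and> set L \<subseteq> carrier A \<and> k < m \<and> x \<in> carrier A \<and> y \<in> carrier A \<longrightarrow>
        T (L[k := x \<oplus> y]) = T (L[k := x]) \<oplus> T (L[k := y])) \<and>
     (\<forall>L k x y e. length L = m \<and> set L \<subseteq> carrier A \<and> Suc k < m \<and> x \<in> carrier A \<and> y \<in> carrier A \<and> e \<in> DD \<longrightarrow>
        T (L[k := x \<otimes> e, Suc k := y]) = T (L[k := x, Suc k := e \<otimes> y])) \<and>
     (\<forall>L x e. 0 < m \<and> length L = m \<and> set L \<subseteq> carrier A \<and> x \<in> carrier A \<and> e \<in> DD \<longrightarrow>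
        T (L[0 := e \<otimes> x]) = e \<otimes> T (L[0 := x])) \<and>
     (\<forall>L x e. 0 < m \<and> length L = m \<and> set L \<subseteq> carrier A \<and> x \<in> carrier A \<and> e \<in> DD \<longrightarrow>
        T (L[m - 1 := x \<otimes> e]) = T (L[m - 1 := x]) \<otimes> e)"

lemma bimodD:
  assumes "bimod m T" "length L = m" "set L \<subseteq> carrier A"
  shows "T L \<in> DD" "T L \<in> carrier A"
    and "k < m \<Longrightarrow> x \<in> carrier A \<Longrightarrow> y \<in> carrier A \<Longrightarrow> T (L[k := x \<oplus> y]) = T (L[k := x]) \<oplus> T (L[k := y])"
    and "Suc k < m \<Longrightarrow> x \<in> carrier A \<Longrightarrow> y \<in> carrier A \<Longrightarrow> e \<in> DD \<Longrightarrow>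
      T (L[k := x \<otimes> e, Suc k := y]) = T (L[k := x, Suc k := e \<otimes> y])"
    and "0 < m \<Longrightarrow> x \<in> carrier A \<Longrightarrow> e \<in> DD \<Longrightarrow> T (L[0 := e \<otimes> x]) = e \<otimes> T (L[0 := x])"
    and "0 < m \<Longrightarrow> x \<in> carrier A \<Longrightarrow> e \<in> DD \<Longrightarrow> T (L[m - 1 := x \<otimes> e]) = T (L[m - 1 := x]) \<otimes> e"
  using assms unfolding bimod_def by (auto simp: DD_closed)

lemma bimodI:
  assumes "\<And>L. length L = m \<Longrightarrow> set L \<subseteq> carrier A \<Longrightarrow> T L \<in> DD"
    and "\<And>L k x y. length L = m \<Longrightarrow> set L \<subseteq> carrier A \<Longrightarrow> k < m \<Longrightarrow> x \<in> carrier A \<Longrightarrow> y \<in> carrier A \<Longrightarrow>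
      T (L[k := x \<oplus> y]) = T (L[k := x]) \<oplus> T (L[k := y])"
    and "\<And>L k x y e. length L = m \<Longrightarrow> set L \<subseteq> carrier A \<Longrightarrow> Suc k < m \<Longrightarrow> x \<in> carrier A \<Longrightarrow> y \<in> carrier A \<Longrightarrow> e \<in> DD \<Longrightarrow>
      T (L[k := x \<otimes> e, Suc k := y]) = T (L[k := x, Suc k := e \<otimes> y])"
    and "\<And>L x e. 0 < m \<Longrightarrow> length L = m \<Longrightarrow> set L \<subseteq> carrier A \<Longrightarrow> x \<in> carrier A \<Longrightarrow> e \<in> DD \<Longrightarrow>
      T (L[0 := e \<otimes> x]) = e \<otimes> T (L[0 := x])"
    and "\<And>L x e. 0 < m \<Longrightarrow> length L = m \<Longrightarrow> set L \<subseteq> carrier A \<Longrightarrow> x \<in> carrier A \<Longrightarrow> e \<in> DD \<Longrightarrow>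
      T (L[m - 1 := x \<otimes> e]) = T (L[m - 1 := x]) \<otimes> e"
  shows "bimod m T"
  unfolding bimod_def by (intro conjI allI impI; elim conjE; rule assms; assumption)

lemma set_update_closed: "set L \<subseteq> carrier A \<Longrightarrow> x \<in> carrier A \<Longrightarrow> set (L[k := x]) \<subseteq> carrier A"
  using set_update_subset_insert by fastforce

lemma DD_add: "e \<in> DD \<Longrightarrow> f \<in> DD \<Longrightarrow> e \<oplus> f \<in> DD"
  unfolding D_span_def by (auto simp flip: De_add)

lemma DD_zero: "\<zero> \<in> DD"
  unfolding D_span_def by (auto simp flip: De_zero)

lemma DD_uminus: "e \<in> DD \<Longrightarrow> \<ominus> e \<in> DD"
proof -
  assume "e \<in> DD"
  then obtain l where l: "e = De l" by (auto simp: D_span_def)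
  have "De (\<lambda>k. - l k) \<oplus> e = \<zero>"
    unfolding l De_add[symmetric] by (simp add: De_zero)
  then have "\<ominus> e = De (\<lambda>k. - l k)" by (simp add: l minus_equality)
  then show ?thesis by (auto simp: D_span_def)
qed

lemma bimod_add:
  assumes "bimod m T" "bimod m U"
  shows "bimod m (\<lambda>L. T L \<oplus> U L)"
proof (rule bimodI, goal_cases)
  case (1 L)
  then show ?case using bimodD(1) assms by (intro DD_add) auto
next
  case (2 L k x y)
  then show ?case
    using bimodD(2)[OF assms(1)] bimodD(2)[OF assms(2)]
    by (simp add: bimodD(3)[OF assms(1)] bimodD(3)[OF assms(2)] set_update_closed a_ac)
next
  case (3 L k x y e)
  then show ?case by (simp add: bimodD(4)[OF assms(1)] bimodD(4)[OF assms(2)])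
next
  case (4 L x e)
  then show ?case
    using bimodD(2)[OF assms(1)] bimodD(2)[OF assms(2)]
    by (simp add: bimodD(5)[OF assms(1)] bimodD(5)[OF assms(2)] set_update_closed r_distr DD_closed)
next
  case (5 L x e)
  then show ?case
    using bimodD(2)[OF assms(1)] bimodD(2)[OF assms(2)]
    using bimodD(6)[OF assms(1)] bimodD(6)[OF assms(2)]
    by (simp add: set_update_closed l_distr DD_closed)
qed

lemma bimod_zero: "bimod m (\<lambda>_. \<zero>)"
  by (rule bimodI) (auto simp: DD_zero DD_closed)

lemma bimod_uminus:
  assumes "bimod m T"
  shows "bimod m (\<lambda>L. \<ominus> T L)"
proof (rule bimodI, goal_cases)
  case (1 L)
  then show ?case using bimodD(1) assms by (intro DD_uminus) auto
next
  case (2 L k x y)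
  then show ?case
    using bimodD(2)[OF assms]
    by (simp add: bimodD(3)[OF assms] set_update_closed minus_add a_comm)
next
  case (3 L k x y e)
  then show ?case by (simp add: bimodD(4)[OF assms])
next
  case (4 L x e)
  then show ?case
    using bimodD(2)[OF assms]
    by (simp add: bimodD(5)[OF assms] set_update_closed r_minus DD_closed)
next
  case (5 L x e)
  then show ?case
    using bimodD(2)[OF assms] bimodD(6)[OF assms]
    by (simp add: set_update_closed l_minus DD_closed)
qed

lemma bimod_finsum:
  assumes "finite I" "\<And>i. i \<in> I \<Longrightarrow> bimod m (T i)"
  shows "bimod m (\<lambda>L. if length L = m \<and> set L \<subseteq> carrier A then (\<Oplus>i\<in>I. T i L) else \<zero>)"
  using assms
proof (induction I rule: finite_induct)
  case empty
  then show ?case by (simp add: bimod_zero cong: if_cong)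
next
  case (insert j I)
  let ?U = "\<lambda>I L. if length L = m \<and> set L \<subseteq> carrier A then (\<Oplus>i\<in>I. T i L) else \<zero>"
  have "bimod m (\<lambda>L. T j L \<oplus> ?U I L)"
    using insert by (intro bimod_add) auto
  moreover have "T j L \<oplus> ?U I L = ?U (insert j I) L" if "length L = m" "set L \<subseteq> carrier A" for L
    using that insert bimodD(2)[of m _ L] by (simp add: Pi_def)
  ultimately show ?case
    unfolding bimod_def by (simp add: set_update_closed DD_closed cong: conj_cong)
qed

lemma bimod_cong:
  assumes "bimod m T" "\<And>L. length L = m \<Longrightarrow> set L \<subseteq> carrier A \<Longrightarrow> T L = U L"
  shows "bimod m U"
  using assms(1) unfolding bimod_def
  by (simp add: assms(2)[symmetric] set_update_closed DD_closed cong: conj_cong)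

lemma bimod_E: "bimod m (\<lambda>L. E (list_mult A L))"
proof (rule bimodI, goal_cases)
  case (1 L)
  show ?case by (rule E_in_DD)
next
  case (2 L k x y)
  then have "set (take k L) \<subseteq> carrier A" "set (drop (Suc k) L) \<subseteq> carrier A"
    by (auto dest: in_set_takeD in_set_dropD)
  with 2 show ?case
    by (simp add: upd_conv_take_nth_drop list_mult_append l_distr r_distr E_add)
next
  case (3 L k x y e)
  then have c: "set (take k L) \<subseteq> carrier A" "set (drop (Suc (Suc k)) L) \<subseteq> carrier A"
    by (auto dest: in_set_takeD in_set_dropD)
  have upd: "L[k := z, Suc k := w] = take k L @ [z, w] @ drop (Suc (Suc k)) L" for z w
  proof -
    have "L[k := z, Suc k := w] = (take k L @ z # drop (Suc k) L)[Suc k := w]"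
      using 3 by (simp add: upd_conv_take_nth_drop)
    also have "drop (Suc k) L = L ! Suc k # drop (Suc (Suc k)) L"
      using 3 by (simp add: Cons_nth_drop_Suc)
    finally show ?thesis using 3 by (simp add: list_update_append)
  qed
  show ?case unfolding upd using 3 c by (simp add: list_mult_append DD_closed m_assoc)
next
  case (4 L x e)
  then obtain l where l: "e = De l" by (auto simp: D_span_def)
  from 4 obtain a L' where "L = a # L'" by (cases L) auto
  then show ?case using 4 by (simp add: l m_assoc E_left)
next
  case (5 L x e)
  then obtain l where l: "e = De l" by (auto simp: D_span_def)
  from 5 obtain a L' where L: "L = L' @ [a]" by (cases L rule: rev_cases) auto
  have "L[m - 1 := z] = L' @ [z]" for z using 5(2) L by (auto simp: list_update_append)
  then show ?case using 5 L by (simp add: l list_mult_append m_assoc[symmetric] E_right)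
qed

context
  fixes \<kappa> :: "'a list \<Rightarrow> 'a" and r i m :: nat
  assumes rim: "r + i + 2 \<le> m"
begin

definition blk :: "'a list \<Rightarrow> 'a list" where "blk L = take (Suc i) (drop (Suc r) L)"

lemma length_contract: "length L = m \<Longrightarrow> length (contract A \<kappa> r i L) = m - i - 1"
  using rim by (simp add: contract_def)

lemma contract_alt: "contract A \<kappa> r i L = take r L @ [L ! r \<otimes> \<kappa> (blk L)] @ drop (r + i + 2) L"
  by (simp add: contract_def blk_def)

lemma length_blk: "length L = m \<Longrightarrow> length (blk L) = Suc i"
  using rim by (simp add: blk_def)

lemma blk_upd_out: "k \<le> r \<or> r + i + 1 < k \<Longrightarrow> blk (L[k := z]) = blk L"
  by (auto simp: blk_def drop_update_swap)

lemma blk_upd_in: "r < k \<Longrightarrow> blk (L[k := z]) = (blk L)[k - Suc r := z]"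
  by (simp add: blk_def drop_update_swap take_update_swap)

lemma contract_upd_lt:
  assumes "length L = m" "k < r"
  shows "contract A \<kappa> r i (L[k := z]) = (contract A \<kappa> r i L)[k := z]"
  using assms rim
  by (simp add: contract_alt blk_upd_out take_update_swap list_update_append)

lemma contract_upd_eq:
  assumes "length L = m"
  shows "contract A \<kappa> r i (L[r := z]) = (contract A \<kappa> r i L)[r := z \<otimes> \<kappa> (blk L)]"
  using assms rim
  by (simp add: contract_alt blk_upd_out list_update_append)

lemma contract_upd_blk:
  assumes "length L = m" "r < k" "k \<le> r + i + 1"
  shows "contract A \<kappa> r i (L[k := z]) = (contract A \<kappa> r i L)[r := L ! r \<otimes> \<kappa> ((blk L)[k - Suc r := z])]"
  using assms rim
  by (simp add: contract_alt blk_upd_in list_update_append)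

lemma contract_upd_gt:
  assumes "length L = m" "r + i + 1 < k" "k < m"
  shows "contract A \<kappa> r i (L[k := z]) = (contract A \<kappa> r i L)[k - Suc i := z]"
proof -
  have "k - Suc i - r = Suc (k - (r + i + 2))" "\<not> k - Suc i < r" using assms by simp_all
  then show ?thesis using assms rim
    by (simp add: contract_alt blk_upd_out drop_update_swap list_update_append)
qed

text \<open>The position of the modified entry relative to the contracted block decides which
  property is used. Before and behind the block it is a property of \<open>T\<close>, inside the
  block one of \<kappa>. At the two borders an element of D is passed between an entry and the
  block, and the one-sided linearity of \<kappa> is combined with multiplication at entry
  \<open>r\<close>.\<close>

lemma bimod_contract:
  assumes T: "bimod (m - i - 1) T" and K: "bimod (Suc i) \<kappa>"
  shows "bimod m (\<lambda>L. T (contract A \<kappa> r i L))"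
proof -
  have blk_c: "set (blk L) \<subseteq> carrier A" if "set L \<subseteq> carrier A" for L
    using that unfolding blk_def by (meson order_trans set_drop_subset set_take_subset)
  have kc: "\<kappa> (blk L) \<in> carrier A" if "length L = m" "set L \<subseteq> carrier A" for L
    using bimodD(2)[OF K] length_blk blk_c that by blast
  have kc': "\<kappa> ((blk L)[j := z]) \<in> carrier A" if "length L = m" "set L \<subseteq> carrier A" "z \<in> carrier A" for L j z
    using bimodD(2)[OF K, of "(blk L)[j := z]"] length_blk blk_c that by (simp add: set_update_closed)
  have Lp: "L ! r \<in> carrier A" if "length L = m" "set L \<subseteq> carrier A" for L
    using that rim by (metis add_lessD1 less_le_trans less_add_same_cancel1 nth_mem subsetD zero_less_numeral add_leD1 add_leE zero_less_Suc add_2_eq_Suc' le_add1 le_imp_less_Suc order_less_le_trans)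
  have coord_contract: "set (contract A \<kappa> r i L) \<subseteq> carrier A" if "length L = m" "set L \<subseteq> carrier A" for L
    using that Lp[OF that] kc[OF that] unfolding contract_alt
    by (auto dest: in_set_takeD in_set_dropD)
  note lc = length_contract
  show ?thesis
  proof (rule bimodI, goal_cases)
    case (1 L)
    then show ?case using bimodD(1)[OF T lc coord_contract] by simp
  next
    case (2 L k x y)
    note L = 2(1,2) and T = bimodD(3)[OF T lc[OF 2(1)] coord_contract[OF 2(1,2)]]
    consider "k < r" | "k = r" | "r < k" "k \<le> r + i + 1" | "r + i + 1 < k" by linarith
    then show ?case
    proof cases
      case 1
      then show ?thesis using 2 rim by (simp add: contract_upd_lt T)
    next
      case 2
      then show ?thesis using L \<open>x \<in> carrier A\<close> \<open>y \<in> carrier A\<close> rim kc[OF L]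
        by (simp add: contract_upd_eq l_distr T)
    next
      case 3
      have "\<kappa> ((blk L)[k - Suc r := x \<oplus> y]) = \<kappa> ((blk L)[k - Suc r := x]) \<oplus> \<kappa> ((blk L)[k - Suc r := y])"
        using bimodD(3)[OF K length_blk blk_c, of L "k - Suc r"] 2 3 by simp
      then show ?thesis using 2 3 rim kc'[OF L] Lp[OF L]
        by (simp add: contract_upd_blk r_distr T)
    next
      case 4
      then show ?thesis using 2 rim by (simp add: contract_upd_gt T)
    qed
  next
    case (3 L k x y e)
    note L = 3(1,2) and T = bimodD(4)[OF T lc[OF 3(1)] coord_contract[OF 3(1,2)]] and xy = 3(4,5,6)
    have ec: "e \<in> carrier A" using xy DD_closed by simp
    consider "Suc k < r" | "Suc k = r" | "k = r" | "r < k" "Suc k \<le> r + i + 1" | "k = r + i + 1" | "r + i + 1 < k"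
      by linarith
    then show ?case
    proof cases
      case 1
      then show ?thesis using 3 rim by (simp add: contract_upd_lt T)
    next
      case 2
      then show ?thesis using L xy ec rim kc[OF L] T[of k x "y \<otimes> \<kappa> (blk L)" e]
        by (auto simp: contract_upd_eq contract_upd_lt blk_upd_out m_assoc)
    next
      case 3
      \<comment> \<open>Left border: \<open>e\<close> leaves the block as a left factor of its value
        and joins \<open>x\<close> at entry \<open>r\<close>.\<close>
      have "\<kappa> ((blk L)[0 := e \<otimes> y]) = e \<otimes> \<kappa> ((blk L)[0 := y])"
        using bimodD(5)[OF K length_blk blk_c, of L y e] L xy by simp
      then show ?thesis using 3 L xy ec rim kc'[OF L]
        by (simp add: contract_upd_blk contract_upd_eq blk_upd_out m_assoc)
    next
      case 4
      have "\<kappa> ((blk L)[k - Suc r := x \<otimes> e, Suc (k - Suc r) := y]) =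
          \<kappa> ((blk L)[k - Suc r := x, Suc (k - Suc r) := e \<otimes> y])"
        using bimodD(4)[OF K length_blk blk_c, of L "k - Suc r"] L xy 4 by simp
      moreover have "Suc k - Suc r = Suc (k - Suc r)" using 4 by simp
      ultimately show ?thesis using 4 L rim
        by (simp add: contract_upd_blk blk_upd_in del: diff_Suc_Suc)
    next
      case 5
      \<comment> \<open>Right border: \<open>e\<close> leaves the block as a right factor of its
        value, so it stands at the right end of entry \<open>r\<close>, from where \<open>T\<close>
        passes it to the entry behind the block.\<close>
      have 1: "\<kappa> ((blk L)[i := x \<otimes> e]) = \<kappa> ((blk L)[i := x]) \<otimes> e"
        using bimodD(6)[OF K length_blk blk_c, of L x e] L xy by simp
      have 2: "contract A \<kappa> r i (L[k := z, Suc k := w]) =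
          (contract A \<kappa> r i L)[r := L ! r \<otimes> \<kappa> ((blk L)[i := z]), Suc r := w]" for z w
        using 5 L 3(3) rim by (simp add: contract_upd_blk contract_upd_gt)
      have "Suc r < m - i - 1" using 5 3(3) by simp
      then show ?thesis
        unfolding 2 1 using T[of r "L ! r \<otimes> \<kappa> ((blk L)[i := x])" y e] L xy ec kc'[OF L] Lp[OF L]
        by (simp add: m_assoc)
    next
      case 6
      then have "Suc k - Suc i = Suc (k - Suc i)" by simp
      then show ?thesis using 6 3 rim by (simp add: contract_upd_gt T del: diff_Suc_Suc)
    qed
  next
    case (4 L x e)
    note L = 4(2,3) and T = bimodD(5)[OF T lc[OF 4(2)] coord_contract[OF 4(2,3)]]
    have ec: "e \<in> carrier A" using 4 DD_closed by simp
    show ?case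
    proof (cases "r = 0")
      case True
      then show ?thesis
        using 4 ec rim kc[OF L] contract_upd_eq[OF L(1)] T[of "x \<otimes> \<kappa> (blk L)" e] by (simp add: m_assoc)
    next
      case False
      then show ?thesis using 4 rim T[of x e] by (simp add: contract_upd_lt)
    qed
  next
    case (5 L x e)
    note L = 5(2,3) and T = bimodD(6)[OF T lc[OF 5(2)] coord_contract[OF 5(2,3)]]
    have ec: "e \<in> carrier A" using 5 DD_closed by simp
    show ?case
    proof (cases "m = r + i + 2")
      case True
      have 1: "\<kappa> ((blk L)[i := x \<otimes> e]) = \<kappa> ((blk L)[i := x]) \<otimes> e"
        using bimodD(6)[OF K length_blk blk_c, of L x e] 5 by simp
      have 2: "contract A \<kappa> r i (L[m - 1 := z]) = (contract A \<kappa> r i L)[r := L ! r \<otimes> \<kappa> ((blk L)[i := z])]" for z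
        using True L by (simp add: contract_upd_blk)
      show ?thesis
        unfolding 2 1 using T[of "L ! r \<otimes> \<kappa> ((blk L)[i := x])" e] 5 ec True kc'[OF L] Lp[OF L]
        by (simp add: m_assoc)
    next
      case False
      then have "contract A \<kappa> r i (L[m - 1 := z]) = (contract A \<kappa> r i L)[m - i - 1 - 1 := z]" for z
        using rim L contract_upd_gt[of L "m - 1" z] by simp
      then show ?thesis using T[of x e] 5 rim by simp
    qed
  qed
qed

end

text \<open>Only arities up to \<open>m\<close> of \<kappa> are assumed, which is what a
  construction by increasing arity can supply.\<close>

lemma bimod_nc_sum:
  assumes "\<And>j. 0 < j \<Longrightarrow> j \<le> m \<Longrightarrow> bimod j \<kappa>" "r < m"
  shows "bimod m (nc_sum A \<kappa> r)"
  using assms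
proof (induction r arbitrary: m)
  case 0
  then have "bimod m \<kappa>" by simp
  then show ?case by (rule bimod_cong) simp
next
  case (Suc r)
  have i: "bimod m (\<lambda>L. nc_sum A \<kappa> r (contract A \<kappa> r i L))" if i: "i \<in> {..<m - Suc r}" for i
  proof (rule bimod_contract)
    show "r + i + 2 \<le> m" using i by auto
    show "bimod (m - i - 1) (nc_sum A \<kappa> r)" by (rule Suc.IH) (use Suc.prems i in auto)
    show "bimod (Suc i) \<kappa>" using Suc.prems i by auto
  qed
  have "bimod m (\<lambda>L. nc_sum A \<kappa> r L \<oplus>
    (if length L = m \<and> set L \<subseteq> carrier A then (\<Oplus>i\<in>{..<m - Suc r}. nc_sum A \<kappa> r (contract A \<kappa> r i L)) else \<zero>))"
  proof (rule bimod_add)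
    show "bimod m (nc_sum A \<kappa> r)" by (rule Suc.IH) (use Suc.prems in auto)
  qed (rule bimod_finsum, simp, rule i)
  then show ?case by (rule bimod_cong) simp
qed

lemma nc_sum_cong:
  assumes "\<And>M. M \<noteq> [] \<Longrightarrow> length M \<le> length L \<Longrightarrow> \<kappa> M = \<kappa>' M"
    and "\<And>j. 0 < j \<Longrightarrow> j \<le> length L \<Longrightarrow> bimod j \<kappa>'"
    and "r < length L" "set L \<subseteq> carrier A"
  shows "nc_sum A \<kappa> r L = nc_sum A \<kappa>' r L"
  using assms
proof (induction r arbitrary: L)
  case 0
  then show ?case by auto
next
  case (Suc r)
  have eq: "contract A \<kappa> r i L = contract A \<kappa>' r i L" if "i \<in> {..<length L - Suc r}" for i
    using that Suc.prems by (simp add: contract_def)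
  have c: "set (contract A \<kappa>' r i L) \<subseteq> carrier A" if i: "i \<in> {..<length L - Suc r}" for i
  proof -
    have "set (take (Suc i) (drop (Suc r) L)) \<subseteq> carrier A"
      using Suc.prems(4) by (meson order_trans set_drop_subset set_take_subset)
    then have "\<kappa>' (take (Suc i) (drop (Suc r) L)) \<in> carrier A"
      using i Suc.prems by (intro bimodD(2)[of "Suc i"]) auto
    moreover have "L ! r \<in> carrier A" using i Suc.prems nth_mem by fastforce
    ultimately show ?thesis using Suc.prems by (auto simp: contract_def dest: in_set_takeD in_set_dropD)
  qed
  have "(\<Oplus>i\<in>{..<length L - Suc r}. nc_sum A \<kappa> r (contract A \<kappa> r i L)) =
      (\<Oplus>i\<in>{..<length L - Suc r}. nc_sum A \<kappa>' r (contract A \<kappa>' r i L))"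
  proof (rule finsum_cong')
    show "(\<lambda>i. nc_sum A \<kappa>' r (contract A \<kappa>' r i L)) \<in> {..<length L - Suc r} \<rightarrow> carrier A"
    proof
      fix i assume i: "i \<in> {..<length L - Suc r}"
      show "nc_sum A \<kappa>' r (contract A \<kappa>' r i L) \<in> carrier A"
        by (rule bimodD(2)[OF bimod_nc_sum refl c[OF i]]) (use i Suc.prems in \<open>auto simp: contract_def\<close>)
    qed
    fix i assume i: "i \<in> {..<length L - Suc r}"
    show "nc_sum A \<kappa> r (contract A \<kappa> r i L) = nc_sum A \<kappa>' r (contract A \<kappa>' r i L)"
      unfolding eq[OF i] by (rule Suc.IH) (use Suc.prems i c[OF i] in \<open>auto simp: contract_def\<close>)
  qed auto
  moreover have "nc_sum A \<kappa> r L = nc_sum A \<kappa>' r L" by (rule Suc.IH) (use Suc.prems in auto)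
  ultimately show ?case by simp
qed

text \<open>Only the one-block partition evaluates \<kappa> on a list as long as \<open>L\<close>,
  since every contraction shortens the list. So the moment-cumulant formula is triangular and can be
  solved for the cumulant of highest arity.\<close>

lemma nc_sum_top:
  assumes "\<And>M. M \<noteq> [] \<Longrightarrow> length M < length L \<Longrightarrow> \<kappa>' M = \<kappa> M" "\<kappa>' L = \<zero>"
    and "\<And>j. 0 < j \<Longrightarrow> j \<le> length L \<Longrightarrow> bimod j \<kappa>" "\<And>j. 0 < j \<Longrightarrow> j \<le> length L \<Longrightarrow> bimod j \<kappa>'"
    and "r < length L" "set L \<subseteq> carrier A"
  shows "nc_sum A \<kappa> r L = \<kappa> L \<oplus> nc_sum A \<kappa>' r L"
  using assms(5)
proof (induction r)
  case 0
  then show ?case using assms bimodD(2)[of "length L" \<kappa> L] by simp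
next
  case (Suc r)
  have eq: "contract A \<kappa> r i L = contract A \<kappa>' r i L" if "i \<in> {..<length L - Suc r}" for i
    using that Suc.prems assms(1) by (simp add: contract_def)
  have c: "set (contract A \<kappa>' r i L) \<subseteq> carrier A" if i: "i \<in> {..<length L - Suc r}" for i
  proof -
    have "set (take (Suc i) (drop (Suc r) L)) \<subseteq> carrier A"
      using assms(6) by (meson order_trans set_drop_subset set_take_subset)
    then have "\<kappa>' (take (Suc i) (drop (Suc r) L)) \<in> carrier A"
      using i Suc.prems assms(4) by (intro bimodD(2)[of "Suc i"]) auto
    moreover have "L ! r \<in> carrier A" using i Suc.prems assms nth_mem by fastforce
    ultimately show ?thesis using assms by (auto simp: contract_def dest: in_set_takeD in_set_dropD)
  qed
  have cl: "nc_sum A \<kappa>' r (contract A \<kappa>' r i L) \<in> carrier A" if i: "i \<in> {..<length L - Suc r}" for i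
    by (rule bimodD(2)[OF bimod_nc_sum refl c[OF i]]) (use i Suc.prems assms in \<open>auto simp: contract_def\<close>)
  have "(\<Oplus>i\<in>{..<length L - Suc r}. nc_sum A \<kappa> r (contract A \<kappa> r i L)) =
      (\<Oplus>i\<in>{..<length L - Suc r}. nc_sum A \<kappa>' r (contract A \<kappa>' r i L))"
  proof (rule finsum_cong')
    show "(\<lambda>i. nc_sum A \<kappa>' r (contract A \<kappa>' r i L)) \<in> {..<length L - Suc r} \<rightarrow> carrier A"
      using cl by auto
    fix i assume i: "i \<in> {..<length L - Suc r}"
    show "nc_sum A \<kappa> r (contract A \<kappa> r i L) = nc_sum A \<kappa>' r (contract A \<kappa>' r i L)"
      unfolding eq[OF i] using i Suc.prems c[OF i]
      by (intro nc_sum_cong assms(1)[symmetric] assms(4)) (auto simp: contract_def)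
  qed auto
  moreover have "nc_sum A \<kappa> r L = \<kappa> L \<oplus> nc_sum A \<kappa>' r L" by (rule Suc.IH) (use Suc.prems in auto)
  moreover have "\<kappa> L \<in> carrier A" "nc_sum A \<kappa>' r L \<in> carrier A"
    using bimodD(2)[OF assms(3) refl assms(6)] bimodD(2)[OF bimod_nc_sum[OF assms(4)] refl assms(6)] Suc.prems
    by fastforce+
  moreover have "(\<Oplus>i\<in>{..<length L - Suc r}. nc_sum A \<kappa>' r (contract A \<kappa>' r i L)) \<in> carrier A"
    using cl by (intro finsum_closed) auto
  ultimately show ?case by (simp add: a_assoc)
qed

text \<open>\<open>Kc m\<close> is the cumulant family truncated to arities at most \<open>m\<close>
  and zero beyond. Its sum over a list of length \<open>m + 1\<close> therefore consists of the
  partitions with more than one block, and the next cumulant is the moment minus this sum.\<close>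

primrec Kc :: "nat \<Rightarrow> 'a list \<Rightarrow> 'a" where
  "Kc 0 = (\<lambda>_. \<zero>)"
| "Kc (Suc m) = (\<lambda>L. if length L = Suc m then E (list_mult A L) \<oplus> \<ominus> nc_sum A (Kc m) m L else Kc m L)"

definition cumulant :: "'a list \<Rightarrow> 'a" where "cumulant L = Kc (length L) L"

lemma Kc_eq: "Kc m L = (if length L \<le> m then cumulant L else \<zero>)"
proof (induction m)
  case 0
  then show ?case by (simp add: cumulant_def)
next
  case (Suc m)
  then show ?case by (auto simp: cumulant_def le_Suc_eq)
qed

lemma bimod_Kc: "bimod j (Kc m)"
proof (induction m arbitrary: j)
  case 0
  show ?case by (simp add: bimod_zero)
next
  case (Suc m)
  show ?case
  proof (cases "j = Suc m")
    case True
    have "bimod j (\<lambda>L. E (list_mult A L) \<oplus> \<ominus> nc_sum A (Kc m) m L)"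
      using Suc True by (intro bimod_add bimod_E bimod_uminus bimod_nc_sum) auto
    then show ?thesis by (rule bimod_cong) (simp add: True)
  next
    case False
    show ?thesis by (rule bimod_cong[OF Suc]) (simp add: False)
  qed
qed

lemma bimod_cumulant: "bimod j cumulant"
  by (rule bimod_cong[OF bimod_Kc[of j j]]) (simp add: Kc_eq)

lemma moment_cumulant:
  assumes "L \<noteq> []" "set L \<subseteq> carrier A"
  shows "E (list_mult A L) = nc_sum A cumulant (length L - 1) L"
proof -
  obtain m where m: "length L = Suc m" using assms by (cases L) auto
  have "nc_sum A cumulant m L = cumulant L \<oplus> nc_sum A (Kc m) m L"
    by (rule nc_sum_top) (use assms m in \<open>auto simp: Kc_eq bimod_cumulant bimod_Kc\<close>)
  moreover have "cumulant L = E (list_mult A L) \<oplus> \<ominus> nc_sum A (Kc m) m L"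
    by (simp add: cumulant_def m)
  moreover have "nc_sum A (Kc m) m L \<in> carrier A"
    using assms m by (intro bimodD(2)[OF bimod_nc_sum[OF bimod_Kc], of m "Suc m"]) auto
  ultimately show ?thesis by (simp add: m a_assoc l_neg)
qed

theorem D_cumulants_cumulant: "D_cumulants A d p cumulant"
  unfolding D_cumulants_def
proof (intro conjI ballI allI impI, goal_cases)
  case (1 as)
  then show ?case using bimodD(1)[OF bimod_cumulant refl] by blast
next
  case (2 as bs x y)
  have "(as @ [x] @ bs)[length as := z] = as @ [z] @ bs" for z by (simp add: list_update_append)
  moreover have "cumulant ((as @ [x] @ bs)[length as := x \<oplus> y]) =
      cumulant ((as @ [x] @ bs)[length as := x]) \<oplus> cumulant ((as @ [x] @ bs)[length as := y])"
    by (rule bimodD(3)[OF bimod_cumulant refl]) (use 2 in auto)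
  ultimately show ?case by simp
next
  case (3 as bs x y e)
  have "(as @ [x, y] @ bs)[length as := z, Suc (length as) := w] = as @ [z, w] @ bs" for z w
    by (simp add: list_update_append)
  moreover have "cumulant ((as @ [x, y] @ bs)[length as := x \<otimes> e, Suc (length as) := y]) =
      cumulant ((as @ [x, y] @ bs)[length as := x, Suc (length as) := e \<otimes> y])"
    by (rule bimodD(4)[OF bimod_cumulant refl]) (use 3 in auto)
  ultimately show ?case by simp
next
  case (4 as x e)
  have "cumulant (([x] @ as)[0 := e \<otimes> x]) = e \<otimes> cumulant (([x] @ as)[0 := x])"
    by (rule bimodD(5)[OF bimod_cumulant refl]) (use 4 in auto)
  then show ?case by simp
next
  case (5 as x e)
  have "cumulant ((as @ [x])[length (as @ [x]) - 1 := x \<otimes> e]) = cumulant ((as @ [x])[length (as @ [x]) - 1 := x]) \<otimes> e"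
    by (rule bimodD(6)[OF bimod_cumulant refl]) (use 5 in auto)
  then show ?case by simp
next
  case (6 as)
  have "(\<Oplus>\<sigma>\<in>noncrossing_partitions (length as). nested_cumulant A cumulant \<sigma> (\<lambda>i. as ! i)) = nc_sum A cumulant (length as - 1) as"
    by (rule sum_noncrossing_eq_nc_sum)
      (use 6 abelian_monoid_axioms bimodD(2)[OF bimod_cumulant refl] in auto)
  then show ?case using moment_cumulant[of as] 6 by simp
qed

section \<open>Circular elements\<close>

definition phiD :: "(nat \<Rightarrow> complex) \<Rightarrow> complex" where "phiD l = (\<Sum>k<d. l k * state A (p k))"

abbreviation ct where "ct \<equiv> circular_cumulant phiD"

context
  fixes c assumes c: "c \<in> carrier A"
begin

definition cw :: "bool \<times> (nat \<Rightarrow> complex) \<Rightarrow> 'a" where "cw x = eps A (fst x) c \<otimes> De (snd x)"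

lemma eps_closed: "eps A b c \<in> carrier A"
  using c by (simp add: eps_def adj_closed)

lemma nc_sum_coord_nc_sum:
  assumes "\<And>v. v \<noteq> [] \<Longrightarrow> length v \<le> length w \<Longrightarrow> \<kappa> (map cw v) = De (f v)" "r < length w"
  shows "nc_sum A \<kappa> r (map cw w) = De (coord_nc_sum f r w)"
  using assms
proof (induction r arbitrary: w)
  case 0
  then have "nc_sum A \<kappa> 0 (map cw w) = De (f w)" by auto
  then show ?case by (simp cong: De_cong)
next
  case (Suc q)
  have ce: "contract A \<kappa> q i (map cw w) = map cw (coord_contract f q i w)" if "i < length w - Suc q" for i
  proof -
    have "cw (w ! q) \<otimes> De m = cw (fst (w ! q), \<lambda>k. snd (w ! q) k * m k)" for m
      by (simp add: cw_def m_assoc eps_closed De_mult)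
    moreover have "\<kappa> (take (Suc i) (drop (Suc q) (map cw w))) = De (f (take (Suc i) (drop (Suc q) w)))"
      using Suc.prems(1)[of "take (Suc i) (drop (Suc q) w)"] that by (simp add: take_map drop_map)
    ultimately show ?thesis using that
      by (simp add: contract_def coord_contract_def take_map drop_map)
  qed
  have "(\<Oplus>i\<in>{..<length w - Suc q}. nc_sum A \<kappa> q (contract A \<kappa> q i (map cw w))) =
      (\<Oplus>i\<in>{..<length w - Suc q}. De (coord_nc_sum f q (coord_contract f q i w)))"
  proof (rule finsum_cong')
    fix i assume i: "i \<in> {..<length w - Suc q}"
    then have "nc_sum A \<kappa> q (map cw (coord_contract f q i w)) = De (coord_nc_sum f q (coord_contract f q i w))"
      by (intro Suc.IH) (use Suc.prems in \<open>auto simp: coord_contract_def\<close>)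
    then show "nc_sum A \<kappa> q (contract A \<kappa> q i (map cw w)) = De (coord_nc_sum f q (coord_contract f q i w))"
      using i ce by simp
  qed auto
  moreover have "nc_sum A \<kappa> q (map cw w) = De (coord_nc_sum f q w)"
    by (intro Suc.IH) (use Suc.prems in auto)
  ultimately show ?case
    using De_add[of "coord_nc_sum f q w" "\<lambda>k. \<Sum>i<length w - Suc q. coord_nc_sum f q (coord_contract f q i w) k"]
    by (simp add: De_sum)
qed

lemma coord_nc_sum_cong:
  assumes "\<And>v. v \<noteq> [] \<Longrightarrow> length v \<le> length w \<Longrightarrow> f v = f' v" "q < length w"
  shows "coord_nc_sum f q w = coord_nc_sum f' q w"
  using assms
proof (induction q arbitrary: w)
  case 0
  then show ?case by (auto simp: fun_eq_iff)
next
  case (Suc q)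
  have "coord_contract f q i w = coord_contract f' q i w" if "i < length w - Suc q" for i
    using that Suc.prems by (simp add: coord_contract_def)
  moreover have "coord_nc_sum f q (coord_contract f' q i w) = coord_nc_sum f' q (coord_contract f' q i w)" if "i < length w - Suc q" for i
    by (rule Suc.IH) (use that Suc.prems in \<open>auto simp: coord_contract_def\<close>)
  moreover have "coord_nc_sum f q w = coord_nc_sum f' q w" by (rule Suc.IH) (use Suc.prems in auto)
  ultimately show ?case by (simp add: fun_eq_iff)
qed

lemma coord_nc_sum_top:
  assumes "\<And>v. v \<noteq> [] \<Longrightarrow> length v < length w \<Longrightarrow> f' v = f v" "f' w = (\<lambda>_. 0)" "q < length w"
  shows "coord_nc_sum f q w k = f w k + coord_nc_sum f' q w k"
  using assms(3)
proof (induction q)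
  case 0
  then show ?case using assms(2) by simp
next
  case (Suc q)
  have "coord_contract f q i w = coord_contract f' q i w" if "i < length w - Suc q" for i
    using that Suc.prems assms(1) by (simp add: coord_contract_def)
  moreover have "coord_nc_sum f q (coord_contract f' q i w) = coord_nc_sum f' q (coord_contract f' q i w)" if "i < length w - Suc q" for i
    by (rule coord_nc_sum_cong) (use that Suc.prems assms(1) in \<open>auto simp: coord_contract_def\<close>)
  ultimately show ?case using Suc by simp
qed

text \<open>The prescribed values \<open>ct\<close> and the true cumulants solve the same triangular
  system, so agreement of the moments forces agreement of the cumulants, by induction on the
  arity.\<close>

lemma cumulant_circular:
  assumes mom: "\<And>w. w \<noteq> [] \<Longrightarrow> E (list_mult A (map cw w)) = De (coord_nc_sum ct (length w - 1) w)"
  shows "w \<noteq> [] \<Longrightarrow> cumulant (map cw w) = De (ct w)"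
proof (induction "length w" arbitrary: w rule: less_induct)
  case less
  then obtain m where m: "length w = Suc m" by (cases w) auto
  \<comment> \<open>The truncation of \<open>ct\<close> that corresponds to
    \<open>Kc m\<close>.\<close>
  define f where "f v = (if length v \<le> m then ct v else (\<lambda>_. 0))" for v
  have "nc_sum A (Kc m) m (map cw w) = De (coord_nc_sum f m w)"
    by (rule nc_sum_coord_nc_sum) (use less m in \<open>auto simp: Kc_eq f_def De_zero\<close>)
  moreover have "cumulant (map cw w) = E (list_mult A (map cw w)) \<oplus> \<ominus> nc_sum A (Kc m) m (map cw w)"
    by (simp add: cumulant_def m)
  moreover have "coord_nc_sum ct m w k = ct w k + coord_nc_sum f m w k" for k
    by (rule coord_nc_sum_top) (use m in \<open>auto simp: f_def\<close>)
  then have "De (coord_nc_sum ct m w) = De (ct w) \<oplus> De (coord_nc_sum f m w)"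
    using De_add[of "ct w" "coord_nc_sum f m w"] by (simp add: fun_eq_iff cong: De_cong)
  ultimately show ?case using mom[OF less.prems] by (simp add: m a_assoc r_neg)
qed

theorem D_circularI:
  assumes mom: "\<And>w. w \<noteq> [] \<Longrightarrow> E (list_mult A (map cw w)) = De (coord_nc_sum ct (length w - 1) w)"
  shows "D_circular A d p c"
  unfolding D_circular_def
proof (intro conjI exI[of _ cumulant] D_cumulants_cumulant ballI allI impI c)
  note kc = cumulant_circular[OF mom]
  \<comment> \<open>The covariance conditions have a bare element in the last place; the coordinates
    of the unit write it as a letter with coefficient.\<close>
  have cw1: "cw (b, \<lambda>_. 1) = eps A b c" for b by (simp add: cw_def De_one eps_closed)
  have e1: "eps A False c = c" "eps A True c = adj A c" by (auto simp: eps_def)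
  show "cumulant [c] = \<zero>" "cumulant [adj A c] = \<zero>"
    using kc[of "[(False, \<lambda>_. 1)]"] kc[of "[(True, \<lambda>_. 1)]"]
    by (simp_all add: cw1 e1 circular_cumulant_zero De_zero)
  have 2: "cumulant [eps A b c \<otimes> De l, eps A b' c] = De (ct [(b, l), (b', \<lambda>_. 1)])" for b b' l
    using kc[of "[(b, l), (b', \<lambda>_. 1)]"] by (simp add: cw1) (simp add: cw_def)
  fix e assume "e \<in> DD"
  then obtain l where l: "e = De l" by (auto simp: D_span_def)
  show "cumulant [c \<otimes> e, c] = \<zero>" "cumulant [adj A c \<otimes> e, adj A c] = \<zero>"
    "cumulant [c \<otimes> e, adj A c] = scal A (state A e) \<one>" "cumulant [adj A c \<otimes> e, c] = scal A (state A e) \<one>"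
    using 2[of False l False] 2[of True l True] 2[of False l True] 2[of True l False]
    by (simp_all add: e1 l circular_cumulant_pair De_zero De_const phiD_def state_De)
next
  fix w :: "(bool \<times> 'a) list"
  assume w: "3 \<le> length w \<and> (\<forall>(\<epsilon>, e)\<in>set w. e \<in> DD)"
  have "\<exists>v. map (\<lambda>(\<epsilon>, e). eps A \<epsilon> c \<otimes> e) w = map cw v \<and> length v = length w"
    using conjunct2[OF w]
  proof (induction w)
    case (Cons x w)
    then obtain v where v: "map (\<lambda>(\<epsilon>, e). eps A \<epsilon> c \<otimes> e) w = map cw v" "length v = length w" by auto
    obtain b l where "x = (b, De l)" using Cons.prems by (cases x) (auto simp: D_span_def)
    then show ?case using v by (intro exI[of _ "(b, l) # v"]) (simp add: cw_def)
  qed simp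
  then obtain v where v: "map (\<lambda>(\<epsilon>, e). eps A \<epsilon> c \<otimes> e) w = map cw v" "length v = length w" by auto
  then have "v \<noteq> []" "length v \<noteq> 2" using w by auto
  then have "cumulant (map cw v) = \<zero>"
    using cumulant_circular[OF mom] by (simp add: circular_cumulant_zero De_zero)
  then show "cumulant (map (\<lambda>(\<epsilon>, e). eps A \<epsilon> c \<otimes> e) w) = \<zero>" using v by simp
qed

end

end

section \<open>Moments of a single circular letter with coefficients in D\<close>

context free_circular_proj
begin

definition Dp :: "(nat \<Rightarrow> complex) \<Rightarrow> (('c + nat \<times> bool) list \<Rightarrow>\<^sub>0 complex)" where
  "Dp l = (\<Sum>k<d. const (l k) * pm k)"

definition xw :: "nat \<Rightarrow> bool \<times> (nat \<Rightarrow> complex) \<Rightarrow> (('c + nat \<times> bool) list \<Rightarrow>\<^sub>0 complex)" where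
  "xw s y = mon [Inr (s, fst y)] * Dp (snd y)"

definition phiF :: "(nat \<Rightarrow> complex) \<Rightarrow> complex" where
  "phiF l = (\<Sum>k<d. l k * \<tau> [P k])"

lemma om_pm [simp]: "om (pm k) = \<tau> [P k]"
  by (simp add: pm_def om0_def tau0_def mon_mult one_eq_mon)

lemma om_Dp: "om (Dp l) = phiF l"
  by (simp add: Dp_def phiF_def)

lemma om_pm_Dp: "k < d \<Longrightarrow> om (pm k * (Dp l * h)) = l k * om (pm k * h)"
  by (simp add: Dp_def sum_distrib_left sum_distrib_right mult.assoc om_pm_pm if_distrib[of "(*) _"] cong: if_cong)

lemma Dp_mult: "om (Dp l * (Dp m * h)) = om (Dp (\<lambda>k. l k * m k) * h)"
proof -
  have "om (Dp l * (Dp m * h)) = (\<Sum>k<d. l k * om (pm k * (Dp m * h)))"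
    by (simp add: Dp_def[of l] sum_distrib_right mult.assoc)
  also have "\<dots> = (\<Sum>k<d. l k * m k * om (pm k * h))"
    by (intro sum.cong) (auto simp: om_pm_Dp)
  finally show ?thesis by (simp add: Dp_def[of "\<lambda>k. l k * m k"] sum_distrib_right mult.assoc)
qed

lemma Dp_scale: "Dp (\<lambda>k. c * l k) = const c * Dp l"
  by (simp add: Dp_def sum_distrib_left const_mult mult.assoc)

lemma Dp_zero: "Dp (\<lambda>_. 0) = 0"
  by (simp add: Dp_def)

definition no_Inr where "no_Inr f \<longleftrightarrow> (\<forall>t F. dd (Inr t) F f = 0)"

lemma no_InrD: "no_Inr f \<Longrightarrow> dd (Inr t) F f = 0"
  unfolding no_Inr_def by blast

lemma no_Inr_pm: "no_Inr (pm k)"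
  by (simp add: no_Inr_def pm_def)

lemma dd_sum: "dd t F (\<Sum>i\<in>I. Z i) = (\<Sum>i\<in>I. dd t F (Z i))"
  by (induction I rule: infinite_finite_induct) auto

lemma no_Inr_Dp: "no_Inr (Dp l)"
  using no_Inr_pm by (auto simp: no_Inr_def Dp_def dd_sum)

text \<open>A prefix \<open>Z\<close> followed by letters which may only be paired to their left.\<close>

fun H :: "nat \<Rightarrow> (('c + nat \<times> bool) list \<Rightarrow>\<^sub>0 complex) \<Rightarrow> (bool \<times> (nat \<Rightarrow> complex)) list \<Rightarrow> complex" where
  "H s Z [] = om Z"
| "H s Z (y # ys) = dd (Inr (s, \<not> fst y)) (\<lambda>a b. H s (a * Dp (snd y)) ys * om b) Z"

lemma H_linear: "H s (Z + Z') ys = H s Z ys + H s Z' ys" "H s (const c * Z) ys = c * H s Z ys" "H s 0 ys = 0"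
  by (cases ys; simp)+

lemma bilinear_H: "bilinear_fa (\<lambda>a b. H s (a * h) ys * om (b * h'))" "bilinear_fa (\<lambda>a b. H s (a * h) ys * om b)"
  by (auto simp: bilinear_fa_def linear_fa_def algebra_simps H_linear)

text \<open>\<open>H\<close> differentiates its prefix, so changing the prefix by a null element is
  not harmless in general. A null element without Gaussian letters at the right end is never split
  and is carried into the enclosed part, where \<open>om\<close> annihilates it.\<close>

lemma H_null:
  assumes "no_Inr n" "\<And>h. om (n * h) = 0"
  shows "H s (Z * n) ys = 0"
proof (cases ys)
  case Nil
  then show ?thesis using assms(2)[of Z] by (simp add: om_comm[of Z])
next
  case (Cons y ys')
  have "om (b * n) = 0" for b using assms(2)[of b] by (simp add: om_comm[of b])
  then have "dd t (\<lambda>a b. H s (a * Dp (snd y)) ys' * om (b * n)) Z = 0" for t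
    by (intro dd_eq_0I) simp
  then show ?thesis using assms(1)
    by (simp add: Cons dd_mult[OF bilinear_H(2)] no_Inr_def)
qed

text \<open>The trace brings the last letter to the front, where the Schwinger-Dyson equation pairs
  it with a letter of the prefix.\<close>

lemma H_step_Nil: "H s (Z * xw s x) [] = H s Z [x]"
proof -
  have "H s (Z * xw s x) [] = om (mon [] * (mon [Inr (s, fst x)] * (Dp (snd x) * Z)))"
    by (simp add: xw_def one_eq_mon[symmetric] om_comm[of Z] mult.assoc)
  also have "\<dots> = dd (Inr (s, \<not> fst x)) (\<lambda>a b. om a * om (mon [] * b)) (Dp (snd x) * Z)"
    by (subst om_SD) (simp_all add: bar_def)
  also have "\<dots> = dd (Inr (s, \<not> fst x)) (\<lambda>a b. om (Dp (snd x) * a) * om (mon [] * b)) Z"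
    by (subst dd_mult[OF bilinear_om(2)]) (use no_Inr_Dp in \<open>simp add: no_Inr_def\<close>)
  also have "\<dots> = H s Z [x]"
    by (simp add: one_eq_mon[symmetric] om_comm[of "Dp (snd x)"])
  finally show ?thesis .
qed

text \<open>By the Leibniz rule \<open>y\<close> is paired either with \<open>x\<close>, the last
  letter of the prefix, which encloses just the coefficient of \<open>x\<close>, or with a letter of
  \<open>Z\<close>. In the latter case \<open>x\<close> is enclosed and has its partner in between,
  so that both letters are paired to their left in \<open>Z\<close>.\<close>

lemma H_step_Cons:
  "H s (Z * xw s x) (y # ys) = H s Z (x # y # ys) + (if fst x \<noteq> fst y then phiF (snd x) * H s (Z * Dp (snd y)) ys else 0)"
proof -
  let ?t = "Inr (s, \<not> fst y) :: 'c + nat \<times> bool" and ?t' = "Inr (s, \<not> fst x) :: 'c + nat \<times> bool"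
  let ?D = "Dp (snd x)" and ?D2 = "Dp (snd y)"
  have nI: "dd (Inr t) F ?D = 0" for t F by (rule no_InrD[OF no_Inr_Dp])
  have SD: "om (b * xw s x) = dd ?t' (\<lambda>a b. om (a * ?D) * om b) b" for b
    using H_step_Nil[of s b x] by simp
  have x1: "dd ?t F (xw s x) = (if fst x \<noteq> fst y then F 1 ?D else 0)" if "bilinear_fa F" for F
    unfolding xw_def by (subst dd_mult[OF that]) (auto simp: nI one_eq_mon[symmetric])
  have "H s (Z * xw s x) (y # ys) = dd ?t (\<lambda>a b. H s (a * ?D2) ys * om (b * xw s x)) Z +
      (if fst x \<noteq> fst y then phiF (snd x) * H s (Z * ?D2) ys else 0)"
    by (simp add: dd_mult[OF bilinear_H(2)] x1 bilinear_fa_shift(2)[OF bilinear_H(2)] om_Dp)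
  also have "dd ?t (\<lambda>a b. H s (a * ?D2) ys * om (b * xw s x)) Z = H s Z (x # y # ys)"
  proof (induction Z rule: FA_induct)
    case (mon w)
    have "dd ?t (\<lambda>a b. H s (a * ?D2) ys * om (b * xw s x)) (mon w) =
       ssum ?t (\<lambda>u v. ssum ?t' (\<lambda>u' v'. H s (mon u * ?D2) ys * om (mon u' * ?D) * om0 v') v) w"
      by (simp add: SD ssum_distrib_left[symmetric] mult.assoc)
    \<comment> \<open>The partner of \<open>y\<close> lies to the left of the partner of
      \<open>x\<close>; the two sums choose them in opposite order.\<close>
    also have "\<dots> = ssum ?t' (\<lambda>u v. ssum ?t (\<lambda>u' v'. H s (mon u' * ?D2) ys * om (mon v' * ?D) * om0 v) u) w"
      by (rule ssum_assoc[symmetric])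
    also have "\<dots> = H s (mon w) (x # y # ys)"
      by (simp add: ssum_distrib_right dd_mult[OF bilinear_H(2)] nI)
    finally show ?case .
  qed (simp_all add: algebra_simps)
  finally show ?thesis .
qed

lemma H_pm_Nil: "H s (pm k) (y # ys) = 0" "H s (pm k * Dp l) (y # ys) = 0"
  using no_Inr_pm[of k] no_Inr_Dp[of l]
  by (simp_all add: no_Inr_def dd_mult[OF bilinear_H(2)])

lemma no_Inr_Dp_Dp: "no_Inr (Dp l * Dp m)"
proof -
  have "dd (Inr t) F (pm j * pm k) = 0" for t F j k
    by (simp add: pm_def mon_mult)
  then show ?thesis
    by (simp add: no_Inr_def Dp_def sum_distrib_left sum_distrib_right dd_sum mult.assoc const_left_comm[of "pm _"])
qed

abbreviation PX where "PX s w \<equiv> prod_list (map (xw s) w)"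

text \<open>Both sides count noncrossing pairings in which only the positions up to \<open>q\<close>
  may open a pair: on the left because block minima are restricted and only pair cumulants are
  nonzero, on the right because \<open>H\<close> pairs all later letters to their left. Raising
  \<open>q\<close> by one is the recursion of \<open>H_step_Nil\<close> and
  \<open>H_step_Cons\<close>, and \<open>\<tau> [P k]\<close> converts a coordinate into a value of
  \<open>om\<close>.\<close>

lemma om_PX:
  assumes "k < d"
  shows "q < length w \<Longrightarrow> \<tau> [P k] * coord_nc_sum (circular_cumulant phiF) q w k = H s (pm k * PX s (take (Suc q) w)) (drop (Suc q) w)"
proof (induction q arbitrary: w)
  case 0
  then obtain x ys where w: "w = x # ys" by (cases w) auto
  show ?case
  proof (cases ys)
    case Nil
    then show ?thesis
      by (simp add: w circular_cumulant_zero H_step_Nil H_pm_Nil(1) del: H.simps)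
  next
    case (Cons y ys')
    have 1: "H s (pm k * PX s (take (Suc 0) w)) (drop (Suc 0) w) =
       (if fst x \<noteq> fst y then phiF (snd x) * H s (pm k * Dp (snd y)) ys' else 0)"
      by (simp add: w Cons H_step_Cons H_pm_Nil(1) del: H.simps)
    show ?thesis
    proof (cases ys')
      case Nil
      then show ?thesis unfolding 1 using om_pm_Dp[of k "snd y" 1] assms
        by (cases x; cases y) (simp add: w Cons circular_cumulant_pair)
    next
      case (Cons z zs)
      then show ?thesis unfolding 1
        by (simp add: w \<open>ys = y # ys'\<close> circular_cumulant_zero H_pm_Nil(2) del: H.simps)
    qed
  qed
next
  case (Suc q)
  let ?x = "w ! Suc q" and ?ys = "drop (Suc (Suc q)) w" and ?Z = "pm k * PX s (take (Suc q) w)"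
  let ?f = "circular_cumulant phiF"
  have tk: "take (Suc (Suc q)) w = take (Suc q) w @ [?x]" "drop (Suc q) w = ?x # ?ys"
    using Suc.prems by (simp_all add: take_Suc_conv_app_nth Cons_nth_drop_Suc)
  have tk': "take (Suc q) w = take q w @ [w ! q]"
    using Suc.prems by (simp add: take_Suc_conv_app_nth)
  have IH: "\<tau> [P k] * coord_nc_sum ?f q w k = H s ?Z (?x # ?ys)"
    using Suc.IH[of w] Suc.prems tk(2) by simp
  have tm: "\<tau> [P k] * coord_nc_sum ?f q (coord_contract ?f q i w) k =
     H s (pm k * PX s (take q w) * xw s (fst (w ! q), \<lambda>k. snd (w ! q) k * ?f (take (Suc i) (?x # ?ys)) k)) (drop (q + i + 2) w)"
    if i: "i < length w - Suc q" for i
    using Suc.IH[of "coord_contract ?f q i w"] i Suc.prems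
    by (simp add: coord_contract_def tk(2) mult.assoc)
  \<comment> \<open>The contracted block has \<open>i + 1\<close> entries, so \<open>i = 1\<close>
    is the case of a pair.\<close>
  have zero: "coord_nc_sum ?f q (coord_contract ?f q i w) k = 0" if i: "i < length w - Suc q" "i \<noteq> 1" for i
  proof -
    have "length (take (Suc i) (?x # ?ys)) \<noteq> 2" using i Suc.prems by auto
    then have "\<tau> [P k] * coord_nc_sum ?f q (coord_contract ?f q i w) k = 0"
      unfolding tm[OF i(1)] by (simp add: circular_cumulant_zero xw_def Dp_zero H_linear)
    then show ?thesis using P_nonzero[OF assms] by simp
  qed
  have split: "H s (pm k * PX s (take (Suc (Suc q)) w)) ?ys = H s (?Z * xw s ?x) ?ys"
    by (simp add: tk(1) mult.assoc)
  show ?case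
  proof (cases ?ys)
    case Nil
    then have "(\<Sum>i<length w - Suc q. coord_nc_sum ?f q (coord_contract ?f q i w) k) = 0"
      using Suc.prems by (intro sum.neutral) (auto intro!: zero)
    then show ?thesis using IH Nil unfolding split
      by (simp add: H_step_Nil del: H.simps)
  next
    case (Cons y cl)
    have len: "1 < length w - Suc q"
    proof -
      have "length ?ys > 0" using Cons by simp
      then show ?thesis by simp
    qed
    have cl: "drop (q + 1 + 2) w = cl"
    proof -
      have "drop (q + 1 + 2) w = drop 1 ?ys" by simp
      then show ?thesis using Cons by simp
    qed
    have sum_eq: "(\<Sum>i<length w - Suc q. coord_nc_sum ?f q (coord_contract ?f q i w) k) = coord_nc_sum ?f q (coord_contract ?f q 1 w) k"
      using len zero by (subst sum.mono_neutral_right[of _ "{1}"]) auto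
    have tm1: "\<tau> [P k] * coord_nc_sum ?f q (coord_contract ?f q 1 w) k =
       (if fst ?x \<noteq> fst y then phiF (snd ?x) * H s (?Z * Dp (snd y)) cl else 0)"
    proof (cases "fst ?x = fst y")
      case True
      then show ?thesis unfolding tm[OF len] Cons
        by (cases ?x; cases y) (simp add: circular_cumulant_pair xw_def Dp_zero H_linear)
    next
      case False
      let ?l = "snd (w ! q)" and ?m = "snd y"
      let ?W = "pm k * PX s (take q w) * mon [Inr (s, fst (w ! q))]"
      have "(\<lambda>k. ?l k * ?f (take (Suc 1) (?x # ?ys)) k) = (\<lambda>k. phiF (snd ?x) * (?l k * ?m k))"
        using False Cons by (cases ?x; cases y) (simp add: circular_cumulant_pair fun_eq_iff)
      then have "\<tau> [P k] * coord_nc_sum ?f q (coord_contract ?f q 1 w) k =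
          phiF (snd ?x) * H s (?W * Dp (\<lambda>k. ?l k * ?m k)) cl"
        unfolding tm[OF len] cl by (simp add: xw_def Dp_scale mult.assoc const_left_comm[of _ "phiF _"] H_linear)
      \<comment> \<open>Contraction yields one coefficient with coordinates
        \<open>?l k * ?m k\<close>, the prefix of \<open>H\<close> two successive ones. They agree
        only modulo the null ideal.\<close>
      also have "H s (?W * Dp (\<lambda>k. ?l k * ?m k)) cl = H s (?W * (Dp ?l * Dp ?m)) cl"
      proof -
        have "H s (?W * (Dp (\<lambda>k. ?l k * ?m k) + const (-1) * (Dp ?l * Dp ?m))) cl = 0"
        proof (rule H_null)
          show "om ((Dp (\<lambda>k. ?l k * ?m k) + const (-1) * (Dp ?l * Dp ?m)) * h) = 0" for h
            by (simp add: distrib_right mult.assoc Dp_mult)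
          show "no_Inr (Dp (\<lambda>k. ?l k * ?m k) + const (-1) * (Dp ?l * Dp ?m))"
            using no_Inr_Dp no_Inr_Dp_Dp by (simp add: no_Inr_def)
        qed
        then show ?thesis
          by (simp only: distrib_left const_left_comm[of ?W] H_linear) simp
      qed
      also have "?W * (Dp ?l * Dp ?m) = ?Z * Dp ?m"
        by (simp add: tk' xw_def mult.assoc)
      finally show ?thesis using False by simp
    qed
    show ?thesis
      by (simp only: Cons coord_nc_sum.simps sum_eq distrib_left tm1 IH[unfolded Cons] split[unfolded Cons] H_step_Cons)
  qed
qed

end

section \<open>Adjoining free circular elements to a tracial algebra\<close>

context projection_ncps
begin

lemma De_eq_zero_iff: "De l = \<zero> \<longleftrightarrow> (\<forall>k<d. l k = 0)"
proof
  assume "De l = \<zero>"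
  then have "De l = De (\<lambda>_. 0)" by (simp add: De_zero)
  then show "\<forall>k<d. l k = 0" using De_inj by blast
next
  assume "\<forall>k<d. l k = 0"
  then have "De l = De (\<lambda>_. 0)" by (intro De_cong) auto
  then show "De l = \<zero>" by (simp add: De_zero)
qed

text \<open>The alphabet is the whole type; letters outside the carrier are read as zero, so that
  the functional on words is total.\<close>

definition vlet :: "'a \<Rightarrow> 'a" where "vlet x = (if x \<in> carrier A then x else \<zero>)"
definition stA :: "'a \<Rightarrow> 'a" where "stA x = (if x \<in> carrier A then adj A x else x)"
definition tauA :: "'a list \<Rightarrow> complex" where "tauA w = state A (list_mult A (map vlet w))"

lemma vlet_closed [simp]: "vlet x \<in> carrier A" by (simp add: vlet_def)

lemma set_map_vlet [simp]: "vlet ` S \<subseteq> carrier A" by auto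

lemma adj_zero: "adj A \<zero> = \<zero>"
  using adj_add[of \<zero> \<zero>] adj_closed[of \<zero>] by (metis add.r_cancel_one' l_zero zero_closed)

lemma adj_one: "adj A \<one> = \<one>"
  using adj_mult[of "adj A \<one>" \<one>] adj_closed[of \<one>] adj_adj[of \<one>] by simp

lemma adj_list_mult: "set L \<subseteq> carrier A \<Longrightarrow> adj A (list_mult A L) = list_mult A (rev (map (adj A) L))"
proof (induction L)
  case (Cons x L)
  then have "set (rev (map (adj A) L)) \<subseteq> carrier A" by (auto simp: adj_closed)
  with Cons show ?case by (simp add: adj_mult list_mult_append adj_closed)
qed (simp add: adj_one)

text \<open>Positivity at \<open>\<one> \<oplus> scal A c x\<close> shows that
  \<open>c * state A x + cnj c * state A (adj A x)\<close> is real. The choices \<open>c = 1\<close>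
  and \<open>c = \<i>\<close> compare imaginary and real parts.\<close>

lemma state_adj: "x \<in> carrier A \<Longrightarrow> state A (adj A x) = cnj (state A x)"
proof -
  assume x: "x \<in> carrier A"
  have ex: "state A (adj A (\<one> \<oplus> scal A c x) \<otimes> (\<one> \<oplus> scal A c x)) =
      1 + c * state A x + cnj c * state A (adj A x) + c * cnj c * state A (adj A x \<otimes> x)" for c
    using x
    by (simp add: adj_add adj_one adj_scal scal_closed adj_closed l_distr r_distr scal_mult_left scal_mult_right
        state_add state_scal state_one scal_scal algebra_simps)
  have "Im (state A (adj A x \<otimes> x)) = 0" using state_pos[OF x] by simp
  moreover have "Im (1 + c * state A x + cnj c * state A (adj A x) + c * cnj c * state A (adj A x \<otimes> x)) = 0" for c
    using state_pos[of "\<one> \<oplus> scal A c x"] x ex[of c] by (simp add: scal_closed)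
  from this[of 1] this[of \<i>] show ?thesis
    using \<open>Im (state A (adj A x \<otimes> x)) = 0\<close> by (simp add: complex_eq_iff)
qed

lemma vlet_stA: "vlet (stA x) = adj A (vlet x)"
  by (auto simp: vlet_def stA_def adj_closed adj_zero)

lemma finsum_adj: "finite I \<Longrightarrow> (\<And>i. i \<in> I \<Longrightarrow> f i \<in> carrier A) \<Longrightarrow> adj A (\<Oplus>i\<in>I. f i) = (\<Oplus>i\<in>I. adj A (f i))"
  by (induction I rule: finite_induct) (auto simp: adj_zero adj_add adj_closed finsum_closed Pi_def)

lemma tauA_pos:
  assumes "finite S"
  shows "(\<Sum>u\<in>S. \<Sum>v\<in>S. cnj (c u) * c v * tauA (rev (map stA u) @ v)) \<in> \<real>\<^sub>\<ge>\<^sub>0"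
proof -
  let ?g = "\<lambda>u. list_mult A (map vlet u)"
  define X where "X = (\<Oplus>u\<in>S. scal A (c u) (?g u))"
  have g: "?g u \<in> carrier A" for u by simp
  have "adj A X = (\<Oplus>u\<in>S. scal A (cnj (c u)) (adj A (?g u)))"
    unfolding X_def using assms g
    by (subst finsum_adj) (auto simp: scal_closed adj_scal intro!: finsum_cong' adj_closed)
  then have "adj A X \<otimes> X = (\<Oplus>u\<in>S. scal A (cnj (c u)) (adj A (?g u)) \<otimes> X)"
    using assms g unfolding X_def by (simp add: finsum_ldistr scal_closed adj_closed finsum_closed Pi_def)
  also have "\<dots> = (\<Oplus>u\<in>S. \<Oplus>v\<in>S. scal A (cnj (c u)) (adj A (?g u)) \<otimes> scal A (c v) (?g v))"
    using assms g unfolding X_def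
    by (intro finsum_cong' refl finsum_rdistr) (auto intro!: finsum_closed simp: scal_closed adj_closed)
  finally have "state A (adj A X \<otimes> X) =
      (\<Sum>u\<in>S. \<Sum>v\<in>S. state A (scal A (cnj (c u)) (adj A (?g u)) \<otimes> scal A (c v) (?g v)))"
    using assms g by (simp add: state_finsum finsum_closed scal_closed adj_closed Pi_def)
  also have "\<dots> = (\<Sum>u\<in>S. \<Sum>v\<in>S. cnj (c u) * c v * tauA (rev (map stA u) @ v))"
  proof (intro sum.cong refl)
    fix u v
    have "adj A (?g u) = list_mult A (map vlet (rev (map stA u)))"
      by (subst adj_list_mult) (auto simp: rev_map vlet_stA o_def)
    then show "state A (scal A (cnj (c u)) (adj A (?g u)) \<otimes> scal A (c v) (?g v)) =
        cnj (c u) * c v * tauA (rev (map stA u) @ v)"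
      by (simp add: tauA_def scal_mult_left scal_mult_right scal_closed state_scal list_mult_append)
  qed
  finally have eq: "(\<Sum>u\<in>S. \<Sum>v\<in>S. cnj (c u) * c v * tauA (rev (map stA u) @ v)) = state A (adj A X \<otimes> X)"
    by simp
  have "X \<in> carrier A" unfolding X_def using g by (auto intro!: finsum_closed scal_closed)
  then show ?thesis unfolding eq nonneg_Reals_iff by (rule state_pos)
qed

sublocale FC: free_circular_proj tauA stA d p
proof unfold_locales
  show "tauA [] = 1" by (simp add: tauA_def state_one)
  show "tauA (u @ v) = tauA (v @ u)" for u v
    by (simp add: tauA_def list_mult_append state_trace)
  show "tauA (rev (map stA w)) = cnj (tauA w)" for w
    using state_adj[of "list_mult A (map vlet w)"] adj_list_mult[of "map vlet w"]
    by (simp add: tauA_def rev_map[symmetric] o_def vlet_stA)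
  show "stA (stA a) = a" for a by (auto simp: stA_def adj_closed adj_adj)
  show "finite S \<Longrightarrow> (\<Sum>u\<in>S. \<Sum>v\<in>S. cnj (c u) * c v * tauA (rev (map stA u) @ v)) \<in> \<real>\<^sub>\<ge>\<^sub>0" for S c
    by (rule tauA_pos)
  have vp: "k < d \<Longrightarrow> vlet (p k) = p k" for k by (simp add: vlet_def proj_closed)
  show "tauA (p k # p l # v) = (if k = l then tauA (p k # v) else 0)" if "k < d" "l < d" for k l v
    using that by (simp add: tauA_def vp m_assoc[symmetric] proj_closed proj_idem proj_orth state_zero)
  show "(\<Sum>k<d. tauA (p k # v)) = tauA v" for v
  proof -
    have "tauA v = state A ((\<Oplus>k\<in>{..<d}. p k) \<otimes> list_mult A (map vlet v))"
      by (simp add: tauA_def proj_sum)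
    also have "\<dots> = state A (\<Oplus>k\<in>{..<d}. p k \<otimes> list_mult A (map vlet v))"
      by (subst finsum_ldistr) (auto simp: proj_closed)
    also have "\<dots> = (\<Sum>k<d. tauA (p k # v))"
      by (subst state_finsum) (auto simp: proj_closed tauA_def vp)
    finally show ?thesis by simp
  qed
  show "k < d \<Longrightarrow> stA (p k) = p k" for k by (simp add: stA_def proj_closed proj_adj)
  show "k < d \<Longrightarrow> tauA [p k] \<noteq> 0" for k by (simp add: tauA_def vp proj_closed proj_state)
qed

section \<open>The quotient by the null ideal and the enlarged algebra\<close>

definition eqv :: "(('a + nat \<times> bool) list \<Rightarrow>\<^sub>0 complex) \<Rightarrow> (('a + nat \<times> bool) list \<Rightarrow>\<^sub>0 complex) \<Rightarrow> bool" where
  "eqv f g \<longleftrightarrow> (\<forall>h. FC.om (f * h) = FC.om (g * h))"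

lemma eqv_refl [simp]: "eqv f f" by (simp add: eqv_def)
lemma eqv_sym: "eqv f g \<Longrightarrow> eqv g f" by (simp add: eqv_def)
lemma eqv_trans: "eqv f g \<Longrightarrow> eqv g h \<Longrightarrow> eqv f h" by (simp add: eqv_def)

lemma eqv_add: "eqv f f' \<Longrightarrow> eqv g g' \<Longrightarrow> eqv (f + g) (f' + g')"
  by (simp add: eqv_def distrib_right)

lemma eqv_scal: "eqv f f' \<Longrightarrow> eqv (const c * f) (const c * f')"
  by (simp add: eqv_def mult.assoc)

text \<open>The relation tests by multiplication from the right only; the trace rotates a left
  factor to the right, which makes the null ideal two-sided.\<close>

lemma eqv_mult: "eqv f f' \<Longrightarrow> eqv g g' \<Longrightarrow> eqv (f * g) (f' * g')"
  unfolding eqv_def mult.assoc by (simp add: FC.om_rotate[of f'])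

lemma eqv_star: "eqv f f' \<Longrightarrow> eqv (FC.star f) (FC.star f')"
  unfolding eqv_def
proof
  fix h assume *: "\<forall>h. FC.om (f * h) = FC.om (f' * h)"
  have "FC.om (FC.star g * h) = cnj (FC.om (g * FC.star h))" for g
    using FC.om_star[of "FC.star h * g"] by (simp add: FC.om_comm[of g])
  then show "FC.om (FC.star f * h) = FC.om (FC.star f' * h)" using * by simp
qed

lemma eqv_om: "eqv f g \<Longrightarrow> FC.om f = FC.om g"
  unfolding eqv_def by (metis mult_1_right)

definition mark :: "'a \<Rightarrow> (('a + nat \<times> bool) list \<Rightarrow> complex)" where
  "mark x = (\<lambda>w. if w = [Inl x] then 0 else 1)"

text \<open>The element \<open>(x, f)\<close> of the product of \<open>A\<close> and the free algebra modulo its null ideal.  The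
  first factor only serves to make the embedding of \<open>A\<close> injective; the state ignores it.  The function
  \<open>mark x\<close> is not finitely supported, so it can be told apart from the members of the class of \<open>f\<close>.\<close>

definition pi2 :: "'a \<Rightarrow> (('a + nat \<times> bool) list \<Rightarrow>\<^sub>0 complex) \<Rightarrow> 'a adjoined" where
  "pi2 x f = insert (mark x) (Poly_Mapping.lookup ` {g. eqv f g})"

lemma mark_neq_lookup: "mark x \<noteq> Poly_Mapping.lookup f"
proof
  assume *: "mark x = Poly_Mapping.lookup f"
  have "infinite (UNIV - {[Inl x]} :: ('a + nat \<times> bool) list set)"
    by (simp add: infinite_UNIV_listI)
  moreover have "UNIV - {[Inl x]} \<subseteq> {w. Poly_Mapping.lookup f w \<noteq> 0}"
    unfolding *[symmetric] mark_def by auto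
  ultimately show False using finite_lookup[of f] finite_subset by blast
qed

lemma mark_inj: "mark x = mark y \<Longrightarrow> x = y"
  unfolding mark_def by (metis list.inject sum.inject(1) zero_neq_one)

lemma pi2_eq_iff: "pi2 x f = pi2 y g \<longleftrightarrow> x = y \<and> eqv f g"
proof
  assume eq: "pi2 x f = pi2 y g"
  have "mark x \<in> pi2 y g" unfolding eq[symmetric] by (simp add: pi2_def)
  then have xy: "x = y" using mark_neq_lookup[of x] mark_inj by (auto simp: pi2_def)
  have "Poly_Mapping.lookup f \<in> pi2 y g" unfolding eq[symmetric] by (auto simp: pi2_def)
  then obtain g' where "Poly_Mapping.lookup f = Poly_Mapping.lookup g'" "eqv g g'"
    using mark_neq_lookup by (auto simp: pi2_def) (metis mark_neq_lookup)
  then show "x = y \<and> eqv f g" using xy eqv_sym by (metis poly_mapping_eq_iff)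
next
  assume "x = y \<and> eqv f g"
  then have "{h. eqv f h} = {h. eqv g h}" using eqv_trans eqv_sym by blast
  with \<open>x = y \<and> eqv f g\<close> show "pi2 x f = pi2 y g" by (simp add: pi2_def)
qed

definition rp :: "'a adjoined \<Rightarrow> 'a \<times> (('a + nat \<times> bool) list \<Rightarrow>\<^sub>0 complex)" where
  "rp X = (SOME (x, f). pi2 x f = X)"

lemma rp_pi2: "fst (rp (pi2 x f)) = x" "eqv (snd (rp (pi2 x f))) f"
proof -
  have "(\<lambda>(y, g). pi2 y g = pi2 x f) (rp (pi2 x f))"
    unfolding rp_def by (rule someI[of _ "(x, f)"]) simp
  then have "pi2 (fst (rp (pi2 x f))) (snd (rp (pi2 x f))) = pi2 x f"
    by (simp add: case_prod_unfold)
  then show "fst (rp (pi2 x f)) = x" "eqv (snd (rp (pi2 x f))) f" by (simp_all add: pi2_eq_iff)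
qed

text \<open>The operations act on chosen representatives. Since \<open>eqv\<close> is a congruence
  the choice does not matter, and \<open>A2_simps\<close> eliminates \<open>rp\<close>.\<close>

definition A2 :: "'a adjoined ncps" where
  "A2 = \<lparr>carrier = {pi2 x f | x f. x \<in> carrier A},
    mult = (\<lambda>X Y. pi2 (fst (rp X) \<otimes> fst (rp Y)) (snd (rp X) * snd (rp Y))),
    one = pi2 \<one> 1, zero = pi2 \<zero> 0,
    add = (\<lambda>X Y. pi2 (fst (rp X) \<oplus> fst (rp Y)) (snd (rp X) + snd (rp Y))),
    scal = (\<lambda>c X. pi2 (scal A c (fst (rp X))) (const c * snd (rp X))),
    adj = (\<lambda>X. pi2 (adj A (fst (rp X))) (FC.star (snd (rp X)))),
    state = (\<lambda>X. FC.om (snd (rp X)))\<rparr>"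

lemma A2_simps:
  "pi2 x f \<otimes>\<^bsub>A2\<^esub> pi2 y g = pi2 (x \<otimes> y) (f * g)"
  "pi2 x f \<oplus>\<^bsub>A2\<^esub> pi2 y g = pi2 (x \<oplus> y) (f + g)"
  "scal A2 c (pi2 x f) = pi2 (scal A c x) (const c * f)"
  "adj A2 (pi2 x f) = pi2 (adj A x) (FC.star f)"
  "state A2 (pi2 x f) = FC.om f"
  "\<one>\<^bsub>A2\<^esub> = pi2 \<one> 1" "\<zero>\<^bsub>A2\<^esub> = pi2 \<zero> 0"
  "pi2 x f \<in> carrier A2 \<longleftrightarrow> x \<in> carrier A"
  by (auto simp: A2_def pi2_eq_iff rp_pi2 eqv_om
      intro!: eqv_mult eqv_add eqv_scal eqv_star exI[of _ f])

lemma A2_cases: "X \<in> carrier A2 \<Longrightarrow> (\<And>x f. X = pi2 x f \<Longrightarrow> x \<in> carrier A \<Longrightarrow> Q) \<Longrightarrow> Q"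
  by (auto simp: A2_def)

lemma ring_A2: "ring A2"
proof (rule ringI)
  show "abelian_group A2"
  proof (rule abelian_groupI)
    fix X assume "X \<in> carrier A2"
    then show "\<exists>Y\<in>carrier A2. Y \<oplus>\<^bsub>A2\<^esub> X = \<zero>\<^bsub>A2\<^esub>"
    proof (rule A2_cases)
      fix x f assume "X = pi2 x f" "x \<in> carrier A"
      then show ?thesis
        by (intro bexI[of _ "pi2 (\<ominus> x) (- f)"]) (auto simp: A2_simps l_neg)
    qed
  qed (auto elim!: A2_cases simp: A2_simps a_ac algebra_simps)
  show "Group.monoid A2"
    by (rule Group.monoidI) (auto elim!: A2_cases simp: A2_simps m_assoc mult.assoc)
qed (auto elim!: A2_cases simp: A2_simps l_distr r_distr algebra_simps)

lemma tracial_A2: "tracial_ncps A2"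
proof -
  have "star_algebra A2"
    by (intro star_algebra.intro ring_A2 star_algebra_axioms.intro)
      (auto elim!: A2_cases simp: A2_simps scal_closed scal_add_left scal_add_right scal_scal scal_one
        scal_mult_left scal_mult_right adj_closed adj_adj adj_add adj_scal adj_mult
        const_add const_one distrib_left distrib_right const_mult mult.assoc simp del: FC.star_mult
        intro!: arg_cong2[where f = pi2, OF refl const_left_comm] arg_cong2[where f = pi2, OF refl FC.star_mult]
        del: equalityI)
  then show ?thesis
    by (intro tracial_ncps.intro tracial_ncps_axioms.intro)
      (auto elim!: A2_cases simp: A2_simps FC.om_pos[unfolded nonneg_Reals_iff] intro: FC.om_comm)
qed

definition iota :: "'a \<Rightarrow> 'a adjoined" where "iota x = pi2 x (mon [Inl x])"

lemma null2:
  assumes "finite I" "\<And>v. (\<Sum>i\<in>I. c i * tauA (\<alpha> i @ v)) = 0"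
  shows "eqv (\<Sum>i\<in>I. const (c i) * mon (map Inl (\<alpha> i))) 0"
  using FC.null_letters[OF assms(2)] by (simp add: eqv_def)

lemma eqv_diff: "eqv (f + const (-1) * g) 0 \<Longrightarrow> eqv f g"
  by (simp add: eqv_def distrib_right mult.assoc)

lemma tauA_Cons: "x \<in> carrier A \<Longrightarrow> tauA (x # v) = state A (x \<otimes> list_mult A (map vlet v))"
  by (simp add: tauA_def vlet_def)

text \<open>As letters of the free algebra, elements of \<open>A\<close> satisfy no relations. Each
  of the first four claims is a combination of two or three words that \<open>tauA\<close>
  annihilates against every continuation, hence a null element.\<close>

lemma iota_eqv:
  assumes "x \<in> carrier A" "y \<in> carrier A"
  shows "eqv (mon [Inl (x \<otimes> y)]) (mon [Inl x] * mon [Inl y])"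
    and "eqv (mon [Inl (x \<oplus> y)]) (mon [Inl x] + mon [Inl y])"
    and "eqv (mon [Inl \<one>]) 1"
    and "eqv (mon [Inl (scal A c x)]) (const c * mon [Inl x])"
    and "FC.star (mon [Inl x]) = mon [Inl (adj A x)]"
proof -
  have 1: "tauA (x # y # v) = tauA ((x \<otimes> y) # v)" for v
  proof -
    have "vlet y = y" using assms by (simp add: vlet_def)
    then show ?thesis using assms by (simp add: tauA_Cons m_assoc)
  qed
  show "eqv (mon [Inl (x \<otimes> y)]) (mon [Inl x] * mon [Inl y])"
    by (rule eqv_diff)
      (use null2[of "{0::nat, 1}" "\<lambda>i. if i = 0 then 1 else -1" "\<lambda>i. if i = 0 then [x \<otimes> y] else [x, y]"] 1
       in \<open>simp add: const_one mon_mult\<close>)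
  have 2: "tauA ((x \<oplus> y) # v) = tauA (x # v) + tauA (y # v)" for v
    using assms by (simp add: tauA_Cons l_distr state_add)
  show "eqv (mon [Inl (x \<oplus> y)]) (mon [Inl x] + mon [Inl y])"
    by (rule eqv_diff)
      (use null2[of "{0::nat, 1, 2}" "\<lambda>i. if i = 0 then 1 else -1" "\<lambda>i. if i = 0 then [x \<oplus> y] else if i = 1 then [x] else [y]"] 2
       in \<open>simp add: const_one distrib_left add.assoc\<close>)
  have 3: "tauA (\<one> # v) = tauA v" for v
    using tauA_Cons[of \<one> v] by (simp add: tauA_def)
  show "eqv (mon [Inl \<one>]) 1"
    by (rule eqv_diff)
      (use null2[of "{0::nat, 1}" "\<lambda>i. if i = 0 then 1 else -1" "\<lambda>i. if i = 0 then [\<one>] else []"] 3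
       in \<open>simp add: const_one one_eq_mon[symmetric]\<close>)
  have 4: "tauA (scal A c x # v) = c * tauA (x # v)" for v
    using assms by (simp add: tauA_Cons scal_closed scal_mult_left state_scal)
  show "eqv (mon [Inl (scal A c x)]) (const c * mon [Inl x])"
    by (rule eqv_diff)
      (use null2[of "{0::nat, 1}" "\<lambda>i. if i = 0 then 1 else - c" "\<lambda>i. if i = 0 then [scal A c x] else [x]"] 4
       in \<open>simp add: const_one mult.assoc[symmetric] const_mult[symmetric]\<close>)
  show "FC.star (mon [Inl x]) = mon [Inl (adj A x)]"
    using assms by (simp add: stA_def)
qed

lemma om0_letter: "x \<in> carrier A \<Longrightarrow> FC.om0 [Inl x] = state A x"
  by (simp add: FC.om0_def FC.tau0_def mon_mult tauA_def vlet_def)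

lemma enlargement_iota: "enlargement A A2 iota"
  unfolding enlargement_def
proof (intro conjI ballI allI)
  show "tracial_ncps A2" by (rule tracial_A2)
  show "iota \<in> Ring.ring_hom A A2"
    by (rule ring_hom_memI) (auto simp: iota_def A2_simps pi2_eq_iff iota_eqv iota_eqv(3)[OF one_closed one_closed])
  show "inj_on iota (carrier A)"
    by (auto simp: inj_on_def iota_def pi2_eq_iff)
  fix x assume x: "x \<in> carrier A"
  show "iota (scal A c x) = scal A2 c (iota x)" for c
    using x by (auto simp: iota_def A2_simps pi2_eq_iff iota_eqv)
  show "iota (adj A x) = adj A2 (iota x)" "state A2 (iota x) = state A x"
    using x iota_eqv(5)[OF x x] by (auto simp: iota_def A2_simps om0_letter simp del: FC.star_single)
qed

end

section \<open>Transport of the projections along enlargements\<close>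

lemma enlargement_D_elem:
  assumes "projection_ncps A d p" "enlargement A B \<iota>"
  shows "\<iota> (D_elem A d p l) = D_elem B d (\<iota> \<circ> p) l"
proof -
  interpret A: projection_ncps A d p by fact
  interpret B: tracial_ncps B using assms(2) by (simp add: enlargement_def)
  have hom: "\<iota> \<in> Ring.ring_hom A B"
    and sc: "\<And>x c. x \<in> carrier A \<Longrightarrow> \<iota> (scal A c x) = scal B c (\<iota> x)"
    using assms(2) by (auto simp: enlargement_def)
  have c: "x \<in> carrier A \<Longrightarrow> \<iota> x \<in> carrier B" for x using ring_hom_closed[OF hom] .
  have zero: "\<iota> \<zero>\<^bsub>A\<^esub> = \<zero>\<^bsub>B\<^esub>"
    using ring_hom_add[OF hom A.zero_closed A.zero_closed] c[OF A.zero_closed]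
    by (metis A.l_zero A.zero_closed B.add.r_cancel_one' B.l_zero B.zero_closed)
  have "\<iota> (\<Oplus>\<^bsub>A\<^esub>i\<in>I. scal A (l i) (p i)) = (\<Oplus>\<^bsub>B\<^esub>i\<in>I. scal B (l i) (\<iota> (p i)))"
    if "finite I" "I \<subseteq> {..<d}" for I
    using that
  proof (induction I rule: finite_induct)
    case (insert i I)
    then have "p i \<in> carrier A" "(\<lambda>i. scal A (l i) (p i)) \<in> I \<rightarrow> carrier A"
      "(\<lambda>i. scal B (l i) (\<iota> (p i))) \<in> I \<rightarrow> carrier B"
      using A.proj_closed c A.scal_closed B.scal_closed by (auto intro!: A.scal_closed B.scal_closed)
    with insert show ?case
      by (simp add: A.finsum_insert B.finsum_insert c ring_hom_add[OF hom] A.finsum_closed A.scal_closed B.scal_closed sc)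
  qed (simp add: zero)
  then show ?thesis by (simp add: D_elem_def)
qed

lemma enlargement_projection:
  assumes "projection_ncps A d p" "enlargement A B \<iota>"
  shows "projection_ncps B d (\<iota> \<circ> p)"
proof -
  interpret A: projection_ncps A d p by fact
  interpret B: tracial_ncps B using assms(2) by (simp add: enlargement_def)
  have hom: "\<iota> \<in> Ring.ring_hom A B" and inj: "inj_on \<iota> (carrier A)"
    and st: "\<And>x. x \<in> carrier A \<Longrightarrow> \<iota> (adj A x) = adj B (\<iota> x)" "\<And>x. x \<in> carrier A \<Longrightarrow> state B (\<iota> x) = state A x"
    using assms(2) by (auto simp: enlargement_def)
  have c: "x \<in> carrier A \<Longrightarrow> \<iota> x \<in> carrier B" for x using ring_hom_closed[OF hom] .
  have zero: "\<iota> \<zero>\<^bsub>A\<^esub> = \<zero>\<^bsub>B\<^esub>"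
    using ring_hom_add[OF hom A.zero_closed A.zero_closed] c[OF A.zero_closed]
    by (metis A.l_zero A.zero_closed B.add.r_cancel_one' B.l_zero B.zero_closed)
  show ?thesis
  proof (intro projection_ncps.intro projection_ncps_axioms.intro)
    show "tracial_ncps B" by (rule B.tracial_ncps_axioms)
    show "(\<Oplus>\<^bsub>B\<^esub>i\<in>{..<d}. (\<iota> \<circ> p) i) = \<one>\<^bsub>B\<^esub>"
    proof -
      have "(\<Oplus>\<^bsub>B\<^esub>i\<in>{..<d}. (\<iota> \<circ> p) i) = D_elem B d (\<iota> \<circ> p) (\<lambda>_. 1)"
        unfolding D_elem_def
        by (rule B.finsum_cong') (auto simp: B.scal_one A.proj_closed c intro!: B.scal_closed)
      then show ?thesis
        using enlargement_D_elem[OF assms, of "\<lambda>_. 1"] ring_hom_one[OF hom] by (simp add: A.De_one)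
    qed
    show "i < d \<Longrightarrow> (\<iota> \<circ> p) i \<noteq> \<zero>\<^bsub>B\<^esub>" for i
      using inj A.proj_nonzero[of i] A.proj_closed[of i] zero A.zero_closed
      unfolding o_def inj_on_def by metis
    show "i < d \<Longrightarrow> j < d \<Longrightarrow> i \<noteq> j \<Longrightarrow> (\<iota> \<circ> p) i \<otimes>\<^bsub>B\<^esub> (\<iota> \<circ> p) j = \<zero>\<^bsub>B\<^esub>" for i j
      by (simp add: ring_hom_mult[OF hom, symmetric] A.proj_closed A.proj_orth zero)
  qed (auto simp: A.proj_closed st(1)[symmetric] st(2) A.proj_adj A.proj_state c
      ring_hom_mult[OF hom, symmetric] A.proj_idem)
qed

lemma enlargement_trans:
  assumes "enlargement A B \<iota>" "enlargement B C \<kappa>"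
  shows "enlargement A C (\<kappa> \<circ> \<iota>)"
proof -
  have hom: "\<iota> \<in> Ring.ring_hom A B" "\<kappa> \<in> Ring.ring_hom B C"
    using assms by (auto simp: enlargement_def)
  have c: "x \<in> carrier A \<Longrightarrow> \<iota> x \<in> carrier B" for x
    using ring_hom_closed[OF hom(1)] by auto
  have "inj_on (\<kappa> \<circ> \<iota>) (carrier A)"
    using assms c by (intro comp_inj_on) (auto simp: enlargement_def intro: inj_on_subset)
  then show ?thesis
    using assms ring_hom_trans[OF hom] c by (auto simp: enlargement_def)
qed

section \<open>Freeness and circularity in the enlarged algebra\<close>

context projection_ncps
begin

abbreviation p2 where "p2 \<equiv> iota \<circ> p"

lemma projection_A2: "projection_ncps A2 d p2"
  by (rule enlargement_projection[OF projection_ncps_axioms enlargement_iota])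

interpretation T: projection_ncps A2 d p2
  by (rule projection_A2)

lemma p2_eq: "p2 k = pi2 (p k) (FC.pm k)"
  by (simp add: iota_def FC.pm_def)

lemma A2_finsum:
  "finite I \<Longrightarrow> (\<And>i. i \<in> I \<Longrightarrow> x i \<in> carrier A) \<Longrightarrow>
    (\<Oplus>\<^bsub>A2\<^esub>i\<in>I. pi2 (x i) (f i)) = pi2 (\<Oplus>i\<in>I. x i) (\<Sum>i\<in>I. f i)"
  by (induction I rule: finite_induct) (auto simp: A2_simps finsum_closed Pi_def T.finsum_insert)

lemma De2: "D_elem A2 d p2 l = pi2 (De l) (FC.Dp l)"
  unfolding D_elem_def p2_eq A2_simps FC.Dp_def
  by (rule A2_finsum) (auto intro: scal_closed proj_closed)

lemma list_mult_A2:
  "(\<And>x f. (x, f) \<in> set L \<Longrightarrow> x \<in> carrier A) \<Longrightarrow>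
    list_mult A2 (map (\<lambda>(x, f). pi2 x f) L) = pi2 (list_mult A (map fst L)) (prod_list (map snd L))"
proof (induction L)
  case (Cons y L)
  then have "list_mult A2 (map (\<lambda>(x, f). pi2 x f) L) = pi2 (list_mult A (map fst L)) (prod_list (map snd L))"
    by auto
  then show ?case by (cases y) (simp add: list_mult_def A2_simps(1))
qed (simp add: list_mult_def A2_simps)

lemma om_pm2: "k < d \<Longrightarrow> FC.om (FC.pm k) = state A (p k)"
  unfolding FC.om_pm by (simp add: tauA_def vlet_def proj_closed)

lemma state_iota: "x \<in> carrier A \<Longrightarrow> state A2 (iota x) = state A x"
  using enlargement_iota by (simp add: enlargement_def)

lemma cond_coord_A2:
  assumes "k < d" "x \<in> carrier A"
  shows "cond_coord A2 p2 (pi2 x f) k = inverse (state A (p k)) * FC.om (FC.pm k * f)"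
proof -
  have "cond_coord A2 p2 (pi2 x f) k = inverse (state A2 (p2 k)) * state A2 (p2 k \<otimes>\<^bsub>A2\<^esub> pi2 x f)"
    using assms by (intro T.cond_coord_eq) (auto simp: A2_simps)
  then show ?thesis using assms by (simp only: p2_eq A2_simps om_pm2)
qed

lemma centered_A2:
  assumes "x \<in> carrier A"
  shows "cond_exp A2 d p2 (pi2 x f) = \<zero>\<^bsub>A2\<^esub> \<longleftrightarrow> FC.centered f"
proof -
  have "cond_exp A2 d p2 (pi2 x f) = \<zero>\<^bsub>A2\<^esub> \<longleftrightarrow> (\<forall>k<d. cond_coord A2 p2 (pi2 x f) k = 0)"
    unfolding cond_exp_def by (rule T.De_eq_zero_iff)
  then show ?thesis
    using assms by (simp add: cond_coord_A2 FC.centered_def proj_state)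
qed

text \<open>The first component ranges over all of \<open>A\<close>, since the conditional
  expectation depends on the second one only; in particular the elements of D, whose components are
  \<open>De l\<close> and \<open>FC.Dp l\<close>, are included.\<close>

definition Sg :: "nat option \<Rightarrow> 'a adjoined set" where
  "Sg g = {pi2 x f | x f. x \<in> carrier A \<and> FC.over g f}"

definition ygen :: "nat \<Rightarrow> 'a adjoined" where "ygen s = pi2 \<zero> (mon [Inr (s, False)])"

lemma adj_ygen: "adj A2 (ygen s) = pi2 \<zero> (mon [Inr (s, True)])"
  by (simp add: ygen_def A2_simps adj_zero FC.bar_def)

lemma over_add: "FC.over g f \<Longrightarrow> FC.over g h \<Longrightarrow> FC.over g (f + h)"
  using keys_add[of f h] by (auto simp: FC.over_def)

lemma over_mult: "FC.over g f \<Longrightarrow> FC.over g h \<Longrightarrow> FC.over g (f * h)"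
  unfolding FC.over_def by (rule FC.keys_mult_subset)

lemma over_const: "FC.over g f \<Longrightarrow> FC.over g (const c * f)"
  unfolding FC.over_def using FC.keys_const_mult by blast

lemma over_mon: "set w \<subseteq> FC.letters g \<Longrightarrow> FC.over g (mon w)"
  by (simp add: FC.over_def)

lemma over_one: "FC.over g 1"
  by (simp add: one_eq_mon over_mon)

lemma la_letters: "x \<in> FC.letters g \<Longrightarrow> FC.la x \<in> FC.letters g"
  by (auto simp: FC.letters_def FC.P_star FC.bar_def split: option.splits)

lemma over_star: "FC.over g f \<Longrightarrow> FC.over g (FC.star f)"
proof -
  assume o: "FC.over g f"
  show ?thesis unfolding FC.over_def
  proof
    fix w assume "w \<in> Poly_Mapping.keys (FC.star f)"
    then have "FC.wadj w \<in> Poly_Mapping.keys f" by (simp add: in_keys_iff FC.lookup_star)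
    then have "set (FC.wadj w) \<subseteq> FC.letters g" using o by (auto simp: FC.over_def)
    then have "set (FC.wadj (FC.wadj w)) \<subseteq> FC.letters g"
      unfolding FC.wadj_def[of "FC.wadj w"] using la_letters by auto
    then show "w \<in> {w. set w \<subseteq> FC.letters g}" by simp
  qed
qed

lemma over_Dp: "FC.over g (FC.Dp l)"
proof -
  have "FC.over g (\<Sum>k\<in>I. const (l k) * FC.pm k)" if "finite I" "I \<subseteq> {..<d}" for I
    using that
  proof (induction I rule: finite_induct)
    case empty
    show ?case by (simp add: FC.over_def)
  next
    case (insert k I)
    have "FC.over g (FC.pm k)" unfolding FC.pm_def
      by (rule over_mon) (use insert in \<open>auto simp: FC.letters_def split: option.splits\<close>)
    then show ?case using insert by (auto intro!: over_add over_const)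
  qed
  then show ?thesis by (simp add: FC.Dp_def)
qed

lemma Sg_I: "x \<in> carrier A \<Longrightarrow> FC.over g f \<Longrightarrow> pi2 x f \<in> Sg g"
  by (auto simp: Sg_def)

lemma Sg_subalgebra: "star_subalgebra A2 (Sg g)"
proof -
  have S: "Sg g \<subseteq> carrier A2" by (auto simp: Sg_def A2_simps)
  have I: "x \<in> carrier A \<Longrightarrow> FC.over g f \<Longrightarrow> pi2 x f \<in> Sg g" for x f by (auto simp: Sg_def)
  show ?thesis unfolding star_subalgebra_def
  proof (intro conjI S ballI allI)
    show "\<one>\<^bsub>A2\<^esub> \<in> Sg g" by (simp add: A2_simps I over_one)
    fix X assume "X \<in> Sg g"
    then obtain x f where X: "X = pi2 x f" "x \<in> carrier A" "FC.over g f" by (auto simp: Sg_def)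
    show "adj A2 X \<in> Sg g" "scal A2 c X \<in> Sg g" for c
      using X by (auto simp: A2_simps intro!: I adj_closed scal_closed over_star over_const)
    fix Y assume "Y \<in> Sg g"
    then obtain y h where Y: "Y = pi2 y h" "y \<in> carrier A" "FC.over g h" by (auto simp: Sg_def)
    show "X \<oplus>\<^bsub>A2\<^esub> Y \<in> Sg g" "X \<otimes>\<^bsub>A2\<^esub> Y \<in> Sg g"
      using X Y by (auto simp: A2_simps intro!: I over_add over_mult)
  qed
qed

lemma D_free_Sg: "D_free_algebras A2 d p2 Sg"
  unfolding D_free_algebras_def
proof (intro conjI allI impI Sg_subalgebra)
  show "D_span A2 d p2 \<subseteq> Sg g" for g
    by (auto simp: D_span_def De2 intro!: Sg_I over_Dp)
next
  fix gs :: "nat option list" and xs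
  assume "gs \<noteq> [] \<and> length xs = length gs \<and> (\<forall>j. Suc j < length gs \<longrightarrow> gs ! j \<noteq> gs ! Suc j) \<and>
    (\<forall>j<length gs. xs ! j \<in> Sg (gs ! j) \<and> cond_exp A2 d p2 (xs ! j) = \<zero>\<^bsub>A2\<^esub>)"
  then have gs: "gs \<noteq> []" "length xs = length gs" "\<forall>j. Suc j < length gs \<longrightarrow> gs ! j \<noteq> gs ! Suc j"
    "\<forall>j<length gs. xs ! j \<in> Sg (gs ! j) \<and> cond_exp A2 d p2 (xs ! j) = \<zero>\<^bsub>A2\<^esub>"
    by blast+
  have "\<forall>j<length gs. \<exists>y. xs ! j = pi2 (fst y) (snd y) \<and> fst y \<in> carrier A \<and> FC.over (gs ! j) (snd y)"
    using gs(4) by (force simp: Sg_def)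
  then obtain y where y: "\<And>j. j < length gs \<Longrightarrow> xs ! j = pi2 (fst (y j)) (snd (y j)) \<and> fst (y j) \<in> carrier A \<and> FC.over (gs ! j) (snd (y j))"
    by metis
  define L where "L = map y [0..<length gs]"
  have Lc: "x \<in> carrier A" if "(x, f) \<in> set L" for x f
  proof -
    from that obtain j where "j < length gs" "(x, f) = y j" by (auto simp: L_def)
    then show ?thesis using y[of j] by (metis fst_conv)
  qed
  have xs: "xs = map (\<lambda>(x, f). pi2 x f) L"
    using y gs(2) by (intro nth_equalityI) (auto simp: L_def case_prod_unfold)
  have cen: "FC.centered (snd (y j))" if "j < length gs" for j
    using gs(4) y[OF that] that centered_A2 by metis
  define X where "X = zip gs (map snd L)"
  have X: "FC.calt X" "X \<noteq> []" "map snd X = map snd L"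
  proof -
    have "distinct_adj gs" using gs(3) by (auto simp: distinct_adj_conv_nth)
    then show "FC.calt X"
      using y cen by (auto simp: FC.calt_def X_def L_def set_zip)
  qed (use gs in \<open>auto simp: X_def L_def\<close>)
  have "FC.centered (prod_list (map snd L))"
    unfolding FC.centered_def
  proof (intro allI impI)
    fix k assume k: "k < d"
    obtain g f X' where X': "X = (g, f) # X'" using X(2) by (cases X) auto
    \<comment> \<open>Centering of the product has to be tested against each projection. The
      projection is absorbed into the first factor, which stays centered and in its algebra.\<close>
    have "FC.over g (FC.pm k * f)"
      using X(1) X' k by (intro over_mult) (auto simp: FC.calt_def FC.pm_def FC.letters_def intro!: over_mon split: option.splits)
    moreover have "FC.centered (FC.pm k * f)"
      by (rule FC.centered_Dpoly_mult) (use X(1) X' k in \<open>auto simp: FC.calt_def FC.pm_def\<close>)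
    ultimately have "FC.calt ((g, FC.pm k * f) # X')"
      using X(1) X' by (auto simp: FC.calt_def)
    from FC.om_alternating[OF this] show "FC.om (FC.pm k * prod_list (map snd L)) = 0"
      unfolding X(3)[symmetric] X' by (simp add: mult.assoc)
  qed
  moreover have "set (map fst L) \<subseteq> carrier A" using Lc by auto
  ultimately show "cond_exp A2 d p2 (list_mult A2 xs) = \<zero>\<^bsub>A2\<^esub>"
    unfolding xs using Lc by (simp add: list_mult_A2 centered_A2 del: set_map)
qed

theorem D_free_A2:
  assumes "\<And>j. x (Inl j) \<in> iota ` carrier A" "\<And>s. x (Inr s) = ygen s"
  shows "D_free A2 d p2 (\<lambda>g. x ` (case g of None \<Rightarrow> range Inl | Some s \<Rightarrow> {Inr s}))"
  unfolding D_free_def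
proof (intro exI[of _ Sg] conjI D_free_Sg allI)
  fix g
  show "x ` (case g of None \<Rightarrow> range Inl | Some s \<Rightarrow> {Inr s}) \<subseteq> Sg g"
  proof (cases g)
    case None
    have iS: "iota a \<in> Sg None" if "a \<in> carrier A" for a
      unfolding iota_def using that by (intro Sg_I over_mon) (auto simp: FC.letters_def)
    show ?thesis
    proof
      fix X assume "X \<in> x ` (case g of None \<Rightarrow> range Inl | Some s \<Rightarrow> {Inr s})"
      then obtain j where "X = x (Inl j)" using None by auto
      then obtain a where "X = iota a" "a \<in> carrier A" using assms(1)[of j] by auto
      then show "X \<in> Sg g" using iS None by simp
    qed
  next
    case (Some s)
    have "ygen s \<in> Sg (Some s)"
      unfolding ygen_def by (intro Sg_I over_mon) (auto simp: FC.letters_def)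
    then show ?thesis using assms(2) Some by auto
  qed
qed

theorem D_circular_A2: "D_circular A2 d p2 (ygen s)"
proof (rule T.D_circularI)
  show c: "ygen s \<in> carrier A2" by (simp add: ygen_def A2_simps)
  have phi: "T.phiD = FC.phiF"
    by (auto simp: fun_eq_iff T.phiD_def FC.phiF_def state_iota tauA_def vlet_def proj_closed)
  fix w :: "(bool \<times> (nat \<Rightarrow> complex)) list" assume w: "w \<noteq> []"
  have cw: "T.cw (ygen s) y = pi2 \<zero> (FC.xw s y)" for y
    by (cases "fst y") (simp_all add: T.cw_def[OF c] eps_def adj_ygen De2 A2_simps FC.xw_def, simp add: ygen_def A2_simps)
  have lm: "list_mult A2 (map (T.cw (ygen s)) w) =
      pi2 (list_mult A (map (\<lambda>_. \<zero>) w)) (prod_list (map (FC.xw s) w))"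
  proof -
    have "map (T.cw (ygen s)) w = map (\<lambda>(x, f). pi2 x f) (map (\<lambda>y. (\<zero>, FC.xw s y)) w)"
      by (simp add: cw)
    then show ?thesis by (simp only:, subst list_mult_A2) (auto simp: comp_def)
  qed
  have "cond_coord A2 p2 (list_mult A2 (map (T.cw (ygen s)) w)) k = coord_nc_sum (circular_cumulant T.phiD) (length w - 1) w k"
    if k: "k < d" for k
  proof -
    have "tauA [p k] * coord_nc_sum (circular_cumulant FC.phiF) (length w - 1) w k = FC.om (FC.pm k * prod_list (map (FC.xw s) w))"
      using FC.om_PX[OF k, of "length w - 1" w s] w by simp
    moreover have "tauA [p k] = state A (p k)" using k by (simp add: tauA_def vlet_def proj_closed)
    moreover have "set (map (\<lambda>_. \<zero>) w) \<subseteq> carrier A" by auto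
    ultimately show ?thesis
      unfolding lm phi using k by (subst cond_coord_A2) (auto simp: proj_state field_simps)
  qed
  then show "cond_exp A2 d p2 (list_mult A2 (map (T.cw (ygen s)) w)) =
      D_elem A2 d p2 (coord_nc_sum (circular_cumulant T.phiD) (length w - 1) w)"
    unfolding cond_exp_def by (rule T.De_cong)
qed

end

section \<open>Gaussian integration by parts\<close>

definition gmom :: "real \<Rightarrow> nat \<Rightarrow> real" where
  "gmom \<sigma> j = (\<integral>x. normal_density 0 \<sigma> x * x ^ j \<partial>lborel)"

lemma gmom_even: "\<sigma> > 0 \<Longrightarrow> gmom \<sigma> (2 * k) = fact (2 * k) / ((2 / \<sigma>\<^sup>2)^k * fact k)"
  using has_bochner_integral_integral_eq[OF normal_moment_even[of \<sigma> 0 k]] by (simp add: gmom_def)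

lemma gmom_odd: "\<sigma> > 0 \<Longrightarrow> gmom \<sigma> (2 * k + 1) = 0"
  using has_bochner_integral_integral_eq[OF normal_moment_odd[of \<sigma> 0 k]] by (simp add: gmom_def)

text \<open>Integration by parts for powers of one variable, read off from the closed form of the
  even moments. For \<open>j = 0\<close> the truncated \<open>j - 1\<close> is made harmless by the
  factor \<open>j\<close>.\<close>

lemma gmom_Suc: "\<sigma> > 0 \<Longrightarrow> gmom \<sigma> (Suc j) = \<sigma>\<^sup>2 * real j * gmom \<sigma> (j - 1)"
proof -
  assume \<sigma>: "\<sigma> > 0"
  show ?thesis
  proof (cases "even j")
    case True
    then obtain k where k: "j = 2 * k" by blast
    show ?thesis
    proof (cases k)
      case (Suc i)
      then have "j - 1 = 2 * i + 1" using k by simp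
      then show ?thesis using gmom_odd[OF \<sigma>, of k] gmom_odd[OF \<sigma>, of i] k by simp
    qed (use k gmom_odd[OF \<sigma>, of k] in simp)
  next
    case False
    then obtain k where k: "j = 2 * k + 1" by (metis oddE)
    have "gmom \<sigma> (Suc j) = gmom \<sigma> (2 * (k + 1))" by (simp add: k)
    also have "\<dots> = fact (2 * (k + 1)) / ((2 / \<sigma>\<^sup>2)^(k + 1) * fact (k + 1))" by (rule gmom_even[OF \<sigma>])
    also have "\<dots> = (2 * real (k + 1) * real j * fact (2 * k)) / ((2 / \<sigma>\<^sup>2 * (2 / \<sigma>\<^sup>2)^k) * (real (k + 1) * fact k))"
      by (simp add: k algebra_simps)
    also have "\<dots> = \<sigma>\<^sup>2 * real j * (fact (2 * k) / ((2 / \<sigma>\<^sup>2)^k * fact k))"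
    proof -
      have aux: "(2 * c * r * F) / ((2 / s * A) * (c * f)) = s * r * (F / (A * f))"
        if "c \<noteq> 0" "s \<noteq> 0" for c r F s A f :: real
        using that by (simp add: field_simps)
      show ?thesis by (rule aux) (use \<sigma> in auto)
    qed
    also have "fact (2 * k) / ((2 / \<sigma>\<^sup>2)^k * fact k) = gmom \<sigma> (j - 1)"
      using gmom_even[OF \<sigma>, of k] by (simp add: k)
    finally show ?thesis .
  qed
qed

locale gaussian_family = prob_space M for M :: "'w measure" +
  fixes X :: "'v \<Rightarrow> 'w \<Rightarrow> real" and V :: "'v set" and \<sigma> :: real
  assumes sigma: "\<sigma> > 0"
    and indep: "indep_vars (\<lambda>_. borel) X V"
    and normal: "v \<in> V \<Longrightarrow> distributed M lborel (X v) (normal_density 0 \<sigma>)"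
begin

abbreviation pl :: "'v list \<Rightarrow> 'w \<Rightarrow> real" where "pl L \<omega> \<equiv> prod_list (map (\<lambda>v. X v \<omega>) L)"

lemma moment: "v \<in> V \<Longrightarrow> integrable M (\<lambda>\<omega>. X v \<omega> ^ j)" "v \<in> V \<Longrightarrow> (\<integral>\<omega>. X v \<omega> ^ j \<partial>M) = gmom \<sigma> j"
proof -
  assume v: "v \<in> V"
  have "integrable lborel (\<lambda>x. normal_density 0 \<sigma> x * x ^ j)"
    using integrable_normal_moment[OF sigma, of 0 j] by simp
  then show "integrable M (\<lambda>\<omega>. X v \<omega> ^ j)"
    using distributed_integrable[OF normal[OF v], of "\<lambda>x. x ^ j"] by simp
  show "(\<integral>\<omega>. X v \<omega> ^ j \<partial>M) = gmom \<sigma> j"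
    using distributed_integral[OF normal[OF v], of "\<lambda>x. x ^ j"] by (simp add: gmom_def)
qed

lemma pl_eq_prod:
  assumes "finite F" "set L \<subseteq> F"
  shows "pl L \<omega> = (\<Prod>v\<in>F. X v \<omega> ^ count_list L v)"
  using assms(2)
proof (induction L)
  case (Cons u L)
  have "(\<Prod>v\<in>F. X v \<omega> ^ count_list (u # L) v) =
      (\<Prod>v\<in>F. (if v = u then X v \<omega> else 1) * X v \<omega> ^ count_list L v)"
    by (intro prod.cong) auto
  also have "\<dots> = X u \<omega> * (\<Prod>v\<in>F. X v \<omega> ^ count_list L v)"
    using assms(1) Cons.prems by (simp add: prod.distrib)
  finally show ?case using Cons by simp
qed simp

lemma pl_integral:
  assumes "finite F" "F \<subseteq> V" "set L \<subseteq> F"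
  shows "integrable M (pl L)" "(\<integral>\<omega>. pl L \<omega> \<partial>M) = (\<Prod>v\<in>F. gmom \<sigma> (count_list L v))"
proof -
  have "indep_vars (\<lambda>_. borel) (\<lambda>v \<omega>. X v \<omega> ^ count_list L v) F"
    by (rule indep_vars_compose2[where M' = "\<lambda>_. borel" and Y = "\<lambda>v x. x ^ count_list L v"])
      (use indep_vars_subset[OF indep assms(2)] in auto)
  note ind = this
  have m: "integrable M (\<lambda>\<omega>. X v \<omega> ^ count_list L v)" "(\<integral>\<omega>. X v \<omega> ^ count_list L v \<partial>M) = gmom \<sigma> (count_list L v)"
    if "v \<in> F" for v
    using moment[of v] assms(2) that by auto
  show "integrable M (pl L)"
    unfolding pl_eq_prod[OF assms(1,3)] by (rule indep_vars_integrable[OF assms(1) ind m(1)])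
  show "(\<integral>\<omega>. pl L \<omega> \<partial>M) = (\<Prod>v\<in>F. gmom \<sigma> (count_list L v))"
  proof -
    have "(\<integral>\<omega>. (\<Prod>v\<in>F. X v \<omega> ^ count_list L v) \<partial>M) = (\<Prod>v\<in>F. \<integral>\<omega>. X v \<omega> ^ count_list L v \<partial>M)"
      by (rule indep_vars_lebesgue_integral[OF assms(1) ind m(1)])
    then show ?thesis unfolding pl_eq_prod[OF assms(1,3)] by (simp add: m(2))
  qed
qed

lemma pl_integrable: "set L \<subseteq> V \<Longrightarrow> integrable M (pl L)"
  by (rule pl_integral[of "set L"]) auto

text \<open>The partial derivative of a monomial in product-rule form, which is convenient for
  products of monomials; \<open>dm_eq\<close> gives the form with multiplicity that matches the
  moments.\<close>

primrec dm :: "'v \<Rightarrow> 'v list \<Rightarrow> 'w \<Rightarrow> real" where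
  "dm v [] \<omega> = 0"
| "dm v (u # L) \<omega> = (if u = v then pl L \<omega> else 0) + X u \<omega> * dm v L \<omega>"

lemma dm_append: "dm v (L @ L') \<omega> = dm v L \<omega> * pl L' \<omega> + pl L \<omega> * dm v L' \<omega>"
  by (induction L) (auto simp: algebra_simps)

lemma dm_eq: "dm v L \<omega> = real (count_list L v) * pl (remove1 v L) \<omega>"
proof (induction L)
  case (Cons u L)
  show ?case
  proof (cases "u = v")
    case True
    have "X v \<omega> * (real (count_list L v) * pl (remove1 v L) \<omega>) = real (count_list L v) * pl L \<omega>"
    proof (cases "v \<in> set L")
      case True
      then have "pl L \<omega> = X v \<omega> * pl (remove1 v L) \<omega>"
        by (induction L) auto
      then show ?thesis by simp
    qed (simp add: count_notin)
    then show ?thesis using Cons True by (simp add: algebra_simps)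
  next
    case False
    then show ?thesis using Cons by simp
  qed
qed simp

lemma dm_integrable: "set L \<subseteq> V \<Longrightarrow> integrable M (dm v L)"
proof -
  assume "set L \<subseteq> V"
  then have "integrable M (pl (remove1 v L))"
    using set_remove1_subset[of v L] by (intro pl_integrable) auto
  moreover have "dm v L = (\<lambda>\<omega>. real (count_list L v) * pl (remove1 v L) \<omega>)"
    by (rule ext) (rule dm_eq)
  ultimately show ?thesis by simp
qed

text \<open>By independence the expectation of a monomial is a product of moments of single
  variables. The factor \<open>X v\<close> raises one exponent only, so \<open>gmom_Suc\<close>
  suffices.\<close>

lemma gauss_parts_pl:
  assumes "v \<in> V" "set L \<subseteq> V"
  shows "(\<integral>\<omega>. X v \<omega> * pl L \<omega> \<partial>M) = (\<integral>\<omega>. \<sigma>\<^sup>2 * dm v L \<omega> \<partial>M)"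
proof -
  let ?F = "insert v (set L)"
  have F: "finite ?F" "?F \<subseteq> V" using assms by auto
  have rest: "(\<Prod>u\<in>?F - {v}. gmom \<sigma> (count_list L' u)) = (\<Prod>u\<in>?F - {v}. gmom \<sigma> (count_list L u))"
    if "L' = v # L \<or> L' = remove1 v L" for L'
  proof (intro prod.cong refl arg_cong[where f = "gmom \<sigma>"])
    fix u assume "u \<in> ?F - {v}"
    then have "u \<noteq> v" by auto
    moreover have "u \<noteq> v \<Longrightarrow> count_list (remove1 v L) u = count_list L u" by (induction L) auto
    ultimately show "count_list L' u = count_list L u" using that by auto
  qed
  have "(\<integral>\<omega>. X v \<omega> * pl L \<omega> \<partial>M) = (\<integral>\<omega>. pl (v # L) \<omega> \<partial>M)" by simp
  also have "\<dots> = (\<Prod>u\<in>?F. gmom \<sigma> (count_list (v # L) u))"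
    by (rule pl_integral(2)[OF F]) auto
  also have "\<dots> = gmom \<sigma> (Suc (count_list L v)) * (\<Prod>u\<in>?F - {v}. gmom \<sigma> (count_list L u))"
    using rest[of "v # L"] prod.remove[OF F(1), of v "\<lambda>u. gmom \<sigma> (count_list (v # L) u)"] by simp
  also have "\<dots> = \<sigma>\<^sup>2 * real (count_list L v) * (gmom \<sigma> (count_list L v - 1) * (\<Prod>u\<in>?F - {v}. gmom \<sigma> (count_list L u)))"
    using sigma by (simp add: gmom_Suc)
  also have "gmom \<sigma> (count_list L v - 1) * (\<Prod>u\<in>?F - {v}. gmom \<sigma> (count_list L u)) =
      (\<Prod>u\<in>?F. gmom \<sigma> (count_list (remove1 v L) u))"
  proof -
    have "count_list (remove1 v L) v = count_list L v - 1" by (induction L) auto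
    then show ?thesis
      using rest[of "remove1 v L"] prod.remove[OF F(1), of v "\<lambda>u. gmom \<sigma> (count_list (remove1 v L) u)"] by simp
  qed
  also have "\<dots> = (\<integral>\<omega>. pl (remove1 v L) \<omega> \<partial>M)"
    by (rule pl_integral(2)[OF F, symmetric]) (use set_remove1_subset[of v L] in auto)
  finally show ?thesis by (simp add: dm_eq)
qed

text \<open>Polynomials in the Gaussian variables together with \<open>\<sigma>\<^sup>2\<close> times their partial derivatives.\<close>

inductive gpoly :: "('w \<Rightarrow> complex) \<Rightarrow> ('v \<Rightarrow> 'w \<Rightarrow> complex) \<Rightarrow> bool" where
  mono: "set L \<subseteq> V \<Longrightarrow> gpoly (\<lambda>\<omega>. of_real (pl L \<omega>)) (\<lambda>v \<omega>. of_real (\<sigma>\<^sup>2 * dm v L \<omega>))"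
| add: "gpoly F D \<Longrightarrow> gpoly G D' \<Longrightarrow> gpoly (\<lambda>\<omega>. F \<omega> + G \<omega>) (\<lambda>v \<omega>. D v \<omega> + D' v \<omega>)"
| scale: "gpoly F D \<Longrightarrow> gpoly (\<lambda>\<omega>. c * F \<omega>) (\<lambda>v \<omega>. c * D v \<omega>)"

lemma gpoly_const: "gpoly (\<lambda>\<omega>. c) (\<lambda>v \<omega>. 0)"
  using scale[OF mono[of "[]"], of c] by simp

lemma gpoly_var: "u \<in> V \<Longrightarrow> gpoly (\<lambda>\<omega>. of_real (X u \<omega>)) (\<lambda>v \<omega>. if u = v then of_real (\<sigma>\<^sup>2) else 0)"
proof -
  assume u: "u \<in> V"
  have "(\<lambda>v \<omega>. complex_of_real (\<sigma>\<^sup>2 * dm v [u] \<omega>)) = (\<lambda>v \<omega>. if u = v then of_real (\<sigma>\<^sup>2) else 0)"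
    by (auto simp: fun_eq_iff)
  then show ?thesis using mono[of "[u]"] u by simp
qed

lemma gpoly_mult:
  assumes "gpoly F D" "gpoly G D'"
  shows "gpoly (\<lambda>\<omega>. F \<omega> * G \<omega>) (\<lambda>v \<omega>. D v \<omega> * G \<omega> + F \<omega> * D' v \<omega>)"
  using assms(1)
proof induction
  case (mono L)
  note L = this
  show ?case using assms(2)
  proof induction
    case (mono L')
    then show ?case using gpoly.mono[of "L @ L'"] L by (simp add: dm_append algebra_simps)
  next
    case (add F D G D')
    then show ?case using gpoly.add[OF add.IH] by (simp add: algebra_simps)
  next
    case (scale F D c)
    then show ?case using gpoly.scale[OF scale.IH, of c] by (simp add: algebra_simps)
  qed
next
  case (add F1 D1 F2 D2)
  then show ?case using gpoly.add[OF add.IH] by (simp add: algebra_simps)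
next
  case (scale F D c)
  then show ?case using gpoly.scale[OF scale.IH, of c] by (simp add: algebra_simps)
qed

lemma gpoly_integral:
  assumes "gpoly F D"
  shows "integrable M F \<and> (\<forall>v\<in>V. integrable M (D v) \<and> integrable M (\<lambda>\<omega>. of_real (X v \<omega>) * F \<omega>) \<and>
    (\<integral>\<omega>. of_real (X v \<omega>) * F \<omega> \<partial>M) = (\<integral>\<omega>. D v \<omega> \<partial>M))"
  using assms
proof induction
  case (mono L)
  have "integrable M (\<lambda>\<omega>. complex_of_real (X v \<omega>) * of_real (pl L \<omega>))"
    "(\<integral>\<omega>. complex_of_real (X v \<omega>) * of_real (pl L \<omega>) \<partial>M) = (\<integral>\<omega>. of_real (\<sigma>\<^sup>2 * dm v L \<omega>) \<partial>M)"
    if v: "v \<in> V" for v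
  proof -
    have "integrable M (\<lambda>\<omega>. complex_of_real (X v \<omega> * pl L \<omega>))"
      using pl_integrable[of "v # L"] v mono by (intro integrable_of_real) simp
    then show "integrable M (\<lambda>\<omega>. complex_of_real (X v \<omega>) * of_real (pl L \<omega>))" by simp
    show "(\<integral>\<omega>. complex_of_real (X v \<omega>) * of_real (pl L \<omega>) \<partial>M) = (\<integral>\<omega>. of_real (\<sigma>\<^sup>2 * dm v L \<omega>) \<partial>M)"
      unfolding of_real_mult[symmetric] integral_complex_of_real gauss_parts_pl[OF v mono] ..
  qed
  moreover have "integrable M (\<lambda>\<omega>. complex_of_real (\<sigma>\<^sup>2 * dm v L \<omega>))" for v
    using dm_integrable[OF mono] by (intro integrable_of_real integrable_mult_right)
  ultimately show ?case using pl_integrable[OF mono] by (auto intro: integrable_of_real)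
next
  case (add F D G D')
  then show ?case by (auto simp: distrib_left)
next
  case (scale F D c)
  then show ?case by (auto simp: mult.left_commute[of _ c])
qed

end

section \<open>The loop equation for Gaussian random matrices\<close>

text \<open>One fixed matrix size; \<open>cm\<close> gives the entries of the constant letters. The
  last index component tells real from imaginary parts, so that both form a single independent
  family.\<close>

locale gaussian_matrices = prob_space M for M :: "'w measure" +
  fixes n :: nat and a :: "nat \<Rightarrow> nat \<Rightarrow> nat \<Rightarrow> 'w \<Rightarrow> complex" and cm :: "'c \<Rightarrow> nat \<Rightarrow> nat \<Rightarrow> complex"
  assumes n_pos: "n > 0"
    and indep_entries: "indep_vars (\<lambda>_. borel)
      (\<lambda>(i, j, s, re) \<omega>. if re then Re (a i j s \<omega>) else Im (a i j s \<omega>))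
      ({..<n} \<times> {..<n} \<times> UNIV \<times> (UNIV :: bool set))"
    and normal_Re: "i < n \<Longrightarrow> j < n \<Longrightarrow>
      distributed M lborel (\<lambda>\<omega>. Re (a i j s \<omega>)) (normal_density 0 (sqrt (1 / (2 * real n))))"
    and normal_Im: "i < n \<Longrightarrow> j < n \<Longrightarrow>
      distributed M lborel (\<lambda>\<omega>. Im (a i j s \<omega>)) (normal_density 0 (sqrt (1 / (2 * real n))))"
begin

sublocale G: gaussian_family M "\<lambda>(i, j, s, re) \<omega>. if re then Re (a i j s \<omega>) else Im (a i j s \<omega>)"
  "{..<n} \<times> {..<n} \<times> UNIV \<times> (UNIV :: bool set)" "sqrt (1 / (2 * real n))"
proof unfold_locales
  show "sqrt (1 / (2 * real n)) > 0" using n_pos by simp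
  show "indep_vars (\<lambda>_. borel)
      (\<lambda>(i, j, s, re) \<omega>. if re then Re (a i j s \<omega>) else Im (a i j s \<omega>))
      ({..<n} \<times> {..<n} \<times> UNIV \<times> (UNIV :: bool set))"
    by (rule indep_entries)
  fix v :: "nat \<times> nat \<times> nat \<times> bool"
  assume "v \<in> {..<n} \<times> {..<n} \<times> UNIV \<times> (UNIV :: bool set)"
  then obtain i j s re where v: "v = (i, j, s, re)" "i < n" "j < n" by (cases v) auto
  then show "distributed M lborel ((\<lambda>(i, j, s, re) \<omega>. if re then Re (a i j s \<omega>) else Im (a i j s \<omega>)) v)
      (normal_density 0 (sqrt (1 / (2 * real n))))"
    using normal_Re[OF v(2,3), of s] normal_Im[OF v(2,3), of s] by (cases re) simp_all
qed

definition g :: "nat \<times> bool \<Rightarrow> nat \<Rightarrow> nat \<Rightarrow> 'w \<Rightarrow> complex" where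
  "g t k l \<omega> = (if snd t then cnj (a l k (fst t) \<omega>) else a k l (fst t) \<omega>)"

definition op :: "nat \<times> bool \<Rightarrow> nat \<times> bool" where "op t = (fst t, \<not> snd t)"

definition ix :: "nat \<times> bool \<Rightarrow> nat \<Rightarrow> nat \<Rightarrow> bool \<Rightarrow> nat \<times> nat \<times> nat \<times> bool" where
  "ix t k l re = (if snd t then (l, k, fst t, re) else (k, l, fst t, re))"

text \<open>The entry \<open>g t k l\<close> is the real variable at \<open>ix t k l True\<close>
  plus \<open>sg t\<close> times the one at \<open>ix t k l False\<close>; the adjoint transposes
  the indices and flips the sign.\<close>

definition sg :: "nat \<times> bool \<Rightarrow> complex" where "sg t = (if snd t then - \<i> else \<i>)"

text \<open>Derivatives in the direction of the complex entry \<open>g t k l\<close>, scaled so that Gaussian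
  integration by parts reads \<open>E (g t k l F) = E (D t k l)\<close>.\<close>

definition cpoly :: "('w \<Rightarrow> complex) \<Rightarrow> (nat \<times> bool \<Rightarrow> nat \<Rightarrow> nat \<Rightarrow> 'w \<Rightarrow> complex) \<Rightarrow> bool" where
  "cpoly F D \<longleftrightarrow> (\<exists>dF. G.gpoly F dF \<and> (\<forall>t k l \<omega>. k < n \<longrightarrow> l < n \<longrightarrow>
     D t k l \<omega> = dF (ix t k l True) \<omega> + sg t * dF (ix t k l False) \<omega>))"

lemma cpoly_cong:
  "cpoly F D \<Longrightarrow> (\<And>t k l \<omega>. k < n \<Longrightarrow> l < n \<Longrightarrow> D t k l \<omega> = D' t k l \<omega>) \<Longrightarrow> cpoly F D'"
  unfolding cpoly_def by (elim exE) (rule exI, auto)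

lemma cpoly_const: "cpoly (\<lambda>\<omega>. c) (\<lambda>t k l \<omega>. 0)"
  unfolding cpoly_def by (intro exI[of _ "\<lambda>v \<omega>. 0"] conjI G.gpoly_const) simp

lemma cpoly_add:
  assumes "cpoly F D" "cpoly F' D'"
  shows "cpoly (\<lambda>\<omega>. F \<omega> + F' \<omega>) (\<lambda>t k l \<omega>. D t k l \<omega> + D' t k l \<omega>)"
proof -
  obtain dF dF' where "G.gpoly F dF" "G.gpoly F' dF'"
    "\<forall>t k l \<omega>. k < n \<longrightarrow> l < n \<longrightarrow> D t k l \<omega> = dF (ix t k l True) \<omega> + sg t * dF (ix t k l False) \<omega>"
    "\<forall>t k l \<omega>. k < n \<longrightarrow> l < n \<longrightarrow> D' t k l \<omega> = dF' (ix t k l True) \<omega> + sg t * dF' (ix t k l False) \<omega>"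
    using assms unfolding cpoly_def by blast
  then show ?thesis unfolding cpoly_def
    by (intro exI[of _ "\<lambda>v \<omega>. dF v \<omega> + dF' v \<omega>"] conjI G.gpoly.add) (auto simp: algebra_simps)
qed

lemma cpoly_mult:
  assumes "cpoly F D" "cpoly F' D'"
  shows "cpoly (\<lambda>\<omega>. F \<omega> * F' \<omega>) (\<lambda>t k l \<omega>. D t k l \<omega> * F' \<omega> + F \<omega> * D' t k l \<omega>)"
proof -
  obtain dF dF' where "G.gpoly F dF" "G.gpoly F' dF'"
    "\<forall>t k l \<omega>. k < n \<longrightarrow> l < n \<longrightarrow> D t k l \<omega> = dF (ix t k l True) \<omega> + sg t * dF (ix t k l False) \<omega>"
    "\<forall>t k l \<omega>. k < n \<longrightarrow> l < n \<longrightarrow> D' t k l \<omega> = dF' (ix t k l True) \<omega> + sg t * dF' (ix t k l False) \<omega>"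
    using assms unfolding cpoly_def by blast
  then show ?thesis unfolding cpoly_def
    by (intro exI[of _ "\<lambda>v \<omega>. dF v \<omega> * F' \<omega> + F \<omega> * dF' v \<omega>"] conjI G.gpoly_mult) (auto simp: algebra_simps)
qed

lemma cpoly_sum:
  assumes "finite I" "\<And>i. i \<in> I \<Longrightarrow> cpoly (F i) (D i)"
  shows "cpoly (\<lambda>\<omega>. \<Sum>i\<in>I. F i \<omega>) (\<lambda>t k l \<omega>. \<Sum>i\<in>I. D i t k l \<omega>)"
  using assms
proof (induction I rule: finite_induct)
  case empty
  show ?case using cpoly_const[of 0] by simp
next
  case (insert i I)
  then show ?case using cpoly_add[of "F i" "D i"] by simp
qed

text \<open>For two entries of the same kind the contributions \<open>1 / (2 n)\<close> and
  \<open>- 1 / (2 n)\<close> of real and imaginary part cancel; for mutually adjoint entries they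
  add up to \<open>1 / n\<close>.\<close>

lemma cpoly_g:
  assumes ij: "i < n" "j < n"
  shows "cpoly (g u i j) (\<lambda>t k l \<omega>. if u = op t \<and> i = l \<and> j = k then 1 / of_nat n else 0)"
proof -
  let ?s = "(sqrt (1 / (2 * real n)))\<^sup>2"
  have s: "complex_of_real ?s = 1 / (2 * of_nat n)" using n_pos by simp
  have mem: "ix u i j b \<in> {..<n} \<times> {..<n} \<times> UNIV \<times> (UNIV :: bool set)" for b
    using ij by (auto simp: ix_def)
  let ?d = "\<lambda>b v \<omega>. if ix u i j b = v then complex_of_real ?s else 0"
  have gp: "G.gpoly (\<lambda>\<omega>. complex_of_real ((\<lambda>(i, j, s, re) \<omega>. if re then Re (a i j s \<omega>) else Im (a i j s \<omega>)) (ix u i j True) \<omega>)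
      + sg u * complex_of_real ((\<lambda>(i, j, s, re) \<omega>. if re then Re (a i j s \<omega>) else Im (a i j s \<omega>)) (ix u i j False) \<omega>))
     (\<lambda>v \<omega>. ?d True v \<omega> + sg u * ?d False v \<omega>)"
    by (intro G.gpoly.add G.gpoly.scale G.gpoly_var mem)
  have geq: "(\<lambda>\<omega>. complex_of_real ((\<lambda>(i, j, s, re) \<omega>. if re then Re (a i j s \<omega>) else Im (a i j s \<omega>)) (ix u i j True) \<omega>)
      + sg u * complex_of_real ((\<lambda>(i, j, s, re) \<omega>. if re then Re (a i j s \<omega>) else Im (a i j s \<omega>)) (ix u i j False) \<omega>)) = g u i j"
    by (auto simp: fun_eq_iff g_def ix_def sg_def complex_eq_iff)
  have gp': "G.gpoly (g u i j) (\<lambda>v \<omega>. ?d True v \<omega> + sg u * ?d False v \<omega>)"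
    using gp unfolding geq .
  show ?thesis
    unfolding cpoly_def
  proof (intro exI[of _ "\<lambda>v \<omega>. ?d True v \<omega> + sg u * ?d False v \<omega>"] conjI allI impI gp')
    fix t k l \<omega> assume "k < n" "l < n"
    show "(if u = op t \<and> i = l \<and> j = k then 1 / of_nat n else 0) =
      (?d True (ix t k l True) \<omega> + sg u * ?d False (ix t k l True) \<omega>) +
      sg t * (?d True (ix t k l False) \<omega> + sg u * ?d False (ix t k l False) \<omega>)"
    proof -
      define c :: complex where "c = 1 / (2 * of_nat n)"
      \<comment> \<open>Both symbols refer to the same entry of the same matrix, up to
        conjugation.\<close>
      define C where "C \<longleftrightarrow> fst u = fst t \<and> (if snd u = snd t then i = k \<and> j = l else i = l \<and> j = k)"
      have e: "ix u i j b = ix t k l b' \<longleftrightarrow> b = b' \<and> C" for b b'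
        by (auto simp: ix_def C_def)
      have "(?d True (ix t k l True) \<omega> + sg u * ?d False (ix t k l True) \<omega>) +
          sg t * (?d True (ix t k l False) \<omega> + sg u * ?d False (ix t k l False) \<omega>) =
          (if C then c + sg t * sg u * c else 0)"
        unfolding e s c_def by simp
      also have "\<dots> = (if u = op t \<and> i = l \<and> j = k then 1 / of_nat n else 0)"
      proof (cases "snd u = snd t")
        case True
        then have "sg t * sg u = -1" "u \<noteq> op t" by (auto simp: sg_def op_def)
        then show ?thesis by simp
      next
        case False
        then have "sg t * sg u = 1" "u = op t \<longleftrightarrow> fst u = fst t" by (auto simp: sg_def op_def prod_eq_iff)
        then show ?thesis using False by (auto simp: C_def c_def)
      qed
      finally show ?thesis by simp
    qed
  qed
qed

lemma cpoly_integral: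
  assumes "cpoly F D"
  shows "integrable M F" "k < n \<Longrightarrow> l < n \<Longrightarrow> integrable M (D t k l)"
    "k < n \<Longrightarrow> l < n \<Longrightarrow> integrable M (\<lambda>\<omega>. g t k l \<omega> * F \<omega>)"
    "k < n \<Longrightarrow> l < n \<Longrightarrow> (\<integral>\<omega>. g t k l \<omega> * F \<omega> \<partial>M) = (\<integral>\<omega>. D t k l \<omega> \<partial>M)"
proof -
  obtain dF where gp: "G.gpoly F dF" and
    D: "\<And>t k l \<omega>. k < n \<Longrightarrow> l < n \<Longrightarrow> D t k l \<omega> = dF (ix t k l True) \<omega> + sg t * dF (ix t k l False) \<omega>"
    using assms unfolding cpoly_def by blast
  note GI = G.gpoly_integral[OF gp]
  show "integrable M F" using GI by blast
  let ?X = "\<lambda>v \<omega>. (\<lambda>(i, j, s, re) \<omega>. if re then Re (a i j s \<omega>) else Im (a i j s \<omega>)) v \<omega>"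
  assume kl: "k < n" "l < n"
  have mem: "ix t k l b \<in> {..<n} \<times> {..<n} \<times> UNIV \<times> (UNIV :: bool set)" for b
    using kl by (auto simp: ix_def)
  note B = bspec[OF conjunct2[OF GI] mem]
  have i: "integrable M (dF (ix t k l b))" "integrable M (\<lambda>\<omega>. of_real (?X (ix t k l b) \<omega>) * F \<omega>)"
    "(\<integral>\<omega>. of_real (?X (ix t k l b) \<omega>) * F \<omega> \<partial>M) = (\<integral>\<omega>. dF (ix t k l b) \<omega> \<partial>M)" for b
    by (rule conjunct1[OF B], rule conjunct1[OF conjunct2[OF B]], rule conjunct2[OF conjunct2[OF B]])
  have Deq: "D t k l = (\<lambda>\<omega>. dF (ix t k l True) \<omega> + sg t * dF (ix t k l False) \<omega>)"
    by (rule ext) (rule D[OF kl])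
  show "integrable M (D t k l)" unfolding Deq using i(1) by auto
  have geq: "g t k l \<omega> * F \<omega> = of_real (?X (ix t k l True) \<omega>) * F \<omega> + sg t * (of_real (?X (ix t k l False) \<omega>) * F \<omega>)" for \<omega>
  proof -
    have "g t k l \<omega> = of_real (?X (ix t k l True) \<omega>) + sg t * of_real (?X (ix t k l False) \<omega>)"
      by (auto simp: g_def ix_def sg_def complex_eq_iff)
    then show ?thesis by (simp add: algebra_simps)
  qed
  show "integrable M (\<lambda>\<omega>. g t k l \<omega> * F \<omega>)"
    unfolding geq by (intro Bochner_Integration.integrable_add integrable_mult_right i(2))
  show "(\<integral>\<omega>. g t k l \<omega> * F \<omega> \<partial>M) = (\<integral>\<omega>. D t k l \<omega> \<partial>M)"
    unfolding geq Deq
    using i(1) i(2) i(3)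
    by (simp only: Bochner_Integration.integral_add integrable_mult_right integral_mult_right_zero)
qed

text \<open>Entries of words as plain random variables, which keeps matrices out of the integration;
  the link is \<open>ent_mprod\<close>.\<close>

primrec ent :: "('c + nat \<times> bool) list \<Rightarrow> nat \<Rightarrow> nat \<Rightarrow> 'w \<Rightarrow> complex" where
  "ent [] i j \<omega> = (if i = j then 1 else 0)"
| "ent (x # w) i j \<omega> = (\<Sum>k<n. (case x of Inl c \<Rightarrow> cm c i k | Inr t \<Rightarrow> g t i k \<omega>) * ent w k j \<omega>)"

lemma ent_append: "i < n \<Longrightarrow> ent (u @ v) i j \<omega> = (\<Sum>k<n. ent u i k \<omega> * ent v k j \<omega>)"
proof (induction u arbitrary: i)
  case Nil
  then show ?case by (simp add: if_distrib[of "\<lambda>x. x * _"] cong: if_cong)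
next
  case (Cons x u)
  then show ?case
    by (simp add: sum_distrib_left sum_distrib_right mult.assoc) (rule sum.swap)
qed

text \<open>Product rule: at each occurrence of \<open>op t\<close> the letter is replaced by
  \<open>1 / n\<close> times the matrix unit with row \<open>l\<close> and column
  \<open>k\<close>.\<close>

lemma cpoly_ent:
  "i < n \<Longrightarrow> j < n \<Longrightarrow> cpoly (ent w i j)
    (\<lambda>t k l \<omega>. 1 / of_nat n * ssum (Inr (op t)) (\<lambda>u v. ent u i l \<omega> * ent v k j \<omega>) w)"
proof (induction w arbitrary: i)
  case Nil
  then show ?case using cpoly_const[of "if i = j then 1 else 0"] by simp
next
  case (Cons x w)
  let ?X = "\<lambda>i r \<omega>. case x of Inl c \<Rightarrow> cm c i r | Inr t \<Rightarrow> g t i r \<omega>"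
  have X: "cpoly (?X i r) (\<lambda>t k l \<omega>. if x = Inr (op t) \<and> i = l \<and> r = k then 1 / of_nat n else 0)" if "r < n" for r
  proof (cases x)
    case (Inl c)
    then show ?thesis using cpoly_const[of "cm c i r"] by simp
  next
    case (Inr u)
    then show ?thesis using cpoly_g[OF \<open>i < n\<close> that, of u] by simp
  qed
  have "cpoly (\<lambda>\<omega>. \<Sum>r<n. ?X i r \<omega> * ent w r j \<omega>)
    (\<lambda>t k l \<omega>. \<Sum>r<n. (if x = Inr (op t) \<and> i = l \<and> r = k then 1 / of_nat n else 0) * ent w r j \<omega> +
       ?X i r \<omega> * (1 / of_nat n * ssum (Inr (op t)) (\<lambda>u v. ent u r l \<omega> * ent v k j \<omega>) w))"
    by (intro cpoly_sum cpoly_mult X Cons.IH Cons.prems) auto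
  then show ?case
    unfolding ent.simps
  proof (rule cpoly_cong)
    fix t k l \<omega> assume kl: "k < n" "l < n"
    have "(\<Sum>r<n. (if x = Inr (op t) \<and> i = l \<and> r = k then 1 / of_nat n else 0) * ent w r j \<omega>) =
        (if x = Inr (op t) \<and> i = l then 1 / of_nat n * ent w k j \<omega> else 0)"
      using kl by (cases "x = Inr (op t) \<and> i = l") (auto simp: if_distrib[of "\<lambda>x. x * _"] cong: if_cong)
    moreover have "(\<Sum>r<n. ?X i r \<omega> * (1 / of_nat n * ssum (Inr (op t)) (\<lambda>u v. ent u r l \<omega> * ent v k j \<omega>) w)) =
        1 / of_nat n * ssum (Inr (op t)) (\<lambda>u v. ent (x # u) i l \<omega> * ent v k j \<omega>) w"
      by (simp add: sum_distrib_left sum_distrib_right ssum_sum[symmetric] ssum_distrib_left[symmetric] mult_ac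
          del: times_divide_eq_left times_divide_eq_right)
    ultimately show "(\<Sum>r<n. (if x = Inr (op t) \<and> i = l \<and> r = k then 1 / of_nat n else 0) * ent w r j \<omega> +
        ?X i r \<omega> * (1 / of_nat n * ssum (Inr (op t)) (\<lambda>u v. ent u r l \<omega> * ent v k j \<omega>) w)) =
      1 / of_nat n * ssum (Inr (op t)) (\<lambda>u v. ent u i l \<omega> * ent v k j \<omega>) (x # w)"
      by (simp add: sum.distrib algebra_simps)
  qed
qed

definition tr :: "('c + nat \<times> bool) list \<Rightarrow> 'w \<Rightarrow> complex" where
  "tr w \<omega> = (\<Sum>i<n. ent w i i \<omega>)"

definition trs :: "('c + nat \<times> bool) list list \<Rightarrow> 'w \<Rightarrow> complex" where
  "trs Ws \<omega> = prod_list (map (\<lambda>w. tr w \<omega>) Ws)"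

lemma tr_rotate: "tr (u @ v) \<omega> = tr (v @ u) \<omega>"
proof -
  have "tr (u @ v) \<omega> = (\<Sum>i<n. \<Sum>k<n. ent u i k \<omega> * ent v k i \<omega>)" by (simp add: tr_def ent_append)
  also have "\<dots> = (\<Sum>k<n. \<Sum>i<n. ent v k i \<omega> * ent u i k \<omega>)" by (subst sum.swap) (simp add: mult.commute)
  also have "\<dots> = tr (v @ u) \<omega>" by (simp add: tr_def ent_append)
  finally show ?thesis .
qed

lemma cpoly_tr: "cpoly (tr w) (\<lambda>t k l \<omega>. 1 / of_nat n * ssum (Inr (op t)) (\<lambda>u v. ent (v @ u) k l \<omega>) w)"
proof -
  have "cpoly (\<lambda>\<omega>. \<Sum>i<n. ent w i i \<omega>) (\<lambda>t k l \<omega>. \<Sum>i<n. 1 / of_nat n * ssum (Inr (op t)) (\<lambda>u v. ent u i l \<omega> * ent v k i \<omega>) w)"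
    by (intro cpoly_sum cpoly_ent) auto
  then show ?thesis unfolding tr_def
    by (rule cpoly_cong)
      (simp add: sum_divide_distrib[symmetric] ssum_sum[symmetric] ent_append mult.commute)
qed

primrec dtrs :: "('c + nat \<times> bool) list list \<Rightarrow> nat \<times> bool \<Rightarrow> nat \<Rightarrow> nat \<Rightarrow> 'w \<Rightarrow> complex" where
  "dtrs [] t k l \<omega> = 0"
| "dtrs (w # Ws) t k l \<omega> = 1 / of_nat n * ssum (Inr (op t)) (\<lambda>u v. ent (v @ u) k l \<omega>) w * trs Ws \<omega> + tr w \<omega> * dtrs Ws t k l \<omega>"

lemma cpoly_trs: "cpoly (trs Ws) (dtrs Ws)"
proof (induction Ws)
  case Nil
  show ?case using cpoly_const[of 1] by (simp add: trs_def)
next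
  case (Cons w Ws)
  from cpoly_mult[OF cpoly_tr[of w] Cons] show ?case
    by (simp add: trs_def)
qed

lemma trs_integrable: "integrable M (trs Ws)"
  by (rule cpoly_integral(1)[OF cpoly_trs])

text \<open>The terms of integration by parts in which the letter finds its partner in another
  trace: that trace is cut open at the partner and joined with \<open>z\<close> to one
  trace.\<close>

primrec merge :: "nat \<times> bool \<Rightarrow> ('c + nat \<times> bool) list \<Rightarrow> ('c + nat \<times> bool) list list \<Rightarrow> 'w \<Rightarrow> complex" where
  "merge t z [] \<omega> = 0"
| "merge t z (w # Ws) \<omega> = ssum (Inr (op t)) (\<lambda>u v. tr (z @ v @ u) \<omega>) w * trs Ws \<omega> + tr w \<omega> * merge t z Ws \<omega>"

lemma sum_ent_dtrs: "(\<Sum>k<n. \<Sum>l<n. ent z l k \<omega> * dtrs Ws t k l \<omega>) = 1 / of_nat n * merge t z Ws \<omega>"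
proof (induction Ws)
  case (Cons w Ws)
  have 1: "(\<Sum>k<n. \<Sum>l<n. ent z l k \<omega> * ent y k l \<omega>) = tr (z @ y) \<omega>" for y
    by (subst sum.swap) (simp add: tr_def ent_append)
  have "(\<Sum>k<n. \<Sum>l<n. ent z l k \<omega> * (1 / of_nat n * ssum (Inr (op t)) (\<lambda>u v. ent (v @ u) k l \<omega>) w * trs Ws \<omega>)) =
      1 / of_nat n * (ssum (Inr (op t)) (\<lambda>u v. \<Sum>k<n. \<Sum>l<n. ent z l k \<omega> * ent (v @ u) k l \<omega>) w * trs Ws \<omega>)"
    by (simp add: ssum_sum ssum_distrib_left sum_distrib_left sum_distrib_right mult_ac
        del: times_divide_eq_left times_divide_eq_right)
  moreover have "(\<Sum>k<n. \<Sum>l<n. ent z l k \<omega> * (tr w \<omega> * dtrs Ws t k l \<omega>)) =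
      tr w \<omega> * (\<Sum>k<n. \<Sum>l<n. ent z l k \<omega> * dtrs Ws t k l \<omega>)"
    by (simp add: sum_distrib_left mult_ac)
  ultimately show ?case
    by (simp only: dtrs.simps distrib_left sum.distrib Cons 1 merge.simps) (simp add: mult_ac)
qed simp

lemma integral_double_sum:
  fixes f :: "nat \<Rightarrow> nat \<Rightarrow> 'w \<Rightarrow> complex"
  assumes "\<And>k l. k < n \<Longrightarrow> l < n \<Longrightarrow> integrable M (f k l)"
  shows "(\<integral>\<omega>. (\<Sum>k<n. \<Sum>l<n. f k l \<omega>) \<partial>M) = (\<Sum>k<n. \<Sum>l<n. (\<integral>\<omega>. f k l \<omega> \<partial>M))"
proof -
  have "(\<integral>\<omega>. (\<Sum>k<n. \<Sum>l<n. f k l \<omega>) \<partial>M) = (\<Sum>k<n. (\<integral>\<omega>. (\<Sum>l<n. f k l \<omega>) \<partial>M))"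
    by (rule Bochner_Integration.integral_sum) (use assms in auto)
  also have "\<dots> = (\<Sum>k<n. \<Sum>l<n. (\<integral>\<omega>. f k l \<omega> \<partial>M))"
    by (intro sum.cong refl Bochner_Integration.integral_sum) (use assms in auto)
  finally show ?thesis .
qed

text \<open>The leading letter is expanded over its entries and integration by parts is applied to
  each. A partner in the same trace cuts \<open>z\<close> into two traces, a partner in another
  trace merges the two.\<close>

theorem loop_equation:
  "(\<integral>\<omega>. trs ((Inr t # z) # Ws) \<omega> \<partial>M) =
    (\<integral>\<omega>. 1 / of_nat n * (ssum (Inr (op t)) (\<lambda>u v. tr u \<omega> * tr v \<omega>) z * trs Ws \<omega> + merge t z Ws \<omega>) \<partial>M)"
proof -
  let ?F = "\<lambda>k l \<omega>. ent z l k \<omega> * trs Ws \<omega>"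
  let ?D = "\<lambda>k' l' t k l \<omega>. 1 / of_nat n * ssum (Inr (op t)) (\<lambda>u v. ent u l' l \<omega> * ent v k k' \<omega>) z * trs Ws \<omega> + ent z l' k' \<omega> * dtrs Ws t k l \<omega>"
  have cp: "cpoly (?F k l) (?D k l)" if "k < n" "l < n" for k l
    by (intro cpoly_mult cpoly_ent cpoly_trs that)
  have "(\<integral>\<omega>. trs ((Inr t # z) # Ws) \<omega> \<partial>M) = (\<integral>\<omega>. (\<Sum>k<n. \<Sum>l<n. g t k l \<omega> * ?F k l \<omega>) \<partial>M)"
    by (simp add: trs_def tr_def sum_distrib_right mult.assoc)
  also have "\<dots> = (\<Sum>k<n. \<Sum>l<n. (\<integral>\<omega>. g t k l \<omega> * ?F k l \<omega> \<partial>M))"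
    by (rule integral_double_sum) (rule cpoly_integral(3)[OF cp])
  also have "\<dots> = (\<Sum>k<n. \<Sum>l<n. (\<integral>\<omega>. ?D k l t k l \<omega> \<partial>M))"
    by (intro sum.cong refl cpoly_integral(4)[OF cp]) auto
  also have "\<dots> = (\<integral>\<omega>. (\<Sum>k<n. \<Sum>l<n. ?D k l t k l \<omega>) \<partial>M)"
    by (rule integral_double_sum[symmetric]) (rule cpoly_integral(2)[OF cp])
  also have "(\<lambda>\<omega>. (\<Sum>k<n. \<Sum>l<n. ?D k l t k l \<omega>)) =
     (\<lambda>\<omega>. 1 / of_nat n * (ssum (Inr (op t)) (\<lambda>u v. tr u \<omega> * tr v \<omega>) z * trs Ws \<omega> + merge t z Ws \<omega>))"
  proof
    fix \<omega>
    have "(\<Sum>k<n. \<Sum>l<n. ent u l l \<omega> * ent v k k \<omega>) = tr u \<omega> * tr v \<omega>" for u v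
      unfolding tr_def sum_product by (rule sum.swap)
    then have "(\<Sum>k<n. \<Sum>l<n. 1 / of_nat n * ssum (Inr (op t)) (\<lambda>u v. ent u l l \<omega> * ent v k k \<omega>) z * trs Ws \<omega>) =
        1 / of_nat n * (ssum (Inr (op t)) (\<lambda>u v. tr u \<omega> * tr v \<omega>) z * trs Ws \<omega>)"
      by (simp add: sum_distrib_left[symmetric] sum_distrib_right[symmetric] sum_divide_distrib[symmetric] ssum_sum[symmetric])
    then show "(\<Sum>k<n. \<Sum>l<n. ?D k l t k l \<omega>) =
        1 / of_nat n * (ssum (Inr (op t)) (\<lambda>u v. tr u \<omega> * tr v \<omega>) z * trs Ws \<omega> + merge t z Ws \<omega>)"
      by (simp only: sum.distrib sum_ent_dtrs distrib_left)
  qed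
  finally show ?thesis .
qed

section \<open>Normalized traces and their limits\<close>

definition ntr :: "('c + nat \<times> bool) list \<Rightarrow> 'w \<Rightarrow> complex" where
  "ntr w \<omega> = tr w \<omega> / of_nat n"

definition ntrs :: "('c + nat \<times> bool) list list \<Rightarrow> 'w \<Rightarrow> complex" where
  "ntrs Ws \<omega> = prod_list (map (\<lambda>w. ntr w \<omega>) Ws)"

lemma ntrs_eq: "ntrs Ws \<omega> = trs Ws \<omega> / of_nat n ^ length Ws"
  by (induction Ws) (auto simp: ntrs_def trs_def ntr_def)

lemma ntrs_integrable: "integrable M (ntrs Ws)"
proof -
  have "ntrs Ws = (\<lambda>\<omega>. trs Ws \<omega> / of_nat n ^ length Ws)" by (rule ext) (rule ntrs_eq)
  then show ?thesis using trs_integrable by simp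
qed

end

text \<open>The splittings of a word as an explicit list, so that integrals and limits can be
  exchanged with the sum over them.\<close>

primrec spl :: "'l \<Rightarrow> 'l list \<Rightarrow> ('l list \<times> 'l list) list" where
  "spl t [] = []"
| "spl t (x # w) = (if x = t then [([], w)] else []) @ map (\<lambda>(u, v). (x # u, v)) (spl t w)"

lemma ssum_spl: "ssum t F w = (\<Sum>(u, v)\<leftarrow>spl t w. F u v)"
  by (induction w arbitrary: F) (auto simp: o_def case_prod_unfold)

lemma set_spl: "(u, v) \<in> set (spl t w) \<Longrightarrow> w = u @ t # v"
  by (induction w arbitrary: u v) (auto split: if_splits)

primrec ml :: "'l \<Rightarrow> 'l list \<Rightarrow> 'l list list \<Rightarrow> 'l list list list" where
  "ml t z [] = []"
| "ml t z (w # Ws) = map (\<lambda>(u, v). (z @ v @ u) # Ws) (spl t w) @ map ((#) w) (ml t z Ws)"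

definition cI :: "('c + nat \<times> bool) list list \<Rightarrow> nat" where
  "cI Ws = length (filter (\<lambda>x. \<not> isl x) (concat Ws))"

lemma cI_simps: "cI [] = 0" "cI (w # Ws) = length (filter (\<lambda>x. \<not> isl x) w) + cI Ws" "cI (As @ Bs) = cI As + cI Bs"
  by (auto simp: cI_def)

text \<open>Merging consumes the partner letter. Together with the letter \<open>t\<close> that
  precedes \<open>z\<close> two Gaussian letters disappear in each application of the loop
  equation.\<close>

lemma cI_ml: "L \<in> set (ml (Inr t) z Ws) \<Longrightarrow> cI L < length (filter (\<lambda>x. \<not> isl x) z) + cI Ws"
proof (induction Ws arbitrary: L)
  case (Cons w Ws)
  then consider u v where "(u, v) \<in> set (spl (Inr t) w)" "L = (z @ v @ u) # Ws"
    | L' where "L' \<in> set (ml (Inr t) z Ws)" "L = w # L'" by auto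
  then show ?case
  proof cases
    case 1
    then show ?thesis using set_spl[OF 1(1)] by (simp add: cI_simps)
  next
    case 2
    then show ?thesis using Cons.IH[of L'] by (simp add: cI_simps)
  qed
qed simp

context gaussian_matrices
begin

lemma merge_eq:
  "merge t z Ws \<omega> = of_nat n ^ length Ws * (\<Sum>L\<leftarrow>ml (Inr (op t)) z Ws. ntrs L \<omega>)"
proof (induction Ws)
  case (Cons w Ws)
  have n0: "of_nat n \<noteq> (0 :: complex)" using n_pos by simp
  have 1: "ssum (Inr (op t)) (\<lambda>u v. tr (z @ v @ u) \<omega>) w * trs Ws \<omega> =
      of_nat n ^ length (w # Ws) * (\<Sum>(u, v)\<leftarrow>spl (Inr (op t)) w. ntrs ((z @ v @ u) # Ws) \<omega>)"
    using n0
    by (simp add: ssum_spl sum_list_mult_const[symmetric] sum_list_const_mult[symmetric] ntrs_eq trs_def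
        case_prod_unfold)
  have 2: "tr w \<omega> * (of_nat n ^ length Ws * (\<Sum>L\<leftarrow>ml (Inr (op t)) z Ws. ntrs L \<omega>)) =
      of_nat n ^ length (w # Ws) * (\<Sum>L\<leftarrow>ml (Inr (op t)) z Ws. ntrs (w # L) \<omega>)"
    using n0
    by (simp add: sum_list_const_mult[symmetric] ntrs_def ntr_def) (simp add: mult_ac)
  show ?case
    unfolding merge.simps Cons 1 2 by (simp add: distrib_left o_def case_prod_unfold)
qed simp

lemma integral_sum_list:
  fixes F :: "'b \<Rightarrow> 'w \<Rightarrow> complex"
  assumes "\<And>x. x \<in> set xs \<Longrightarrow> integrable M (F x)"
  shows "(\<integral>\<omega>. (\<Sum>x\<leftarrow>xs. F x \<omega>) \<partial>M) = (\<Sum>x\<leftarrow>xs. \<integral>\<omega>. F x \<omega> \<partial>M) \<and> integrable M (\<lambda>\<omega>. \<Sum>x\<leftarrow>xs. F x \<omega>)"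
  using assms by (induction xs) auto

text \<open>Powers of \<open>n\<close>: the loop equation carries \<open>1 / n\<close>; splitting
  raises the number of traces by one, which restores a factor \<open>n\<close>, while merging lowers
  it by one and costs another \<open>1 / n\<close>.\<close>

theorem normalized_loop_equation:
  "(\<integral>\<omega>. ntrs ((Inr t # z) # Ws) \<omega> \<partial>M) =
    (\<Sum>(u, v)\<leftarrow>spl (Inr (op t)) z. \<integral>\<omega>. ntrs (u # v # Ws) \<omega> \<partial>M) +
    (1 / of_nat n)\<^sup>2 * (\<Sum>L\<leftarrow>ml (Inr (op t)) z Ws. \<integral>\<omega>. ntrs L \<omega> \<partial>M)"
proof -
  let ?m = "length Ws"
  have n0: "of_nat n \<noteq> (0 :: complex)" using n_pos by simp
  have "(\<integral>\<omega>. ntrs ((Inr t # z) # Ws) \<omega> \<partial>M) = (\<integral>\<omega>. trs ((Inr t # z) # Ws) \<omega> \<partial>M) / of_nat n ^ Suc ?m"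
    unfolding ntrs_eq by simp
  also have "\<dots> = (\<integral>\<omega>. 1 / of_nat n * (ssum (Inr (op t)) (\<lambda>u v. tr u \<omega> * tr v \<omega>) z * trs Ws \<omega> + merge t z Ws \<omega>)
      / of_nat n ^ Suc ?m \<partial>M)"
    unfolding loop_equation by simp
  also have "\<dots> = (\<integral>\<omega>. (\<Sum>(u, v)\<leftarrow>spl (Inr (op t)) z. ntrs (u # v # Ws) \<omega>) +
      (1 / of_nat n)\<^sup>2 * (\<Sum>L\<leftarrow>ml (Inr (op t)) z Ws. ntrs L \<omega>) \<partial>M)"
  proof (rule Bochner_Integration.integral_cong[OF refl])
    fix \<omega>
    have 1: "ssum (Inr (op t)) (\<lambda>u v. tr u \<omega> * tr v \<omega>) z * trs Ws \<omega> =
        of_nat n ^ (?m + 2) * (\<Sum>(u, v)\<leftarrow>spl (Inr (op t)) z. ntrs (u # v # Ws) \<omega>)"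
      using n0
      by (simp add: ssum_spl sum_list_mult_const[symmetric] sum_list_const_mult[symmetric] ntrs_eq trs_def
          case_prod_unfold mult.assoc)
    show "1 / of_nat n * (ssum (Inr (op t)) (\<lambda>u v. tr u \<omega> * tr v \<omega>) z * trs Ws \<omega> + merge t z Ws \<omega>) / of_nat n ^ Suc ?m =
       (\<Sum>(u, v)\<leftarrow>spl (Inr (op t)) z. ntrs (u # v # Ws) \<omega>) +
      (1 / of_nat n)\<^sup>2 * (\<Sum>L\<leftarrow>ml (Inr (op t)) z Ws. ntrs L \<omega>)"
      unfolding 1 merge_eq using n0 by (simp add: field_simps power2_eq_square)
  qed
  also have "\<dots> = (\<Sum>(u, v)\<leftarrow>spl (Inr (op t)) z. \<integral>\<omega>. ntrs (u # v # Ws) \<omega> \<partial>M) +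
    (1 / of_nat n)\<^sup>2 * (\<Sum>L\<leftarrow>ml (Inr (op t)) z Ws. \<integral>\<omega>. ntrs L \<omega> \<partial>M)"
  proof -
    have "(\<integral>\<omega>. (\<Sum>p\<leftarrow>spl (Inr (op t)) z. ntrs (fst p # snd p # Ws) \<omega>) \<partial>M) =
        (\<Sum>p\<leftarrow>spl (Inr (op t)) z. \<integral>\<omega>. ntrs (fst p # snd p # Ws) \<omega> \<partial>M)"
      "integrable M (\<lambda>\<omega>. \<Sum>p\<leftarrow>spl (Inr (op t)) z. ntrs (fst p # snd p # Ws) \<omega>)"
      using integral_sum_list[of "spl (Inr (op t)) z" "\<lambda>p. ntrs (fst p # snd p # Ws)"] ntrs_integrable by auto
    moreover have "(\<integral>\<omega>. (\<Sum>L\<leftarrow>ml (Inr (op t)) z Ws. ntrs L \<omega>) \<partial>M) = (\<Sum>L\<leftarrow>ml (Inr (op t)) z Ws. \<integral>\<omega>. ntrs L \<omega> \<partial>M)"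
      "integrable M (\<lambda>\<omega>. \<Sum>L\<leftarrow>ml (Inr (op t)) z Ws. ntrs L \<omega>)"
      using integral_sum_list[of "ml (Inr (op t)) z Ws" ntrs] ntrs_integrable by auto
    ultimately show ?thesis by (simp add: case_prod_unfold)
  qed
  finally show ?thesis .
qed

lemma ent_Inl: "set w \<subseteq> range Inl \<Longrightarrow> ent w i j \<omega> = ent w i j \<omega>'"
  by (induction w arbitrary: i) auto

lemma ntrs_perm: "ntrs (As @ (u @ v) # Bs) \<omega> = ntrs ((v @ u) # As @ Bs) \<omega>"
  by (simp add: ntrs_def ntr_def tr_rotate[of u v] mult_ac)

end

lemma tendsto_sum_list:
  fixes f :: "'b \<Rightarrow> 'd \<Rightarrow> complex"
  shows "(\<And>x. x \<in> set xs \<Longrightarrow> (f x \<longlongrightarrow> l x) F) \<Longrightarrow> ((\<lambda>n. \<Sum>x\<leftarrow>xs. f x n) \<longlongrightarrow> (\<Sum>x\<leftarrow>xs. l x)) F"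
  by (induction xs) (auto intro!: tendsto_add)

lemma tendsto_prod_list:
  fixes f :: "'b \<Rightarrow> 'd \<Rightarrow> complex"
  shows "(\<And>x. x \<in> set xs \<Longrightarrow> (f x \<longlongrightarrow> l x) F) \<Longrightarrow> ((\<lambda>n. prod_list (map (\<lambda>x. f x n) xs)) \<longlongrightarrow> prod_list (map l xs)) F"
  by (induction xs) (auto intro!: tendsto_mult)

text \<open>The splitting terms reproduce the recursion of \<open>lim\<close>; the merging terms
  converge by induction, so their prefactor \<open>1 / n\<close> squared removes them. Only trace
  property, recursion and values on constant words are asked of \<open>lim\<close>.\<close>

theorem traces_factorize:
  fixes M :: "nat \<Rightarrow> 'w measure" and a :: "nat \<Rightarrow> nat \<Rightarrow> nat \<Rightarrow> nat \<Rightarrow> 'w \<Rightarrow> complex"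
    and cm :: "nat \<Rightarrow> 'c \<Rightarrow> nat \<Rightarrow> nat \<Rightarrow> complex" and lim :: "('c + nat \<times> bool) list \<Rightarrow> complex"
  assumes G: "\<And>n. n \<ge> N \<Longrightarrow> gaussian_matrices (M n) n (a n)"
    and rot: "\<And>u v. lim (u @ v) = lim (v @ u)"
    and SD: "\<And>t w. lim (Inr t # w) = ssum (Inr (fst t, \<not> snd t)) (\<lambda>u v. lim u * lim v) w"
    and base: "\<And>w \<omega>. set w \<subseteq> range Inl \<Longrightarrow> (\<lambda>n. gaussian_matrices.ntr n (a n) (cm n) w \<omega>) \<longlonglongrightarrow> lim w"
  shows "(\<lambda>n. \<integral>\<omega>. gaussian_matrices.ntrs n (a n) (cm n) Ws \<omega> \<partial>M n) \<longlonglongrightarrow> prod_list (map lim Ws)"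
proof (induction "cI Ws" arbitrary: Ws rule: less_induct)
  case less
  let ?ntrs = "\<lambda>n. gaussian_matrices.ntrs n (a n) (cm n)"
  have ev: "eventually (\<lambda>n. n \<ge> N) sequentially" by (rule eventually_ge_at_top)
  show ?case
  proof (cases "\<forall>w\<in>set Ws. set w \<subseteq> range Inl")
    case True
    \<comment> \<open>Without Gaussian letters the traces are deterministic; their value is read off
      at an arbitrary sample point.\<close>
    fix \<omega>0 :: 'w
    have "(\<lambda>n. prod_list (map (\<lambda>w. gaussian_matrices.ntr n (a n) (cm n) w \<omega>0) Ws)) \<longlonglongrightarrow> prod_list (map lim Ws)"
      by (rule tendsto_prod_list) (use True base in auto)
    then show ?thesis
    proof (rule Lim_transform_eventually)
      show "\<forall>\<^sub>F n in sequentially. prod_list (map (\<lambda>w. gaussian_matrices.ntr n (a n) (cm n) w \<omega>0) Ws) =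
          (\<integral>\<omega>. ?ntrs n Ws \<omega> \<partial>M n)"
        using ev
      proof eventually_elim
        case (elim n)
        interpret gaussian_matrices "M n" n "a n" "cm n" by (rule G[OF elim])
        have c: "ntr w \<omega> = ntr w \<omega>0" if "w \<in> set Ws" for w \<omega>
          using True that ent_Inl[of w _ _ \<omega> \<omega>0] by (simp add: ntr_def tr_def)
        have mp: "map (\<lambda>w. ntr w \<omega>) Ws = map (\<lambda>w. ntr w \<omega>0) Ws" for \<omega>
          by (rule map_cong[OF refl c])
        have "ntrs Ws = (\<lambda>\<omega>. prod_list (map (\<lambda>w. ntr w \<omega>0) Ws))"
          unfolding ntrs_def by (rule ext) (rule arg_cong[OF mp])
        then show ?case by (simp add: prob_space)
      qed
    qed
  next
    case False
    then obtain w x where "w \<in> set Ws" "x \<in> set w" "x \<notin> range Inl" by blast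
    then obtain t where t: "Inr t \<in> set w" by (cases x) auto
    obtain As Bs where Ws: "Ws = As @ w # Bs" using \<open>w \<in> set Ws\<close> by (meson split_list)
    obtain u v where w: "w = u @ Inr t # v" using t by (meson split_list)
    let ?z = "v @ u" and ?R = "As @ Bs" and ?t = "Inr (fst t, \<not> snd t) :: 'c + nat \<times> bool"
    have c: "cI Ws = Suc (length (filter (\<lambda>x. \<not> isl x) ?z) + cI ?R)"
      by (simp add: Ws w cI_simps)
    have 1: "(\<lambda>n. (\<Sum>(u, v)\<leftarrow>spl ?t ?z. \<integral>\<omega>. ?ntrs n (u # v # ?R) \<omega> \<partial>M n)) \<longlonglongrightarrow>
        (\<Sum>(u, v)\<leftarrow>spl ?t ?z. prod_list (map lim (u # v # ?R)))"
      unfolding case_prod_unfold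
    proof (rule tendsto_sum_list)
      fix p assume "p \<in> set (spl ?t ?z)"
      then have "?z = fst p @ ?t # snd p" using set_spl[of "fst p" "snd p"] by simp
      then have "length (filter (\<lambda>x. \<not> isl x) ?z) = length (filter (\<lambda>x. \<not> isl x) (fst p @ ?t # snd p))" by simp
      then have "cI (fst p # snd p # ?R) < cI Ws" unfolding c by (simp add: cI_simps)
      then show "(\<lambda>n. \<integral>\<omega>. ?ntrs n (fst p # snd p # ?R) \<omega> \<partial>M n) \<longlonglongrightarrow> prod_list (map lim (fst p # snd p # ?R))"
        by (rule less)
    qed
    have 2: "(\<lambda>n. (\<Sum>L\<leftarrow>ml ?t ?z ?R. \<integral>\<omega>. ?ntrs n L \<omega> \<partial>M n)) \<longlonglongrightarrow> (\<Sum>L\<leftarrow>ml ?t ?z ?R. prod_list (map lim L))"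
    proof (rule tendsto_sum_list)
      fix L assume "L \<in> set (ml ?t ?z ?R)"
      then have "cI L < cI Ws" using cI_ml[of L] c by fastforce
      then show "(\<lambda>n. \<integral>\<omega>. ?ntrs n L \<omega> \<partial>M n) \<longlonglongrightarrow> prod_list (map lim L)" by (rule less)
    qed
    have "(\<lambda>n. (\<Sum>(u, v)\<leftarrow>spl ?t ?z. \<integral>\<omega>. ?ntrs n (u # v # ?R) \<omega> \<partial>M n) +
        (1 / of_nat n)\<^sup>2 * (\<Sum>L\<leftarrow>ml ?t ?z ?R. \<integral>\<omega>. ?ntrs n L \<omega> \<partial>M n)) \<longlonglongrightarrow>
      (\<Sum>(u, v)\<leftarrow>spl ?t ?z. prod_list (map lim (u # v # ?R))) + 0\<^sup>2 * (\<Sum>L\<leftarrow>ml ?t ?z ?R. prod_list (map lim L))"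
      by (intro tendsto_add tendsto_mult 1 2 tendsto_power lim_1_over_n)
    moreover have "(\<Sum>(u, v)\<leftarrow>spl ?t ?z. prod_list (map lim (u # v # ?R))) + 0\<^sup>2 * (\<Sum>L\<leftarrow>ml ?t ?z ?R. prod_list (map lim L)) =
        prod_list (map lim Ws)"
    proof -
      have "lim w = lim (Inr t # ?z)" using rot[of u "Inr t # v"] w by simp
      also have "\<dots> = (\<Sum>(u, v)\<leftarrow>spl ?t ?z. lim u * lim v)" by (simp only: SD ssum_spl)
      finally have "prod_list (map lim Ws) = (\<Sum>(u, v)\<leftarrow>spl ?t ?z. lim u * lim v) * prod_list (map lim ?R)"
        by (simp add: Ws mult_ac)
      also have "\<dots> = (\<Sum>(u, v)\<leftarrow>spl ?t ?z. prod_list (map lim (u # v # ?R)))"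
        by (simp add: sum_list_mult_const[symmetric] case_prod_unfold mult.assoc)
      finally show ?thesis by simp
    qed
    ultimately have "(\<lambda>n. (\<Sum>(u, v)\<leftarrow>spl ?t ?z. \<integral>\<omega>. ?ntrs n (u # v # ?R) \<omega> \<partial>M n) +
        (1 / of_nat n)\<^sup>2 * (\<Sum>L\<leftarrow>ml ?t ?z ?R. \<integral>\<omega>. ?ntrs n L \<omega> \<partial>M n)) \<longlonglongrightarrow> prod_list (map lim Ws)"
      by simp
    then show ?thesis
    proof (rule Lim_transform_eventually)
      show "\<forall>\<^sub>F n in sequentially. (\<Sum>(u, v)\<leftarrow>spl ?t ?z. \<integral>\<omega>. ?ntrs n (u # v # ?R) \<omega> \<partial>M n) +
        (1 / of_nat n)\<^sup>2 * (\<Sum>L\<leftarrow>ml ?t ?z ?R. \<integral>\<omega>. ?ntrs n L \<omega> \<partial>M n) = (\<integral>\<omega>. ?ntrs n Ws \<omega> \<partial>M n)"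
        using ev
      proof eventually_elim
        case (elim n)
        interpret gaussian_matrices "M n" n "a n" "cm n" by (rule G[OF elim])
        have "ntrs Ws \<omega> = ntrs ((Inr t # ?z) # ?R) \<omega>" for \<omega>
          using ntrs_perm[of As u "Inr t # v" Bs] by (simp add: Ws w)
        then show ?case using normalized_loop_equation[of t ?z ?R] by (simp add: op_def)
      qed
    qed
  qed
qed

section \<open>Convergence of words\<close>

definition mprod :: "nat \<Rightarrow> complex mat list \<Rightarrow> complex mat" where
  "mprod n Ls = foldr (*) Ls (1\<^sub>m n)"

lemma mprod_simps [simp]: "mprod n [] = 1\<^sub>m n" "mprod n (X # Ls) = X * mprod n Ls"
  by (simp_all add: mprod_def)

lemma mprod_carrier: "set Ls \<subseteq> carrier_mat n n \<Longrightarrow> mprod n Ls \<in> carrier_mat n n"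
  by (induction Ls) auto

lemma mprod_append:
  "set Ls \<subseteq> carrier_mat n n \<Longrightarrow> set Ks \<subseteq> carrier_mat n n \<Longrightarrow> mprod n (Ls @ Ks) = mprod n Ls * mprod n Ks"
proof (induction Ls)
  case Nil
  then show ?case using mprod_carrier[of Ks n] by simp
next
  case (Cons X Ls)
  then show ?case using mprod_carrier[of Ks n] mprod_carrier[of Ls n] by (simp add: assoc_mult_mat[of _ n n _ n _ n])
qed

lemma mat_adjoint_entries:
  assumes "X \<in> carrier_mat n n"
  shows "mat_adjoint X \<in> carrier_mat n n" "i < n \<Longrightarrow> j < n \<Longrightarrow> mat_adjoint X $$ (i, j) = cnj (X $$ (j, i))"
  using assms by (auto simp: mat_adjoint_def mat_of_rows_def)

lemma D_mat_carrier [simp]: "D_mat q n l \<in> carrier_mat n n"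
  by (simp add: D_mat_def mat_diag_def)

lemma D_mat_mult: "D_mat q n l * D_mat q n m = D_mat q n (\<lambda>k. l k * m k)"
  unfolding D_mat_def by (subst mat_diag_diag) simp

lemma D_mat_one: "D_mat q n (\<lambda>_. 1) = 1\<^sub>m n"
  by (auto simp: D_mat_def mat_diag_def intro!: eq_matI)

lemma D_mat_mult_entry:
  "X \<in> carrier_mat n n \<Longrightarrow> i < n \<Longrightarrow> j < n \<Longrightarrow> (D_mat q n l * X) $$ (i, j) = l (block_index q i) * X $$ (i, j)"
  by (simp add: D_mat_def mat_diag_mult_left[of X n n])

lemma mult_D_mat_entry:
  "X \<in> carrier_mat n n \<Longrightarrow> i < n \<Longrightarrow> j < n \<Longrightarrow> (X * D_mat q n l) $$ (i, j) = X $$ (i, j) * l (block_index q j)"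
  by (simp add: D_mat_def mat_diag_mult_right[of X n n])

lemma block_index_eq_iff:
  assumes "i < (\<Sum>k<d. q k)"
  shows "block_index q i = k \<longleftrightarrow> (\<Sum>l<k. q l) \<le> i \<and> i < (\<Sum>l<Suc k. q l)" "block_index q i < d"
proof -
  have "d \<noteq> 0" using assms by (cases d) auto
  then have d: "i < (\<Sum>l\<le>d - 1. q l)" using assms by (simp add: lessThan_Suc_atMost[symmetric])
  show "block_index q i < d"
    using Least_le[of "\<lambda>k. i < (\<Sum>l\<le>k. q l)", OF d] \<open>d \<noteq> 0\<close> by (simp add: block_index_def)
  have B: "i < (\<Sum>l\<le>block_index q i. q l)" unfolding block_index_def by (rule LeastI[of _ "d - 1"]) (rule d)
  have mono: "(\<Sum>l<k. q l) \<le> (\<Sum>l<k'. q l)" if "k \<le> k'" for k k' by (rule sum_mono2) (use that in auto)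
  have L: "(\<Sum>l<block_index q i. q l) \<le> i"
  proof (cases "block_index q i")
    case (Suc m)
    then have "\<not> i < (\<Sum>l\<le>m. q l)" using not_less_Least[of m "\<lambda>k. i < (\<Sum>l\<le>k. q l)"] by (simp add: block_index_def)
    then show ?thesis using Suc by (simp add: lessThan_Suc_atMost)
  qed simp
  show "block_index q i = k \<longleftrightarrow> (\<Sum>l<k. q l) \<le> i \<and> i < (\<Sum>l<Suc k. q l)"
  proof
    assume R: "(\<Sum>l<k. q l) \<le> i \<and> i < (\<Sum>l<Suc k. q l)"
    have "\<not> Suc k \<le> block_index q i" using mono[of "Suc k" "block_index q i"] L R by auto
    moreover have "\<not> Suc (block_index q i) \<le> k"
      using mono[of "Suc (block_index q i)" k] B R by (auto simp: lessThan_Suc_atMost)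
    ultimately show "block_index q i = k" by auto
  qed (use B L in \<open>auto simp: lessThan_Suc_atMost\<close>)
qed

lemma card_block:
  assumes "(\<Sum>k<d. q k) = n" "k < d"
  shows "card {i. i < n \<and> block_index q i = k} = q k"
proof -
  have "(\<Sum>l<Suc k. q l) \<le> (\<Sum>l<d. q l)" by (rule sum_mono2) (use assms(2) in auto)
  then have "(i < n \<and> block_index q i = k) \<longleftrightarrow> (\<Sum>l<k. q l) \<le> i \<and> i < (\<Sum>l<Suc k. q l)" for i
    using block_index_eq_iff(1)[of i q d k] assms(1) by (cases "i < n") (simp_all del: sum.lessThan_Suc)
  then have "{i. i < n \<and> block_index q i = k} = {(\<Sum>l<k. q l)..<(\<Sum>l<Suc k. q l)}"
    by (simp add: set_eq_iff del: sum.lessThan_Suc)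
  then show ?thesis by simp
qed

lemma Tr_p_mat:
  assumes "X \<in> carrier_mat n n"
  shows "Tr (p_mat q n k * X * p_mat q n k) = (\<Sum>i | i < n \<and> block_index q i = k. X $$ (i, i))"
proof -
  have c: "p_mat q n k * X \<in> carrier_mat n n" by (rule mult_carrier_mat[OF _ assms]) (simp add: p_mat_def)
  then have "dim_row (p_mat q n k * X * p_mat q n k) = n" by (auto simp: p_mat_def)
  moreover have "(p_mat q n k * X * p_mat q n k) $$ (i, i) = (if block_index q i = k then X $$ (i, i) else 0)"
    if "i < n" for i
  proof -
    have "(p_mat q n k * X * p_mat q n k) $$ (i, i) = (p_mat q n k * X) $$ (i, i) * (if block_index q i = k then 1 else 0)"
      unfolding p_mat_def by (rule mult_D_mat_entry[OF c[unfolded p_mat_def] that that])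
    also have "(p_mat q n k * X) $$ (i, i) = (if block_index q i = k then 1 else 0) * X $$ (i, i)"
      unfolding p_mat_def by (rule D_mat_mult_entry[OF assms that that])
    finally show ?thesis by simp
  qed
  ultimately show ?thesis
    by (simp add: Tr_def sum.If_cases) (rule sum.cong, auto)
qed

lemma Tr_D_mat:
  assumes "X \<in> carrier_mat n n" "(\<Sum>k<d. q k) = n"
  shows "Tr (D_mat q n l * X) = (\<Sum>k<d. l k * Tr (p_mat q n k * X * p_mat q n k))"
proof -
  have "dim_row (D_mat q n l * X) = n" by (simp add: D_mat_def mat_diag_def)
  then have "Tr (D_mat q n l * X) = (\<Sum>i<n. l (block_index q i) * X $$ (i, i))"
    unfolding Tr_def using assms(1) by (simp only:, intro sum.cong) (simp_all add: D_mat_mult_entry del: index_mult_mat(1))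
  also have "\<dots> = (\<Sum>i<n. \<Sum>k<d. if block_index q i = k then l k * X $$ (i, i) else 0)"
    using block_index_eq_iff(2)[of _ q d] assms(2) by (intro sum.cong) auto
  also have "\<dots> = (\<Sum>k<d. \<Sum>i<n. if block_index q i = k then l k * X $$ (i, i) else 0)"
    by (rule sum.swap)
  also have "\<dots> = (\<Sum>k<d. l k * (\<Sum>i | i < n \<and> block_index q i = k. X $$ (i, i)))"
    by (intro sum.cong refl) (auto simp: sum.If_cases sum_distrib_left intro!: sum.cong)
  finally show ?thesis using assms(1) by (simp add: Tr_p_mat)
qed

text \<open>Symbols common to all sizes and to the limit: a matrix of the family or its adjoint, or
  an element of D by its coordinates. \<open>const_mat\<close> and \<open>const_elem\<close>
  interpret them, so one word can be evaluated on both sides.\<close>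

type_synonym const_letter = "(nat \<times> bool) + (nat \<Rightarrow> complex)"

definition const_mat :: "(nat \<Rightarrow> complex mat) \<Rightarrow> (nat \<Rightarrow> nat) \<Rightarrow> nat \<Rightarrow> const_letter \<Rightarrow> complex mat" where
  "const_mat X q n c = (case c of Inl (j, \<epsilon>) \<Rightarrow> if \<epsilon> then mat_adjoint (X j) else X j | Inr l \<Rightarrow> D_mat q n l)"

text \<open>A letter of a D-word carries its coefficient with it; here the two become separate
  letters, the coefficient being a constant.\<close>

definition factors :: "(nat + nat) \<times> bool \<times> (nat \<Rightarrow> complex) \<Rightarrow> (const_letter + nat \<times> bool) list" where
  "factors = (\<lambda>(i, \<epsilon>, l). [case i of Inl j \<Rightarrow> Inl (Inl (j, \<epsilon>)) | Inr s \<Rightarrow> Inr (s, \<epsilon>), Inl (Inr l)])"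

lemma const_mat_carrier: "(\<And>j. X j \<in> carrier_mat n n) \<Longrightarrow> const_mat X q n c \<in> carrier_mat n n"
  by (auto simp: const_mat_def mat_adjoint_entries(1) split: sum.split)

lemma word_mat_simps:
  "word_mat q n X [] = 1\<^sub>m n"
  "word_mat q n X ((i, \<epsilon>, l) # w) = (if \<epsilon> then mat_adjoint (X i) else X i) * D_mat q n l * word_mat q n X w"
  by (simp_all add: word_mat_def)

lemma word_mat_carrier: "(\<And>i. X i \<in> carrier_mat n n) \<Longrightarrow> word_mat q n X w \<in> carrier_mat n n"
proof (induction w)
  case (Cons y w)
  have "(if \<epsilon> then mat_adjoint (X i) else X i) * D_mat q n l \<in> carrier_mat n n" for i \<epsilon> l
    using Cons.prems mat_adjoint_entries(1) by (intro mult_carrier_mat[of _ n n]) auto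
  from mult_carrier_mat[OF this Cons.IH[OF Cons.prems]] show ?case
    by (cases y) (simp only: word_mat_simps)
qed (simp add: word_mat_simps)

context gaussian_matrices
begin

definition lmat :: "'w \<Rightarrow> 'c + nat \<times> bool \<Rightarrow> complex mat" where
  "lmat \<omega> x = Matrix.mat n n (\<lambda>(i, k). case x of Inl c \<Rightarrow> cm c i k | Inr t \<Rightarrow> g t i k \<omega>)"

lemma lmat_carrier: "lmat \<omega> x \<in> carrier_mat n n"
  by (simp add: lmat_def)

lemma ent_mprod: "i < n \<Longrightarrow> j < n \<Longrightarrow> ent w i j \<omega> = mprod n (map (lmat \<omega>) w) $$ (i, j)"
proof (induction w arbitrary: i)
  case (Cons x w)
  have "mprod n (map (lmat \<omega>) w) \<in> carrier_mat n n" by (rule mprod_carrier) (auto simp: lmat_carrier)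
  then show ?case
    using Cons lmat_carrier[of \<omega> x]
    by (simp add: times_mat_def scalar_prod_def atLeast0LessThan) (simp add: lmat_def)
qed simp

lemma tr_mprod: "tr w \<omega> = Tr (mprod n (map (lmat \<omega>) w))"
proof -
  have "mprod n (map (lmat \<omega>) w) \<in> carrier_mat n n" by (rule mprod_carrier) (auto simp: lmat_carrier)
  then show ?thesis by (auto simp: tr_def Tr_def ent_mprod)
qed

end

lemma lmat_const:
  assumes "\<And>j. X j \<in> carrier_mat n n" "gaussian_matrices M n a"
  shows "gaussian_matrices.lmat n a (\<lambda>c i k. const_mat X q n c $$ (i, k)) \<omega> (Inl c) = const_mat X q n c"
proof -
  interpret gaussian_matrices M n a "\<lambda>c i k. const_mat X q n c $$ (i, k)" by fact
  show ?thesis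
    using const_mat_carrier[where X = X and q = q and c = c, OF assms(1)] by (intro eq_matI) (auto simp: lmat_def)
qed

text \<open>Compression by \<open>p_mat q n k\<close> puts the letter \<open>unit\<close> of that
  projection at both ends of the word, and \<open>n / q k\<close> changes the normalization from the
  block to the full matrix.\<close>

lemma E_mat_word:
  fixes k :: nat
  assumes X: "\<And>j. X j \<in> carrier_mat n n" and G: "gaussian_matrices M n a"
    and Y: "\<And>s \<omega>. Y s \<omega> = Matrix.mat n n (\<lambda>(i, j). a i j s \<omega>)"
  defines "unit \<equiv> Inl (Inr (\<lambda>l. if l = k then 1 else 0))"
  shows "E_mat M q n (\<lambda>\<omega>. word_mat q n (\<lambda>i. case i of Inl j \<Rightarrow> X j | Inr s \<Rightarrow> Y s \<omega>) w) k =
    of_nat n / of_nat (q k) *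
      (\<integral>\<omega>. gaussian_matrices.ntrs n a (\<lambda>c i k. const_mat X q n c $$ (i, k)) [[unit] @ concat (map factors w) @ [unit]] \<omega> \<partial>M)"
proof -
  interpret gaussian_matrices M n a "\<lambda>c i k. const_mat X q n c $$ (i, k)" by fact
  have Inr: "lmat \<omega> (Inr (s, \<epsilon>)) = (if \<epsilon> then mat_adjoint (Y s \<omega>) else Y s \<omega>)" for \<omega> s \<epsilon>
  proof -
    have Yc: "Y s \<omega> \<in> carrier_mat n n" by (simp add: Y)
    then show ?thesis using mat_adjoint_entries[OF Yc]
      by (intro eq_matI) (auto simp: lmat_def g_def Y)
  qed
  note Inl = lmat_const[OF X G]
  have W: "word_mat q n (\<lambda>i. case i of Inl j \<Rightarrow> X j | Inr s \<Rightarrow> Y s \<omega>) w = mprod n (map (lmat \<omega>) (concat (map factors w)))" for \<omega>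
  proof (induction w)
    case (Cons y w)
    obtain i \<epsilon> l where y: "y = (i, \<epsilon>, l)" by (cases y)
    let ?Z = "case i of Inl j \<Rightarrow> X j | Inr s \<Rightarrow> Y s \<omega>"
    let ?x = "case i of Inl j \<Rightarrow> Inl (Inl (j, \<epsilon>)) | Inr s \<Rightarrow> Inr (s, \<epsilon>)"
    have "(if \<epsilon> then mat_adjoint ?Z else ?Z) = lmat \<omega> ?x"
      by (cases i) (simp_all add: Inl Inr, simp add: const_mat_def)
    moreover have "D_mat q n l = lmat \<omega> (Inl (Inr l))" by (simp add: Inl, simp add: const_mat_def)
    moreover have "mprod n (map (lmat \<omega>) (concat (map factors w))) \<in> carrier_mat n n"
      by (rule mprod_carrier) (auto simp: lmat_carrier)
    ultimately show ?case
      using Cons lmat_carrier[of \<omega>]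
      by (simp add: y word_mat_simps factors_def assoc_mult_mat[of _ n n _ n _ n])
  qed (simp add: word_mat_simps)
  have "Tr (p_mat q n k * mprod n (map (lmat \<omega>) v) * p_mat q n k) = of_nat n * ntrs [[unit] @ v @ [unit]] \<omega>" for v \<omega>
  proof -
    have "p_mat q n k = lmat \<omega> unit" by (simp add: unit_def Inl, simp add: const_mat_def p_mat_def)
    moreover have "mprod n (map (lmat \<omega>) (v @ [unit])) = mprod n (map (lmat \<omega>) v) * lmat \<omega> unit"
      using lmat_carrier[of \<omega>] by (simp add: mprod_append[of _ n] image_subset_iff right_mult_one_mat[OF lmat_carrier])
    moreover have "mprod n (map (lmat \<omega>) v) \<in> carrier_mat n n"
      by (rule mprod_carrier) (auto simp: lmat_carrier)
    ultimately show ?thesis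
      using n_pos lmat_carrier[of \<omega>] by (simp add: ntrs_def ntr_def tr_mprod assoc_mult_mat[of _ n n _ n _ n])
  qed
  then show ?thesis unfolding E_mat_def W by simp
qed

context projection_ncps
begin

definition const_elem :: "(nat \<Rightarrow> 'a) \<Rightarrow> const_letter \<Rightarrow> 'a" where
  "const_elem b c = (case c of Inl (j, \<epsilon>) \<Rightarrow> eps A \<epsilon> (b j) | Inr l \<Rightarrow> De l)"

lemma eps_in: "x \<in> carrier A \<Longrightarrow> eps A \<epsilon> x \<in> carrier A"
  by (simp add: eps_def adj_closed)

lemma const_elem_closed: "(\<And>j. b j \<in> carrier A) \<Longrightarrow> const_elem b c \<in> carrier A"
  by (auto simp: const_elem_def eps_in split: sum.split)

lemma word_elem_simps:
  "word_elem A d p x [] = \<one>"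
  "word_elem A d p x ((i, \<epsilon>, l) # w) = eps A \<epsilon> (x i) \<otimes> De l \<otimes> word_elem A d p x w"
  by (simp_all add: word_elem_def)

lemma word_elem_closed: "(\<And>i. x i \<in> carrier A) \<Longrightarrow> word_elem A d p x w \<in> carrier A"
  by (induction w) (auto simp: word_elem_simps eps_in)

text \<open>In a word of constants the elements of D may stand anywhere, in a D-word exactly one
  follows each letter. Missing ones are filled in as units, adjacent ones multiplied, and a leading
  one is kept as \<open>l\<close>. The same \<open>l\<close> and \<open>v\<close> serve the limit
  and all sizes.\<close>

lemma const_word_normal_form:
  assumes b: "\<And>j. b j \<in> carrier A"
  obtains l v where "list_mult A (map (const_elem b) c) = De l \<otimes> word_elem A d p b v"
    "\<And>n X q. (\<And>j. X j \<in> carrier_mat n n) \<Longrightarrow>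
       mprod n (map (const_mat X q n) c) = D_mat q n l * word_mat q n X v"
proof (induction c arbitrary: thesis)
  case Nil
  show ?case
  proof (rule Nil)
    show "list_mult A (map (const_elem b) []) = De (\<lambda>_. 1) \<otimes> word_elem A d p b []"
      by (simp add: De_one word_elem_simps)
  qed (simp add: D_mat_one word_mat_simps)
next
  case (Cons x c)
  then obtain l v where lv: "list_mult A (map (const_elem b) c) = De l \<otimes> word_elem A d p b v"
    "\<And>n X q. (\<And>j. X j \<in> carrier_mat n n) \<Longrightarrow>
       mprod n (map (const_mat X q n) c) = D_mat q n l * word_mat q n X v"
    by blast
  note wc = word_elem_closed[of b v, OF b]
  show ?case
  proof (cases x)
    case (Inl y)
    then obtain j \<epsilon> where y: "x = Inl (j, \<epsilon>)" by (cases y) auto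
    show ?thesis
    proof (rule Cons.prems)
      show "list_mult A (map (const_elem b) (x # c)) = De (\<lambda>_. 1) \<otimes> word_elem A d p b ((j, \<epsilon>, l) # v)"
        using wc b[of j] by (simp add: De_one y word_elem_simps lv(1) const_elem_def m_assoc eps_in)
      fix n q and X :: "nat \<Rightarrow> complex mat" assume X: "\<And>j. X j \<in> carrier_mat n n"
      have "(if \<epsilon> then mat_adjoint (X j) else X j) \<in> carrier_mat n n"
        using X[of j] mat_adjoint_entries(1)[of "X j"] by auto
      then have "mprod n (map (const_mat X q n) (x # c)) = word_mat q n X ((j, \<epsilon>, l) # v)"
        using word_mat_carrier[of X n q v, OF X]
        by (simp add: y const_mat_def word_mat_simps lv(2)[OF X] assoc_mult_mat[of _ n n _ n _ n])
      then show "mprod n (map (const_mat X q n) (x # c)) = D_mat q n (\<lambda>_. 1) * word_mat q n X ((j, \<epsilon>, l) # v)"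
        using word_mat_carrier[of X n q, OF X] by (simp add: D_mat_one left_mult_one_mat[of _ n n])
    qed
  next
    case (Inr m)
    show ?thesis
    proof (rule Cons.prems)
      show "list_mult A (map (const_elem b) (x # c)) = De (\<lambda>k. m k * l k) \<otimes> word_elem A d p b v"
        using wc by (simp add: Inr lv(1) const_elem_def m_assoc[symmetric] De_mult)
      show "mprod n (map (const_mat X q n) (x # c)) = D_mat q n (\<lambda>k. m k * l k) * word_mat q n X v"
        if X: "\<And>j. X j \<in> carrier_mat n n" for n X q
        using word_mat_carrier[of X n q v, OF X]
        by (simp add: Inr const_mat_def lv(2)[OF X] assoc_mult_mat[of _ n n _ n _ n, symmetric] D_mat_mult)
    qed
  qed
qed

lemma state_De_mult:
  assumes x: "x \<in> carrier A"
  shows "state A (De l \<otimes> x) = (\<Sum>k<d. l k * state A (p k) * cond_coord A p x k)"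
proof -
  have "De l \<otimes> x = (\<Oplus>k\<in>{..<d}. scal A (l k) (p k) \<otimes> x)"
    unfolding D_elem_def using x by (intro finsum_ldistr) (auto intro!: scal_closed proj_closed)
  then have "state A (De l \<otimes> x) = (\<Sum>k<d. state A (scal A (l k) (p k) \<otimes> x))"
    using x by (simp only:, intro state_finsum) (auto intro!: scal_closed proj_closed)
  also have "\<dots> = (\<Sum>k<d. l k * state A (p k) * cond_coord A p x k)"
    using x by (intro sum.cong) (auto simp: cond_coord_eq scal_mult_left proj_closed state_scal proj_state)
  finally show ?thesis .
qed

text \<open>The normalized trace of a D-element times a word is an average of the coordinates of the
  conditional expectation, with weights \<open>q n k / n\<close> that converge to the states of the
  projections.\<close>

lemma const_words_converge:
  assumes conv: "converges_in_D_distribution M q (\<lambda>j n _. B j n) A d p b"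
    and q: "\<And>n k. n \<ge> N \<Longrightarrow> k < d \<Longrightarrow> q n k > 0" "\<And>n. n \<ge> N \<Longrightarrow> (\<Sum>k<d. q n k) = n"
      "\<And>k. k < d \<Longrightarrow> (\<lambda>n. of_nat (q n k) / of_nat n) \<longlonglongrightarrow> state A (p k)"
    and M: "\<And>n. n \<ge> N \<Longrightarrow> prob_space (M n)" and B: "\<And>j n. n \<ge> N \<Longrightarrow> B j n \<in> carrier_mat n n"
  shows "(\<lambda>n. Tr (mprod n (map (const_mat (\<lambda>j. B j n) (q n) n) c)) / of_nat n)
    \<longlonglongrightarrow> state A (list_mult A (map (const_elem b) c))"
proof -
  have b: "b j \<in> carrier A" for j using conv by (simp add: converges_in_D_distribution_def)
  obtain l v where lv: "list_mult A (map (const_elem b) c) = De l \<otimes> word_elem A d p b v"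
    "\<And>n X q. (\<And>j. X j \<in> carrier_mat n n) \<Longrightarrow>
       mprod n (map (const_mat X q n) c) = D_mat q n l * word_mat q n X v"
    using const_word_normal_form[of b c] b by blast
  let ?W = "\<lambda>n. word_mat (q n) n (\<lambda>j. B j n) v"
  let ?T = "\<lambda>n k. Tr (p_mat (q n) n k * ?W n * p_mat (q n) n k)"
  have T: "(\<lambda>n. ?T n k / of_nat (q n k)) \<longlonglongrightarrow> cond_coord A p (word_elem A d p b v) k" if k: "k < d" for k
  \<comment> \<open>Convergence in D-distribution does not speak of the empty word; there the
    coordinate is 1 because the block has \<open>q n k\<close> diagonal entries.\<close>
  proof (cases "v = []")
    case True
    have "?T n k / of_nat (q n k) = 1" if "n \<ge> N" for n
    proof -
      have "?T n k = (\<Sum>i | i < n \<and> block_index (q n) i = k. 1)"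
        by (subst Tr_p_mat) (auto simp: True word_mat_simps intro!: sum.cong)
      then show ?thesis using card_block[OF q(2)[OF that] k] q(1)[OF that k] by simp
    qed
    moreover have "cond_coord A p \<one> k = 1"
      using cond_coord_De[OF k, of "\<lambda>_. 1"] by (simp add: De_one)
    ultimately show ?thesis
      by (intro tendsto_eventually eventually_sequentiallyI[of N]) (simp add: True word_elem_simps)
  next
    case False
    have "(\<lambda>n. E_mat (M n) (q n) n (\<lambda>\<omega>. ?W n) k) \<longlonglongrightarrow> cond_coord A p (word_elem A d p b v) k"
      using conv False k by (simp add: converges_in_D_distribution_def)
    then show ?thesis
    proof (rule Lim_transform_eventually)
      show "\<forall>\<^sub>F n in sequentially. E_mat (M n) (q n) n (\<lambda>\<omega>. ?W n) k = ?T n k / of_nat (q n k)"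
        by (rule eventually_sequentiallyI[of N]) (simp add: E_mat_def prob_space.prob_space[OF M])
    qed
  qed
  have "(\<lambda>n. \<Sum>k<d. l k * (of_nat (q n k) / of_nat n) * (?T n k / of_nat (q n k)))
    \<longlonglongrightarrow> (\<Sum>k<d. l k * state A (p k) * cond_coord A p (word_elem A d p b v) k)"
    by (intro tendsto_sum tendsto_mult tendsto_const T q(3)) auto
  then show ?thesis
    unfolding lv(1) state_De_mult[OF word_elem_closed[of b v, OF b]]
  proof (rule Lim_transform_eventually)
    show "\<forall>\<^sub>F n in sequentially. (\<Sum>k<d. l k * (of_nat (q n k) / of_nat n) * (?T n k / of_nat (q n k))) =
      Tr (mprod n (map (const_mat (\<lambda>j. B j n) (q n) n) c)) / of_nat n"
    proof (rule eventually_sequentiallyI[of N])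
      fix n assume n: "N \<le> n"
      have T: "Tr (mprod n (map (const_mat (\<lambda>j. B j n) (q n) n) c)) = (\<Sum>k<d. l k * ?T n k)"
        using B[OF n] by (subst lv(2)) (auto intro!: Tr_D_mat word_mat_carrier q(2)[OF n])
      show "(\<Sum>k<d. l k * (of_nat (q n k) / of_nat n) * (?T n k / of_nat (q n k))) =
        Tr (mprod n (map (const_mat (\<lambda>j. B j n) (q n) n) c)) / of_nat n"
        unfolding T sum_divide_distrib
      proof (intro sum.cong refl)
        show "l k * (of_nat (q n k) / of_nat n) * (?T n k / of_nat (q n k)) = l k * ?T n k / of_nat n"
          if "k \<in> {..<d}" for k
          using q(1)[OF n, of k] that by simp
      qed
    qed
  qed
qed

text \<open>The first component \<open>z\<close> is left unspecified, as the state ignores it; all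
  moments are read off from the second one, a single word.\<close>

lemma word_elem_A2:
  assumes b: "\<And>j. b j \<in> carrier A" and x: "\<And>j. x (Inl j) = iota (b j)" "\<And>s. x (Inr s) = ygen s"
  obtains z where "z \<in> carrier A"
    "word_elem A2 d p2 x w = pi2 z (mon (map (map_sum (const_elem b) id) (concat (map factors w))))"
proof (induction w arbitrary: thesis)
  case Nil
  show ?case by (rule Nil[OF one_closed]) (simp add: word_elem_def list_mult_def A2_simps one_eq_mon)
next
  case (Cons y w)
  obtain i \<epsilon> l where y: "y = (i, \<epsilon>, l)" by (cases y)
  obtain z where z: "z \<in> carrier A"
    "word_elem A2 d p2 x w = pi2 z (mon (map (map_sum (const_elem b) id) (concat (map factors w))))"
    using Cons.IH by blast
  have D: "D_elem A2 d p2 l = pi2 (De l) (mon [Inl (De l)])"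
    using enlargement_D_elem[OF projection_ncps_axioms enlargement_iota, of l] by (simp add: iota_def)
  have "\<exists>u\<in>carrier A. eps A2 \<epsilon> (x i) = pi2 u (mon [map_sum (const_elem b) id (hd (factors y))])"
  proof (cases i)
    case (Inl j)
    have "eps A2 \<epsilon> (iota (b j)) = iota (eps A \<epsilon> (b j))"
      using enlargement_iota b[of j] by (auto simp: eps_def enlargement_def)
    then show ?thesis using b[of j] by (auto simp: Inl y x factors_def const_elem_def iota_def eps_in)
  next
    case (Inr s)
    then show ?thesis
      by (auto simp: y x factors_def eps_def adj_ygen) (auto simp: ygen_def)
  qed
  then obtain u where u: "u \<in> carrier A" "eps A2 \<epsilon> (x i) = pi2 u (mon [map_sum (const_elem b) id (hd (factors y))])"
    by blast
  show ?case
  proof (rule Cons.prems)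
    show "u \<otimes> De l \<otimes> z \<in> carrier A" using u z by simp
    have "word_elem A2 d p2 x (y # w) = eps A2 \<epsilon> (x i) \<otimes>\<^bsub>A2\<^esub> D_elem A2 d p2 l \<otimes>\<^bsub>A2\<^esub> word_elem A2 d p2 x w"
      by (simp add: word_elem_def list_mult_def y)
    then show "word_elem A2 d p2 x (y # w) =
        pi2 (u \<otimes> De l \<otimes> z) (mon (map (map_sum (const_elem b) id) (concat (map factors (y # w)))))"
      by (simp add: u(2) D z(2) A2_simps mon_mult) (simp add: y factors_def const_elem_def)
  qed
qed

lemma om0_Inl_letters: "(\<And>x. x \<in> set c \<Longrightarrow> x \<in> carrier A) \<Longrightarrow> FC.om0 (map Inl c) = state A (list_mult A c)"
proof -
  assume c: "\<And>x. x \<in> set c \<Longrightarrow> x \<in> carrier A"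
  have "FC.om0 (map Inl c) = FC.phi0 (mon (map Inl c))"
    using FC.om_Inl[of "mon (map Inl c)"] by auto
  also have "\<dots> = tauA c" by (simp add: FC.phi0_def FC.tau0_def comp_def image_subset_iff)
  also have "\<dots> = state A (list_mult A c)"
    using c by (simp add: tauA_def vlet_def cong: map_cong)
  finally show ?thesis .
qed

text \<open>By trace property and idempotence the projection may stand at both ends instead of one,
  which gives the very word that occurs on the matrix side in \<open>E_mat_word\<close>.\<close>

lemma cond_coord_word_elem_A2:
  fixes k :: nat
  assumes b: "\<And>j. b j \<in> carrier A" and x: "\<And>j. x (Inl j) = iota (b j)" "\<And>s. x (Inr s) = ygen s"
    and k: "k < d"
  defines "unit \<equiv> Inl (Inr (\<lambda>l. if l = k then 1 else 0))"
  shows "cond_coord A2 p2 (word_elem A2 d p2 x w) k =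
    inverse (state A (p k)) * FC.om0 (map (map_sum (const_elem b) id) ([unit] @ concat (map factors w) @ [unit]))"
proof -
  let ?W = "map (map_sum (const_elem b) id) (concat (map factors w))"
  obtain z where z: "z \<in> carrier A" "word_elem A2 d p2 x w = pi2 z (mon ?W)"
    using word_elem_A2[of b x w] b x by blast
  have "FC.om0 (map (map_sum (const_elem b) id) ([unit] @ concat (map factors w) @ [unit])) =
      FC.om0 ([Inl (p k)] @ ?W @ [Inl (p k)])"
    using De_unit[OF k] by (simp add: unit_def const_elem_def)
  also have "\<dots> = FC.om (FC.pm k * (mon ?W * FC.pm k))"
    by (simp add: FC.pm_def mon_mult)
  also have "\<dots> = FC.om (FC.pm k * (FC.pm k * mon ?W))"
    by (rule trans[OF FC.om_rotate FC.om_rotate])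
  also have "\<dots> = FC.om (FC.pm k * mon ?W)" using FC.om_pm_pm[OF k k] by simp
  finally show ?thesis unfolding z(2) using cond_coord_A2[OF k z(1)] by simp
qed

end

theorem corollary4p2:
  fixes A :: "'a ncps" and d :: nat and p :: "nat \<Rightarrow> 'a"
    and q :: "nat \<Rightarrow> nat \<Rightarrow> nat" and N :: nat
    and M :: "nat \<Rightarrow> 'w measure"
    and a :: "nat \<Rightarrow> nat \<Rightarrow> nat \<Rightarrow> nat \<Rightarrow> 'w \<Rightarrow> complex"
    and Y :: "nat \<Rightarrow> nat \<Rightarrow> 'w \<Rightarrow> complex mat"
    and B :: "nat \<Rightarrow> nat \<Rightarrow> complex mat"
    and A1 :: "'b ncps" and \<iota>1 :: "'a \<Rightarrow> 'b" and b :: "nat \<Rightarrow> 'b"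
  assumes "projection_ncps A d p"
    and "\<And>n k. n \<ge> N \<Longrightarrow> k < d \<Longrightarrow> q n k > 0"
    and "\<And>n. n \<ge> N \<Longrightarrow> (\<Sum>k<d. q n k) = n"
    and "\<And>k. k < d \<Longrightarrow> (\<lambda>n. of_nat (q n k) / of_nat n) \<longlonglongrightarrow> state A (p k)"
    and "\<And>n. n \<ge> N \<Longrightarrow> prob_space (M n)"
    and "\<And>s n \<omega>. n \<ge> N \<Longrightarrow> Y s n \<omega> = Matrix.mat n n (\<lambda>(i, j). a i j n s \<omega>)"
    and "\<And>n. n \<ge> N \<Longrightarrow>
           prob_space.indep_vars (M n) (\<lambda>_. borel)
             (\<lambda>(i, j, s, re) \<omega>. if re then Re (a i j n s \<omega>) else Im (a i j n s \<omega>))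
             ({..<n} \<times> {..<n} \<times> UNIV \<times> (UNIV :: bool set))"
    and "\<And>n i j s. n \<ge> N \<Longrightarrow> i < n \<Longrightarrow> j < n \<Longrightarrow>
           distributed (M n) lborel (\<lambda>\<omega>. Re (a i j n s \<omega>)) (normal_density 0 (sqrt (1 / (2 * real n))))"
    and "\<And>n i j s. n \<ge> N \<Longrightarrow> i < n \<Longrightarrow> j < n \<Longrightarrow>
           distributed (M n) lborel (\<lambda>\<omega>. Im (a i j n s \<omega>)) (normal_density 0 (sqrt (1 / (2 * real n))))"
    and "\<And>j n. n \<ge> N \<Longrightarrow> B j n \<in> carrier_mat n n"
    and "\<And>i j n. n \<ge> N \<Longrightarrow> B i n * B j n \<in> range (\<lambda>m. B m n)"
    and "\<And>j n. n \<ge> N \<Longrightarrow> mat_adjoint (B j n) \<in> range (\<lambda>m. B m n)"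
    and "\<And>n k. n \<ge> N \<Longrightarrow> k < d \<Longrightarrow> p_mat (q n) n k \<in> range (\<lambda>m. B m n)"
    and "\<And>j. \<exists>C. \<forall>n\<ge>N. op_norm (D_mat (q n) n (E_mat (M n) (q n) n (\<lambda>_. B j n))) \<le> C"
    and "enlargement A A1 \<iota>1"
    and "converges_in_D_distribution M q (\<lambda>j n _. B j n) A1 d (\<iota>1 \<circ> p) b"
  shows "\<exists>(A2 :: 'b adjoined ncps) (\<iota>2 :: 'a \<Rightarrow> 'b adjoined) (x :: nat + nat \<Rightarrow> 'b adjoined).
           enlargement A A2 \<iota>2 \<and>
           asymptotically_D_free M q
             (\<lambda>i n \<omega>. case i of Inl j \<Rightarrow> B j n | Inr s \<Rightarrow> Y s n \<omega>)
             (\<lambda>g. case g of None \<Rightarrow> range Inl | Some s \<Rightarrow> {Inr s})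
             A2 d (\<iota>2 \<circ> p) x \<and>
           (\<forall>s. D_circular A2 d (\<iota>2 \<circ> p) (x (Inr s)))"
proof -
  \<comment> \<open>The space \<open>A1\<close>, in which the constant matrices have their limits,
    with the images of the projections is the base of the construction; the enlargement of
    \<open>A\<close> is obtained by composition at the end.\<close>
  define p1 where "p1 = \<iota>1 \<circ> p"
  interpret P: projection_ncps A1 d p1
    unfolding p1_def by (rule enlargement_projection[OF assms(1) assms(15)])
  note conv = assms(16)[folded p1_def]
  have b: "b j \<in> carrier A1" for j using conv by (simp add: converges_in_D_distribution_def)
  have p1: "state A (p k) = state A1 (p1 k)" if "k < d" for k
    using assms(15) projection_ncps.proj_closed[OF assms(1) that] by (simp add: p1_def enlargement_def)
  define x where "x i = (case i of Inl j \<Rightarrow> P.iota (b j) | Inr s \<Rightarrow> P.ygen s)" for i :: "nat + nat"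
  have x: "x (Inl j) = P.iota (b j)" "x (Inr s) = P.ygen s" for j s by (simp_all add: x_def)
  let ?cm = "\<lambda>n c i k. const_mat (\<lambda>j. B j n) (q n) n c $$ (i, k)"
  let ?a = "\<lambda>n i j s. a i j n s"
  let ?h = "map (map_sum (P.const_elem b) id)"
  let ?lim = "\<lambda>w. P.FC.om0 (?h w)"
  let ?Z = "\<lambda>n \<omega> i. case i of Inl j \<Rightarrow> B j n | Inr s \<Rightarrow> Y s n \<omega>"
  \<comment> \<open>\<open>N\<close> may be 0, whereas normalized traces need a positive
    size.\<close>
  have G: "gaussian_matrices (M n) n (?a n)" if "n \<ge> max N 1" for n
    by (intro gaussian_matrices.intro gaussian_matrices_axioms.intro assms(5,7-9)) (use that in auto)
  have traces: "(\<lambda>n. \<integral>\<omega>. gaussian_matrices.ntrs n (?a n) (?cm n) Ws \<omega> \<partial>M n) \<longlonglongrightarrow> prod_list (map ?lim Ws)" for Ws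
  proof (rule traces_factorize[where N = "max N 1"])
    show "gaussian_matrices (M n) n (?a n)" if "n \<ge> max N 1" for n by (rule G[OF that])
    show "?lim (u @ v) = ?lim (v @ u)" for u v by (simp add: P.FC.om0_trace)
    show "?lim (Inr t # w) = ssum (Inr (fst t, \<not> snd t)) (\<lambda>u v. ?lim u * ?lim v) w" for t w
    proof -
      have "?lim (Inr t # w) =
          ssum (map_sum (P.const_elem b) id (Inr (fst t, \<not> snd t))) (\<lambda>u v. P.FC.om0 u * P.FC.om0 v) (?h w)"
        by (simp add: P.FC.om0_Inr P.FC.bar_def)
      \<comment> \<open>Different constant letters may have the same value under
        \<open>P.const_elem b\<close>, but nothing else is mapped to a given Gaussian letter, so the
        splittings correspond.\<close>
      also have "\<dots> = ssum (Inr (fst t, \<not> snd t)) (\<lambda>u v. ?lim u * ?lim v) w"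
      proof (rule ssum_map)
        show "map_sum (P.const_elem b) id y = map_sum (P.const_elem b) id (Inr (fst t, \<not> snd t)) \<longleftrightarrow>
          y = Inr (fst t, \<not> snd t)" for y by (cases y) auto
      qed
      finally show ?thesis .
    qed
    fix w :: "(const_letter + nat \<times> bool) list" and \<omega> assume "set w \<subseteq> range Inl"
    then obtain c where w: "w = map Inl c" by (metis ex_map_conv subsetD rangeE)
    have "(\<lambda>n. Tr (mprod n (map (const_mat (\<lambda>j. B j n) (q n) n) c)) / of_nat n)
        \<longlonglongrightarrow> state A1 (list_mult A1 (map (P.const_elem b) c))"
      by (rule P.const_words_converge[where N = N and M = M]) (use conv assms(2-5,10) p1 in auto)
    moreover have "state A1 (list_mult A1 (map (P.const_elem b) c)) = ?lim w"
    proof -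
      have "P.FC.om0 (map Inl (map (P.const_elem b) c)) = state A1 (list_mult A1 (map (P.const_elem b) c))"
        by (rule P.om0_Inl_letters) (use P.const_elem_closed[of b, OF b] in auto)
      then show ?thesis by (simp add: w comp_def)
    qed
    ultimately show "(\<lambda>n. gaussian_matrices.ntr n (?a n) (?cm n) w \<omega>) \<longlonglongrightarrow> ?lim w"
    proof (simp only:, elim Lim_transform_eventually, intro eventually_sequentiallyI[of "max N 1"])
      fix n assume n: "max N 1 \<le> n"
      then have B: "B j n \<in> carrier_mat n n" for j using assms(10) by simp
      interpret gaussian_matrices "M n" n "?a n" "?cm n" by (rule G[OF n])
      have "lmat \<omega> (Inl y) = const_mat (\<lambda>j. B j n) (q n) n y" for y
        using lmat_const[where X = "\<lambda>j. B j n", OF B G[OF n]] .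
      then show "Tr (mprod n (map (const_mat (\<lambda>j. B j n) (q n) n) c)) / of_nat n = ntr w \<omega>"
        by (simp add: ntr_def tr_mprod w comp_def)
    qed
  qed
  have joint: "converges_in_D_distribution M q (\<lambda>i n \<omega>. ?Z n \<omega> i) P.A2 d P.p2 x"
    unfolding converges_in_D_distribution_def
  proof (intro conjI allI impI)
    show "x i \<in> carrier P.A2" for i
      using b by (cases i) (simp_all add: x P.iota_def P.ygen_def P.A2_simps)
    fix w :: "(nat + nat) D_word" and k assume k: "k < d"
    let ?unit = "Inl (Inr (\<lambda>l. if l = k then 1 else 0)) :: const_letter + nat \<times> bool"
    let ?w = "[?unit] @ concat (map factors w) @ [?unit]"
    \<comment> \<open>The factor \<open>n / q n k\<close> is written as an inverse so that its limit
      is the inverse of \<open>state A1 (p1 k)\<close>, the normalization in the coordinates of the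
      conditional expectation.\<close>
    have "(\<lambda>n. inverse (of_nat (q n k) / of_nat n) * (\<integral>\<omega>. gaussian_matrices.ntrs n (?a n) (?cm n) [?w] \<omega> \<partial>M n))
        \<longlonglongrightarrow> inverse (state A1 (p1 k)) * prod_list (map ?lim [?w])"
      using P.proj_state[OF k] assms(4)[OF k] p1[OF k] by (intro tendsto_mult tendsto_inverse traces) simp_all
    moreover have "inverse (state A1 (p1 k)) * prod_list (map ?lim [?w]) =
        cond_coord P.A2 P.p2 (word_elem P.A2 d P.p2 x w) k"
      using P.cond_coord_word_elem_A2[of b x k w, OF b x k] by simp
    ultimately show "(\<lambda>n. E_mat (M n) (q n) n (\<lambda>\<omega>. word_mat (q n) n (?Z n \<omega>) w) k)
        \<longlonglongrightarrow> cond_coord P.A2 P.p2 (word_elem P.A2 d P.p2 x w) k"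
    proof (simp only:, elim Lim_transform_eventually, intro eventually_sequentiallyI[of "max N 1"])
      fix n assume n: "max N 1 \<le> n"
      have "E_mat (M n) (q n) n (\<lambda>\<omega>. word_mat (q n) n (?Z n \<omega>) w) k =
          of_nat n / of_nat (q n k) * (\<integral>\<omega>. gaussian_matrices.ntrs n (?a n) (?cm n) [?w] \<omega> \<partial>M n)"
        by (rule E_mat_word[where X = "\<lambda>j. B j n" and Y = "\<lambda>s. Y s n"]) (use n assms(6,10) G[OF n] in auto)
      then show "inverse (of_nat (q n k) / of_nat n) * (\<integral>\<omega>. gaussian_matrices.ntrs n (?a n) (?cm n) [?w] \<omega> \<partial>M n) =
          E_mat (M n) (q n) n (\<lambda>\<omega>. word_mat (q n) n (?Z n \<omega>) w) k"
        by simp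
    qed
  qed
  have p2: "P.p2 = (P.iota \<circ> \<iota>1) \<circ> p" by (simp add: p1_def comp_assoc)
  have "D_free P.A2 d P.p2 (\<lambda>g. x ` (case g of None \<Rightarrow> range Inl | Some s \<Rightarrow> {Inr s}))"
    by (rule P.D_free_A2) (use b in \<open>auto simp: x\<close>)
  with joint have "asymptotically_D_free M q (\<lambda>i n \<omega>. ?Z n \<omega> i)
      (\<lambda>g. case g of None \<Rightarrow> range Inl | Some s \<Rightarrow> {Inr s}) P.A2 d P.p2 x"
    by (simp add: asymptotically_D_free_def)
  moreover have "\<forall>s. D_circular P.A2 d P.p2 (x (Inr s))" by (simp add: x P.D_circular_A2)
  moreover have "enlargement A P.A2 (P.iota \<circ> \<iota>1)"
    by (rule enlargement_trans[OF assms(15) P.enlargement_iota])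
  ultimately show ?thesis unfolding p2 by blast
qed

end
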